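(* Let $F:M^2\to(\mathbb{R}^5,\Phi,\xi,\eta,g)$ be an immersed self-shrinker for the Legendrian mean curvature flow whose Legendre angle $\alpha$ is a harmonic function with respect to $g^T$. Then $F$ is an embedding and is locally congruent to one of the following models: (1) $\tilde C:\mathbb{R}^2\to\mathbb{C}^2\times\mathbb{R}$, $$\tilde C(t,s)=\Big(\tfrac{1}{\sqrt{-2a}}e^{it},\ s,\ \tfrac{1}{4a}t+C_1\Big);$$ (2) $\tilde T:\mathbb{R}^2\to\mathbb{C}^2\times\mathbb{R}$, $$\tilde T(t,s)=\Big(\tfrac{1}{\sqrt{-2a}}e^{it},\ \tfrac{1}{\sqrt{-2a}}e^{is},\ \tfrac{1}{4a}(t+s)+C_2\Big);$$ (3) $\tilde\Upsilon_\gamma:\mathbb{R}^2\to\mathbb{C}^2\times\mathbb{R}$ with parameter $0<\gamma<\frac{\pi}{2}$, $$\tilde\Upsilon_\gamma(s,t)=\Big(\tfrac{-i\sin\gamma}{\sqrt{-2a}}\cosh t\,e^{\frac{is}{\cos\gamma}},\ \tfrac{\tan\gamma}{\sqrt{-2a}}\sinh t\,e^{-i\cos\gamma\, s},\ \tfrac{\sin\gamma\tan\gamma}{4a}s+C_3\Big);$$ (4) $\tilde\Psi_\nu:\mathbb{S}^1\times\mathbb{R}\to\mathbb{C}^2\times\mathbb{R}$ with parameter $\nu>0$, $$\tilde\Psi_\nu(e^{is},t)=\Big(\tfrac{\cosh\nu}{\sqrt{-2a}}\cos s\,e^{\frac{it}{\sinh\nu}},\ \tfrac{\coth\nu}{\sqrt{-2a}}\sin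 s\,e^{i\sinh\nu\, t},\ \tfrac{\cosh\nu\coth\nu}{4a}t+C_4\Big),$$ where $C_1,C_2,C_3,C_4$ are constants and the first two components in (1)–(4) are the Hamiltonian stationary Lagrangian models of Castro–Lerma. Moreover, they all satisfy $H-2\alpha\xi=8aX^\perp$ with $a<0$.
   Context: $\mathbb{R}^5=\mathbb{C}^2\times\mathbb{R}$ has coordinates $(x_1,y_1,x_2,y_2,z)$, $z_j=x_j+iy_j$, and carries the contact form $\eta=\frac12dz-\frac14\sum_{i=1}^2(y_i\,dx_i-x_i\,dy_i)$, the metric $g=\eta\otimes\eta+g^T$ with transverse part $g^T=\frac14\sum_{i=1}^2(dx_i^2+dy_i^2)$, the Reeb field $\xi=2\partial_z$, and the $(1,1)$-tensor $\Phi$ given by $\Phi(\partial_{x_i})=-\partial_{y_i}+\frac{x_i}{2}\partial_z$, $\Phi(\partial_{y_i})=\partial_{x_i}+\frac{y_i}{2}\partial_z$, $\Phi(\partial_z)=0$. An immersed surface $F:M^2\to\mathbb{R}^5$ is Legendrian if $F^*\eta=0$. Its normal bundle is $\Phi TM\oplus\mathbb{R}\xi$; $H$ is its mean curvature vector (trace of the second fundamental form with respect to $g$). The Legendre angle $\alpha$ is normalized by $F^*\Omega^T=e^{-i\alpha}\mathrm{Vol}$, equivalently $H=\Phi\nabla\alpha$, where $\Omega^T=\frac14dz_1\wedge dz_2$ and $\mathrm{Vol}$ is the induced volume form. The vector field $X=\sum_i(x_i\partial_{x_i}+y_i\partial_{y_i})+2z\partial_z$ generates the contact dilations $(x,y,z)\mapsto(\lambda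 x,\lambda y,\lambda^2z)$, and $X^\perp$ is its projection onto the normal bundle. A Legendrian immersion is a self-shrinker for the Legendrian mean curvature flow $\frac{d}{dt}F_t=H-2\alpha\xi$ if $H-2\alpha\xi=bX^\perp$ for some constant $b<0$. A Lagrangian surface in $\mathbb{C}^2$ is Hamiltonian stationary if its Lagrangian angle function is harmonic; Castro and Lerma classified the Hamiltonian stationary Lagrangian self-similar surfaces in $\mathbb{C}^2$.
   Formalization: Proved with corrections: minimal Legendrian planes are added as a fifth model; "F is an embedding" becomes "F(M) is embedded, and F is an embedding if injective" (model (2) is not injective); the Legendre angle is taken up to an additive constant so that all C_i are allowed. *)

theory Defs
  imports "HOL-Analysis.Analysis"
begin

section \<open>Calculus on open sets\<close>

abbreviation Df :: "('a::real_normed_vector \<Rightarrow> 'b::real_normed_vector) \<Rightarrow> 'a \<Rightarrow> 'a \<Rightarrow> 'b" where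
  "Df f q \<equiv> frechet_derivative f (at q)"

text \<open>\<^term>\<open>smooth_on S f\<close> is only meant for open \<^term>\<open>S\<close>.\<close>

primrec Ck_on :: "nat \<Rightarrow> 'a::real_normed_vector set \<Rightarrow> ('a \<Rightarrow> 'b::real_normed_vector) \<Rightarrow> bool" where
  "Ck_on 0 S f \<longleftrightarrow> continuous_on S f"
| "Ck_on (Suc k) S f \<longleftrightarrow> (\<forall>x\<in>S. f differentiable (at x)) \<and> (\<forall>e. Ck_on k S (\<lambda>x. Df f x e))"

definition smooth_on :: "'a::real_normed_vector set \<Rightarrow> ('a \<Rightarrow> 'b::real_normed_vector) \<Rightarrow> bool" where
  "smooth_on S f \<longleftrightarrow> (\<forall>k. Ck_on k S f)"

type_synonym R2 = "real \<times> real"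

abbreviation e1 :: R2 where "e1 \<equiv> (1, 0)"
abbreviation e2 :: R2 where "e2 \<equiv> (0, 1)"


section \<open>Oriented smooth surfaces\<close>

text \<open>A surface is a subset \<^term>\<open>M\<close> of a Hausdorff, second countable space, with the subspace
  topology and an oriented smooth atlas.  The atlas consists of local parametrizations
  \<^term>\<open>(U, \<phi>)\<close>, that is, of inverses of coordinate charts, with \<^term>\<open>U\<close> open in the plane.\<close>

type_synonym 'm atlas = "(R2 set \<times> (R2 \<Rightarrow> 'm)) set"

definition oriented_surface :: "'m::{t2_space,second_countable_topology} set \<Rightarrow> 'm atlas \<Rightarrow> bool" where
  "oriented_surface M \<A> \<longleftrightarrow>
     M \<noteq> {} \<and> (\<Union>(U, \<phi>)\<in>\<A>. \<phi> ` U) = M \<and>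
     (\<forall>(U, \<phi>)\<in>\<A>. open U \<and> openin (top_of_set M) (\<phi> ` U) \<and> (\<exists>\<psi>. homeomorphism U (\<phi> ` U) \<phi> \<psi>)) \<and>
     (\<forall>(U, \<phi>)\<in>\<A>. \<forall>(V, \<psi>)\<in>\<A>.
        let W = {q\<in>U. \<phi> q \<in> \<psi> ` V}; h = inv_into V \<psi> \<circ> \<phi> in
          smooth_on W h \<and>
          (\<forall>q\<in>W. fst (Df h q e1) * snd (Df h q e2) - snd (Df h q e1) * fst (Df h q e2) > 0))"

definition smooth_between :: "'m atlas \<Rightarrow> 'n atlas \<Rightarrow> 'm set \<Rightarrow> ('m \<Rightarrow> 'n) \<Rightarrow> bool" where
  "smooth_between \<A> \<B> U h \<longleftrightarrow>
     (\<forall>(P, \<phi>)\<in>\<A>. \<forall>(Q, \<psi>)\<in>\<B>.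
        smooth_on {q\<in>P. \<phi> q \<in> U \<and> h (\<phi> q) \<in> \<psi> ` Q} (inv_into Q \<psi> \<circ> h \<circ> \<phi>))"

definition plane_atlas :: "R2 atlas" where
  "plane_atlas = {(UNIV, \<lambda>q. q)}"

text \<open>The surface \<open>S\<^sup>1 \<times> \<real>\<close>, with the unit circle inside the complex plane.\<close>

definition cylinder :: "(complex \<times> real) set" where
  "cylinder = sphere 0 1 \<times> UNIV"

definition cylinder_atlas :: "(complex \<times> real) atlas" where
  "cylinder_atlas = range (\<lambda>s0. ({s0 <..< s0 + 2 * pi} \<times> UNIV, \<lambda>(s, t). (cis s, t)))"

text \<open>For the metric \<open>h\<close> below, \<^term>\<open>h q e e'\<close> is the product of the tangent vectors \<open>e, e'\<close> at \<open>q\<close>.\<close>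

definition area :: "(R2 \<Rightarrow> R2 \<Rightarrow> R2 \<Rightarrow> real) \<Rightarrow> R2 \<Rightarrow> real" where
  "area h q = sqrt (h q e1 e1 * h q e2 e2 - (h q e1 e2)\<^sup>2)"

text \<open>The Laplace--Beltrami operator of \<open>h\<close>, written with the inverse matrix of \<open>h\<close>.\<close>

definition laplacian :: "(R2 \<Rightarrow> R2 \<Rightarrow> R2 \<Rightarrow> real) \<Rightarrow> (R2 \<Rightarrow> real) \<Rightarrow> R2 \<Rightarrow> real" where
  "laplacian h u q =
     (Df (\<lambda>x. (h x e2 e2 * Df u x e1 - h x e1 e2 * Df u x e2) / area h x) q e1 +
      Df (\<lambda>x. (h x e1 e1 * Df u x e2 - h x e1 e2 * Df u x e1) / area h x) q e2) / area h q"

definition smooth_immersion :: "'m atlas \<Rightarrow> ('m \<Rightarrow> 'b::real_normed_vector) \<Rightarrow> bool" where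
  "smooth_immersion \<A> F \<longleftrightarrow>
     (\<forall>(U, \<phi>)\<in>\<A>. smooth_on U (F \<circ> \<phi>) \<and> (\<forall>q\<in>U. inj (Df (F \<circ> \<phi>) q)))"

definition smooth_embedding ::
  "'m::topological_space set \<Rightarrow> 'm atlas \<Rightarrow> ('m \<Rightarrow> 'b::real_normed_vector) \<Rightarrow> bool" where
  "smooth_embedding M \<A> F \<longleftrightarrow> smooth_immersion \<A> F \<and> (\<exists>G. homeomorphism M (F ` M) F G)"

text \<open>Embedded two-dimensional submanifolds, not necessarily closed.\<close>

definition embedded_surface :: "'b::real_normed_vector set \<Rightarrow> bool" where
  "embedded_surface S \<longleftrightarrow>
     (\<forall>p\<in>S. \<exists>(U :: R2 set) f g. open U \<and> p \<in> f ` U \<and> openin (top_of_set S) (f ` U) \<and>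
        homeomorphism U (f ` U) f g \<and> smooth_on U f \<and> (\<forall>q\<in>U. inj (Df f q)))"


section \<open>The contact metric structure\<close>

text \<open>A point, and likewise a tangent vector, is a triple \<open>(z\<^sub>1, z\<^sub>2, z)\<close> with \<open>z\<^sub>j = x\<^sub>j + \<i> y\<^sub>j\<close>.\<close>

type_synonym R5 = "complex \<times> complex \<times> real"

fun eta :: "R5 \<Rightarrow> R5 \<Rightarrow> real" where
  "eta (z1, z2, z) (v1, v2, v) =
     v / 2 - ((Im z1 * Re v1 - Re z1 * Im v1) + (Im z2 * Re v2 - Re z2 * Im v2)) / 4"

fun gT :: "R5 \<Rightarrow> R5 \<Rightarrow> real" where
  "gT (v1, v2, v) (w1, w2, w) = (v1 \<bullet> w1 + v2 \<bullet> w2) / 4"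

definition g :: "R5 \<Rightarrow> R5 \<Rightarrow> R5 \<Rightarrow> real" where
  "g p v w = eta p v * eta p w + gT v w"

definition xi :: R5 where
  "xi = (0, 0, 2)"

text \<open>On the coordinate fields this is
  \<open>\<partial>\<^sub>x \<mapsto> - \<partial>\<^sub>y + (x/2) \<partial>\<^sub>z\<close>, \<open>\<partial>\<^sub>y \<mapsto> \<partial>\<^sub>x + (y/2) \<partial>\<^sub>z\<close>, \<open>\<partial>\<^sub>z \<mapsto> 0\<close>; the real inner product
  of complex numbers collects the two \<open>\<partial>\<^sub>z\<close> terms.\<close>

fun Phi :: "R5 \<Rightarrow> R5 \<Rightarrow> R5" where
  "Phi (z1, z2, z) (v1, v2, v) = (- \<i> * v1, - \<i> * v2, (z1 \<bullet> v1 + z2 \<bullet> v2) / 2)"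

fun OmegaT :: "R5 \<Rightarrow> R5 \<Rightarrow> complex" where
  "OmegaT (v1, v2, v) (w1, w2, w) = (v1 * w2 - v2 * w1) / 4"

fun X :: "R5 \<Rightarrow> R5" where
  "X (z1, z2, z) = (z1, z2, 2 * z)"

text \<open>Congruences: the symmetries of the whole structure \<open>(\<Phi>, \<xi>, \<eta>, g)\<close> that also preserve the
  field \<^const>\<open>X\<close>, i.e. the centre of the self-similar motion.\<close>

definition congruence :: "(R5 \<Rightarrow> R5) \<Rightarrow> bool" where
  "congruence A \<longleftrightarrow> bij A \<and> smooth_on UNIV A \<and>
     (\<forall>p. Df A p xi = xi \<and> Df A p (X p) = X (A p) \<and>
        (\<forall>v. eta (A p) (Df A p v) = eta p v \<and> Df A p (Phi p v) = Phi (A p) (Df A p v) \<and>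
          (\<forall>w. g (A p) (Df A p v) (Df A p w) = g p v w)))"

text \<open>Koszul formula for the Levi-Civita connection of \<^const>\<open>g\<close> on constant vector fields.\<close>

definition christoffel :: "R5 \<Rightarrow> R5 \<Rightarrow> R5 \<Rightarrow> R5" where
  "christoffel p v w = (THE y. \<forall>x. g p y x =
     (Df (\<lambda>r. g r w x) p v + Df (\<lambda>r. g r v x) p w - Df (\<lambda>r. g r v w) p x) / 2)"


section \<open>Local geometry of a parametrized surface\<close>

definition normal_part :: "(R2 \<Rightarrow> R5) \<Rightarrow> R2 \<Rightarrow> R5 \<Rightarrow> R5" where
  "normal_part f q w = (THE n. w - n \<in> range (Df f q) \<and> (\<forall>e. g (f q) n (Df f q e) = 0))"

definition second_ff :: "(R2 \<Rightarrow> R5) \<Rightarrow> R2 \<Rightarrow> R2 \<Rightarrow> R2 \<Rightarrow> R5" where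
  "second_ff f q e e' =
     normal_part f q (Df (\<lambda>x. Df f x e') q e + christoffel (f q) (Df f q e) (Df f q e'))"

definition induced :: "(R2 \<Rightarrow> R5) \<Rightarrow> R2 \<Rightarrow> R2 \<Rightarrow> R2 \<Rightarrow> real" where
  "induced f q e e' = g (f q) (Df f q e) (Df f q e')"

definition inducedT :: "(R2 \<Rightarrow> R5) \<Rightarrow> R2 \<Rightarrow> R2 \<Rightarrow> R2 \<Rightarrow> real" where
  "inducedT f q e e' = gT (Df f q e) (Df f q e')"

text \<open>The (non-averaged) trace of the second fundamental form.\<close>

definition mean_curvature :: "(R2 \<Rightarrow> R5) \<Rightarrow> R2 \<Rightarrow> R5" where
  "mean_curvature f q =
     (1 / (area (induced f) q)\<^sup>2) *\<^sub>R
       (induced f q e2 e2 *\<^sub>R second_ff f q e1 e1 - (2 * induced f q e1 e2) *\<^sub>R second_ff f q e1 e2 +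
        induced f q e1 e1 *\<^sub>R second_ff f q e2 e2)"


section \<open>Legendrian self-shrinkers\<close>

definition legendrian_immersion :: "'m atlas \<Rightarrow> ('m \<Rightarrow> R5) \<Rightarrow> bool" where
  "legendrian_immersion \<A> F \<longleftrightarrow> smooth_immersion \<A> F \<and>
     (\<forall>(U, \<phi>)\<in>\<A>. \<forall>q\<in>U. \<forall>e. eta (F (\<phi> q)) (Df (F \<circ> \<phi>) q e) = 0)"

definition minimal :: "'m atlas \<Rightarrow> ('m \<Rightarrow> R5) \<Rightarrow> bool" where
  "minimal \<A> F \<longleftrightarrow> (\<forall>(U, \<phi>)\<in>\<A>. \<forall>q\<in>U. mean_curvature (F \<circ> \<phi>) q = 0)"

definition smooth_function :: "'m atlas \<Rightarrow> ('m \<Rightarrow> real) \<Rightarrow> bool" where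
  "smooth_function \<A> \<alpha> \<longleftrightarrow> (\<forall>(U, \<phi>)\<in>\<A>. smooth_on U (\<alpha> \<circ> \<phi>))"

definition legendre_angle :: "'m atlas \<Rightarrow> ('m \<Rightarrow> R5) \<Rightarrow> ('m \<Rightarrow> real) \<Rightarrow> bool" where
  "legendre_angle \<A> F \<alpha> \<longleftrightarrow> smooth_function \<A> \<alpha> \<and>
     (\<forall>(U, \<phi>)\<in>\<A>. \<forall>q\<in>U. OmegaT (Df (F \<circ> \<phi>) q e1) (Df (F \<circ> \<phi>) q e2) =
        exp (- \<i> * of_real (\<alpha> (\<phi> q))) * of_real (area (induced (F \<circ> \<phi>)) q))"

definition harmonic_gT :: "'m atlas \<Rightarrow> ('m \<Rightarrow> R5) \<Rightarrow> ('m \<Rightarrow> real) \<Rightarrow> bool" where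
  "harmonic_gT \<A> F \<alpha> \<longleftrightarrow>
     (\<forall>(U, \<phi>)\<in>\<A>. \<forall>q\<in>U. laplacian (inducedT (F \<circ> \<phi>)) (\<alpha> \<circ> \<phi>) q = 0)"

text \<open>The equation \<open>H - 2\<alpha>\<xi> = b X\<^sup>\<bottom>\<close>.\<close>

definition self_similar :: "'m atlas \<Rightarrow> ('m \<Rightarrow> R5) \<Rightarrow> ('m \<Rightarrow> real) \<Rightarrow> real \<Rightarrow> bool" where
  "self_similar \<A> F \<alpha> b \<longleftrightarrow>
     (\<forall>(U, \<phi>)\<in>\<A>. \<forall>q\<in>U. mean_curvature (F \<circ> \<phi>) q - (2 * \<alpha> (\<phi> q)) *\<^sub>R xi =
        b *\<^sub>R normal_part (F \<circ> \<phi>) q (X (F (\<phi> q))))"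

text \<open>The two usual normalizations of the Legendre angle, \<open>F\<^sup>*\<Omega>\<^sup>T = exp (- \<i> \<alpha>) Vol\<close> and
  \<open>H = \<Phi>\<nabla>\<alpha>\<close>, differ by an additive constant on a connected surface: the second one determines
  \<open>\<alpha>\<close> only up to such a constant, whereas the self-similar equation is sensitive to it.  The
  parameter \<open>\<theta>\<close> covers both; \<open>\<theta> = 0\<close> is the first normalization.\<close>

definition harmonic_self_shrinker ::
  "'m atlas \<Rightarrow> ('m \<Rightarrow> R5) \<Rightarrow> ('m \<Rightarrow> real) \<Rightarrow> real \<Rightarrow> real \<Rightarrow> bool" where
  "harmonic_self_shrinker \<A> F \<alpha> \<theta> b \<longleftrightarrow>
     legendrian_immersion \<A> F \<and> legendre_angle \<A> F (\<lambda>p. \<alpha> p + \<theta>) \<and> harmonic_gT \<A> F \<alpha> \<and>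
     b < 0 \<and> self_similar \<A> F \<alpha> b"

definition locally_congruent ::
  "'m::topological_space set \<Rightarrow> 'm atlas \<Rightarrow> ('m \<Rightarrow> R5) \<Rightarrow>
   'n::topological_space set \<Rightarrow> 'n atlas \<Rightarrow> ('n \<Rightarrow> R5) \<Rightarrow> bool" where
  "locally_congruent M \<A> F N \<B> G \<longleftrightarrow>
     (\<forall>p\<in>M. \<exists>U V h k A. p \<in> U \<and> openin (top_of_set M) U \<and> openin (top_of_set N) V \<and>
        homeomorphism U V h k \<and> smooth_between \<A> \<B> U h \<and> smooth_between \<B> \<A> V k \<and>
        congruence A \<and> (\<forall>x\<in>U. F x = A (G (h x))))"


section \<open>Hamiltonian stationary Lagrangian surfaces in the complex plane squared\<close>

definition inducedC :: "(R2 \<Rightarrow> complex \<times> complex) \<Rightarrow> R2 \<Rightarrow> R2 \<Rightarrow> R2 \<Rightarrow> real" where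
  "inducedC f q e e' = Df f q e \<bullet> Df f q e'"

definition lagrangian_immersion :: "'m atlas \<Rightarrow> ('m \<Rightarrow> complex \<times> complex) \<Rightarrow> bool" where
  "lagrangian_immersion \<A> f \<longleftrightarrow> smooth_immersion \<A> f \<and>
     (\<forall>(U, \<phi>)\<in>\<A>. \<forall>q\<in>U. \<forall>e e'.
        let (v1, v2) = Df (f \<circ> \<phi>) q e; (w1, w2) = Df (f \<circ> \<phi>) q e' in Im (cnj v1 * w1 + cnj v2 * w2) = 0)"

definition lagrangian_angle ::
  "'m atlas \<Rightarrow> ('m \<Rightarrow> complex \<times> complex) \<Rightarrow> ('m \<Rightarrow> real) \<Rightarrow> bool" where
  "lagrangian_angle \<A> f \<beta> \<longleftrightarrow> smooth_function \<A> \<beta> \<and>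
     (\<forall>(U, \<phi>)\<in>\<A>. \<forall>q\<in>U.
        let (v1, v2) = Df (f \<circ> \<phi>) q e1; (w1, w2) = Df (f \<circ> \<phi>) q e2 in
          v1 * w2 - v2 * w1 = cis (\<beta> (\<phi> q)) * of_real (area (inducedC (f \<circ> \<phi>)) q))"

definition hamiltonian_stationary_lagrangian :: "'m atlas \<Rightarrow> ('m \<Rightarrow> complex \<times> complex) \<Rightarrow> bool" where
  "hamiltonian_stationary_lagrangian \<A> f \<longleftrightarrow> lagrangian_immersion \<A> f \<and>
     (\<exists>\<beta>. lagrangian_angle \<A> f \<beta> \<and>
        (\<forall>(U, \<phi>)\<in>\<A>. \<forall>q\<in>U. laplacian (inducedC (f \<circ> \<phi>)) (\<beta> \<circ> \<phi>) q = 0))"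

fun proj_C2 :: "R5 \<Rightarrow> complex \<times> complex" where
  "proj_C2 (z1, z2, z) = (z1, z2)"


section \<open>The models\<close>

fun model_C :: "real \<Rightarrow> real \<Rightarrow> R2 \<Rightarrow> R5" where
  "model_C a c (t, s) = (of_real (1 / sqrt (- 2 * a)) * cis t, of_real s, 1 / (4 * a) * t + c)"

fun model_T :: "real \<Rightarrow> real \<Rightarrow> R2 \<Rightarrow> R5" where
  "model_T a c (t, s) =
     (of_real (1 / sqrt (- 2 * a)) * cis t, of_real (1 / sqrt (- 2 * a)) * cis s,
      1 / (4 * a) * (t + s) + c)"

fun model_Upsilon :: "real \<Rightarrow> real \<Rightarrow> real \<Rightarrow> R2 \<Rightarrow> R5" where
  "model_Upsilon \<gamma> a c (s, t) =
     (- \<i> * of_real (sin \<gamma> / sqrt (- 2 * a) * cosh t) * cis (s / cos \<gamma>),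
      of_real (tan \<gamma> / sqrt (- 2 * a) * sinh t) * cis (- cos \<gamma> * s),
      sin \<gamma> * tan \<gamma> / (4 * a) * s + c)"

text \<open>A point \<open>w = exp (\<i> s)\<close> of the circle enters only through \<open>cos s = Re w\<close> and \<open>sin s = Im w\<close>.\<close>

fun model_Psi :: "real \<Rightarrow> real \<Rightarrow> real \<Rightarrow> complex \<times> real \<Rightarrow> R5" where
  "model_Psi \<nu> a c (w, t) =
     (of_real (cosh \<nu> / sqrt (- 2 * a) * Re w) * cis (t / sinh \<nu>),
      of_real (cosh \<nu> / sinh \<nu> / sqrt (- 2 * a) * Im w) * cis (sinh \<nu> * t),
      cosh \<nu> * (cosh \<nu> / sinh \<nu>) / (4 * a) * t + c)"

text \<open>The static case: for \<open>\<alpha> = - b c / 2\<close> constant this solves the self-similar equation with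
  \<open>H = 0\<close>, so it has to be listed among the harmonic self-shrinkers.\<close>

fun model_plane :: "real \<Rightarrow> R2 \<Rightarrow> R5" where
  "model_plane c (t, s) = (of_real t, of_real s, c)"

text \<open>The family \<open>G\<close> of models, indexed by the additive constant \<open>c\<close> of the last coordinate.
  Every \<open>c\<close> is admissible if the Legendre angle is normalized suitably, and every normalization
  of the Legendre angle (in particular \<open>\<theta> = 0\<close>) is realized for a suitable \<open>c\<close>.\<close>

definition shrinker_family :: "'m atlas \<Rightarrow> (real \<Rightarrow> 'm \<Rightarrow> R5) \<Rightarrow> real \<Rightarrow> bool" where
  "shrinker_family \<A> G b \<longleftrightarrow>
     (\<forall>c. hamiltonian_stationary_lagrangian \<A> (proj_C2 \<circ> G c)) \<and>
     (\<forall>c. \<exists>\<alpha> \<theta>. harmonic_self_shrinker \<A> (G c) \<alpha> \<theta> b) \<and>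
     (\<forall>\<theta>. \<exists>c \<alpha>. harmonic_self_shrinker \<A> (G c) \<alpha> \<theta> b)"

end

(* Pairing the shrinker equation with the Reeb field gives \<alpha> = -(b/2) z, so the height z is harmonic
   on the surface and the projection f to C^2 is Lagrangian with angle -(b/2) z + const.  Where dz does
   not vanish, T = \<nabla>z/|\<nabla>z|^2 and its rotation N by a right angle are commuting orthogonal fields,
   and the structure equations give a constant Hermitian matrix S of trace b/2 with S f = -i df(T).
   In an orthonormal eigenbasis of S, with eigenvalues k and l, the surface therefore consists of points
   (r1 cis(k z), r2 cis(l z), z) with r1, r2 real and k r1^2 + l r2^2 = -2.  Such sets are the models:
   l = 0, l > 0 and l < 0 give C, Upsilon and Psi, and the torus T is congruent to the Psi with
   sinh \<nu> = 1.  If dz vanishes identically, the surface is minimal and lies in a plane.  First order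
   contact with one of these sets is a closed condition and it spreads to a neighbourhood, so on a
   connected surface one model serves everywhere.  A surface whose image lies in an embedded one is
   locally congruent to it by the inverse function theorem. *)
theory Submission
  imports Defs
begin

subsection \<open>Smooth maps\<close>

text \<open>The commuting frame exists only where dz is nonzero, so the constancy of S cannot be
  carried across a surface with the frame alone. Contact is formulated without the frame, it forces
  dz to be nonzero, and at a single point it already fixes S: a Hermitian 2x2 matrix is determined
  by its value on a nonzero vector f together with its trace. Inside a chart no uniqueness theorem
  for differential equations is invoked. Every quantity that has to vanish obeys a linear system
  whose squared norm changes at the same relative rate as the squared length of df(T), so the
  quotient of the two is constant. The factor in b = 8a comes from the trace: in the first model the
  height is t/(4a), so the phase t is 4a times the height, and the eigenvalues 4a and 0 must add up
  to b/2. As b < 0, the smaller eigenvalue is always negative and only the sign of the other one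
  distinguishes cases. F may cover its image several times. It is therefore compared with a model
  through the inverse of the model embedding, which gives an embedded image in general and an
  embedding when F is injective.\<close>

lemma Df_eqI: "(f has_derivative f') (at x) \<Longrightarrow> Df f x = f'"
  using frechet_derivative_at by metis

lemma Df_has_derivative: "f differentiable (at x) \<Longrightarrow> (f has_derivative Df f x) (at x)"
  using frechet_derivative_works by blast

lemma Df_cong_open:
  assumes "open S" "x \<in> S" "\<And>y. y \<in> S \<Longrightarrow> f y = h y"
  shows "Df f x = Df h x"
proof -
  have "(f has_derivative f') (at x) \<longleftrightarrow> (h has_derivative f') (at x)" for f'
    using assms by (metis has_derivative_transform_within_open)
  then show ?thesis
    unfolding frechet_derivative_def by simp
qed

lemma differentiable_cong_open:
  assumes "open S" "x \<in> S" "\<And>y. y \<in> S \<Longrightarrow> f y = h y" "f differentiable (at x)"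
  shows "h differentiable (at x)"
  using assms unfolding differentiable_def by (metis has_derivative_transform_within_open)

lemma Df_linear: "f differentiable (at x) \<Longrightarrow> linear (Df f x)"
  using Df_has_derivative has_derivative_linear by blast

text \<open>\<open>Ck_on\<close> uses derivatives at full neighbourhoods, so the values on
  \<open>S\<close> determine them only because \<open>S\<close> is open.\<close>

lemma Ck_on_cong:
  assumes "open S" "\<And>x. x \<in> S \<Longrightarrow> f x = h x" "Ck_on k S f"
  shows "Ck_on k S h"
  using assms(2,3)
proof (induction k arbitrary: f h)
  case 0
  then show ?case by (simp cong: continuous_on_cong)
next
  case (Suc k)
  have 1: "\<forall>x\<in>S. h differentiable (at x)"
    using Suc.prems differentiable_cong_open[OF assms(1)] by (metis Ck_on.simps(2))
  have "Ck_on k S (\<lambda>x. Df h x e)" for e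
  proof (rule Suc.IH[of "\<lambda>x. Df f x e"])
    show "Df f x e = Df h x e" if "x \<in> S" for x
      using Df_cong_open[OF assms(1) that, of f h] Suc.prems(1) by simp
  qed (use Suc.prems in simp)
  with 1 show ?case by simp
qed

lemma Ck_on_SucD: "Ck_on (Suc k) S f \<Longrightarrow> Ck_on k S f"
proof (induction k arbitrary: f)
  case 0
  then show ?case
    by (auto intro!: continuous_at_imp_continuous_on differentiable_imp_continuous_within)
next
  case (Suc k)
  then have "f differentiable (at x)" if "x \<in> S" for x
    using that by simp
  moreover have "Ck_on k S (\<lambda>x. Df f x e)" for e
    by (rule Suc.IH) (use Suc.prems in simp)
  ultimately show ?case by simp
qed

lemma Ck_on_subset: "Ck_on k S f \<Longrightarrow> T \<subseteq> S \<Longrightarrow> Ck_on k T f"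
  by (induction k arbitrary: f) (auto intro: continuous_on_subset)

lemma Ck_on_local:
  assumes "\<And>x. x \<in> S \<Longrightarrow> \<exists>T. open T \<and> x \<in> T \<and> Ck_on k T f"
  shows "Ck_on k S f"
  using assms
proof (induction k arbitrary: f)
  case 0
  then show ?case
    by (metis Ck_on.simps(1) continuous_at_imp_continuous_on continuous_on_eq_continuous_at)
next
  case (Suc k)
  have "f differentiable (at x)" if "x \<in> S" for x
    using Suc.prems[OF that] by auto
  moreover have "Ck_on k S (\<lambda>x. Df f x e)" for e
    by (rule Suc.IH) (use Suc.prems in force)
  ultimately show ?case by simp
qed

lemma Ck_on_const: "Ck_on k S (\<lambda>x. c)"
  by (induction k arbitrary: c) (simp_all add: Df_eqI[OF has_derivative_const])

lemma Ck_on_bounded_linear: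
  assumes "bounded_linear L" "Ck_on k S f" "open S"
  shows "Ck_on k S (\<lambda>x. L (f x))"
  using assms(2)
proof (induction k arbitrary: f)
  case 0
  then show ?case
    using assms(1) by (auto intro: bounded_linear.continuous_on)
next
  case (Suc k)
  have d: "((\<lambda>x. L (f x)) has_derivative (\<lambda>e. L (Df f x e))) (at x)" if "x \<in> S" for x
    using Suc.prems that bounded_linear.has_derivative[OF assms(1)] Df_has_derivative
    by (metis Ck_on.simps(2))
  have "Ck_on k S (\<lambda>x. Df (\<lambda>x. L (f x)) x e)" for e
    by (rule Ck_on_cong[OF assms(3), of "\<lambda>x. L (Df f x e)"])
       (use Suc Df_eqI[OF d] in auto)
  with d show ?case by (auto simp: differentiable_def)
qed

lemma Ck_on_linear: 
  assumes "bounded_linear L" "open S"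
  shows "Ck_on k S L"
proof (cases k)
  case 0
  then show ?thesis using assms linear_continuous_on by auto
next
  case (Suc j)
  have "Df L x = L" for x
    using assms(1) by (intro Df_eqI bounded_linear_imp_has_derivative)
  then show ?thesis
    using Suc bounded_linear_imp_differentiable[OF assms(1)] by (simp add: Ck_on_const)
qed

lemma Ck_on_add:
  assumes "open S" "Ck_on k S f" "Ck_on k S h"
  shows "Ck_on k S (\<lambda>x. f x + h x)"
  using assms(2,3)
proof (induction k arbitrary: f h)
  case 0
  then show ?case by (auto intro: continuous_intros)
next
  case (Suc k)
  have d: "((\<lambda>x. f x + h x) has_derivative (\<lambda>e. Df f x e + Df h x e)) (at x)" if "x \<in> S" for x
    using Suc.prems that by (auto intro!: has_derivative_add Df_has_derivative)
  have "Ck_on k S (\<lambda>x. Df (\<lambda>x. f x + h x) x e)" for e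
    by (rule Ck_on_cong[OF assms(1), of "\<lambda>x. Df f x e + Df h x e"])
       (use Suc Df_eqI[OF d] in auto)
  with d show ?case by (auto simp: differentiable_def)
qed

lemma Ck_on_bilinear:
  assumes "bounded_bilinear B" "open S" "Ck_on k S f" "Ck_on k S h"
  shows "Ck_on k S (\<lambda>x. B (f x) (h x))"
  using assms(3,4)
proof (induction k arbitrary: f h)
  case 0
  then show ?case using assms(1) by (auto intro: bounded_bilinear.continuous_on)
next
  case (Suc k)
  have d: "((\<lambda>x. B (f x) (h x)) has_derivative (\<lambda>e. B (f x) (Df h x e) + B (Df f x e) (h x))) (at x)"
    if "x \<in> S" for x
    using Suc.prems that by (auto intro!: bounded_bilinear.FDERIV[OF assms(1)] Df_has_derivative)
  have "Ck_on k S f" "Ck_on k S h"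
    using Suc.prems Ck_on_SucD by blast+
  then have "Ck_on k S (\<lambda>x. B (f x) (Df h x e) + B (Df f x e) (h x))" for e
    using Suc.prems by (intro Ck_on_add assms(2) Suc.IH) auto
  then have "Ck_on k S (\<lambda>x. Df (\<lambda>x. B (f x) (h x)) x e)" for e
    by (rule Ck_on_cong[OF assms(2), rotated]) (use Df_eqI[OF d] in auto)
  with d show ?case by (auto simp: differentiable_def)
qed

lemma Ck_on_sum:
  assumes "open S" "\<And>i. i \<in> I \<Longrightarrow> Ck_on k S (f i)"
  shows "Ck_on k S (\<lambda>x. \<Sum>i\<in>I. f i x)"
proof (cases "finite I")
  case True
  then show ?thesis
    using assms(2) by (induction I rule: finite_induct) (auto intro: Ck_on_const Ck_on_add[OF assms(1)])
qed (simp add: Ck_on_const)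

text \<open>The chain rule contains \<open>Df h\<close> in a direction that varies with the point.
  Expanding that direction in the basis of the Euclidean middle space leaves derivatives of
  \<open>h\<close> in finitely many fixed directions, which the induction hypothesis covers.\<close>

lemma Ck_on_compose:
  fixes f :: "'a::real_normed_vector \<Rightarrow> 'b::euclidean_space"
  assumes "open S" "open T" "f ` S \<subseteq> T" "Ck_on k S f" "Ck_on k T h"
  shows "Ck_on k S (\<lambda>x. h (f x))"
  using assms(4,5)
proof (induction k arbitrary: h)
  case 0
  then show ?case using assms(3) continuous_on_compose2[of T h S f] by simp
next
  case (Suc k)
  have d: "((\<lambda>x. h (f x)) has_derivative (\<lambda>e. Df h (f x) (Df f x e))) (at x)" if "x \<in> S" for x
  proof -
    have "f differentiable (at x)" "h differentiable (at (f x))"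
      using Suc.prems assms(3) that by auto
    then have "(f has_derivative Df f x) (at x)" "(h has_derivative Df h (f x)) (at (f x))"
      using Df_has_derivative by blast+
    from diff_chain_at[OF this] show ?thesis
      by (simp add: o_def)
  qed
  have e: "Df h (f x) (Df f x e) = (\<Sum>b\<in>Basis. (Df f x e \<bullet> b) *\<^sub>R Df h (f x) b)" if "x \<in> S" for x e
  proof -
    have "linear (Df h (f x))"
      using Suc.prems assms(3) that by (auto intro!: Df_linear)
    then have "Df h (f x) (\<Sum>b\<in>Basis. (Df f x e \<bullet> b) *\<^sub>R b) = (\<Sum>b\<in>Basis. (Df f x e \<bullet> b) *\<^sub>R Df h (f x) b)"
      by (simp add: linear_sum linear_scale)
    then show ?thesis by (simp add: euclidean_representation)
  qed
  have f: "Ck_on k S f" "Ck_on k S (\<lambda>x. Df f x e)" for e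
    using Suc.prems Ck_on_SucD by auto
  have h: "Ck_on k S (\<lambda>x. Df h (f x) b)" for b
    by (rule Suc.IH) (use Suc.prems f in auto)
  have "Ck_on k S (\<lambda>x. \<Sum>b\<in>Basis. (Df f x e \<bullet> b) *\<^sub>R Df h (f x) b)" for e
    by (intro Ck_on_sum assms(1) Ck_on_bilinear[OF bounded_bilinear_scaleR] h
        Ck_on_bounded_linear[OF bounded_linear_inner_left f(2)])
  then have "Ck_on k S (\<lambda>x. Df (\<lambda>x. h (f x)) x e)" for e
    by (rule Ck_on_cong[OF assms(1), rotated]) (use Df_eqI[OF d] e in auto)
  with d show ?case by (auto simp: differentiable_def)
qed

lemma smooth_on_cong: "open S \<Longrightarrow> (\<And>x. x \<in> S \<Longrightarrow> f x = h x) \<Longrightarrow> smooth_on S f \<Longrightarrow> smooth_on S h"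
  unfolding smooth_on_def using Ck_on_cong by blast

lemma smooth_on_subset: "smooth_on S f \<Longrightarrow> T \<subseteq> S \<Longrightarrow> smooth_on T f"
  unfolding smooth_on_def using Ck_on_subset by blast

lemma smooth_on_local:
  "(\<And>x. x \<in> S \<Longrightarrow> \<exists>T. open T \<and> x \<in> T \<and> smooth_on T f) \<Longrightarrow> smooth_on S f"
  unfolding smooth_on_def by (meson Ck_on_local)

lemma smooth_on_const [simp]: "smooth_on S (\<lambda>x. c)"
  unfolding smooth_on_def using Ck_on_const by blast

lemma smooth_on_bounded_linear:
  "bounded_linear L \<Longrightarrow> smooth_on S f \<Longrightarrow> open S \<Longrightarrow> smooth_on S (\<lambda>x. L (f x))"
  unfolding smooth_on_def using Ck_on_bounded_linear by blast

lemma smooth_on_linear: "bounded_linear L \<Longrightarrow> open S \<Longrightarrow> smooth_on S L"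
  unfolding smooth_on_def using Ck_on_linear by blast

lemma smooth_on_id: "open S \<Longrightarrow> smooth_on S (\<lambda>x. x)"
  using smooth_on_linear[OF bounded_linear_ident] .

lemma smooth_on_add:
  "smooth_on S f \<Longrightarrow> smooth_on S h \<Longrightarrow> open S \<Longrightarrow> smooth_on S (\<lambda>x. f x + h x)"
  unfolding smooth_on_def using Ck_on_add by blast

lemma smooth_on_bilinear:
  "bounded_bilinear B \<Longrightarrow> smooth_on S f \<Longrightarrow> smooth_on S h \<Longrightarrow> open S \<Longrightarrow> smooth_on S (\<lambda>x. B (f x) (h x))"
  unfolding smooth_on_def using Ck_on_bilinear by blast

lemma smooth_on_compose:
  fixes f :: "'a::real_normed_vector \<Rightarrow> 'b::euclidean_space"
  shows "smooth_on T h \<Longrightarrow> smooth_on S f \<Longrightarrow> f ` S \<subseteq> T \<Longrightarrow> open S \<Longrightarrow> open T \<Longrightarrow> smooth_on S (\<lambda>x. h (f x))"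
  unfolding smooth_on_def using Ck_on_compose by metis

lemmas smooth_on_mult = smooth_on_bilinear[OF bounded_bilinear_mult]
lemmas smooth_on_scaleR = smooth_on_bilinear[OF bounded_bilinear_scaleR]
lemmas smooth_on_inner = smooth_on_bilinear[OF bounded_bilinear_inner]
lemmas smooth_on_fst = smooth_on_bounded_linear[OF bounded_linear_fst]
lemmas smooth_on_snd = smooth_on_bounded_linear[OF bounded_linear_snd]
lemmas smooth_on_of_real = smooth_on_bounded_linear[OF bounded_linear_of_real]
lemmas smooth_on_minus = smooth_on_bounded_linear[OF bounded_linear_minus[OF bounded_linear_ident]]

lemma smooth_on_diff:
  "smooth_on S f \<Longrightarrow> smooth_on S h \<Longrightarrow> open S \<Longrightarrow> smooth_on S (\<lambda>x. f x - h x)"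
  using smooth_on_add[OF _ smooth_on_minus, of S f h] by simp

lemma smooth_on_Pair:
  assumes "smooth_on S f" "smooth_on S h" "open S"
  shows "smooth_on S (\<lambda>x. (f x, h x))"
proof -
  have "bounded_linear (\<lambda>x::'b. (x, 0::'c))" "bounded_linear (\<lambda>x::'c. (0::'b, x))"
    by (intro bounded_linear_Pair bounded_linear_ident bounded_linear_zero)+
  then have "smooth_on S (\<lambda>x. (f x, 0) + (0, h x))"
    using smooth_on_bounded_linear[of "\<lambda>x. (x, 0)" S f] smooth_on_bounded_linear[of "\<lambda>x. (0, x)" S h] assms
    by (intro smooth_on_add) blast+
  then show ?thesis by simp
qed

lemma smooth_on_differentiable: "smooth_on S f \<Longrightarrow> x \<in> S \<Longrightarrow> f differentiable (at x)"
  unfolding smooth_on_def by (metis Ck_on.simps(2))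

lemma smooth_on_has_derivative: "smooth_on S f \<Longrightarrow> x \<in> S \<Longrightarrow> (f has_derivative Df f x) (at x)"
  using smooth_on_differentiable Df_has_derivative by blast

lemma smooth_on_Df: "smooth_on S f \<Longrightarrow> smooth_on S (\<lambda>x. Df f x e)"
  unfolding smooth_on_def by (metis Ck_on.simps(2))

lemma smooth_on_continuous: "smooth_on S f \<Longrightarrow> continuous_on S f"
  unfolding smooth_on_def by (metis Ck_on.simps(1))

text \<open>Differentiation exchanges the two functions up to sign, so the induction has to carry
  both at once.\<close>

lemma Ck_on_sin_cos: "Ck_on k UNIV (sin::real \<Rightarrow> real) \<and> Ck_on k UNIV (cos::real \<Rightarrow> real)"
proof (induction k)
  case 0
  then show ?case by (auto intro: continuous_intros)
next
  case (Suc k)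
  have s: "(sin has_derivative (\<lambda>e. e * cos x)) (at x)" for x :: real
    by (auto intro!: derivative_eq_intros)
  have c: "(cos has_derivative (\<lambda>e. - e * sin x)) (at x)" for x :: real
    by (auto intro!: derivative_eq_intros)
  have "Ck_on k UNIV (\<lambda>x::real. e * cos x)" "Ck_on k UNIV (\<lambda>x::real. - e * sin x)" for e
    by (intro Ck_on_bilinear[OF bounded_bilinear_mult] Ck_on_const conjunct1[OF Suc] conjunct2[OF Suc] open_UNIV)+
  then show ?case
    by (auto simp: Df_eqI[OF s] Df_eqI[OF c] differentiable_def intro: s c)
qed

lemma Ck_on_sinh_cosh: "Ck_on k UNIV (sinh::real \<Rightarrow> real) \<and> Ck_on k UNIV (cosh::real \<Rightarrow> real)"
proof (induction k)
  case 0
  then show ?case by (auto intro: continuous_intros)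
next
  case (Suc k)
  have s: "(sinh has_derivative (\<lambda>e. e * cosh x)) (at x)" for x :: real
    by (auto intro!: derivative_eq_intros)
  have c: "(cosh has_derivative (\<lambda>e. e * sinh x)) (at x)" for x :: real
    by (auto intro!: derivative_eq_intros)
  have "Ck_on k UNIV (\<lambda>x::real. e * cosh x)" "Ck_on k UNIV (\<lambda>x::real. e * sinh x)" for e
    by (intro Ck_on_bilinear[OF bounded_bilinear_mult] Ck_on_const conjunct1[OF Suc] conjunct2[OF Suc] open_UNIV)+
  then show ?case
    by (auto simp: Df_eqI[OF s] Df_eqI[OF c] differentiable_def intro: s c)
qed

lemma Ck_on_inverse: "Ck_on k {x::real. x \<noteq> 0} inverse"
proof (induction k)
  case 0
  then show ?case by (auto intro: continuous_intros)
next
  case (Suc k)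
  have o: "open {x::real. x \<noteq> 0}"
    by (simp add: open_Collect_neq)
  have d: "(inverse has_derivative (\<lambda>e. - e * (inverse x * inverse x))) (at x)" if "x \<noteq> 0" for x :: real
    using that by (auto intro!: derivative_eq_intros)
  have "Ck_on k {x. x \<noteq> 0} (\<lambda>x::real. - e * (inverse x * inverse x))" for e
    by (intro Ck_on_bilinear[OF bounded_bilinear_mult] Ck_on_const Suc o)
  then have "Ck_on k {x. x \<noteq> 0} (\<lambda>x::real. Df inverse x e)" for e
    by (rule Ck_on_cong[OF o, rotated]) (use Df_eqI[OF d] in auto)
  then show ?case
    by (auto simp: differentiable_def intro: d)
qed

lemma smooth_on_real_compose:
  fixes h :: "real \<Rightarrow> real"
  assumes "\<And>k. Ck_on k UNIV h" "smooth_on S f" "open S"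
  shows "smooth_on S (\<lambda>x. h (f x))"
  using assms smooth_on_compose[of UNIV h S f] by (auto simp: smooth_on_def)

lemmas smooth_on_sin = smooth_on_real_compose[OF conjunct1[OF Ck_on_sin_cos]]
lemmas smooth_on_cos = smooth_on_real_compose[OF conjunct2[OF Ck_on_sin_cos]]
lemmas smooth_on_sinh = smooth_on_real_compose[OF conjunct1[OF Ck_on_sinh_cosh]]
lemmas smooth_on_cosh = smooth_on_real_compose[OF conjunct2[OF Ck_on_sinh_cosh]]

lemma smooth_on_divide:
  fixes f h :: "'a::real_normed_vector \<Rightarrow> real"
  assumes "smooth_on S f" "smooth_on S h" "open S" "\<And>x. x \<in> S \<Longrightarrow> h x \<noteq> 0"
  shows "smooth_on S (\<lambda>x. f x / h x)"
proof -
  have i: "smooth_on {x::real. x \<noteq> 0} inverse" "open {x::real. x \<noteq> 0}"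
    using Ck_on_inverse by (simp_all add: smooth_on_def open_Collect_neq)
  have "smooth_on S (\<lambda>x. inverse (h x))"
    by (rule smooth_on_compose[OF i(1) assms(2) _ assms(3) i(2)]) (use assms(4) in auto)
  then show ?thesis
    using smooth_on_mult[OF assms(1) _ assms(3)] by (simp add: divide_inverse)
qed

lemma smooth_on_cis: 
  assumes "smooth_on S f" "open S"
  shows "smooth_on S (\<lambda>x. cis (f x))"
proof -
  have "smooth_on S (\<lambda>x. of_real (cos (f x)) + \<i> * of_real (sin (f x)))"
    by (intro smooth_on_add smooth_on_mult smooth_on_of_real smooth_on_const smooth_on_sin smooth_on_cos assms)
  moreover have "of_real (cos t) + \<i> * of_real (sin t) = cis t" for t
    by (simp add: complex_eq_iff)
  ultimately show ?thesis by simp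
qed

lemmas smooth_on_intros = smooth_on_const smooth_on_id smooth_on_add smooth_on_diff smooth_on_minus
  smooth_on_mult smooth_on_scaleR smooth_on_inner smooth_on_fst smooth_on_snd smooth_on_of_real
  smooth_on_Pair smooth_on_sin smooth_on_cos smooth_on_sinh smooth_on_cosh smooth_on_cis

subsection \<open>Symmetry of second derivatives\<close>

lemma DERIV_along_line:
  assumes "f differentiable (at (p + s *\<^sub>R e))"
  shows "((\<lambda>s. f (p + s *\<^sub>R e)) has_real_derivative Df f (p + s *\<^sub>R e) e) (at s)"
proof -
  have 1: "((\<lambda>s. p + s *\<^sub>R e) has_derivative (\<lambda>h. h *\<^sub>R e)) (at s)"
    by (auto intro!: derivative_eq_intros)
  have "((\<lambda>s. f (p + s *\<^sub>R e)) has_derivative (\<lambda>h. Df f (p + s *\<^sub>R e) (h *\<^sub>R e))) (at s)"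
    using diff_chain_at[OF 1 Df_has_derivative[OF assms]] by (simp add: o_def)
  moreover have "(\<lambda>h. Df f (p + s *\<^sub>R e) (h *\<^sub>R e)) = (*) (Df f (p + s *\<^sub>R e) e)"
    using linear_scale[OF Df_linear[OF assms]] by (auto simp: mult.commute)
  ultimately show ?thesis
    by (simp add: has_field_derivative_def)
qed

text \<open>The mean value theorem is applied first along \<open>e\<close> to a difference of two
  lines, then along \<open>e'\<close>. The left-hand side is symmetric in \<open>e\<close> and
  \<open>e'\<close>, which is what makes the two mixed derivatives comparable.\<close>

lemma second_difference_mvt:
  fixes f :: "'a::real_normed_vector \<Rightarrow> real"
  assumes "t > 0" "\<And>s r. 0 \<le> s \<Longrightarrow> s \<le> t \<Longrightarrow> 0 \<le> r \<Longrightarrow> r \<le> t \<Longrightarrow> q + s *\<^sub>R e + r *\<^sub>R e' \<in> U"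
    and "\<And>x. x \<in> U \<Longrightarrow> f differentiable (at x)" "\<And>x. x \<in> U \<Longrightarrow> (\<lambda>x. Df f x e) differentiable (at x)"
  obtains s r where "0 < s" "s < t" "0 < r" "r < t"
    "f (q + t *\<^sub>R e + t *\<^sub>R e') - f (q + t *\<^sub>R e) - f (q + t *\<^sub>R e') + f q
      = t * (t * Df (\<lambda>x. Df f x e) (q + s *\<^sub>R e + r *\<^sub>R e') e')"
proof -
  define \<phi> where "\<phi> s = f ((q + t *\<^sub>R e') + s *\<^sub>R e) - f (q + s *\<^sub>R e)" for s
  have "(\<phi> has_real_derivative Df f ((q + t *\<^sub>R e') + s *\<^sub>R e) e - Df f (q + s *\<^sub>R e) e) (at s)"
    if "0 \<le> s" "s \<le> t" for s
    unfolding \<phi>_def using assms(2)[OF that, of t] assms(2)[OF that, of 0] \<open>t > 0\<close>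
    by (intro DERIV_diff DERIV_along_line assms(3)) (simp_all add: algebra_simps)
  from MVT2[OF \<open>t > 0\<close> this] obtain s where s: "0 < s" "s < t"
    "\<phi> t - \<phi> 0 = t * (Df f ((q + t *\<^sub>R e') + s *\<^sub>R e) e - Df f (q + s *\<^sub>R e) e)"
    by auto
  have "((\<lambda>r. Df f ((q + s *\<^sub>R e) + r *\<^sub>R e') e) has_real_derivative
      Df (\<lambda>x. Df f x e) ((q + s *\<^sub>R e) + r *\<^sub>R e') e') (at r)" if "0 \<le> r" "r \<le> t" for r
    using s that by (intro DERIV_along_line assms(4) assms(2)) auto
  from MVT2[OF \<open>t > 0\<close> this] obtain r where r: "0 < r" "r < t"
    "Df f ((q + s *\<^sub>R e) + t *\<^sub>R e') e - Df f (q + s *\<^sub>R e) e = t * Df (\<lambda>x. Df f x e) ((q + s *\<^sub>R e) + r *\<^sub>R e') e'"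
    by auto
  show thesis
  proof (rule that[OF s(1,2) r(1,2)])
    show "f (q + t *\<^sub>R e + t *\<^sub>R e') - f (q + t *\<^sub>R e) - f (q + t *\<^sub>R e') + f q
      = t * (t * Df (\<lambda>x. Df f x e) (q + s *\<^sub>R e + r *\<^sub>R e') e')"
      using s(3) r(3) unfolding \<phi>_def by (simp add: add_ac)
  qed
qed

lemma Df_symmetric_real:
  fixes f :: "'a::real_normed_vector \<Rightarrow> real"
  assumes "open U" "q \<in> U" "smooth_on U f"
  shows "Df (\<lambda>x. Df f x e) q e' = Df (\<lambda>x. Df f x e') q e"
proof (rule ccontr)
  let ?A = "\<lambda>x. Df (\<lambda>x. Df f x e) x e'" and ?B = "\<lambda>x. Df (\<lambda>x. Df f x e') x e"
  assume ne: "?A q \<noteq> ?B q"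
  define \<epsilon> where "\<epsilon> = dist (?A q) (?B q) / 2"
  have "\<epsilon> > 0" using ne by (simp add: \<epsilon>_def)
  have sm: "smooth_on U (\<lambda>x. Df f x e)" "smooth_on U (\<lambda>x. Df f x e')"
    using smooth_on_Df assms by blast+
  have "isCont ?A q" "isCont ?B q"
    using sm assms(1,2) smooth_on_continuous[OF smooth_on_Df] continuous_on_eq_continuous_at by blast+
  then obtain d1 d2 where d: "d1 > 0" "d2 > 0"
    "\<And>x. dist x q < d1 \<Longrightarrow> dist (?A x) (?A q) < \<epsilon>" "\<And>x. dist x q < d2 \<Longrightarrow> dist (?B x) (?B q) < \<epsilon>"
    using \<open>\<epsilon> > 0\<close> unfolding continuous_at_eps_delta by metis
  obtain d3 where d3: "d3 > 0" "ball q d3 \<subseteq> U"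
    using assms openE by blast
  define c where "c = norm e + norm e' + 1"
  \<comment> \<open>With this side length the whole parallelogram stays in the ball on which both
    continuity estimates and membership in \<open>U\<close> hold; the summand 1 in \<open>c\<close>
    avoids division by zero when both directions vanish.\<close>
  define t where "t = min d1 (min d2 d3) / (2 * c)"
  have "c > 0" by (simp add: c_def add_nonneg_pos)
  then have "t > 0" using d d3 by (simp add: t_def)
  have near: "dist (q + s *\<^sub>R e + r *\<^sub>R e') q < min d1 (min d2 d3)" if "0 \<le> s" "s \<le> t" "0 \<le> r" "r \<le> t" for s r
  proof -
    have "dist (q + s *\<^sub>R e + r *\<^sub>R e') q = norm (s *\<^sub>R e + r *\<^sub>R e')"
      by (simp add: dist_norm add.assoc)
    also have "\<dots> \<le> s * norm e + r * norm e'"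
      using norm_triangle_ineq[of "s *\<^sub>R e" "r *\<^sub>R e'"] that by simp
    also have "\<dots> \<le> t * norm e + t * norm e'"
      using that by (intro add_mono mult_right_mono) auto
    also have "\<dots> = t * (c - 1)"
      by (simp add: c_def algebra_simps)
    also have "\<dots> < t * (2 * c)"
      using \<open>t > 0\<close> \<open>c > 0\<close> by (intro mult_strict_left_mono) auto
    also have "\<dots> = min d1 (min d2 d3)"
      using \<open>c > 0\<close> by (simp add: t_def)
    finally show ?thesis .
  qed
  have inU: "q + s *\<^sub>R e + r *\<^sub>R e' \<in> U" if "0 \<le> s" "s \<le> t" "0 \<le> r" "r \<le> t" for s r
    using near[OF that] d3 by (auto simp: dist_commute)
  have inU': "q + s *\<^sub>R e' + r *\<^sub>R e \<in> U" if "0 \<le> s" "s \<le> t" "0 \<le> r" "r \<le> t" for s r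
    using inU[OF that(3,4,1,2)] by (simp add: add_ac)
  have dif: "f differentiable (at x)" "(\<lambda>x. Df f x e) differentiable (at x)" "(\<lambda>x. Df f x e') differentiable (at x)"
    if "x \<in> U" for x
    using that sm assms(3) smooth_on_differentiable by blast+
  obtain s r where sr: "0 < s" "s < t" "0 < r" "r < t"
    "f (q + t *\<^sub>R e + t *\<^sub>R e') - f (q + t *\<^sub>R e) - f (q + t *\<^sub>R e') + f q = t * (t * ?A (q + s *\<^sub>R e + r *\<^sub>R e'))"
    by (rule second_difference_mvt[OF \<open>t > 0\<close> inU dif(1,2)])
  obtain s' r' where sr': "0 < s'" "s' < t" "0 < r'" "r' < t"
    "f (q + t *\<^sub>R e' + t *\<^sub>R e) - f (q + t *\<^sub>R e') - f (q + t *\<^sub>R e) + f q = t * (t * ?B (q + s' *\<^sub>R e' + r' *\<^sub>R e))"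
    by (rule second_difference_mvt[OF \<open>t > 0\<close> inU' dif(1,3)])
  have swap: "q + t *\<^sub>R e' + t *\<^sub>R e = q + t *\<^sub>R e + t *\<^sub>R e'" by (simp add: add_ac)
  have "t * (t * ?A (q + s *\<^sub>R e + r *\<^sub>R e')) = t * (t * ?B (q + s' *\<^sub>R e' + r' *\<^sub>R e))"
    using sr(5) sr'(5) unfolding swap by linarith
  then have "?A (q + s *\<^sub>R e + r *\<^sub>R e') = ?B (q + r' *\<^sub>R e + s' *\<^sub>R e')"
    using \<open>t > 0\<close> by (simp add: add_ac)
  moreover have "dist (?A (q + s *\<^sub>R e + r *\<^sub>R e')) (?A q) < \<epsilon>"
    using near[of s r] sr by (intro d(3)) auto
  moreover have "dist (?B (q + r' *\<^sub>R e + s' *\<^sub>R e')) (?B q) < \<epsilon>"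
    using near[of r' s'] sr' by (intro d(4)) auto
  ultimately have "dist (?A q) (?B q) < 2 * \<epsilon>"
    using dist_triangle3[of "?A q" "?B q" "?A (q + s *\<^sub>R e + r *\<^sub>R e')"] by simp
  then show False by (simp add: \<epsilon>_def)
qed

lemma Df_bounded_linear:
  assumes "bounded_linear L" "f differentiable (at x)"
  shows "Df (\<lambda>x. L (f x)) x = (\<lambda>e. L (Df f x e))"
  by (rule Df_eqI, rule bounded_linear.has_derivative[OF assms(1) Df_has_derivative[OF assms(2)]])

lemma Df_symmetric:
  fixes f :: "'a::real_normed_vector \<Rightarrow> 'b::euclidean_space"
  assumes "open U" "q \<in> U" "smooth_on U f"
  shows "Df (\<lambda>x. Df f x e) q e' = Df (\<lambda>x. Df f x e') q e"
proof (rule euclidean_eqI)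
  fix b :: 'b
  note bl = bounded_linear_inner_left[of b]
  have 1: "Df (\<lambda>x. f x \<bullet> b) x e = Df f x e \<bullet> b" if "x \<in> U" for x e
    using Df_bounded_linear[OF bl smooth_on_differentiable[OF assms(3) that]] by (rule fun_cong)
  have 2: "Df (\<lambda>x. Df f x e) q e' \<bullet> b = Df (\<lambda>x. Df (\<lambda>x. f x \<bullet> b) x e) q e'" for e e'
  proof -
    have "Df (\<lambda>x. Df f x e \<bullet> b) q e' = Df (\<lambda>x. Df f x e) q e' \<bullet> b"
      using Df_bounded_linear[OF bl smooth_on_differentiable[OF smooth_on_Df[OF assms(3)] assms(2)]]
      by (rule fun_cong)
    moreover have "Df (\<lambda>x. Df f x e \<bullet> b) q = Df (\<lambda>x. Df (\<lambda>x. f x \<bullet> b) x e) q"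
      by (rule Df_cong_open[OF assms(1,2)]) (simp add: 1)
    ultimately show ?thesis by simp
  qed
  have "smooth_on U (\<lambda>x. f x \<bullet> b)"
    by (rule smooth_on_bounded_linear[OF bl assms(3,1)])
  then show "Df (\<lambda>x. Df f x e) q e' \<bullet> b = Df (\<lambda>x. Df f x e') q e \<bullet> b"
    unfolding 2 by (rule Df_symmetric_real[OF assms(1,2)])
qed

subsection \<open>Inverse functions in the plane\<close>

lemma linear_R2: "linear L \<Longrightarrow> L e = fst e *\<^sub>R L e1 + snd e *\<^sub>R L e2" for L :: "R2 \<Rightarrow> 'b::real_vector"
proof -
  assume L: "linear L"
  have "L e = L (fst e *\<^sub>R e1 + snd e *\<^sub>R e2)" by simp
  then show ?thesis using L by (simp only: linear_add linear_scale)
qed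

lemma linear_R2_det_nonzero:
  fixes L :: "R2 \<Rightarrow> R2"
  assumes "linear L" "inj L"
  shows "fst (L e1) * snd (L e2) - snd (L e1) * fst (L e2) \<noteq> 0"
proof
  assume d: "fst (L e1) * snd (L e2) - snd (L e1) * fst (L e2) = 0"
  \<comment> \<open>The two arguments are taken from the adjugate of the matrix of \<open>L\<close>;
    with determinant zero both lie in the kernel.\<close>
  have "L (snd (L e2), - snd (L e1)) = 0" "L (fst (L e2), - fst (L e1)) = 0"
    using d by (subst linear_R2[OF assms(1)]; simp add: prod_eq_iff algebra_simps)+
  then have "(snd (L e2), - snd (L e1)) = 0" "(fst (L e2), - fst (L e1)) = 0"
    using assms linear_injective_0 by blast+
  then have "L e1 = 0" by (simp add: prod_eq_iff)
  then have "e1 = 0" using assms linear_injective_0 by blast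
  then show False by (simp add: zero_prod_def)
qed

text \<open>The inverse function theorem supplies a differentiable inverse \<open>k\<close>.
  Cramer's rule writes its derivative as \<open>J\<close> evaluated along \<open>k\<close>, and
  \<open>J\<close> is smooth where the determinant \<open>d\<close> is nonzero, so the regularity of
  \<open>k\<close> rises by one order at each induction step.\<close>

lemma smooth_inverse_function:
  fixes f :: "R2 \<Rightarrow> R2"
  assumes "open U" "x0 \<in> U" "smooth_on U f" "inj (Df f x0)"
  obtains W V k where "open W" "W \<subseteq> U" "x0 \<in> W" "open V" "homeomorphism W V f k" "smooth_on V k"
proof -
  have bl: "bounded_linear (Df f x)" if "x \<in> U" for x
    using smooth_on_has_derivative[OF assms(3) that] has_derivative_bounded_linear by blast
  define f' where "f' x = Blinfun (Df f x)" for x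
  have f': "blinfun_apply (f' x) = Df f x" if "x \<in> U" for x
    unfolding f'_def by (rule bounded_linear_Blinfun_apply[OF bl[OF that]])
  have contf: "continuous_on U f'"
  proof (rule continuous_on_blinfun_componentwise)
    fix i :: R2
    have "continuous_on U (\<lambda>x. Df f x i)"
      by (rule smooth_on_continuous[OF smooth_on_Df[OF assms(3)]])
    then show "continuous_on U (\<lambda>x. blinfun_apply (f' x) i)"
      by (rule continuous_on_eq) (simp add: f')
  qed
  obtain L where L: "linear L" "L \<circ> Df f x0 = id"
    using linear_injective_left_inverse[OF bounded_linear.linear[OF bl[OF assms(2)]] assms(4)] by blast
  have LB: "blinfun_apply (Blinfun L) = L"
    using L(1) by (simp add: bounded_linear_Blinfun_apply linear_conv_bounded_linear)
  have "Blinfun L o\<^sub>L f' x0 = id_blinfun"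
  proof (rule blinfun_eqI)
    fix i
    have "L (Df f x0 i) = i" using L(2) by (metis comp_apply id_apply)
    then show "blinfun_apply (Blinfun L o\<^sub>L f' x0) i = blinfun_apply id_blinfun i"
      by (simp only: blinfun_apply_blinfun_compose LB f'[OF assms(2)] blinfun_apply_id_blinfun id_apply)
  qed
  from inverse_function_theorem[OF assms(1) _ contf assms(2) this, of f]
  obtain W V k k' where W: "open W" "W \<subseteq> U" "x0 \<in> W" "open V" "homeomorphism W V f k"
    and k': "\<And>y. y \<in> V \<Longrightarrow> (k has_derivative (k' y)) (at y)"
      "\<And>y. y \<in> V \<Longrightarrow> k' y = inv (blinfun_apply (f' (k y)))"
      "\<And>y. y \<in> V \<Longrightarrow> bij (blinfun_apply (f' (k y)))"
    using smooth_on_has_derivative[OF assms(3)] f' by metis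
  have kW: "k y \<in> W" "k y \<in> U" if "y \<in> V" for y
    using W that by (auto simp: homeomorphism_def)
  define d where "d q = fst (Df f q e1) * snd (Df f q e2) - snd (Df f q e1) * fst (Df f q e2)" for q
  define J where "J q e = ((snd (Df f q e2) * fst e - fst (Df f q e2) * snd e) / d q,
      (fst (Df f q e1) * snd e - snd (Df f q e1) * fst e) / d q)" for q e
  define U0 where "U0 = {q\<in>U. d q \<noteq> 0}"
  have sd: "smooth_on U d"
    unfolding d_def by (intro smooth_on_intros smooth_on_Df assms)
  have "open (U \<inter> d -` (- {0}))"
    by (rule continuous_open_preimage[OF smooth_on_continuous[OF sd] assms(1)]) (intro open_Compl closed_singleton)
  moreover have "U \<inter> d -` (- {0}) = U0" unfolding U0_def by auto
  ultimately have U0: "open U0" "U0 \<subseteq> U" by (simp, force simp: U0_def)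
  have sJ: "smooth_on U0 (\<lambda>q. J q e)" for e
    unfolding J_def
    by (intro smooth_on_divide smooth_on_intros smooth_on_Df smooth_on_subset[OF assms(3)] smooth_on_subset[OF sd] U0)
       (auto simp: U0_def)
  have kU0: "k y \<in> U0" "k' y = J (k y)" if "y \<in> V" for y
  proof -
    let ?L = "Df f (k y)"
    have lin: "linear ?L" using bl[OF kW(2)[OF that]] by (rule bounded_linear.linear)
    have bij: "bij ?L" using k'(3)[OF that] f'[OF kW(2)[OF that]] by simp
    have dn: "d (k y) \<noteq> 0"
      using linear_R2_det_nonzero[OF lin] bij by (simp add: d_def bij_def)
    then show "k y \<in> U0" using kW that by (simp add: U0_def)
    have "J (k y) (?L e) = e" for e
      using dn linear_R2[OF lin, of e] unfolding J_def 
      by (simp add: prod_eq_iff field_simps) (simp add: d_def algebra_simps)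
    then have "inv ?L v = J (k y) v" for v
      using bij by (metis bij_inv_eq_iff)
    then show "k' y = J (k y)"
      using k'(2)[OF that] f'[OF kW(2)[OF that]] by auto
  qed
  have "Ck_on n V k" for n
  proof (induction n)
    case 0
    show ?case using W(5) by (simp add: homeomorphism_def)
  next
    case (Suc n)
    have "Ck_on n V (\<lambda>y. J (k y) e)" for e
      by (rule Ck_on_compose[OF W(4) U0(1) _ Suc]) (use kU0 sJ in \<open>auto simp: smooth_on_def\<close>)
    then have "Ck_on n V (\<lambda>y. Df k y e)" for e
      by (rule Ck_on_cong[OF W(4), rotated]) (use Df_eqI[OF k'(1)] kU0(2) in auto)
    moreover have "k differentiable (at y)" if "y \<in> V" for y
      using k'(1)[OF that] by (rule differentiableI)
    ultimately show ?case by simp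
  qed
  then show thesis
    using that W by (auto simp: smooth_on_def)
qed

text \<open>Taking inner products with the two tangent vectors of \<open>\<Psi>\<close> at a point
  turns \<open>\<Psi>\<close> into a planar map with invertible derivative. Its smooth local inverse
  recovers \<open>v\<close> from the smooth composite; continuity of \<open>v\<close> keeps it in
  the right sheet.\<close>

lemma smooth_on_immersion_lift:
  fixes \<Psi> :: "R2 \<Rightarrow> 'b::euclidean_space" and v :: "'c::real_normed_vector \<Rightarrow> R2"
  assumes P: "open P" "smooth_on P \<Psi>" "\<And>x. x \<in> P \<Longrightarrow> inj (Df \<Psi> x)"
    and S: "open S" "continuous_on S v" "v ` S \<subseteq> P" "smooth_on S (\<lambda>x. \<Psi> (v x))"
  shows "smooth_on S v"
proof (rule smooth_on_local)
  fix x0 assume x0: "x0 \<in> S"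
  define p where "p = v x0"
  have p: "p \<in> P" using S x0 by (auto simp: p_def)
  define \<pi> where "\<pi> w = (w \<bullet> Df \<Psi> p e1, w \<bullet> Df \<Psi> p e2)" for w
  have bl: "bounded_linear \<pi>"
    unfolding \<pi>_def by (intro bounded_linear_Pair bounded_linear_inner_left)
  have sm: "smooth_on P (\<lambda>x. \<pi> (\<Psi> x))"
    by (rule smooth_on_bounded_linear[OF bl P(2,1)])
  have D: "Df (\<lambda>x. \<pi> (\<Psi> x)) p = (\<lambda>e. \<pi> (Df \<Psi> p e))"
    by (rule Df_bounded_linear[OF bl smooth_on_differentiable[OF P(2) p]])
  have lin: "linear (Df \<Psi> p)"
    by (rule Df_linear[OF smooth_on_differentiable[OF P(2) p]])
  have "inj (Df (\<lambda>x. \<pi> (\<Psi> x)) p)"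
  proof -
    have "linear (\<lambda>e. \<pi> (Df \<Psi> p e))"
      using lin bounded_linear.linear[OF bl] linear_compose[of "Df \<Psi> p" \<pi>] by (simp add: o_def)
    moreover have "e = 0" if "\<pi> (Df \<Psi> p e) = 0" for e
    proof -
      let ?w = "Df \<Psi> p e"
      have "?w \<bullet> ?w = ?w \<bullet> (fst e *\<^sub>R Df \<Psi> p e1 + snd e *\<^sub>R Df \<Psi> p e2)"
        using linear_R2[OF lin, of e] by simp
      also have "\<dots> = 0" using that by (simp add: \<pi>_def inner_add_right prod_eq_iff)
      finally have "?w = 0" by simp
      then show ?thesis using lin P(3)[OF p] linear_injective_0 by blast
    qed
    ultimately show ?thesis unfolding D using linear_injective_0 by blast
  qed
  from smooth_inverse_function[OF P(1) p sm this]
  obtain W V k where W: "open W" "W \<subseteq> P" "p \<in> W" "open V" "homeomorphism W V (\<lambda>x. \<pi> (\<Psi> x)) k" "smooth_on V k" .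
  define T where "T = S \<inter> v -` W"
  have oT: "open T" unfolding T_def by (rule continuous_open_preimage[OF S(2,1) W(1)])
  have 1: "smooth_on T (\<lambda>x. \<pi> (\<Psi> (v x)))"
    by (rule smooth_on_bounded_linear[OF bl smooth_on_subset[OF S(4)] oT]) (auto simp: T_def)
  have inV: "\<pi> (\<Psi> (v x)) \<in> V" and kk: "k (\<pi> (\<Psi> (v x))) = v x" if "x \<in> T" for x
    using that W(5) by (auto simp: T_def homeomorphism_def)
  have "smooth_on T (\<lambda>x. k (\<pi> (\<Psi> (v x))))"
    by (rule smooth_on_compose[OF W(6) 1 _ oT W(4)]) (use inV in auto)
  then have "smooth_on T v"
    by (rule smooth_on_cong[OF oT, rotated]) (simp add: kk)
  then show "\<exists>T. open T \<and> x0 \<in> T \<and> smooth_on T v"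
    using oT x0 W(3) by (auto simp: T_def p_def)
qed

subsection \<open>Immersed surfaces inside embedded surfaces\<close>

text \<open>The topological content of an atlas, shared by the given surface and the model domains.
  Smoothness of maps between surfaces is read off through immersions into Euclidean space.\<close>

definition charted :: "'m::topological_space set \<Rightarrow> 'm atlas \<Rightarrow> bool" where
  "charted M \<A> \<longleftrightarrow> (\<Union>(U, \<phi>)\<in>\<A>. \<phi> ` U) = M \<and>
     (\<forall>(U, \<phi>)\<in>\<A>. open U \<and> openin (top_of_set M) (\<phi> ` U) \<and> (\<exists>\<psi>. homeomorphism U (\<phi> ` U) \<phi> \<psi>))"

lemma oriented_surface_charted: "oriented_surface M \<A> \<Longrightarrow> charted M \<A>"
  unfolding oriented_surface_def charted_def by blast

lemma charted_chart:
  assumes "charted M \<A>" "(P, \<phi>) \<in> \<A>"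
  shows "open P" "openin (top_of_set M) (\<phi> ` P)" "homeomorphism P (\<phi> ` P) \<phi> (inv_into P \<phi>)"
    "\<phi> ` P \<subseteq> M" "continuous_on P \<phi>" "continuous_on (\<phi> ` P) (inv_into P \<phi>)" "inj_on \<phi> P"
proof -
  have *: "open P \<and> openin (top_of_set M) (\<phi> ` P) \<and> (\<exists>\<psi>. homeomorphism P (\<phi> ` P) \<phi> \<psi>)"
    using assms unfolding charted_def by blast
  then show "open P" "openin (top_of_set M) (\<phi> ` P)" by blast+
  then show "\<phi> ` P \<subseteq> M" using openin_imp_subset by blast
  obtain \<psi> where \<psi>: "homeomorphism P (\<phi> ` P) \<phi> \<psi>" using * by blast
  show inj: "inj_on \<phi> P"
    using homeomorphism_apply1[OF \<psi>] by (rule inj_on_inverseI)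
  have "homeomorphism P (\<phi> ` P) \<phi> (inv_into P \<phi>)"
    by (rule homeomorphism_cong[OF \<psi>]) (auto simp: inv_into_f_f[OF inj] homeomorphism_apply1[OF \<psi>])
  then show "homeomorphism P (\<phi> ` P) \<phi> (inv_into P \<phi>)" "continuous_on P \<phi>"
    "continuous_on (\<phi> ` P) (inv_into P \<phi>)"
    by (auto simp: homeomorphism_def)
qed

lemma charted_cover:
  assumes "charted M \<A>" "p \<in> M"
  obtains P \<phi> q where "(P, \<phi>) \<in> \<A>" "q \<in> P" "p = \<phi> q"
  using assms unfolding charted_def by blast

lemma chart_open_image:
  assumes "charted M \<A>" "(P, \<phi>) \<in> \<A>" "open W" "W \<subseteq> P"
  shows "openin (top_of_set M) (\<phi> ` W)"
proof -
  have "openin (top_of_set P) W"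
    using assms(3,4) open_subset by blast
  then have "openin (top_of_set (\<phi> ` P)) (\<phi> ` W)"
    by (rule homeomorphism_imp_open_map[OF charted_chart(3)[OF assms(1,2)]])
  then show ?thesis
    using charted_chart(2)[OF assms(1,2)] openin_trans by blast
qed

lemma chart_open_preimage:
  assumes "charted M \<A>" "(P, \<phi>) \<in> \<A>" "openin (top_of_set M) S"
  shows "open {q\<in>P. \<phi> q \<in> S}"
proof -
  obtain S' where S': "open S'" "S = M \<inter> S'" using assms(3) openin_open by blast
  have "{q\<in>P. \<phi> q \<in> S} = P \<inter> \<phi> -` S'"
    using S' charted_chart(4)[OF assms(1,2)] by auto
  then show ?thesis
    using continuous_open_preimage[OF charted_chart(5,1)[OF assms(1,2)] S'(1)] by simp
qed

lemma charted_openinI: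
  assumes "charted M \<A>" "S \<subseteq> M" "\<And>P \<phi>. (P, \<phi>) \<in> \<A> \<Longrightarrow> open {q\<in>P. \<phi> q \<in> S}"
  shows "openin (top_of_set M) S"
proof (subst openin_subopen, intro ballI)
  fix p assume p: "p \<in> S"
  obtain P \<phi> q where c: "(P, \<phi>) \<in> \<A>" "q \<in> P" "p = \<phi> q"
    using charted_cover[OF assms(1)] p assms(2) by blast
  have "openin (top_of_set M) (\<phi> ` {q\<in>P. \<phi> q \<in> S})"
    by (rule chart_open_image[OF assms(1) c(1) assms(3)[OF c(1)]]) auto
  then show "\<exists>T. openin (top_of_set M) T \<and> p \<in> T \<and> T \<subseteq> S"
    using c p by (intro exI[of _ "\<phi> ` {q\<in>P. \<phi> q \<in> S}"]) auto
qed

lemma charted_continuous_on: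
  assumes "charted M \<A>" "\<And>P \<phi>. (P, \<phi>) \<in> \<A> \<Longrightarrow> continuous_on P (F \<circ> \<phi>)"
  shows "continuous_on M F"
  unfolding continuous_on_open_invariant
proof (intro allI impI)
  fix B :: "'b set" assume B: "open B"
  have "openin (top_of_set M) (F -` B \<inter> M)"
  proof (rule charted_openinI[OF assms(1)])
    fix P \<phi> assume c: "(P, \<phi>) \<in> \<A>"
    have "{q\<in>P. \<phi> q \<in> F -` B \<inter> M} = P \<inter> (F \<circ> \<phi>) -` B"
      using charted_chart(4)[OF assms(1) c] by auto
    then show "open {q\<in>P. \<phi> q \<in> F -` B \<inter> M}"
      using continuous_open_preimage[OF assms(2)[OF c] charted_chart(1)[OF assms(1) c] B] by simp
  qed simp
  then obtain A where "open A" "F -` B \<inter> M = M \<inter> A" using openin_open by blast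
  then show "\<exists>A. open A \<and> A \<inter> M = F -` B \<inter> M" by blast
qed

lemma smooth_immersion_chart:
  assumes "smooth_immersion \<A> F" "(P, \<phi>) \<in> \<A>"
  shows "smooth_on P (F \<circ> \<phi>)" "\<And>q. q \<in> P \<Longrightarrow> inj (Df (F \<circ> \<phi>) q)"
  using assms unfolding smooth_immersion_def by blast+

lemma chart_lift_smooth:
  fixes F :: "'m::topological_space \<Rightarrow> 'b::euclidean_space"
  assumes "charted M \<A>" "smooth_immersion \<A> F" "(P, \<phi>) \<in> \<A>"
    and "open S" "continuous_on S v" "v ` S \<subseteq> \<phi> ` P" "smooth_on S (\<lambda>x. F (v x))"
  shows "smooth_on S (inv_into P \<phi> \<circ> v)"
proof (rule smooth_on_immersion_lift[where P = P and \<Psi> = "F \<circ> \<phi>"])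
  note c = charted_chart[OF assms(1,3)]
  show "continuous_on S (inv_into P \<phi> \<circ> v)"
    by (rule continuous_on_compose[OF assms(5) continuous_on_subset[OF c(6) assms(6)]])
  show "(inv_into P \<phi> \<circ> v) ` S \<subseteq> P"
  proof (rule image_subsetI)
    fix x assume "x \<in> S"
    then have "v x \<in> \<phi> ` P" using assms(6) by blast
    then show "(inv_into P \<phi> \<circ> v) x \<in> P" by (simp add: inv_into_into)
  qed
  show "smooth_on S (\<lambda>x. (F \<circ> \<phi>) ((inv_into P \<phi> \<circ> v) x))"
  proof (rule smooth_on_cong[OF assms(4) _ assms(7)])
    fix x assume "x \<in> S"
    then have "v x \<in> \<phi> ` P" using assms(6) by blast
    then show "F (v x) = (F \<circ> \<phi>) ((inv_into P \<phi> \<circ> v) x)" by (simp add: f_inv_into_f)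
  qed
qed (use charted_chart[OF assms(1,3)] smooth_immersion_chart[OF assms(2,3)] assms(4) in auto)

text \<open>The inverse \<open>L\<close> of the embedding \<open>G\<close> turns \<open>F\<close>
  into a map between surfaces of the same dimension, to which the planar inverse function theorem
  applies.\<close>

locale surface_in_surface =
  fixes M :: "'m::topological_space set" and \<A> :: "'m atlas" and F :: "'m \<Rightarrow> 'b::euclidean_space"
    and N :: "'n::topological_space set" and \<B> :: "'n atlas" and G :: "'n \<Rightarrow> 'b" and L :: "'b \<Rightarrow> 'n"
  assumes charted_M: "charted M \<A>" and charted_N: "charted N \<B>"
    and imm_F: "smooth_immersion \<A> F" and imm_G: "smooth_immersion \<B> G"
    and homeo_G: "homeomorphism N (G ` N) G L" and FG: "F ` M \<subseteq> G ` N"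
begin

definition H where "H = L \<circ> F"

lemma GH: "p \<in> M \<Longrightarrow> G (H p) = F p" and HN: "p \<in> M \<Longrightarrow> H p \<in> N"
  using FG homeo_G unfolding H_def homeomorphism_def by auto

lemma cont_F: "continuous_on M F"
  by (rule charted_continuous_on[OF charted_M smooth_on_continuous[OF smooth_immersion_chart(1)[OF imm_F]]])

lemma cont_H: "continuous_on M H"
  unfolding H_def
  by (rule continuous_on_compose[OF cont_F]) (use homeo_G FG continuous_on_subset in \<open>auto simp: homeomorphism_def\<close>)

text \<open>In charts \<open>H\<close> has an injective derivative, because composing it with the
  derivative of \<open>G\<close> gives the derivative of the immersion \<open>F\<close>. The freedom
  in \<open>D\<close> is what later yields openness of \<open>F\<close>.\<close>

lemma local_diffeo:
  assumes D: "openin (top_of_set M) D" and p: "p \<in> D"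
  obtains P \<phi> W V k where "(P, \<phi>) \<in> \<A>" "open W" "W \<subseteq> P" "p \<in> \<phi> ` W" "\<phi> ` W \<subseteq> D"
    "openin (top_of_set N) V" "homeomorphism (\<phi> ` W) V H k"
proof -
  have pM: "p \<in> M" using D p openin_imp_subset by blast
  obtain P \<phi> q where c: "(P, \<phi>) \<in> \<A>" "q \<in> P" "p = \<phi> q" using charted_cover[OF charted_M pM] .
  obtain Q \<psi> x where d: "(Q, \<psi>) \<in> \<B>" "x \<in> Q" "H p = \<psi> x" using charted_cover[OF charted_N HN[OF pM]] .
  note cP = charted_chart[OF charted_M c(1)] and cQ = charted_chart[OF charted_N d(1)]
  define T where "T = {q\<in>P. \<phi> q \<in> D \<inter> {p\<in>M. H p \<in> \<psi> ` Q}}"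
  have "openin (top_of_set M) {p\<in>M. H p \<in> \<psi> ` Q}"
  proof -
    obtain O' where "open O'" "\<psi> ` Q = N \<inter> O'" using cQ(2) openin_open by blast
    then have "{p\<in>M. H p \<in> \<psi> ` Q} = M \<inter> H -` O'" using HN by auto
    then show ?thesis using continuous_openin_preimage_gen[OF cont_H \<open>open O'\<close>] by simp
  qed
  then have oT: "open T"
    unfolding T_def by (intro chart_open_preimage[OF charted_M c(1)] openin_Int D)
  have qT: "q \<in> T" using c d p pM by (auto simp: T_def)
  have TP: "T \<subseteq> P" and TQ: "(H \<circ> \<phi>) ` T \<subseteq> \<psi> ` Q" and TD: "\<phi> ` T \<subseteq> D" by (auto simp: T_def)
  define h where "h = inv_into Q \<psi> \<circ> (H \<circ> \<phi>)"
  have contT: "continuous_on T (H \<circ> \<phi>)"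
    using cont_H cP(4,5) TP by (intro continuous_on_compose) (auto intro: continuous_on_subset)
  have smF: "smooth_on T (F \<circ> \<phi>)"
    by (rule smooth_on_subset[OF smooth_immersion_chart(1)[OF imm_F c(1)] TP])
  have sm: "smooth_on T h"
    unfolding h_def
  proof (rule chart_lift_smooth[OF charted_N imm_G d(1) oT contT TQ])
    show "smooth_on T (\<lambda>x. G ((H \<circ> \<phi>) x))"
    proof (rule smooth_on_cong[OF oT _ smF])
      fix x assume "x \<in> T"
      then have "\<phi> x \<in> M" using cP(4) TP by blast
      then show "(F \<circ> \<phi>) x = G ((H \<circ> \<phi>) x)" by (simp add: GH)
    qed
  qed
  have hQ: "h y \<in> Q" "\<psi> (h y) = H (\<phi> y)" if "y \<in> T" for y
    using TQ that f_inv_into_f[of "H (\<phi> y)" \<psi> Q] by (auto simp: h_def intro!: inv_into_into)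
  have Gh: "(G \<circ> \<psi>) (h y) = (F \<circ> \<phi>) y" if "y \<in> T" for y
  proof -
    have "\<phi> y \<in> M" using cP(4) TP that by blast
    then show ?thesis by (simp add: hQ(2)[OF that] GH)
  qed
  have "inj (Df h q)"
  proof -
    have "((\<lambda>y. (G \<circ> \<psi>) (h y)) has_derivative (\<lambda>e. Df (G \<circ> \<psi>) (h q) (Df h q e))) (at q)"
      using diff_chain_at[OF smooth_on_has_derivative[OF sm qT]
          smooth_on_has_derivative[OF smooth_immersion_chart(1)[OF imm_G d(1)] hQ(1)[OF qT]]]
      by (simp add: o_def)
    then have "Df (\<lambda>y. (G \<circ> \<psi>) (h y)) q = (\<lambda>e. Df (G \<circ> \<psi>) (h q) (Df h q e))"
      by (rule Df_eqI)
    moreover have "Df (\<lambda>y. (G \<circ> \<psi>) (h y)) q = Df (F \<circ> \<phi>) q"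
      by (rule Df_cong_open[OF oT qT Gh])
    ultimately have e: "Df (G \<circ> \<psi>) (h q) (Df h q e) = Df (F \<circ> \<phi>) q e" for e
      by (auto dest: fun_cong)
    show ?thesis
    proof (rule injI)
      fix a b assume "Df h q a = Df h q b"
      then have "Df (F \<circ> \<phi>) q a = Df (F \<circ> \<phi>) q b" using e[of a] e[of b] by simp
      then show "a = b" by (rule injD[OF smooth_immersion_chart(2)[OF imm_F c(1,2)]])
    qed
  qed
  from smooth_inverse_function[OF oT qT sm this]
  obtain W V k where W: "open W" "W \<subseteq> T" "q \<in> W" "open V" "homeomorphism W V h k" .
  have VQ: "V \<subseteq> Q" using W hQ by (auto simp: homeomorphism_def)
  have hom1: "homeomorphism (\<phi> ` W) W (inv_into P \<phi>) \<phi>"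
    using homeomorphism_of_subsets[OF cP(3), of W "\<phi> ` W"] W(2) TP homeomorphism_symD by blast
  have hom2: "homeomorphism V (\<psi> ` V) \<psi> (inv_into Q \<psi>)"
    using homeomorphism_of_subsets[OF cQ(3), of V "\<psi> ` V"] VQ by blast
  have "homeomorphism (\<phi> ` W) (\<psi> ` V) (\<psi> \<circ> (h \<circ> inv_into P \<phi>)) ((\<phi> \<circ> k) \<circ> inv_into Q \<psi>)"
    by (rule homeomorphism_compose[OF homeomorphism_compose[OF hom1 W(5)] hom2])
  then have "homeomorphism (\<phi> ` W) (\<psi> ` V) H ((\<phi> \<circ> k) \<circ> inv_into Q \<psi>)"
  proof (rule homeomorphism_cong)
    fix y assume "y \<in> \<phi> ` W"
    then obtain w where w: "w \<in> W" "y = \<phi> w" by blast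
    then have "w \<in> T" "w \<in> P" using W(2) TP by blast+
    then show "H y = (\<psi> \<circ> (h \<circ> inv_into P \<phi>)) y"
      using hQ(2)[of w] inv_into_f_f[OF cP(7), of w] w(2) by simp
  qed simp_all
  moreover have "openin (top_of_set N) (\<psi> ` V)"
    by (rule chart_open_image[OF charted_N d(1) W(4) VQ])
  ultimately show thesis
    using that c W TP TD by blast
qed

lemma open_preimage_pair:
  assumes "charted M' \<A>'" "(P', \<phi>') \<in> \<A>'" "openin (top_of_set M') U" "continuous_on U k"
    and "k ` U \<subseteq> K" "openin (top_of_set K) C"
  shows "open {q\<in>P'. \<phi>' q \<in> U \<and> k (\<phi>' q) \<in> C}"
proof -
  obtain O' where "open O'" "C = K \<inter> O'" using assms(6) openin_open by blast
  then have "{x\<in>U. k x \<in> C} = U \<inter> k -` O'" using assms(5) by auto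
  then have "openin (top_of_set U) {x\<in>U. k x \<in> C}"
    using continuous_openin_preimage_gen[OF assms(4) \<open>open O'\<close>] by simp
  then have "openin (top_of_set M') {x\<in>U. k x \<in> C}"
    using assms(3) openin_trans by blast
  from chart_open_preimage[OF assms(1,2) this] show ?thesis by simp
qed

text \<open>Both directions are lifts through an immersion: \<open>F = G \<circ> H\<close> makes
  \<open>H\<close> smooth since \<open>G\<close> is an immersion, and \<open>G = F \<circ> k\<close>
  makes \<open>k\<close> smooth since \<open>F\<close> is one.\<close>

lemma local_smooth_diffeo:
  assumes "p \<in> M"
  shows "\<exists>U V h k. p \<in> U \<and> openin (top_of_set M) U \<and> openin (top_of_set N) V \<and>
        homeomorphism U V h k \<and> smooth_between \<A> \<B> U h \<and> smooth_between \<B> \<A> V k \<and> (\<forall>x\<in>U. F x = G (h x))"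
proof -
  have M: "openin (top_of_set M) M" by simp
  obtain P \<phi> W V k where c: "(P, \<phi>) \<in> \<A>" "open W" "W \<subseteq> P" "p \<in> \<phi> ` W"
    "\<phi> ` W \<subseteq> M" "openin (top_of_set N) V" and hom: "homeomorphism (\<phi> ` W) V H k"
    using local_diffeo[OF M assms] .
  define U where "U = \<phi> ` W"
  have oU: "openin (top_of_set M) U" unfolding U_def by (rule chart_open_image[OF charted_M c(1-3)])
  have UM: "U \<subseteq> M" and VN: "V \<subseteq> N" using oU c(6) openin_imp_subset by blast+
  note hm = hom[folded U_def, unfolded homeomorphism_def]
  have "smooth_between \<A> \<B> U H"
    unfolding smooth_between_def
  proof (clarify)
    fix P' \<phi>' Q \<psi> assume a: "(P', \<phi>') \<in> \<A>" "(Q, \<psi>) \<in> \<B>"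
    let ?S = "{q\<in>P'. \<phi>' q \<in> U \<and> H (\<phi>' q) \<in> \<psi> ` Q}"
    have o: "open ?S"
      by (rule open_preimage_pair[OF charted_M a(1) oU, where K = N])
         (use cont_H UM HN charted_chart(2)[OF charted_N a(2)] in \<open>auto intro: continuous_on_subset\<close>)
    have "smooth_on ?S (inv_into Q \<psi> \<circ> (H \<circ> \<phi>'))"
    proof (rule chart_lift_smooth[OF charted_N imm_G a(2) o])
      show "continuous_on ?S (H \<circ> \<phi>')"
        using charted_chart(5)[OF charted_M a(1)] cont_H UM
        by (intro continuous_on_compose) (auto intro: continuous_on_subset)
      show "smooth_on ?S (\<lambda>x. G ((H \<circ> \<phi>') x))"
      proof (rule smooth_on_cong[OF o])
        show "smooth_on ?S (F \<circ> \<phi>')"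
          by (rule smooth_on_subset[OF smooth_immersion_chart(1)[OF imm_F a(1)]]) auto
        fix x assume "x \<in> ?S"
        then have "\<phi>' x \<in> M" using UM by blast
        then show "(F \<circ> \<phi>') x = G ((H \<circ> \<phi>') x)" by (simp add: GH)
      qed
    qed auto
    then show "smooth_on ?S (inv_into Q \<psi> \<circ> H \<circ> \<phi>')" by (simp add: comp_assoc)
  qed
  moreover have "smooth_between \<B> \<A> V k"
    unfolding smooth_between_def
  proof (clarify)
    fix P' \<phi>' Q \<psi> assume a: "(Q, \<psi>) \<in> \<B>" "(P', \<phi>') \<in> \<A>"
    let ?S = "{q\<in>Q. \<psi> q \<in> V \<and> k (\<psi> q) \<in> \<phi>' ` P'}"
    have o: "open ?S"
      by (rule open_preimage_pair[OF charted_N a(1) c(6), where K = M])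
         (use hm UM charted_chart(2)[OF charted_M a(2)] in auto)
    have "smooth_on ?S (inv_into P' \<phi>' \<circ> (k \<circ> \<psi>))"
    proof (rule chart_lift_smooth[OF charted_M imm_F a(2) o])
      show "continuous_on ?S (k \<circ> \<psi>)"
        using charted_chart(5)[OF charted_N a(1)] hm
        by (intro continuous_on_compose) (auto intro: continuous_on_subset)
      show "smooth_on ?S (\<lambda>x. F ((k \<circ> \<psi>) x))"
      proof (rule smooth_on_cong[OF o])
        show "smooth_on ?S (G \<circ> \<psi>)"
          by (rule smooth_on_subset[OF smooth_immersion_chart(1)[OF imm_G a(1)]]) auto
        fix x assume "x \<in> ?S"
        then have "H (k (\<psi> x)) = \<psi> x" "k (\<psi> x) \<in> M" using hm UM by blast+
        then show "(G \<circ> \<psi>) x = F ((k \<circ> \<psi>) x)" using GH[of "k (\<psi> x)"] by simp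
      qed
    qed auto
    then show "smooth_on ?S (inv_into P' \<phi>' \<circ> k \<circ> \<psi>)" by (simp add: comp_assoc)
  qed
  moreover have "F x = G (H x)" if "x \<in> U" for x using that UM GH by auto
  ultimately show ?thesis
    using c hom oU unfolding U_def by blast
qed

lemma open_image:
  assumes "openin (top_of_set M) U" "openin (top_of_set N) V" "homeomorphism U V H k"
  shows "openin (top_of_set (F ` M)) (F ` U)" "\<exists>k. homeomorphism U (F ` U) F k"
proof -
  have UM: "U \<subseteq> M" and VN: "V \<subseteq> N" using assms openin_imp_subset by blast+
  have FU: "F ` U = G ` V"
  proof -
    have "F ` U = G ` H ` U" using GH UM by (force simp: image_iff)
    then show ?thesis using assms(3) by (simp add: homeomorphism_def)
  qed
  have "openin (top_of_set (G ` N)) (G ` V)"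
    by (rule homeomorphism_imp_open_map[OF homeo_G assms(2)])
  then obtain O' where O': "open O'" "G ` V = G ` N \<inter> O'" unfolding openin_open by auto
  have "F ` U = F ` M \<inter> O'"
    using image_mono[OF UM, of F] FG O'(2) unfolding FU by (intro equalityI subsetI) auto
  then show "openin (top_of_set (F ` M)) (F ` U)" using openin_open_Int[OF O'(1)] by simp
  have "homeomorphism V (G ` V) G L"
    by (rule homeomorphism_of_subsets[OF homeo_G VN image_mono[OF VN] refl])
  from homeomorphism_compose[OF assms(3) this]
  have "homeomorphism U (F ` U) (G \<circ> H) (k \<circ> L)" by (simp add: FU)
  then have "homeomorphism U (F ` U) F (k \<circ> L)"
    by (rule homeomorphism_cong) (use GH UM in auto)
  then show "\<exists>k. homeomorphism U (F ` U) F k" by blast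
qed

text \<open>By equality of dimensions every sheet of \<open>F\<close> already covers an open part of
  \<open>G\<close> N\<open>, hence of\<close>F \<open>M\<close>; so the charts of \<open>M\<close>,
  composed with \<open>F\<close>, parametrize the image even where \<open>F\<close> is
  many-to-one.\<close>

lemma embedded_image: "embedded_surface (F ` M)"
  unfolding embedded_surface_def
proof
  fix y assume "y \<in> F ` M"
  then obtain p where p: "p \<in> M" "y = F p" by blast
  have M: "openin (top_of_set M) M" by simp
  obtain P \<phi> W V k where c: "(P, \<phi>) \<in> \<A>" "open W" "W \<subseteq> P" "p \<in> \<phi> ` W"
    "\<phi> ` W \<subseteq> M" "openin (top_of_set N) V" and hom: "homeomorphism (\<phi> ` W) V H k"
    using local_diffeo[OF M p(1)] .
  note op = open_image[OF chart_open_image[OF charted_M c(1-3)] c(6) hom]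
  obtain k' where k': "homeomorphism (\<phi> ` W) (F ` \<phi> ` W) F k'" using op(2) by blast
  have "homeomorphism W (\<phi> ` W) \<phi> (inv_into P \<phi>)"
    using homeomorphism_of_subsets[OF charted_chart(3)[OF charted_M c(1)], of W "\<phi> ` W"] c(3) by blast
  from homeomorphism_compose[OF this k']
  have "homeomorphism W ((F \<circ> \<phi>) ` W) (F \<circ> \<phi>) (inv_into P \<phi> \<circ> k')" by (simp add: image_comp)
  moreover have "openin (top_of_set (F ` M)) ((F \<circ> \<phi>) ` W)"
    using op(1) by (simp add: image_comp)
  moreover have "smooth_on W (F \<circ> \<phi>)" "\<forall>q\<in>W. inj (Df (F \<circ> \<phi>) q)"
    using smooth_immersion_chart[OF imm_F c(1)] c(3) smooth_on_subset by blast+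
  moreover have "y \<in> (F \<circ> \<phi>) ` W" using c(4) p by auto
  ultimately show "\<exists>(U :: R2 set) f g. open U \<and> y \<in> f ` U \<and> openin (top_of_set (F ` M)) (f ` U) \<and>
        homeomorphism U (f ` U) f g \<and> smooth_on U f \<and> (\<forall>q\<in>U. inj (Df f q))"
    using c(2) by blast
qed

text \<open>\<open>F\<close> is open onto its image because it is so on arbitrarily small pieces;
  injectivity then makes the inverse continuous.\<close>

lemma embedding_if_inj:
  assumes "inj_on F M"
  shows "smooth_embedding M \<A> F"
proof -
  have "openin (top_of_set (F ` M)) (F ` D)" if D: "openin (top_of_set M) D" for D
  proof (subst openin_subopen, intro ballI)
    fix y assume "y \<in> F ` D"
    then obtain p where p: "p \<in> D" "y = F p" by blast
    obtain P \<phi> W V k where c: "(P, \<phi>) \<in> \<A>" "open W" "W \<subseteq> P" "p \<in> \<phi> ` W" "\<phi> ` W \<subseteq> D"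
      "openin (top_of_set N) V" and hom: "homeomorphism (\<phi> ` W) V H k"
      using local_diffeo[OF D p(1)] .
    have "openin (top_of_set (F ` M)) (F ` \<phi> ` W)"
      by (rule open_image(1)[OF chart_open_image[OF charted_M c(1-3)] c(6) hom])
    then show "\<exists>T. openin (top_of_set (F ` M)) T \<and> y \<in> T \<and> T \<subseteq> F ` D"
      using c p by (intro exI[of _ "F ` \<phi> ` W"]) auto
  qed
  then obtain k where "homeomorphism M (F ` M) F k"
    using homeomorphism_injective_open_map[OF cont_F refl assms] by metis
  then show ?thesis
    using imm_F by (auto simp: smooth_embedding_def)
qed

end

subsection \<open>Legendrian surfaces in a chart\<close>

type_synonym C2 = "complex \<times> complex"

section \<open>Hermitian algebra of the complex plane squared and the contact metric expressed by
  it\<close>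

text \<open>The Hermitian form, conjugate linear in the first slot. Its real part is the Euclidean
  product and its imaginary part the symplectic form.\<close>

definition hp :: "C2 \<Rightarrow> C2 \<Rightarrow> complex" where
  "hp v w = cnj (fst v) * fst w + cnj (snd v) * snd w"

text \<open>The complex area form; on a Lagrangian plane its argument is the Lagrangian angle and
  its modulus the area.\<close>

definition cdet :: "C2 \<Rightarrow> C2 \<Rightarrow> complex" where
  "cdet v w = fst v * snd w - snd v * fst w"

definition ht :: "R5 \<Rightarrow> real" where "ht p = snd (snd p)"

lemma proj_C2_def: "proj_C2 p = (fst p, fst (snd p))"
  by (cases p) simp

lemma bounded_linear_proj_C2: "bounded_linear proj_C2"
proof -
  have "bounded_linear (\<lambda>p::R5. (fst p, fst (snd p)))"
    by (intro bounded_linear_Pair bounded_linear_fst bounded_linear_compose[OF bounded_linear_fst bounded_linear_snd])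
  then show ?thesis by (simp add: proj_C2_def[abs_def])
qed

lemma bounded_linear_ht: "bounded_linear ht"
  unfolding ht_def by (intro bounded_linear_compose[OF bounded_linear_snd bounded_linear_snd])

lemma R5_eqI: "proj_C2 p = proj_C2 p' \<Longrightarrow> ht p = ht p' \<Longrightarrow> p = p'"
  by (simp add: proj_C2_def ht_def prod_eq_iff)

lemma proj_C2_simps [simp]: "proj_C2 (v + w) = proj_C2 v + proj_C2 w" "proj_C2 (v - w) = proj_C2 v - proj_C2 w"
  "proj_C2 (r *\<^sub>R v) = r *\<^sub>R proj_C2 v" "proj_C2 0 = 0" "proj_C2 (- v) = - proj_C2 v"
  by (simp_all add: proj_C2_def prod_eq_iff)

lemma ht_simps [simp]: "ht (v + w) = ht v + ht w" "ht (v - w) = ht v - ht w"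
  "ht (r *\<^sub>R v) = r * ht v" "ht 0 = 0" "ht (- v) = - ht v"
  by (simp_all add: ht_def)

lemma hp_simps: "hp (u + v) w = hp u w + hp v w" "hp u (v + w) = hp u v + hp u w"
  "hp (u - v) w = hp u w - hp v w" "hp u (v - w) = hp u v - hp u w"
  "hp (r *\<^sub>R u) v = of_real r * hp u v" "hp u (r *\<^sub>R v) = of_real r * hp u v"
  "hp 0 v = 0" "hp v 0 = 0" "hp (- u) v = - hp u v" "hp u (- v) = - hp u v"
  by (simp_all add: hp_def algebra_simps scaleR_conv_of_real)

lemma cdet_simps: "cdet (u + v) w = cdet u w + cdet v w" "cdet u (v + w) = cdet u v + cdet u w"
  "cdet (u - v) w = cdet u w - cdet v w" "cdet u (v - w) = cdet u v - cdet u w"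
  "cdet (r *\<^sub>R u) v = of_real r * cdet u v" "cdet u (r *\<^sub>R v) = of_real r * cdet u v"
  "cdet v v = 0" "cdet (- u) v = - cdet u v" "cdet u (- v) = - cdet u v"
  by (simp_all add: cdet_def algebra_simps scaleR_conv_of_real)

lemma cdet_swap: "cdet v w = - cdet w v" by (simp add: cdet_def)

lemma hp_cnj: "hp v w = cnj (hp w v)"
  by (simp add: hp_def)

lemma hp_Im_swap: "Im (hp v w) = - Im (hp w v)" and hp_Re_swap: "Re (hp v w) = Re (hp w v)"
  by (subst hp_cnj, simp)+

lemma hp_self: "hp v v = of_real ((cmod (fst v))\<^sup>2 + (cmod (snd v))\<^sup>2)"
  by (simp only: hp_def of_real_add complex_norm_square mult.commute)

lemma hp_self_pos: "v \<noteq> 0 \<Longrightarrow> Re (hp v v) > 0"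
  by (cases v) (auto simp: hp_self zero_prod_def add_pos_nonneg add_nonneg_pos)

lemma bounded_bilinear_hp: "bounded_bilinear hp"
  unfolding bilinear_conv_bounded_bilinear[symmetric] bilinear_def
  by (auto intro!: linearI simp: hp_def algebra_simps scaleR_conv_of_real)

lemma bounded_bilinear_cdet: "bounded_bilinear cdet"
  unfolding bilinear_conv_bounded_bilinear[symmetric] bilinear_def
  by (auto intro!: linearI simp: cdet_def algebra_simps scaleR_conv_of_real)

text \<open>The Gram determinant of the Hermitian form; on a Lagrangian plane its entries are real,
  so it is the ordinary squared area.\<close>

lemma cdet_norm: "cdet v w * cnj (cdet v w) = hp v v * hp w w - hp v w * hp w v"
  by (simp add: cdet_def hp_def algebra_simps)

lemma cdet_expand: "cdet v w *  hp u x = cdet x w * hp u v + cdet v x * hp u w"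
  by (simp add: cdet_def hp_def algebra_simps)

lemma eta_eq: "eta p v = ht v / 2 + Im (hp (proj_C2 p) (proj_C2 v)) / 4"
  by (cases p; cases v) (simp add: hp_def ht_def field_simps)

lemma gT_eq: "gT v w = Re (hp (proj_C2 v) (proj_C2 w)) / 4"
  by (cases v; cases w) (simp add: hp_def inner_complex_def)

lemma OmegaT_eq: "OmegaT v w = cdet (proj_C2 v) (proj_C2 w) / 4"
  by (cases v; cases w) (simp add: cdet_def)

lemma ht_X [simp]: "ht (X p) = 2 * ht p" and proj_C2_X [simp]: "proj_C2 (X p) = proj_C2 p"
  by (cases p; simp add: ht_def)+

lemma ht_xi [simp]: "ht xi = 2" and proj_C2_xi [simp]: "proj_C2 xi = 0"
  by (simp_all add: xi_def ht_def zero_prod_def)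

lemma eta_simps: "eta p (v + w) = eta p v + eta p w" "eta p (v - w) = eta p v - eta p w"
  "eta p (r *\<^sub>R v) = r * eta p v" "eta p xi = 1" "eta p (X p) = ht p" "eta p 0 = 0"
  by (simp_all add: eta_eq hp_simps field_simps hp_self)

lemma g_simps: "g p (v + w) x = g p v x + g p w x" "g p (v - w) x = g p v x - g p w x"
  "g p (r *\<^sub>R v) x = r * g p v x" "g p x (v + w) = g p x v + g p x w" "g p x (v - w) = g p x v - g p x w"
  "g p x (r *\<^sub>R v) = r * g p x v" "g p 0 x = 0" "g p x 0 = 0"
  by (simp_all add: g_def eta_simps gT_eq hp_simps algebra_simps add_divide_distrib diff_divide_distrib)

lemma g_sym: "g p v w = g p w v"
  by (simp add: g_def gT_eq hp_Re_swap mult.commute)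

lemma g_pos: "v \<noteq> 0 \<Longrightarrow> g p v v > 0"
proof -
  assume v: "v \<noteq> 0"
  show ?thesis
  proof (cases "proj_C2 v = 0")
    case True
    then have "ht v \<noteq> 0" using v R5_eqI[of v 0] by auto
    then have "0 < ht v * ht v" using not_real_square_gt_zero by blast
    then show ?thesis using True by (simp add: g_def gT_eq eta_eq hp_simps)
  next
    case False
    then show ?thesis using hp_self_pos[OF False] by (simp add: g_def gT_eq add_nonneg_pos)
  qed
qed

text \<open>The form \<open>eta\<close> depends on the base point through a skew form. In the Koszul
  formula two terms cancel by skewness and the third vanishes because both arguments are horizontal.
  Hence second derivatives of a Legendrian map need no Christoffel correction.\<close>

lemma christoffel_horizontal:
  assumes "eta p v = 0" "eta p w = 0"
  shows "christoffel p v w = 0"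
proof -
  have d: "Df (\<lambda>r. g r a x) p c =
      eta p a * (Im (hp (proj_C2 c) (proj_C2 x)) / 4) + Im (hp (proj_C2 c) (proj_C2 a)) / 4 * eta p x" for a x c
  proof -
    have e: "((\<lambda>r. eta r a) has_derivative (\<lambda>c. Im (hp (proj_C2 c) (proj_C2 a)) / 4)) (at p)" for a
    proof -
      have "bounded_linear (\<lambda>c. hp (proj_C2 c) (proj_C2 a))"
        by (rule bounded_linear_compose[OF bounded_bilinear.bounded_linear_left[OF bounded_bilinear_hp] bounded_linear_proj_C2])
      then have "bounded_linear (\<lambda>c. Im (hp (proj_C2 c) (proj_C2 a)) / 4)"
        by (intro bounded_linear_compose[OF bounded_linear_divide] bounded_linear_compose[OF bounded_linear_Im])
      then have "((\<lambda>r. ht a / 2 + Im (hp (proj_C2 r) (proj_C2 a)) / 4) has_derivative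
          (\<lambda>c. 0 + Im (hp (proj_C2 c) (proj_C2 a)) / 4)) (at p)"
        by (intro has_derivative_add has_derivative_const bounded_linear_imp_has_derivative)
      then show ?thesis unfolding eta_eq by simp
    qed
    have "((\<lambda>r. g r a x) has_derivative
        (\<lambda>c. eta p a * (Im (hp (proj_C2 c) (proj_C2 x)) / 4) + Im (hp (proj_C2 c) (proj_C2 a)) / 4 * eta p x)) (at p)"
      unfolding g_def by (auto intro!: derivative_eq_intros e)
    from Df_eqI[OF this] show ?thesis by simp
  qed
  have "(Df (\<lambda>r. g r w x) p v + Df (\<lambda>r. g r v x) p w - Df (\<lambda>r. g r v w) p x) / 2 = 0" for x
    unfolding d using assms hp_Im_swap[of "proj_C2 v" "proj_C2 w"] by simp
  then have "christoffel p v w = (THE y. \<forall>x. g p y x = 0)"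
    unfolding christoffel_def by simp
  also have "\<dots> = 0"
  proof (rule the_equality)
    fix y assume "\<forall>x. g p y x = 0"
    then have "g p y y = 0" by blast
    then show "y = 0" using g_pos[of y p] by force
  qed (simp add: g_simps)
  finally show ?thesis .
qed

text \<open>Cramer's rule gives complex coefficients. Their imaginary parts solve a homogeneous
  system with the real Gram matrix of \<open>a\<close>, \<open>c\<close>, which is invertible since
  \<open>cdet a c\<close> is nonzero.\<close>

lemma span_Lagrangian:
  assumes "Im (hp a c) = 0" "cdet a c \<noteq> 0" "Im (hp a v) = 0" "Im (hp c v) = 0"
  obtains x y where "v = x *\<^sub>R a + y *\<^sub>R c"
proof -
  define s where "s = cdet v c / cdet a c"
  define t where "t = cdet a v / cdet a c"
  have v: "fst v = s * fst a + t * fst c" "snd v = s * snd a + t * snd c"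
    using assms(2) by (simp_all add: s_def t_def field_simps) (simp_all add: cdet_def algebra_simps)
  have h: "hp w v = s * hp w a + t * hp w c" for w
    by (simp add: hp_def v algebra_simps)
  have r: "hp a c = of_real (Re (hp a c))" "hp c a = of_real (Re (hp a c))"
    "hp a a = of_real (Re (hp a a))" "hp c c = of_real (Re (hp c c))"
    using assms(1) hp_Im_swap[of a c] hp_Re_swap[of a c] by (simp_all add: complex_eq_iff hp_self)
  have im: "Im (hp a a) = 0" "Im (hp c c) = 0" "Im (hp c a) = 0" "Re (hp c a) = Re (hp a c)"
    using assms(1) hp_Im_swap[of a c] hp_Re_swap[of a c] by (simp_all add: hp_self)
  have 1: "Im s * Re (hp a a) + Im t * Re (hp a c) = 0"
    using assms(1,3) im unfolding h[of a] by simp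
  have 2: "Im s * Re (hp a c) + Im t * Re (hp c c) = 0"
    using assms(1,4) im unfolding h[of c] by simp
  have d: "Re (hp a a) * Re (hp c c) - (Re (hp a c))\<^sup>2 \<noteq> 0"
  proof
    assume "Re (hp a a) * Re (hp c c) - (Re (hp a c))\<^sup>2 = 0"
    moreover have "cdet a c * cnj (cdet a c) = of_real (Re (hp a a) * Re (hp c c) - (Re (hp a c))\<^sup>2)"
      unfolding cdet_norm using r by (metis of_real_diff of_real_mult power2_eq_square)
    ultimately show False using assms(2) by simp
  qed
  have "Im s * (Re (hp a a) * Re (hp c c) - (Re (hp a c))\<^sup>2) = 0" "Im t * (Re (hp a a) * Re (hp c c) - (Re (hp a c))\<^sup>2) = 0"
    using 1 2 by algebra+
  then have "Im s = 0" "Im t = 0" using d by auto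
  then have "v = Re s *\<^sub>R a + Re t *\<^sub>R c"
    using v by (simp add: prod_eq_iff complex_eq_iff)
  then show thesis using that by blast
qed

lemma normal_part_eqI:
  assumes "linear (Df f q)" "w - n \<in> range (Df f q)" "\<And>e. g (f q) n (Df f q e) = 0"
  shows "normal_part f q w = n"
  unfolding normal_part_def
proof (rule the_equality)
  fix n' assume n': "w - n' \<in> range (Df f q) \<and> (\<forall>e. g (f q) n' (Df f q e) = 0)"
  obtain e e' where e: "w - n = Df f q e" "w - n' = Df f q e'" using assms(2) n' by blast
  have "n' - n = (w - n) - (w - n')" by simp
  also have "\<dots> = Df f q (e - e')" unfolding e linear_diff[OF assms(1)] ..
  finally have u: "n' - n = Df f q (e - e')" .
  have "g (f q) n' (Df f q (e - e')) = 0" "g (f q) n (Df f q (e - e')) = 0" using assms(3) n' by blast+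
  then have "g (f q) (n' - n) (n' - n) = 0" unfolding u[symmetric] g_simps(2) by simp
  then show "n' = n" using g_pos[of "n' - n" "f q"] by force
qed (use assms in blast)

lemma normal_part_props:
  assumes "linear (Df f q)" "inj (Df f q)"
  shows "w - normal_part f q w \<in> range (Df f q) \<and> (\<forall>e. g (f q) (normal_part f q w) (Df f q e) = 0)"
proof -
  let ?a = "Df f q e1" and ?c = "Df f q e2" and ?g = "g (f q)"
  define d where "d = ?g ?a ?a * ?g ?c ?c - (?g ?a ?c)\<^sup>2"
  have c0: "?c \<noteq> 0"
  proof
    assume "?c = 0"
    then have "e2 = 0" using assms linear_injective_0 by blast
    then show False by (simp add: zero_prod_def)
  qed
  have d0: "d \<noteq> 0"
  proof
    assume "d = 0"
    \<comment> \<open>This combination has squared length \<open>?g ?c ?c * d\<close>, so a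
      degenerate Gram matrix would put it in the kernel of the derivative.\<close>
    let ?e = "(?g ?c ?c, - ?g ?a ?c)"
    have u: "Df f q ?e = ?g ?c ?c *\<^sub>R ?a - ?g ?a ?c *\<^sub>R ?c"
      by (subst linear_R2[OF assms(1)]) simp
    have "?g (Df f q ?e) (Df f q ?e) = ?g ?c ?c * d"
      unfolding u by (simp add: g_simps d_def g_sym[of _ ?c ?a] algebra_simps power2_eq_square)
    then have "Df f q ?e = 0" using \<open>d = 0\<close> g_pos[of "Df f q ?e" "f q"] by force
    then have "?e = 0" using assms linear_injective_0 by blast
    then show False using g_pos[OF c0, of "f q"] by (simp add: zero_prod_def)
  qed
  \<comment> \<open>The tangential projection in coordinates: the inverse Gram matrix applied to the
    products of \<open>w\<close> with the tangent basis.\<close>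
  define e where "e = ((?g w ?a * ?g ?c ?c - ?g w ?c * ?g ?a ?c) / d, (?g w ?c * ?g ?a ?a - ?g w ?a * ?g ?a ?c) / d)"
  define n where "n = w - Df f q e"
  have n: "n = w - (fst e *\<^sub>R ?a + snd e *\<^sub>R ?c)" unfolding n_def by (subst linear_R2[OF assms(1)]) simp
  have na: "?g n ?a = 0" and nc: "?g n ?c = 0"
    unfolding n using d0
    by (simp_all add: g_simps e_def g_sym[of _ ?c ?a] divide_simps) (simp_all add: d_def algebra_simps power2_eq_square)
  have "?g n (Df f q x) = 0" for x
    by (subst linear_R2[OF assms(1)]) (simp add: g_simps na nc)
  moreover have "w - n \<in> range (Df f q)" by (simp add: n_def)
  moreover from calculation have "normal_part f q w = n" by (intro normal_part_eqI[OF assms(1)])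
  ultimately show ?thesis by simp
qed

lemma normal_part_add:
  assumes "linear (Df f q)" "inj (Df f q)"
  shows "normal_part f q (v + w) = normal_part f q v + normal_part f q w"
proof (rule normal_part_eqI[OF assms(1)])
  note v = normal_part_props[OF assms, of v] and w = normal_part_props[OF assms, of w]
  obtain e e' where e: "v - normal_part f q v = Df f q e" "w - normal_part f q w = Df f q e'" using v w by blast
  have "v + w - (normal_part f q v + normal_part f q w) = (v - normal_part f q v) + (w - normal_part f q w)" by simp
  also have "\<dots> = Df f q (e + e')" unfolding e linear_add[OF assms(1)] ..
  finally show "v + w - (normal_part f q v + normal_part f q w) \<in> range (Df f q)" by blast
  show "g (f q) (normal_part f q v + normal_part f q w) (Df f q e) = 0" for e
    unfolding g_simps(1) using spec[OF conjunct2[OF v], of e] spec[OF conjunct2[OF w], of e] by simp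
qed

lemma normal_part_scale:
  assumes "linear (Df f q)" "inj (Df f q)"
  shows "normal_part f q (r *\<^sub>R v) = r *\<^sub>R normal_part f q v"
proof (rule normal_part_eqI[OF assms(1)])
  note v = normal_part_props[OF assms, of v]
  obtain e where e: "v - normal_part f q v = Df f q e" using v by blast
  have "r *\<^sub>R v - r *\<^sub>R normal_part f q v = r *\<^sub>R (v - normal_part f q v)" by (simp add: algebra_simps)
  also have "\<dots> = Df f q (r *\<^sub>R e)" unfolding e linear_scale[OF assms(1)] ..
  finally show "r *\<^sub>R v - r *\<^sub>R normal_part f q v \<in> range (Df f q)" by blast
  show "g (f q) (r *\<^sub>R normal_part f q v) (Df f q e) = 0" for e
    unfolding g_simps(3) using spec[OF conjunct2[OF v], of e] by simp
qed

lemma has_derivative_cis: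
  assumes "(\<Theta> has_derivative \<Theta>') (at x)"
  shows "((\<lambda>x. cis (\<Theta> x)) has_derivative (\<lambda>e. \<i> * of_real (\<Theta>' e) * cis (\<Theta> x))) (at x)"
proof -
  have "((\<lambda>x. of_real (cos (\<Theta> x)) + \<i> * of_real (sin (\<Theta> x))) has_derivative
      (\<lambda>e. of_real (- (\<Theta>' e) * sin (\<Theta> x)) + \<i> * of_real (\<Theta>' e * cos (\<Theta> x)))) (at x)"
    by (auto intro!: derivative_eq_intros assms simp: algebra_simps)
  moreover have "(\<lambda>x. of_real (cos (\<Theta> x)) + \<i> * of_real (sin (\<Theta> x))) = (\<lambda>x. cis (\<Theta> x))"
    by (auto simp: complex_eq_iff)
  moreover have "(\<lambda>e. of_real (- (\<Theta>' e) * sin (\<Theta> x)) + \<i> * of_real (\<Theta>' e * cos (\<Theta> x))) =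
      (\<lambda>e. \<i> * of_real (\<Theta>' e) * cis (\<Theta> x))"
    by (auto simp: complex_eq_iff)
  ultimately show ?thesis by simp
qed

text \<open>The device for differentiating identities that hold throughout a chart.\<close>

lemma Df_eq_0_open:
  assumes "open U" "q \<in> U" "\<And>x. x \<in> U \<Longrightarrow> f x = 0" "(f has_derivative f') (at q)"
  shows "f' = (\<lambda>e. 0)"
proof -
  have "(f has_derivative (\<lambda>e. 0)) (at q)"
    by (rule has_derivative_transform_within_open[OF has_derivative_const assms(1,2)]) (use assms(3) in auto)
  then show ?thesis using assms(4) has_derivative_unique by blast
qed

section \<open>Legendrian charts: induced metric, cubic form, angle and mean curvature\<close>

locale legendrian_chart =
  fixes U :: "R2 set" and f :: "R2 \<Rightarrow> R5"
  assumes open_U: "open U" and smooth_f: "smooth_on U f"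
    and imm: "\<And>q. q \<in> U \<Longrightarrow> inj (Df f q)"
    and leg: "\<And>q e. q \<in> U \<Longrightarrow> eta (f q) (Df f q e) = 0"
begin

text \<open>The planar parts and heights of the map and of its first and second derivatives. In
  \<open>ddc e e'\<close> and \<open>ddz e e'\<close> the direction \<open>e'\<close> is
  differentiated first and \<open>e\<close> second.\<close>

definition fc where "fc q = proj_C2 (f q)"
definition fz where "fz q = ht (f q)"
definition dc where "dc e q = proj_C2 (Df f q e)"
definition dz where "dz e q = ht (Df f q e)"
definition ddc where "ddc e e' q = proj_C2 (Df (\<lambda>x. Df f x e') q e)"
definition ddz where "ddz e e' q = ht (Df (\<lambda>x. Df f x e') q e)"

lemma lin: "q \<in> U \<Longrightarrow> linear (Df f q)"
  using Df_linear smooth_on_differentiable[OF smooth_f] by blast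

lemma d_fc: "q \<in> U \<Longrightarrow> (fc has_derivative (\<lambda>e. dc e q)) (at q)"
  unfolding fc_def dc_def
  by (rule bounded_linear.has_derivative[OF bounded_linear_proj_C2 smooth_on_has_derivative[OF smooth_f]])

lemma d_fz: "q \<in> U \<Longrightarrow> (fz has_derivative (\<lambda>e. dz e q)) (at q)"
  unfolding fz_def dz_def
  by (rule bounded_linear.has_derivative[OF bounded_linear_ht smooth_on_has_derivative[OF smooth_f]])

lemma d_dc: "q \<in> U \<Longrightarrow> (dc e has_derivative (\<lambda>e'. ddc e' e q)) (at q)"
  unfolding dc_def ddc_def
  by (rule bounded_linear.has_derivative[OF bounded_linear_proj_C2 smooth_on_has_derivative[OF smooth_on_Df[OF smooth_f]]])

lemma d_dz: "q \<in> U \<Longrightarrow> (dz e has_derivative (\<lambda>e'. ddz e' e q)) (at q)"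
  unfolding dz_def ddz_def
  by (rule bounded_linear.has_derivative[OF bounded_linear_ht smooth_on_has_derivative[OF smooth_on_Df[OF smooth_f]]])

lemma ddc_sym: "q \<in> U \<Longrightarrow> ddc e e' q = ddc e' e q" and ddz_sym: "q \<in> U \<Longrightarrow> ddz e e' q = ddz e' e q"
  unfolding ddc_def ddz_def using Df_symmetric[OF open_U _ smooth_f] by simp_all

lemma dc_R2: "q \<in> U \<Longrightarrow> dc e q = fst e *\<^sub>R dc e1 q + snd e *\<^sub>R dc e2 q"
  and dz_R2: "q \<in> U \<Longrightarrow> dz e q = fst e * dz e1 q + snd e * dz e2 q"
  unfolding dc_def dz_def by (subst linear_R2[OF lin], assumption, simp)+

lemma leg': "q \<in> U \<Longrightarrow> Im (hp (fc q) (dc e q)) = - 2 * dz e q"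
  using leg[of q e] by (simp add: eta_eq fc_def dc_def dz_def)

text \<open>Differentiating the Legendrian identity gives an expression symmetric in
  \<open>e\<close>, \<open>e'\<close> plus a multiple of the skew term
  \<open>Im (hp (dc e q) (dc e' q))\<close>. Both parts must vanish: the projection is Lagrangian,
  and second derivatives are again horizontal.\<close>

lemma leg2: assumes q: "q \<in> U"
  shows "ddz e e' q / 2 + Im (hp (fc q) (ddc e e' q)) / 4 = 0" and lag: "Im (hp (dc e q) (dc e' q)) = 0"
proof -
  have main: "ddz e e' q / 2 + Im (hp (dc e q) (dc e' q) + hp (fc q) (ddc e e' q)) / 4 = 0" for e e'
  proof -
    have "((\<lambda>x. dz e' x / 2 + Im (hp (fc x) (dc e' x)) / 4) has_derivative
       (\<lambda>e. ddz e e' q / 2 + Im (hp (fc q) (ddc e e' q) + hp (dc e q) (dc e' q)) / 4)) (at q)"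
      by (intro has_derivative_add bounded_linear.has_derivative[OF bounded_linear_divide]
          bounded_linear.has_derivative[OF bounded_linear_Im] bounded_bilinear.FDERIV[OF bounded_bilinear_hp]
          d_dz d_fc d_dc q)
    from fun_cong[OF Df_eq_0_open[OF open_U q _ this], of e] leg' show ?thesis
      by (simp add: add.commute)
  qed
  have "Im (hp (dc e q) (dc e' q)) = - Im (hp (dc e' q) (dc e q))"
    by (rule hp_Im_swap)
  with main[of e e'] main[of e' e] ddz_sym[OF q, of e e'] ddc_sym[OF q, of e e']
  show "ddz e e' q / 2 + Im (hp (fc q) (ddc e e' q)) / 4 = 0" "Im (hp (dc e q) (dc e' q)) = 0"
    by (simp_all add: field_simps)
qed

lemma hp_dc_real: "q \<in> U \<Longrightarrow> hp (dc e q) (dc e' q) = of_real (Re (hp (dc e q) (dc e' q)))"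
  using lag by (simp add: complex_eq_iff)

text \<open>The derivative of the Lagrangian condition. Together with symmetry of second derivatives
  it makes \<open>Im (hp (dc e q) (ddc e' e'' q))\<close> a totally symmetric cubic form, which
  encodes the second fundamental form.\<close>

lemma sym3: assumes q: "q \<in> U"
  shows "Im (hp (dc e q) (ddc e' e'' q)) = Im (hp (dc e'' q) (ddc e' e q))"
proof -
  have "((\<lambda>x. Im (hp (dc e x) (dc e'' x))) has_derivative
     (\<lambda>e'. Im (hp (dc e q) (ddc e' e'' q) + hp (ddc e' e q) (dc e'' q)))) (at q)"
    by (intro bounded_linear.has_derivative[OF bounded_linear_Im] bounded_bilinear.FDERIV[OF bounded_bilinear_hp] d_dc q)
  from fun_cong[OF Df_eq_0_open[OF open_U q _ this], of e'] lag
  have "Im (hp (dc e q) (ddc e' e'' q)) + Im (hp (ddc e' e q) (dc e'' q)) = 0"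
    by simp
  then show ?thesis using hp_Im_swap[of "ddc e' e q" "dc e'' q"] by simp
qed

definition G where "G e e' q = Re (hp (dc e q) (dc e' q))"
definition dG where "dG q = G e1 e1 q * G e2 e2 q - (G e1 e2 q)\<^sup>2"

lemma hp_G: "q \<in> U \<Longrightarrow> hp (dc e q) (dc e' q) = of_real (G e e' q)"
  unfolding G_def by (rule hp_dc_real)

lemma G_sym: "G e e' q = G e' e q" by (simp add: G_def hp_Re_swap)

text \<open>A tangent vector with zero projection would be vertical, and a horizontal vertical
  vector is zero. So the projection to the complex plane squared is an immersion too.\<close>

lemma dc_nonzero: assumes "q \<in> U" "e \<noteq> 0" shows "dc e q \<noteq> 0"
proof
  assume 0: "dc e q = 0"
  then have "dz e q = 0" using leg'[OF assms(1), of e] by (simp add: hp_simps)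
  then have "Df f q e = 0" using 0 by (intro R5_eqI) (simp_all add: dc_def dz_def)
  then show False using lin[OF assms(1)] imm[OF assms(1)] linear_injective_0 assms(2) by blast
qed

lemma G_pos: "q \<in> U \<Longrightarrow> e \<noteq> 0 \<Longrightarrow> G e e q > 0"
  unfolding G_def by (rule hp_self_pos[OF dc_nonzero])

lemma cdet_dG: assumes q: "q \<in> U"
  shows "cdet (dc e1 q) (dc e2 q) * cnj (cdet (dc e1 q) (dc e2 q)) = of_real (dG q)"
  unfolding cdet_norm dG_def hp_G[OF q] by (simp add: G_sym[of e2 e1] power2_eq_square)

lemma dG_pos: assumes q: "q \<in> U" shows "dG q > 0"
proof -
  have e2: "e2 \<noteq> 0" by (simp add: zero_prod_def)
  \<comment> \<open>This vector is orthogonal to \<open>e2\<close>, so its squared length carries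
    the Gram determinant as a factor.\<close>
  define e where "e = (G e2 e2 q, - G e1 e2 q)"
  have "e \<noteq> 0" using G_pos[OF q e2] by (simp add: e_def zero_prod_def)
  then have "G e e q > 0" by (rule G_pos[OF q])
  moreover have "G e e q = G e2 e2 q * dG q"
  proof -
    have "G e e q = fst e * (fst e * G e1 e1 q + snd e * G e1 e2 q) + snd e * (fst e * G e1 e2 q + snd e * G e2 e2 q)"
      unfolding G_def dc_R2[OF q, of e] hp_simps using hp_Re_swap[of "dc e2 q" "dc e1 q"] by (simp add: algebra_simps)
    then show ?thesis by (simp add: e_def dG_def algebra_simps power2_eq_square)
  qed
  ultimately show ?thesis using G_pos[OF q e2] by (simp add: zero_less_mult_iff)
qed

lemma cdet_nonzero: assumes q: "q \<in> U" shows "cdet (dc e1 q) (dc e2 q) \<noteq> 0"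
proof
  assume "cdet (dc e1 q) (dc e2 q) = 0"
  then have "complex_of_real (dG q) = 0" unfolding cdet_dG[OF q, symmetric] by simp
  then show False using dG_pos[OF q] by simp
qed

lemma cmod_cdet: assumes q: "q \<in> U" shows "cmod (cdet (dc e1 q) (dc e2 q)) = sqrt (dG q)"
proof (rule real_sqrt_unique[symmetric])
  have "of_real ((cmod (cdet (dc e1 q) (dc e2 q)))\<^sup>2) = complex_of_real (dG q)"
    unfolding complex_norm_square by (rule cdet_dG[OF q])
  then show "(cmod (cdet (dc e1 q) (dc e2 q)))\<^sup>2 = dG q" unfolding of_real_eq_iff .
qed simp

lemma induced_eq: "q \<in> U \<Longrightarrow> induced f q e e' = G e e' q / 4"
  by (simp add: induced_def g_def leg gT_eq G_def dc_def)

lemma inducedT_eq: "inducedT f q e e' = G e e' q / 4"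
  by (simp add: inducedT_def gT_eq G_def dc_def)

lemma area_induced: "q \<in> U \<Longrightarrow> area (induced f) q = sqrt (dG q) / 4"
  and area_inducedT: "area (inducedT f) q = sqrt (dG q) / 4"
proof -
  have "area (inducedT f) q = sqrt (dG q / 16)"
    unfolding area_def inducedT_eq dG_def by (simp add: power2_eq_square field_simps)
  then show "area (inducedT f) q = sqrt (dG q) / 4" by (simp add: real_sqrt_divide)
  then show "q \<in> U \<Longrightarrow> area (induced f) q = sqrt (dG q) / 4"
    by (simp add: area_def induced_eq inducedT_eq)
qed

lemma eta_second: "q \<in> U \<Longrightarrow> eta (f q) (Df (\<lambda>x. Df f x e') q e) = 0"
  using leg2[of q e e'] by (simp add: eta_eq fc_def ddc_def ddz_def)

definition tr where "tr q = G e2 e2 q *\<^sub>R Df (\<lambda>x. Df f x e1) q e1 - (2 * G e1 e2 q) *\<^sub>R Df (\<lambda>x. Df f x e2) q e1 +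
        G e1 e1 q *\<^sub>R Df (\<lambda>x. Df f x e2) q e2"

text \<open>The induced metric is a quarter of \<open>G\<close>, so its inverse is the adjugate of
  \<open>G\<close> times \<open>4 / dG\<close>; the adjugate contracted with the second derivatives
  is \<open>tr\<close>.\<close>

lemma mean_curvature_eq: assumes q: "q \<in> U"
  shows "mean_curvature f q = normal_part f q ((4 / dG q) *\<^sub>R tr q)"
proof -
  note n = normal_part_add[OF lin[OF q] imm[OF q]] normal_part_scale[OF lin[OF q] imm[OF q]]
  have s: "second_ff f q e e' = normal_part f q (Df (\<lambda>x. Df f x e') q e)" for e e'
    unfolding second_ff_def using christoffel_horizontal leg[OF q] by simp
  have a: "(area (induced f) q)\<^sup>2 = dG q / 16"
    unfolding area_induced[OF q] using dG_pos[OF q] by (simp add: power_divide)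
  have t: "tr q = G e2 e2 q *\<^sub>R Df (\<lambda>x. Df f x e1) q e1 + (- (2 * G e1 e2 q)) *\<^sub>R Df (\<lambda>x. Df f x e2) q e1 +
        G e1 e1 q *\<^sub>R Df (\<lambda>x. Df f x e2) q e2"
    by (simp add: tr_def)
  show ?thesis
    unfolding mean_curvature_def s a t n induced_eq[OF q]
    by (simp add: scaleR_right_distrib scaleR_right_diff_distrib)
qed

lemma eta_normal_part: assumes q: "q \<in> U"
  shows "eta (f q) (normal_part f q w) = eta (f q) w"
proof -
  obtain e where "w - normal_part f q w = Df f q e"
    using normal_part_props[OF lin[OF q] imm[OF q], of w] by blast
  then have "eta (f q) (w - normal_part f q w) = 0" using leg[OF q] by simp
  then show ?thesis by (simp add: eta_simps)
qed

text \<open>Second derivatives are horizontal, and removing a tangential part does not change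
  \<open>eta\<close>.\<close>

lemma eta_mean_curvature: assumes q: "q \<in> U" shows "eta (f q) (mean_curvature f q) = 0"
  unfolding mean_curvature_eq[OF q] eta_normal_part[OF q] tr_def eta_simps eta_second[OF q] by simp

lemma self_similar_angle:
  assumes q: "q \<in> U" and "mean_curvature f q - (2 * a) *\<^sub>R xi = b *\<^sub>R normal_part f q (X (f q))"
  shows "a = - (b / 2) * fz q"
proof -
  have "eta (f q) (mean_curvature f q - (2 * a) *\<^sub>R xi) = eta (f q) (b *\<^sub>R normal_part f q (X (f q)))"
    using assms(2) by simp
  then have "- (2 * a) = b * fz q"
    unfolding eta_simps eta_mean_curvature[OF q] eta_normal_part[OF q] fz_def by simp
  then show ?thesis by simp
qed

text \<open>A Lagrangian plane is its own symplectic complement, which places the projection of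
  \<open>w\<close> in the tangent plane; horizontality then determines the height component.\<close>

lemma horizontal_in_range:
  assumes q: "q \<in> U" and w: "eta (f q) w = 0" "\<And>e. Im (hp (dc e q) (proj_C2 w)) = 0"
  shows "w \<in> range (Df f q)"
proof -
  obtain x y where xy: "proj_C2 w = x *\<^sub>R dc e1 q + y *\<^sub>R dc e2 q"
    using span_Lagrangian[OF lag[OF q] cdet_nonzero[OF q] w(2) w(2)] by blast
  have p: "proj_C2 (w - Df f q (x, y)) = 0"
    using dc_R2[OF q, of "(x, y)"] xy by (simp add: dc_def)
  have "eta (f q) (w - Df f q (x, y)) = 0" using w leg[OF q] by (simp add: eta_simps)
  then have "ht (w - Df f q (x, y)) = 0" unfolding eta_eq p by (simp add: hp_simps)
  then have "w - Df f q (x, y) = 0" using p by (intro R5_eqI) simp_all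
  then show ?thesis by (simp add: rangeI)
qed

lemma cdet_cramer:
  "cdet x w * (hp v v * hp w w - hp v w * hp w v) = cdet v w * (hp w w * hp v x - hp v w * hp w x)"
  "cdet v x * (hp v v * hp w w - hp v w * hp w v) = cdet v w * (hp v v * hp w x - hp w v * hp v x)"
  by (simp_all add: cdet_def hp_def algebra_simps)

text \<open>The logarithmic derivative of the complex area form is the trace of the derivative of
  the frame, expressed here with the adjugate of \<open>G\<close>. Its imaginary part is the rate of
  change of the angle, so this is the relation between the trace of the cubic form and the gradient
  of the angle.\<close>

lemma angle_derivative:
  assumes q: "q \<in> U" and \<Theta>: "(\<Theta> has_derivative \<Theta>') (at q)"
    and re: "\<And>x. x \<in> U \<Longrightarrow> Im (cdet (dc e1 x) (dc e2 x) * cis (\<Theta> x)) = 0"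
  shows "G e2 e2 q * Im (hp (dc e1 q) (ddc e e1 q)) - G e1 e2 q * (Im (hp (dc e2 q) (ddc e e1 q)) + Im (hp (dc e1 q) (ddc e e2 q)))
     + G e1 e1 q * Im (hp (dc e2 q) (ddc e e2 q)) = - \<Theta>' e * dG q"
proof -
  let ?v = "dc e1 q" and ?w = "dc e2 q" and ?v' = "ddc e e1 q" and ?w' = "ddc e e2 q"
  define c where "c = cdet ?v ?w"
  define c' where "c' = cdet ?v ?w' + cdet ?v' ?w"
  have "((\<lambda>x. Im (cdet (dc e1 x) (dc e2 x) * cis (\<Theta> x))) has_derivative
     (\<lambda>e. Im (cdet ?v ?w * (\<i> * of_real (\<Theta>' e) * cis (\<Theta> q)) + (cdet ?v (ddc e e2 q) + cdet (ddc e e1 q) ?w) * cis (\<Theta> q)))) (at q)"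
    by (intro bounded_linear.has_derivative[OF bounded_linear_Im] bounded_bilinear.FDERIV[OF bounded_bilinear_mult]
        bounded_bilinear.FDERIV[OF bounded_bilinear_cdet] has_derivative_cis \<Theta> d_dc q)
  from fun_cong[OF Df_eq_0_open[OF open_U q re this], of e]
  have 0: "Im (c * (\<i> * of_real (\<Theta>' e) * cis (\<Theta> q)) + c' * cis (\<Theta> q)) = 0"
    by (simp add: c_def c'_def)
  \<comment> \<open>Turned by \<open>\<Theta>\<close>, the area form becomes this nonzero real
    number, which cancels at the end.\<close>
  define r where "r = Re (c * cis (\<Theta> q))"
  have r: "c * cis (\<Theta> q) = of_real r"
    using re[OF q] by (simp add: r_def c_def complex_eq_iff)
  have "c \<noteq> 0" using cdet_nonzero[OF q] by (simp add: c_def)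
  then have "r \<noteq> 0" using r by auto
  note hG = hp_G[OF q]
  have dg: "hp ?v ?v * hp ?w ?w - hp ?v ?w * hp ?w ?v = of_real (dG q)"
    using cdet_dG[OF q] by (simp add: cdet_norm)
  define k where "k = of_real (G e2 e2 q) * hp ?v ?v' - of_real (G e1 e2 q) * (hp ?w ?v' + hp ?v ?w') + of_real (G e1 e1 q) * hp ?w ?w'"
  have A: "cdet ?v' ?w * of_real (dG q) = c * (of_real (G e2 e2 q) * hp ?v ?v' - of_real (G e1 e2 q) * hp ?w ?v')"
    using cdet_cramer(1)[of ?v' ?w ?v] unfolding dg unfolding hG c_def .
  have B: "cdet ?v ?w' * of_real (dG q) = c * (of_real (G e1 e1 q) * hp ?w ?w' - of_real (G e1 e2 q) * hp ?v ?w')"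
    using cdet_cramer(2)[of ?v ?w' ?w] unfolding dg unfolding hG c_def G_sym[of e2 e1] .
  have "c' * of_real (dG q) = c * k"
    unfolding c'_def distrib_right A B k_def by (simp add: algebra_simps)
  then have "(c' * cis (\<Theta> q)) * of_real (dG q) = (c * cis (\<Theta> q)) * k"
    by (simp add: algebra_simps)
  then have "(c' * cis (\<Theta> q)) * of_real (dG q) = of_real r * k" unfolding r .
  then have "Im ((c' * cis (\<Theta> q)) * of_real (dG q)) = Im (of_real r * k)" by (rule arg_cong)
  then have 1: "Im (c' * cis (\<Theta> q)) * dG q = r * Im k" by (simp del: times_complex.sel(1))
  have "c * (\<i> * of_real (\<Theta>' e) * cis (\<Theta> q)) = \<i> * of_real (\<Theta>' e) * (c * cis (\<Theta> q))"
    by (simp add: algebra_simps)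
  then have "c * (\<i> * of_real (\<Theta>' e) * cis (\<Theta> q)) = \<i> * of_real (\<Theta>' e * r)"
    unfolding r by simp
  from 0[unfolded this] have "Im (\<i> * of_real (\<Theta>' e * r) + c' * cis (\<Theta> q)) = 0" .
  then have "\<Theta>' e * r + Im (c' * cis (\<Theta> q)) = 0"
    by (simp only: plus_complex.sel Im_i_times Re_complex_of_real)
  then have "r * (Im k + \<Theta>' e * dG q) = 0" using 1 by algebra
  then have "Im k = - \<Theta>' e * dG q" using \<open>r \<noteq> 0\<close> by simp
  then show ?thesis by (simp add: k_def algebra_simps)
qed

text \<open>Total symmetry of the cubic form turns the derivative of the angle into the normal part
  of \<open>tr\<close>. The converse direction to \<open>self_similar_angle\<close>: knowledge of
  the angle alone gives the shrinker equation.\<close>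

lemma angle_self_similar:
  assumes q: "q \<in> U"
    and re: "\<And>x. x \<in> U \<Longrightarrow> Im (cdet (dc e1 x) (dc e2 x) * cis (- (b / 2) * fz x + \<theta>)) = 0"
  shows "mean_curvature f q - (2 * (- (b / 2) * fz q)) *\<^sub>R xi = b *\<^sub>R normal_part f q (X (f q))"
proof -
  have \<Theta>: "((\<lambda>x. - (b / 2) * fz x + \<theta>) has_derivative (\<lambda>e. - (b / 2) * dz e q)) (at q)"
    by (auto intro!: derivative_eq_intros d_fz q)
  note a = angle_derivative[OF q \<Theta> re]
  let ?T = "\<lambda>e. G e2 e2 q * Im (hp (dc e q) (ddc e1 e1 q)) - 2 * G e1 e2 q * Im (hp (dc e q) (ddc e1 e2 q)) +
        G e1 e1 q * Im (hp (dc e q) (ddc e2 e2 q))"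
  have T: "?T e = (b / 2) * dz e q * dG q" for e
  proof -
    have s: "Im (hp (dc e1 q) (ddc e e1 q)) = Im (hp (dc e q) (ddc e1 e1 q))"
      "Im (hp (dc e2 q) (ddc e e1 q)) = Im (hp (dc e q) (ddc e1 e2 q))"
      "Im (hp (dc e1 q) (ddc e e2 q)) = Im (hp (dc e q) (ddc e1 e2 q))"
      "Im (hp (dc e2 q) (ddc e e2 q)) = Im (hp (dc e q) (ddc e2 e2 q))"
      using sym3[OF q] ddc_sym[OF q] by metis+
    show ?thesis using a[of e] unfolding s by (simp add: algebra_simps)
  qed
  have ptr: "Im (hp (dc e q) (proj_C2 (tr q))) = ?T e" for e
    unfolding tr_def by (simp add: hp_simps ddc_def)
  \<comment> \<open>The difference of the two sides before normal projection; the claim is that it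
    is tangential.\<close>
  define w where "w = (4 / dG q) *\<^sub>R tr q + (b * fz q) *\<^sub>R xi + (- b) *\<^sub>R X (f q)"
  have "w \<in> range (Df f q)"
  proof (rule horizontal_in_range[OF q])
    show "eta (f q) w = 0"
      unfolding w_def eta_simps tr_def eta_second[OF q] by (simp add: fz_def)
    fix e
    have "Im (hp (dc e q) (fc q)) = 2 * dz e q"
      using leg'[OF q, of e] hp_Im_swap[of "dc e q" "fc q"] by simp
    then have "Im (hp (dc e q) (proj_C2 w)) = (4 / dG q) * Im (hp (dc e q) (proj_C2 (tr q))) - b * (2 * dz e q)"
      by (simp add: w_def hp_simps fc_def)
    then show "Im (hp (dc e q) (proj_C2 w)) = 0"
      unfolding ptr T using dG_pos[OF q] by simp
  qed
  then have "normal_part f q w = 0"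
    by (intro normal_part_eqI[OF lin[OF q]]) (simp_all add: g_simps)
  moreover have "normal_part f q xi = xi"
  proof (rule normal_part_eqI[OF lin[OF q]])
    show "xi - xi \<in> range (Df f q)" using linear_0[OF lin[OF q]] by (metis diff_self rangeI)
    show "g (f q) xi (Df f q e) = 0" for e
      by (simp add: g_def leg[OF q] gT_eq hp_simps)
  qed
  ultimately have "normal_part f q ((4 / dG q) *\<^sub>R tr q) + (b * fz q) *\<^sub>R xi - b *\<^sub>R normal_part f q (X (f q)) = 0"
    unfolding w_def normal_part_add[OF lin[OF q] imm[OF q]] normal_part_scale[OF lin[OF q] imm[OF q]] by simp
  then show ?thesis unfolding mean_curvature_eq[OF q] by simp
qed

end

subsection \<open>Moving frames\<close>

text \<open>Derivatives along two vector fields, kept together with full differentiability so that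
  product and chain rules act on both components at once.\<close>

definition hasD :: "('a \<Rightarrow> 'a) \<Rightarrow> ('a \<Rightarrow> 'a) \<Rightarrow> ('a::real_normed_vector \<Rightarrow> 'b::real_normed_vector) \<Rightarrow> 'a \<Rightarrow> 'b \<Rightarrow> 'b \<Rightarrow> bool" where
  "hasD t n h q hx hy \<longleftrightarrow> (\<exists>h'. (h has_derivative h') (at q) \<and> h' (t q) = hx \<and> h' (n q) = hy)"

lemma hasD_bilinear:
  assumes "bounded_bilinear B" "hasD t n f q fx fy" "hasD t n h q hx hy"
  shows "hasD t n (\<lambda>x. B (f x) (h x)) q (B (f q) hx + B fx (h q)) (B (f q) hy + B fy (h q))"
proof -
  obtain f' h' where "(f has_derivative f') (at q)" "f' (t q) = fx" "f' (n q) = fy"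
    "(h has_derivative h') (at q)" "h' (t q) = hx" "h' (n q) = hy"
    using assms(2,3) unfolding hasD_def by blast
  then show ?thesis
    unfolding hasD_def
    by (intro exI[of _ "\<lambda>e. B (f q) (h' e) + B (f' e) (h q)"] conjI bounded_bilinear.FDERIV[OF assms(1)]) auto
qed

lemma hasD_bounded_linear:
  assumes "bounded_linear L" "hasD t n f q fx fy"
  shows "hasD t n (\<lambda>x. L (f x)) q (L fx) (L fy)"
proof -
  obtain f' where "(f has_derivative f') (at q)" "f' (t q) = fx" "f' (n q) = fy"
    using assms(2) unfolding hasD_def by blast
  then show ?thesis
    unfolding hasD_def
    by (intro exI[of _ "\<lambda>e. L (f' e)"] conjI bounded_linear.has_derivative[OF assms(1)]) auto
qed

lemma hasD_const: "hasD t n (\<lambda>x. c) q 0 0"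
  unfolding hasD_def by (intro exI[of _ "\<lambda>e. 0"]) auto

lemma hasD_add:
  assumes "hasD t n f q fx fy" "hasD t n h q hx hy"
  shows "hasD t n (\<lambda>x. f x + h x) q (fx + hx) (fy + hy)"
proof -
  obtain f' h' where "(f has_derivative f') (at q)" "f' (t q) = fx" "f' (n q) = fy"
    "(h has_derivative h') (at q)" "h' (t q) = hx" "h' (n q) = hy"
    using assms unfolding hasD_def by blast
  then show ?thesis
    unfolding hasD_def by (intro exI[of _ "\<lambda>e. f' e + h' e"] conjI has_derivative_add) auto
qed

lemma hasD_divide:
  fixes f h :: "'a::real_normed_vector \<Rightarrow> real"
  assumes "hasD t n f q fx fy" "hasD t n h q hx hy" "h q \<noteq> 0"
  shows "hasD t n (\<lambda>x. f x / h x) q ((fx * h q - f q * hx) / (h q * h q)) ((fy * h q - f q * hy) / (h q * h q))"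
proof -
  obtain f' h' where "(f has_derivative f') (at q)" "f' (t q) = fx" "f' (n q) = fy"
    "(h has_derivative h') (at q)" "h' (t q) = hx" "h' (n q) = hy"
    using assms unfolding hasD_def by blast
  then show ?thesis
    unfolding hasD_def
    by (intro exI[of _ "\<lambda>e. (f' e * h q - f q * h' e) / (h q * h q)"] conjI has_derivative_divide' assms) auto
qed

lemma hasD_cis:
  assumes "hasD t n f q fx fy"
  shows "hasD t n (\<lambda>x. cis (f x)) q (\<i> * of_real fx * cis (f q)) (\<i> * of_real fy * cis (f q))"
proof -
  obtain f' where "(f has_derivative f') (at q)" "f' (t q) = fx" "f' (n q) = fy"
    using assms unfolding hasD_def by blast
  then show ?thesis
    unfolding hasD_def
    by (intro exI[of _ "\<lambda>e. \<i> * of_real (f' e) * cis (f q)"] conjI has_derivative_cis) auto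
qed

lemma hasD_eq:
  assumes "hasD t n f q fx fy" "hasD t n h q hx hy" "open U" "q \<in> U" "\<And>x. x \<in> U \<Longrightarrow> f x = h x"
  shows "fx = hx" "fy = hy"
proof -
  obtain f' h' where d: "(f has_derivative f') (at q)" "f' (t q) = fx" "f' (n q) = fy"
    "(h has_derivative h') (at q)" "h' (t q) = hx" "h' (n q) = hy"
    using assms(1,2) unfolding hasD_def by blast
  have "(h has_derivative f') (at q)"
    by (rule has_derivative_transform_within_open[OF d(1) assms(3,4)]) (use assms(5) in auto)
  then have "f' = h'" using d(4) has_derivative_unique by blast
  then show "fx = hx" "fy = hy" using d by auto
qed

lemma hasD_cong:
  assumes "hasD t n f q fx fy" "open U" "q \<in> U" "\<And>x. x \<in> U \<Longrightarrow> f x = h x" "fx = hx" "fy = hy"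
  shows "hasD t n h q hx hy"
proof -
  obtain f' where d: "(f has_derivative f') (at q)" "f' (t q) = fx" "f' (n q) = fy"
    using assms(1) unfolding hasD_def by blast
  have "(h has_derivative f') (at q)"
    by (rule has_derivative_transform_within_open[OF d(1) assms(2,3)]) (use assms(4) in auto)
  then show ?thesis using d assms unfolding hasD_def by auto
qed

lemma hasD_eq0:
  assumes "hasD t n f q fx fy" "open U" "q \<in> U" "\<And>x. x \<in> U \<Longrightarrow> f x = c"
  shows "fx = 0" "fy = 0"
  using hasD_eq[OF assms(1) hasD_const assms(2,3,4)] by blast+

lemma hasD_constant_on:
  assumes U: "open U" "connected U" and h: "\<And>q. q \<in> U \<Longrightarrow> hasD t n h q 0 0"
    and tn: "\<And>q e. q \<in> U \<Longrightarrow> \<exists>x y. e = x *\<^sub>R t q + y *\<^sub>R n q"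
    and "p \<in> U" "q \<in> U"
  shows "h p = h q"
proof (rule has_derivative_zero_unique_connected[OF U _ assms(5,6)])
  fix x assume x: "x \<in> U"
  obtain h' where d: "(h has_derivative h') (at x)" "h' (t x) = 0" "h' (n x) = 0"
    using h[OF x] unfolding hasD_def by blast
  have "h' e = 0" for e
  proof -
    obtain r s where "e = r *\<^sub>R t x + s *\<^sub>R n x" using tn[OF x] by blast
    then show ?thesis
      using d has_derivative_linear[OF d(1)] by (simp add: linear_add linear_scale)
  qed
  then have "h' = (\<lambda>e. 0)" by auto
  then show "(h has_derivative (\<lambda>e. 0)) (at x)" using d(1) by simp
qed

text \<open>Two orthogonal vectors of equal length form a unitary basis up to scale. Used for the
  moving frame, and with \<open>m = 1\<close> for constant orthonormal bases.\<close>

lemma frame_expand: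
  assumes "hp a a = of_real m" "hp c c = of_real m" "hp a c = 0" "m \<noteq> 0"
  shows "of_real m * hp u v = hp u a * hp a v + hp u c * hp c v"
    and "of_real m * cdet v c = cdet a c * hp a v" "of_real m * cdet a v = cdet a c * hp c v"
proof -
  have ca: "hp c a = 0" using assms(3) hp_cnj[of c a] by simp
  have id: "cdet v c * (hp a a * hp c c - hp a c * hp c a) = cdet a c * (hp c c * hp a v - hp a c * hp c v)"
    "cdet a v * (hp a a * hp c c - hp a c * hp c a) = cdet a c * (hp a a * hp c v - hp c a * hp a v)"
    by (simp_all add: cdet_def hp_def algebra_simps)
  have m: "complex_of_real m \<noteq> 0" using assms(4) by simp
  have "of_real m * (of_real m * cdet v c) = of_real m * (cdet a c * hp a v)"
    using id(1) unfolding assms ca by (simp add: algebra_simps)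
  then show 1: "of_real m * cdet v c = cdet a c * hp a v" using m by simp
  have "of_real m * (of_real m * cdet a v) = of_real m * (cdet a c * hp c v)"
    using id(2) unfolding assms ca by (simp add: algebra_simps)
  then show 2: "of_real m * cdet a v = cdet a c * hp c v" using m by simp
  have "cdet a c \<noteq> 0"
  proof
    assume "cdet a c = 0"
    then have "of_real m * of_real m = (0::complex)" using cdet_norm[of a c] assms ca by simp
    then show False using m by simp
  qed
  moreover have "cdet a c * (of_real m * hp u v) = cdet a c * (hp u a * hp a v + hp u c * hp c v)"
  proof -
    have "cdet a c * (of_real m * hp u v) = of_real m * (cdet v c * hp u a + cdet a v * hp u c)"
      unfolding cdet_expand[of a c u v, symmetric] by (simp add: algebra_simps)
    also have "\<dots> = (of_real m * cdet v c) * hp u a + (of_real m * cdet a v) * hp u c"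
      by (simp add: algebra_simps)
    also have "\<dots> = cdet a c * (hp u a * hp a v + hp u c * hp c v)"
      unfolding 1 2 by (simp add: algebra_simps)
    finally show ?thesis .
  qed
  ultimately show "of_real m * hp u v = hp u a * hp a v + hp u c * hp c v" by simp
qed

section \<open>Structure equations of a shrinker in a commuting orthogonal frame\<close>

text \<open>\<open>FX\<close>, \<open>FY\<close> are the derivatives of \<open>f\<close> along
  \<open>T\<close>, \<open>N\<close>. The same \<open>FXY\<close> in \<open>DX\<close> and
  \<open>DY\<close> expresses that the fields commute; \<open>Dz\<close> makes \<open>T\<close> dual
  to dz, and then the value -2 in \<open>fX\<close> is the Legendrian condition.\<close>

locale shrinker_frame =
  fixes U :: "R2 set" and T N :: "R2 \<Rightarrow> R2" and f FX FY FXX FXY FYY :: "R2 \<Rightarrow> C2"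
    and z \<mu> :: "R2 \<Rightarrow> real" and b \<theta> :: real
  assumes open_U: "open U" and b0: "b \<noteq> 0"
    and spanTN: "\<And>q e. q \<in> U \<Longrightarrow> \<exists>x y. e = x *\<^sub>R T q + y *\<^sub>R N q"
    and Df': "\<And>q. q \<in> U \<Longrightarrow> hasD T N f q (FX q) (FY q)"
    and Dz: "\<And>q. q \<in> U \<Longrightarrow> hasD T N z q 1 0"
    and DX: "\<And>q. q \<in> U \<Longrightarrow> hasD T N FX q (FXX q) (FXY q)"
    and DY: "\<And>q. q \<in> U \<Longrightarrow> hasD T N FY q (FXY q) (FYY q)"
    and XX: "\<And>q. q \<in> U \<Longrightarrow> hp (FX q) (FX q) = of_real (\<mu> q)"
    and YY: "\<And>q. q \<in> U \<Longrightarrow> hp (FY q) (FY q) = of_real (\<mu> q)"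
    and XY: "\<And>q. q \<in> U \<Longrightarrow> hp (FX q) (FY q) = 0"
    and \<mu>: "\<And>q. q \<in> U \<Longrightarrow> \<mu> q > 0"
    and fX: "\<And>q. q \<in> U \<Longrightarrow> Im (hp (f q) (FX q)) = -2"
    and fY: "\<And>q. q \<in> U \<Longrightarrow> Im (hp (f q) (FY q)) = 0"
    and angle: "\<And>q. q \<in> U \<Longrightarrow> Im (cdet (FX q) (FY q) * cis (- (b / 2) * z q + \<theta>)) = 0"
begin

lemma D_hp: 
  assumes "hasD T N u q ux uy" "hasD T N v q vx vy"
  shows "hasD T N (\<lambda>x. hp (u x) (v x)) q (hp (u q) vx + hp ux (v q)) (hp (u q) vy + hp uy (v q))"
  by (rule hasD_bilinear[OF bounded_bilinear_hp assms])

lemma D_Im: "hasD T N u q ux uy \<Longrightarrow> hasD T N (\<lambda>x. Im (u x)) q (Im ux) (Im uy)"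
  and D_Re: "hasD T N u q ux uy \<Longrightarrow> hasD T N (\<lambda>x. Re (u x)) q (Re ux) (Re uy)"
  by (rule hasD_bounded_linear[OF bounded_linear_Im] hasD_bounded_linear[OF bounded_linear_Re], assumption)+

lemma YX: "q \<in> U \<Longrightarrow> hp (FY q) (FX q) = 0"
  using XY hp_cnj[of "FY q" "FX q"] by simp

lemma orth1: assumes q: "q \<in> U"
  shows "hp (FX q) (FXY q) = - cnj (hp (FY q) (FXX q))" "hp (FX q) (FYY q) = - cnj (hp (FY q) (FXY q))"
proof -
  note D = D_hp[OF DX[OF q] DY[OF q]]
  have "hp (FX q) (FXY q) + hp (FXX q) (FY q) = 0" "hp (FX q) (FYY q) + hp (FXY q) (FY q) = 0"
    using hasD_eq0[OF D open_U q XY] by simp_all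
  then show "hp (FX q) (FXY q) = - cnj (hp (FY q) (FXX q))" "hp (FX q) (FYY q) = - cnj (hp (FY q) (FXY q))"
    by (metis hp_cnj add_eq_0_iff2)+
qed

lemma orth2: assumes q: "q \<in> U"
  shows "Re (hp (FX q) (FXX q)) = Re (hp (FY q) (FXY q))" "Re (hp (FX q) (FXY q)) = Re (hp (FY q) (FYY q))"
proof -
  note D1 = D_Re[OF D_hp[OF DX[OF q] DX[OF q]]] and D2 = D_Re[OF D_hp[OF DY[OF q] DY[OF q]]]
  have "Re (hp (FX x) (FX x)) = Re (hp (FY x) (FY x))" if "x \<in> U" for x
    using XX[OF that] YY[OF that] by simp
  from hasD_eq[OF D1 D2 open_U q this]
  show "Re (hp (FX q) (FXX q)) = Re (hp (FY q) (FXY q))" "Re (hp (FX q) (FXY q)) = Re (hp (FY q) (FYY q))"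
    by (simp_all add: hp_Re_swap[of "FXX q" "FX q"] hp_Re_swap[of "FXY q" "FX q"]
      hp_Re_swap[of "FXY q" "FY q"] hp_Re_swap[of "FYY q" "FY q"])
qed

lemma mu_nz: "q \<in> U \<Longrightarrow> \<mu> q \<noteq> 0" using \<mu>[of q] by auto

text \<open>The trace of the cubic form against the frame equals the rate of the angle, which is
  proportional to the height and therefore changes along \<open>T\<close> only.\<close>

lemma angle1: assumes q: "q \<in> U"
  shows "Im (hp (FX q) (FXX q)) + Im (hp (FY q) (FXY q)) = \<mu> q * b / 2" 
    "Im (hp (FX q) (FXY q)) + Im (hp (FY q) (FYY q)) = 0"
proof -
  let ?\<Theta> = "- (b / 2) * z q + \<theta>"
  have D0: "hasD T N (\<lambda>x. - (b / 2) * z x + \<theta>) q (- (b / 2) * 1 + 0) (- (b / 2) * 0 + 0)"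
    by (intro hasD_add hasD_const hasD_bounded_linear[OF bounded_linear_mult_right] Dz q)
  note D = D_Im[OF hasD_bilinear[OF bounded_bilinear_mult hasD_bilinear[OF bounded_bilinear_cdet DX[OF q] DY[OF q]] hasD_cis[OF D0]]]
  note e = hasD_eq0[OF D open_U q angle]
  let ?c = "cdet (FX q) (FY q)"
  define r where "r = Re (?c * cis ?\<Theta>)"
  have r: "?c * cis ?\<Theta> = of_real r"
    using angle[OF q] by (simp add: r_def complex_eq_iff)
  have "?c \<noteq> 0"
    using cdet_norm[of "FX q" "FY q"] mu_nz[OF q] by (auto simp: XX[OF q] YY[OF q] XY[OF q])
  then have r0: "r \<noteq> 0" using r by auto
  \<comment> \<open>Common to both directions: multiplied by \<mu>, the two determinants expand in
    the frame into multiples of \<open>?c\<close>, and the rotated \<open>?c\<close> is the real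
    number \<open>r\<close>.\<close>
  have key: "Im (hp (FX q) v + hp (FY q) w) = - \<mu> q * s"
    if "Im (?c * (\<i> * of_real s * cis ?\<Theta>) + (cdet (FX q) w + cdet v (FY q)) * cis ?\<Theta>) = 0" for v w s
  proof -
    note fe = frame_expand[OF XX[OF q] YY[OF q] XY[OF q] mu_nz[OF q]]
    have "of_real (\<mu> q) * (?c * (\<i> * of_real s * cis ?\<Theta>) + (cdet (FX q) w + cdet v (FY q)) * cis ?\<Theta>)
       = of_real (\<mu> q) * \<i> * of_real s * (?c * cis ?\<Theta>) + (of_real (\<mu> q) * cdet (FX q) w + of_real (\<mu> q) * cdet v (FY q)) * cis ?\<Theta>"
      by (simp add: algebra_simps)
    also have "\<dots> = of_real (\<mu> q) * \<i> * of_real s * (?c * cis ?\<Theta>) + (hp (FX q) v + hp (FY q) w) * (?c * cis ?\<Theta>)"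
      unfolding fe(2,3) by (simp add: algebra_simps)
    also have "\<dots> = of_real r * (\<i> * of_real (\<mu> q * s) + (hp (FX q) v + hp (FY q) w))"
      unfolding r by (simp add: algebra_simps)
    finally have eq: "of_real (\<mu> q) * (?c * (\<i> * of_real s * cis ?\<Theta>) + (cdet (FX q) w + cdet v (FY q)) * cis ?\<Theta>)
      = of_real r * (\<i> * of_real (\<mu> q * s) + (hp (FX q) v + hp (FY q) w))" .
    have "Im (of_real r * (\<i> * of_real (\<mu> q * s) + (hp (FX q) v + hp (FY q) w))) = 0"
      unfolding eq[symmetric] using that by (simp only: Im_complex_of_real times_complex.sel Re_complex_of_real)
    then have "\<mu> q * s + Im (hp (FX q) v + hp (FY q) w) = 0"
      using r0 by simp
    then show ?thesis by simp
  qed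
  show "Im (hp (FX q) (FXX q)) + Im (hp (FY q) (FXY q)) = \<mu> q * b / 2"
    using key[of "- (b / 2)" "FXY q" "FXX q"] e(1) by simp
  show "Im (hp (FX q) (FXY q)) + Im (hp (FY q) (FYY q)) = 0"
    using key[of 0 "FYY q" "FXY q"] e(2) by simp
qed

lemma leg1: assumes q: "q \<in> U"
  shows "Im (hp (f q) (FXX q)) = 0" "Im (hp (f q) (FXY q)) = 0" "Im (hp (f q) (FYY q)) = 0"
proof -
  note D1 = D_Im[OF D_hp[OF Df'[OF q] DX[OF q]]] and D2 = D_Im[OF D_hp[OF Df'[OF q] DY[OF q]]]
  show "Im (hp (f q) (FXX q)) = 0" "Im (hp (f q) (FXY q)) = 0" "Im (hp (f q) (FYY q)) = 0"
    using hasD_eq0[OF D1 open_U q fX] hasD_eq0[OF D2 open_U q fY] by (simp_all add: XX YY XY YX q)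
qed

lemma expand: "q \<in> U \<Longrightarrow> of_real (\<mu> q) * hp u v = hp u (FX q) * hp (FX q) v + hp u (FY q) * hp (FY q) v"
  using frame_expand(1)[OF XX YY XY mu_nz] by blast

definition B where "B q = Re (hp (f q) (FY q))"

lemma hp_fY: "q \<in> U \<Longrightarrow> hp (f q) (FY q) = of_real (B q)"
  using fY by (simp add: B_def complex_eq_iff)

lemma expand_Im: assumes q: "q \<in> U"
  shows "\<mu> q * Im (hp (f q) v) = Re (hp (f q) (FX q)) * Im (hp (FX q) v) - 2 * Re (hp (FX q) v) + B q * Im (hp (FY q) v)"
    and "\<mu> q * Re (hp (f q) v) = Re (hp (f q) (FX q)) * Re (hp (FX q) v) + 2 * Im (hp (FX q) v) + B q * Re (hp (FY q) v)"
proof -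
  note e = expand[OF q, of "f q" v, unfolded hp_fY[OF q]]
  show "\<mu> q * Im (hp (f q) v) = Re (hp (f q) (FX q)) * Im (hp (FX q) v) - 2 * Re (hp (FX q) v) + B q * Im (hp (FY q) v)"
    using arg_cong[OF e, of Im] fX[OF q] by simp
  show "\<mu> q * Re (hp (f q) v) = Re (hp (f q) (FX q)) * Re (hp (FX q) v) + 2 * Im (hp (FX q) v) + B q * Re (hp (FY q) v)"
    using arg_cong[OF e, of Re] fX[OF q] by simp
qed

text \<open>\<open>f\<close> is symplectically orthogonal to both \<open>FXX\<close> and
  \<open>FYY\<close>. In the sum of the two expansions everything cancels except
  \<open>Re (hp (f q) (FX q))\<close> times the trace \<mu> b / 2, and b is nonzero.\<close>

lemma hp_fX: assumes q: "q \<in> U" shows "hp (f q) (FX q) = - 2 * \<i>"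
proof -
  have "B q * (Im (hp (FY q) (FXX q)) + Im (hp (FY q) (FYY q))) = 0"
    using orth1[OF q] angle1(2)[OF q] by simp
  then have i: "B q * Im (hp (FY q) (FXX q)) + B q * Im (hp (FY q) (FYY q)) = 0"
    by (simp add: distrib_left)
  have "0 = \<mu> q * Im (hp (f q) (FXX q)) + \<mu> q * Im (hp (f q) (FYY q))"
    using leg1[OF q] by simp
  also have "\<dots> = Re (hp (f q) (FX q)) * (Im (hp (FX q) (FXX q)) + Im (hp (FY q) (FXY q)))"
    unfolding expand_Im[OF q] using orth1[OF q] orth2[OF q] i by (simp add: algebra_simps)
  finally have "Re (hp (f q) (FX q)) = 0"
    unfolding angle1[OF q] using mu_nz[OF q] b0 by simp
  then show ?thesis using fX[OF q] by (simp add: complex_eq_iff)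
qed

text \<open>\<open>p\<close>, \<open>u\<close>, \<open>r\<close> are the entries of the Hermitian
  matrix in the moving frame. They are the solution of the linear system solved in
  \<open>structure_eqs\<close>, with \<open>p + r = b / 2\<close>.\<close>

definition r where "r q = 2 * (\<mu> q + b) / (4 + (B q)\<^sup>2)"
definition u where "u q = B q * r q / 2"
definition p where "p q = b / 2 - r q"

lemma B_pos: "4 + (B q)\<^sup>2 > 0" by (simp add: add_pos_nonneg)

text \<open>Orthogonality, equal lengths and the angle reduce the six products to the two with
  \<open>FXY\<close>. Differentiating \<open>hp_fX\<close> and expanding in the frame gives real
  linear equations for these; every elimination leaves the positive factor
  \<open>4 + (B q)\<^sup>2\<close>.\<close>

lemma structure_eqs: assumes q: "q \<in> U"
  shows "hp (FX q) (FXX q) = \<i> * of_real (\<mu> q * p q)" "hp (FY q) (FXX q) = of_real (- (\<mu> q * u q))"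
    "hp (FX q) (FXY q) = of_real (\<mu> q * u q)" "hp (FY q) (FXY q) = \<i> * of_real (\<mu> q * r q)"
    "hp (FX q) (FYY q) = \<i> * of_real (\<mu> q * r q)" "hp (FY q) (FYY q) = of_real (\<mu> q * u q)"
proof -
  let ?z1 = "hp (FX q) (FXY q)" and ?z2 = "hp (FY q) (FXY q)"
  let ?c1 = "hp (FX q) (FXX q)" and ?c2 = "hp (FY q) (FXX q)"
  let ?y1 = "hp (FX q) (FYY q)" and ?y2 = "hp (FY q) (FYY q)"
  have re: "Re (hp (f x) (FX x)) = 0" if "x \<in> U" for x using hp_fX[OF that] by simp
  note D1 = D_Re[OF D_hp[OF Df'[OF q] DX[OF q]]]
  have R: "Re (hp (f q) (FXX q)) = - \<mu> q" "Re (hp (f q) (FXY q)) = 0"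
    using hasD_eq0[OF D1 open_U q re] by (simp_all add: XX YX q)
  have 1: "- \<mu> q * \<mu> q = 2 * Im ?c1 + B q * Re ?c2" "0 = - 2 * Re ?c1 + B q * Im ?c2"
    using expand_Im[OF q, of "FXX q"] R leg1[OF q] re[OF q] by simp_all
  have 2: "0 = 2 * Im ?z1 + B q * Re ?z2" "0 = - 2 * Re ?z1 + B q * Im ?z2"
    using expand_Im[OF q, of "FXY q"] R leg1[OF q] re[OF q] by simp_all
  have o: "Re ?c2 = - Re ?z1" "Im ?c2 = Im ?z1" "Re ?y1 = - Re ?z2" "Im ?y1 = Im ?z2" "Re ?c1 = Re ?z2" "Re ?y2 = Re ?z1"
    "Im ?c1 = \<mu> q * b / 2 - Im ?z2" "Im ?y2 = - Im ?z1"
    using orth1[OF q] orth2[OF q] angle1[OF q] by simp_all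
  have "Im ?z1 * (4 + (B q)\<^sup>2) = 0" using 1(2) 2(1) o by algebra
  then have z1: "Im ?z1 = 0" using B_pos[of q] by simp
  then have z2: "Re ?z2 = 0" using 1(2) o by simp
  have "Im ?z2 * (4 + (B q)\<^sup>2) = 2 * \<mu> q * (\<mu> q + b)"
    using 1(1) 2(2) o by algebra
  then have r: "Im ?z2 = \<mu> q * r q"
    using B_pos[of q] by (simp add: r_def field_simps)
  have u: "Re ?z1 = \<mu> q * u q" using 2(2) r by (simp add: u_def algebra_simps)
  show "hp (FX q) (FXX q) = \<i> * of_real (\<mu> q * p q)" "hp (FY q) (FXX q) = of_real (- (\<mu> q * u q))"
    "hp (FX q) (FXY q) = of_real (\<mu> q * u q)" "hp (FY q) (FXY q) = \<i> * of_real (\<mu> q * r q)"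
    "hp (FX q) (FYY q) = \<i> * of_real (\<mu> q * r q)" "hp (FY q) (FYY q) = of_real (\<mu> q * u q)"
    using z1 z2 r u o by (simp_all add: complex_eq_iff p_def algebra_simps)
qed

text \<open>Since \<mu> f equals 2 \<i> \<open>FX\<close> + \<open>B\<close> \<open>FY\<close>, this
  is the \<open>FX\<close> component of S f = - \<i> \<open>FX\<close>; the \<open>FY\<close>
  component is the definition of \<open>u\<close>.\<close>

lemma p_u: assumes q: "q \<in> U" shows "\<mu> q + 2 * p q - B q * u q = 0"
  using B_pos[of q] by (simp add: p_def u_def r_def field_simps power2_eq_square)

text \<open>The determinant of the matrix S; it is what brings the derivative of \<open>u\<close>
  into the form of \<open>D_u\<close>.\<close>

lemma det_S: "p q * r q - (u q)\<^sup>2 = - r q * \<mu> q / 2"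
proof -
  have "r q * (4 + (B q)\<^sup>2) = 2 * (\<mu> q + b)" using B_pos[of q] by (simp add: r_def)
  then show ?thesis unfolding u_def p_def by (simp add: power2_eq_square field_simps) algebra
qed

lemma D_mu: assumes q: "q \<in> U" shows "hasD T N \<mu> q 0 (2 * \<mu> q * u q)"
proof -
  note D = D_Re[OF D_hp[OF DY[OF q] DY[OF q]]]
  show ?thesis
    by (rule hasD_cong[OF D open_U q])
       (use YY structure_eqs[OF q] in \<open>simp_all add: hp_Re_swap[of "FXY q" "FY q"] hp_Re_swap[of "FYY q" "FY q"]\<close>)
qed

lemma D_B: assumes q: "q \<in> U" shows "hasD T N B q 0 (\<mu> q + 2 * r q + B q * u q)"
proof -
  note D = D_Re[OF D_hp[OF Df'[OF q] DY[OF q]]]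
  have "\<mu> q * Re (hp (f q) (FXY q)) = 0" "\<mu> q * Re (hp (f q) (FYY q)) = \<mu> q * (2 * r q + B q * u q)"
    unfolding expand_Im[OF q] structure_eqs[OF q] hp_fX[OF q] by (simp_all add: algebra_simps)
  then have "Re (hp (f q) (FXY q)) = 0" "Re (hp (f q) (FYY q)) = 2 * r q + B q * u q"
    using mu_nz[OF q] by simp_all
  then show ?thesis
    by (intro hasD_cong[OF D open_U q]) (simp_all add: B_def XY YY q)
qed

text \<open>Together with \<open>D_p\<close> and \<open>D_u\<close> this says that S is a constant
  matrix: its entries vary only because the frame does.\<close>

lemma D_r: assumes q: "q \<in> U" shows "hasD T N r q 0 (- 2 * r q * u q)"
proof -
  have D1: "hasD T N (\<lambda>x. 2 * (\<mu> x + b)) q (2 * (0 + 0)) (2 * (2 * \<mu> q * u q + 0))"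
    by (intro hasD_bounded_linear[OF bounded_linear_mult_right] hasD_add D_mu hasD_const q)
  have D2: "hasD T N (\<lambda>x. 4 + B x * B x) q (0 + (B q * 0 + 0 * B q)) (0 + (B q * (\<mu> q + 2 * r q + B q * u q) + (\<mu> q + 2 * r q + B q * u q) * B q))"
    by (intro hasD_add hasD_const hasD_bilinear[OF bounded_bilinear_mult] D_B q)
  let ?s = "4 + B q * B q"
  have s: "?s \<noteq> 0" using B_pos[of q] by (simp add: power2_eq_square)
  have rs: "2 * (\<mu> q + b) = r q * ?s" using s by (simp add: r_def power2_eq_square)
  note D = hasD_divide[OF D1 D2 s]
  show ?thesis
  proof (rule hasD_cong[OF D open_U q])
    let ?t = "\<mu> q + 2 * r q + B q * u q"
    have "(2 * (2 * \<mu> q * u q + 0)) * ?s - 2 * (\<mu> q + b) * (0 + (B q * ?t + ?t * B q)) = - 2 * r q * u q * (?s * ?s)"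
      unfolding rs u_def by (simp add: field_simps) 
    then show "(2 * (2 * \<mu> q * u q + 0) * ?s - 2 * (\<mu> q + b) * (0 + (B q * ?t + ?t * B q))) / (?s * ?s) = - 2 * r q * u q"
      using s by (simp add: divide_eq_eq)
  qed (simp_all add: r_def power2_eq_square)
qed

lemma D_p: assumes q: "q \<in> U" shows "hasD T N p q 0 (2 * r q * u q)"
proof -
  have D: "hasD T N (\<lambda>x. b / 2 + (- 1) * r x) q (0 + (- 1) * 0) (0 + (- 1) * (- 2 * r q * u q))"
    by (intro hasD_bounded_linear[OF bounded_linear_mult_right] hasD_add D_r hasD_const q)
  show ?thesis by (rule hasD_cong[OF D open_U q]) (simp_all add: p_def)
qed

lemma D_u: assumes q: "q \<in> U" shows "hasD T N u q 0 (r q * (r q - p q))"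
proof -
  have D: "hasD T N (\<lambda>x. (1/2) * (B x * r x)) q ((1/2) * (B q * 0 + 0 * r q))
     ((1/2) * (B q * (- 2 * r q * u q) + (\<mu> q + 2 * r q + B q * u q) * r q))"
    by (intro hasD_bounded_linear[OF bounded_linear_mult_right] hasD_bilinear[OF bounded_bilinear_mult] D_r D_B q)
  show ?thesis
  proof (rule hasD_cong[OF D open_U q])
    have "r q * p q = (u q)\<^sup>2 - r q * \<mu> q / 2" using det_S[of q] by (simp add: algebra_simps)
    moreover have "B q * r q = 2 * u q" by (simp add: u_def)
    ultimately show "(1/2) * (B q * (- 2 * r q * u q) + (\<mu> q + 2 * r q + B q * u q) * r q) = r q * (r q - p q)"
      by algebra
  qed (simp_all add: u_def)
qed

end

section \<open>Eigenvectors of the constant matrix and the conic\<close>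

context shrinker_frame
begin

lemma hp_second: assumes q: "q \<in> U"
  shows "hp v (FXX q) = \<i> * of_real (p q) * hp v (FX q) - of_real (u q) * hp v (FY q)"
    "hp v (FXY q) = of_real (u q) * hp v (FX q) + \<i> * of_real (r q) * hp v (FY q)"
    "hp v (FYY q) = \<i> * of_real (r q) * hp v (FX q) + of_real (u q) * hp v (FY q)"
proof -
  have m: "complex_of_real (\<mu> q) \<noteq> 0" using mu_nz[OF q] by simp
  have *: "x = y" if "of_real (\<mu> q) * x = of_real (\<mu> q) * y" for x y :: complex
    using that m by simp
  show "hp v (FXX q) = \<i> * of_real (p q) * hp v (FX q) - of_real (u q) * hp v (FY q)"
    "hp v (FXY q) = of_real (u q) * hp v (FX q) + \<i> * of_real (r q) * hp v (FY q)"
    "hp v (FYY q) = \<i> * of_real (r q) * hp v (FX q) + of_real (u q) * hp v (FY q)"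
    by (rule *, unfold expand[OF q] structure_eqs[OF q], simp add: algebra_simps)+
qed

lemma D_hp_X: assumes q: "q \<in> U"
  shows "hasD T N (\<lambda>x. hp v (FX x)) q (\<i> * of_real (p q) * hp v (FX q) - of_real (u q) * hp v (FY q))
     (of_real (u q) * hp v (FX q) + \<i> * of_real (r q) * hp v (FY q))"
  using hasD_bounded_linear[OF bounded_bilinear.bounded_linear_right[OF bounded_bilinear_hp, of v] DX[OF q]]
  unfolding hp_second[OF q] .

lemma D_hp_Y: assumes q: "q \<in> U"
  shows "hasD T N (\<lambda>x. hp v (FY x)) q (of_real (u q) * hp v (FX q) + \<i> * of_real (r q) * hp v (FY q))
     (\<i> * of_real (r q) * hp v (FX q) + of_real (u q) * hp v (FY q))"
  using hasD_bounded_linear[OF bounded_bilinear.bounded_linear_right[OF bounded_bilinear_hp, of v] DY[OF q]]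
  unfolding hp_second[OF q] .

text \<open>\<open>n\<close> and \<mu> have the same derivative rates, 0 along \<open>T\<close> and
  2 \<open>u\<close> along \<open>N\<close>, so their quotient is constant. This takes the place of
  uniqueness for linear differential equations.\<close>

lemma ratio_const:
  assumes conn: "connected U" and n: "\<And>q. q \<in> U \<Longrightarrow> hasD T N n q 0 (2 * u q * n q)"
    and q0: "q0 \<in> U" "n q0 = 0" and q: "q \<in> U"
  shows "n q = (0::real)"
proof -
  have "hasD T N (\<lambda>x. n x / \<mu> x) q 0 0" if q: "q \<in> U" for q
    by (rule hasD_cong[OF hasD_divide[OF n[OF q] D_mu[OF q] mu_nz[OF q]] open_U q]) simp_all
  from hasD_constant_on[OF open_U conn this spanTN q q0(1)]
  have "n q / \<mu> q = n q0 / \<mu> q0" .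
  then show ?thesis using q0 mu_nz[OF q] by simp
qed

text \<open>The coefficient matrix is skew-Hermitian along \<open>T\<close>, and along
  \<open>N\<close> it is \<open>u\<close> times the identity plus a skew-Hermitian matrix. Hence the
  squared norm satisfies the hypothesis of \<open>ratio_const\<close>.\<close>

lemma complex_pair_vanish:
  assumes conn: "connected U"
    and E1: "\<And>q. q \<in> U \<Longrightarrow> hasD T N E1 q (\<i> * of_real (p q) * E1 q - of_real (u q) * E2 q) (of_real (u q) * E1 q + \<i> * of_real (r q) * E2 q)"
    and E2: "\<And>q. q \<in> U \<Longrightarrow> hasD T N E2 q (of_real (u q) * E1 q + \<i> * of_real (r q) * E2 q) (\<i> * of_real (r q) * E1 q + of_real (u q) * E2 q)"
    and q0: "q0 \<in> U" "E1 q0 = 0" "E2 q0 = 0" and q: "q \<in> U"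
  shows "E1 q = 0" "E2 q = 0"
proof -
  define n where "n x = Re (cnj (E1 x) * E1 x + cnj (E2 x) * E2 x)" for x
  have "hasD T N n q 0 (2 * u q * n q)" if q: "q \<in> U" for q
  proof -
    have c: "hasD T N (\<lambda>x. cnj (E x)) q (cnj ex) (cnj ey)" if "hasD T N E q ex ey" for E ex ey
      by (rule hasD_bounded_linear[OF bounded_linear_cnj that])
    note D = D_Re[OF hasD_add[OF hasD_bilinear[OF bounded_bilinear_mult c[OF E1[OF q]] E1[OF q]]
        hasD_bilinear[OF bounded_bilinear_mult c[OF E2[OF q]] E2[OF q]]]]
    show ?thesis
      by (rule hasD_cong[OF D open_U q]) (simp_all add: n_def algebra_simps)
  qed
  from ratio_const[OF conn this q0(1) _ q] have "n q = 0" using q0 by (simp add: n_def)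
  moreover have "(cmod (E1 q))\<^sup>2 + (cmod (E2 q))\<^sup>2 = n q"
    unfolding n_def cmod_power2 by (simp add: power2_eq_square)
  ultimately show "E1 q = 0" "E2 q = 0" by (simp_all add: sum_power2_eq_zero_iff)
qed

text \<open>Along \<open>N\<close> the coefficient matrix is \<open>u\<close> times the identity
  plus a real skew matrix; the squared norm again falls under \<open>ratio_const\<close>.\<close>

lemma real_pair_vanish:
  assumes conn: "connected U"
    and w: "\<And>q. q \<in> U \<Longrightarrow> hasD T N w q 0 (u q * w q - r q * y q)"
    and y: "\<And>q. q \<in> U \<Longrightarrow> hasD T N y q 0 (r q * w q + u q * y q)"
    and q0: "q0 \<in> U" "w q0 = 0" "y q0 = 0" and q: "q \<in> U"
  shows "w q = (0::real)" "y q = 0"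
proof -
  define n where "n x = w x * w x + y x * y x" for x
  have "hasD T N n q 0 (2 * u q * n q)" if q: "q \<in> U" for q
  proof -
    note D = hasD_add[OF hasD_bilinear[OF bounded_bilinear_mult w[OF q] w[OF q]]
        hasD_bilinear[OF bounded_bilinear_mult y[OF q] y[OF q]]]
    show ?thesis
      by (rule hasD_cong[OF D open_U q]) (simp_all add: n_def algebra_simps)
  qed
  from ratio_const[OF conn this q0(1) _ q] have "n q = 0" using q0 by (simp add: n_def)
  then show "w q = 0" "y q = 0" by (simp_all add: n_def sum_squares_eq_zero_iff)
qed

text \<open>The matrix \<open>S\<close> with \<open>S FX = p FX + \<i> u FY\<close> and \<open>S FY = - \<i> u FX + r FY\<close> is Hermitian and
  generates the motion along \<^term>\<open>T\<close>.  The first two equations say that \<open>v\<close> is an eigenvector of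
  \<open>S\<close> for the eigenvalue \<open>k\<close>, the others fix its phase.\<close>

definition eigen_at where
  "eigen_at q v k \<longleftrightarrow>
     of_real (p q - k) * hp v (FX q) + \<i> * of_real (u q) * hp v (FY q) = 0 \<and>
     of_real (r q - k) * hp v (FY q) - \<i> * of_real (u q) * hp v (FX q) = 0 \<and>
     Im (\<i> * (hp v (FX q) * cis (- k * z q))) = 0 \<and> Im (hp v (FY q) * cis (- k * z q)) = 0"

text \<open>The defects \<open>E1\<close>, \<open>E2\<close> are the products of \<open>v\<close>
  with (S - k) \<open>FX\<close> and (S - k) \<open>FY\<close>. As S is constant, they obey the same
  linear system as \<open>hp v (FX q)\<close> and \<open>hp v (FY q)\<close>. Once they vanish, the
  phase conditions obey a real system of the same kind.\<close>

lemma eigen_at_everywhere: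
  assumes conn: "connected U" and q0: "q0 \<in> U" "eigen_at q0 v k" and q: "q \<in> U"
  shows "eigen_at q v k"
proof -
  define E1 where "E1 q = of_real (p q - k) * hp v (FX q) + \<i> * of_real (u q) * hp v (FY q)" for q
  define E2 where "E2 q = of_real (r q - k) * hp v (FY q) - \<i> * of_real (u q) * hp v (FX q)" for q
  have D1: "hasD T N E1 q (\<i> * of_real (p q) * E1 q - of_real (u q) * E2 q) (of_real (u q) * E1 q + \<i> * of_real (r q) * E2 q)"
    and D2: "hasD T N E2 q (of_real (u q) * E1 q + \<i> * of_real (r q) * E2 q) (\<i> * of_real (r q) * E1 q + of_real (u q) * E2 q)"
    if q: "q \<in> U" for q
  proof -
    have P: "hasD T N (\<lambda>x. of_real (p x + (- k))) q (of_real (0 + 0)) (of_real (2 * r q * u q + 0) :: complex)"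
      and R: "hasD T N (\<lambda>x. of_real (r x + (- k))) q (of_real (0 + 0)) (of_real (- 2 * r q * u q + 0) :: complex)"
      and W: "hasD T N (\<lambda>x. \<i> * of_real (u x)) q (\<i> * of_real 0) (\<i> * of_real (r q * (r q - p q)))"
      and W': "hasD T N (\<lambda>x. - \<i> * of_real (u x)) q (- \<i> * of_real 0) (- \<i> * of_real (r q * (r q - p q)))"
      by (intro hasD_bounded_linear[OF bounded_linear_of_real] hasD_add D_p D_r hasD_const D_u q
           hasD_bounded_linear[OF bounded_linear_mult_right])+
    note D = hasD_add[OF hasD_bilinear[OF bounded_bilinear_mult P D_hp_X[OF q]] hasD_bilinear[OF bounded_bilinear_mult W D_hp_Y[OF q]]]
    note D' = hasD_add[OF hasD_bilinear[OF bounded_bilinear_mult R D_hp_Y[OF q]] hasD_bilinear[OF bounded_bilinear_mult W' D_hp_X[OF q]]]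
    show "hasD T N E1 q (\<i> * of_real (p q) * E1 q - of_real (u q) * E2 q) (of_real (u q) * E1 q + \<i> * of_real (r q) * E2 q)"
      by (rule hasD_cong[OF D open_U q]) (simp_all add: E1_def E2_def algebra_simps, algebra+)
    show "hasD T N E2 q (of_real (u q) * E1 q + \<i> * of_real (r q) * E2 q) (\<i> * of_real (r q) * E1 q + of_real (u q) * E2 q)"
      by (rule hasD_cong[OF D' open_U q]) (simp_all add: E1_def E2_def algebra_simps, algebra+)
  qed
  have E0: "E1 x = 0" "E2 x = 0" if "x \<in> U" for x
    using complex_pair_vanish[of E1 E2, OF conn D1 D2 q0(1) _ _ that] q0(2) by (simp_all add: eigen_at_def E1_def E2_def)
  define w where "w x = Im (\<i> * (hp v (FX x) * cis (- k * z x)))" for x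
  define y where "y x = Im (hp v (FY x) * cis (- k * z x))" for x
  have Dw: "hasD T N w q 0 (u q * w q - r q * y q)" and Dy: "hasD T N y q 0 (r q * w q + u q * y q)"
    if q: "q \<in> U" for q
  proof -
    let ?c = "cis (- k * z q)"
    have C: "hasD T N (\<lambda>x. cis (- k * z x)) q (\<i> * of_real (- k * 1) * ?c) (\<i> * of_real (- k * 0) * ?c)"
      by (intro hasD_cis hasD_bounded_linear[OF bounded_linear_mult_right] Dz q)
    have e: "of_real k * hp v (FX q) = of_real (p q) * hp v (FX q) + \<i> * of_real (u q) * hp v (FY q)"
      "of_real k * hp v (FY q) = of_real (r q) * hp v (FY q) - \<i> * of_real (u q) * hp v (FX q)"
      using E0[OF q] by (simp_all add: E1_def E2_def algebra_simps)
    \<comment> \<open>Along \<open>T\<close> the products with an eigenvector rotate at speed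
      \<open>k\<close>, which the factor \<open>cis (- k * z q)\<close> undoes exactly.\<close>
    have x1: "hp v (FX q) * (\<i> * of_real (- k * 1) * ?c) + (\<i> * of_real (p q) * hp v (FX q) - of_real (u q) * hp v (FY q)) * ?c = 0"
    proof -
      have "hp v (FX q) * (\<i> * of_real (- k * 1) * ?c) = - \<i> * (of_real k * hp v (FX q)) * ?c" by simp
      then show ?thesis unfolding e by (simp add: algebra_simps)
    qed
    have x2: "hp v (FY q) * (\<i> * of_real (- k * 1) * ?c) + (of_real (u q) * hp v (FX q) + \<i> * of_real (r q) * hp v (FY q)) * ?c = 0"
    proof -
      have "hp v (FY q) * (\<i> * of_real (- k * 1) * ?c) = - \<i> * (of_real k * hp v (FY q)) * ?c" by simp
      then show ?thesis unfolding e by (simp add: algebra_simps)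
    qed
    note D = D_Im[OF hasD_bounded_linear[OF bounded_linear_mult_right[of \<i>] hasD_bilinear[OF bounded_bilinear_mult D_hp_X[OF q] C]]]
    note D' = D_Im[OF hasD_bilinear[OF bounded_bilinear_mult D_hp_Y[OF q] C]]
    show "hasD T N w q 0 (u q * w q - r q * y q)"
    proof (rule hasD_cong[OF D open_U q])
      show "Im (\<i> * (hp v (FX q) * (\<i> * of_real (- k * 1) * ?c) + (\<i> * of_real (p q) * hp v (FX q) - of_real (u q) * hp v (FY q)) * ?c)) = 0"
        unfolding x1 by simp
    qed (simp_all add: w_def y_def algebra_simps del: cis.sel)
    show "hasD T N y q 0 (r q * w q + u q * y q)"
    proof (rule hasD_cong[OF D' open_U q])
      show "Im (hp v (FY q) * (\<i> * of_real (- k * 1) * ?c) + (of_real (u q) * hp v (FX q) + \<i> * of_real (r q) * hp v (FY q)) * ?c) = 0"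
        unfolding x2 by simp
    qed (simp_all add: w_def y_def algebra_simps del: cis.sel)
  qed
  have "w q = 0" "y q = 0"
    using real_pair_vanish[of w y, OF conn Dw Dy q0(1) _ _ q] q0(2) by (simp_all add: eigen_at_def w_def y_def)
  with E0[OF q] show ?thesis
    by (simp only: eigen_at_def E1_def E2_def w_def y_def simp_thms)
qed

lemma hp_X_f: "q \<in> U \<Longrightarrow> hp (FX q) (f q) = 2 * \<i>" and hp_Y_f: "q \<in> U \<Longrightarrow> hp (FY q) (f q) = of_real (B q)"
  using hp_cnj[of "FX q" "f q"] hp_cnj[of "FY q" "f q"] by (simp_all add: hp_fX hp_fY)

text \<open>Expanding \<open>f\<close> in the frame makes its rotated coordinate real because those
  of \<i> \<open>FX\<close> and \<open>FY\<close> are. The second claim is S f = - \<i>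
  \<open>FX\<close>, paired with an eigenvector.\<close>

lemma eigen_at_coords:
  assumes q: "q \<in> U" and e: "eigen_at q v k"
  shows "Im (hp v (f q) * cis (- k * z q)) = 0" "hp v (FX q) = \<i> * of_real k * hp v (f q)"
proof -
  let ?a = "hp v (FX q)" and ?c = "hp v (FY q)" and ?h = "hp v (f q)"
  have h: "of_real (\<mu> q) * ?h = 2 * \<i> * ?a + of_real (B q) * ?c"
    using expand[OF q, of v "f q"] by (simp add: hp_X_f[OF q] hp_Y_f[OF q] algebra_simps)
  have "of_real (\<mu> q) * (?h * cis (- k * z q)) = 2 * (\<i> * (?a * cis (- k * z q))) + of_real (B q) * (?c * cis (- k * z q))"
    unfolding mult.assoc[symmetric] h by (simp add: algebra_simps)
  from arg_cong[OF this, of Im] e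
  have "\<mu> q * Im (?h * cis (- k * z q)) = 0"
    unfolding eigen_at_def by (simp only: Im_complex_of_real Re_complex_of_real plus_complex.sel times_complex.sel complex_Re_numeral complex_Im_numeral)
  then show "Im (?h * cis (- k * z q)) = 0" using mu_nz[OF q] by simp
  have E: "of_real k * ?a = of_real (p q) * ?a + \<i> * of_real (u q) * ?c"
    "of_real k * ?c = of_real (r q) * ?c - \<i> * of_real (u q) * ?a"
    using e by (simp_all add: eigen_at_def algebra_simps)
  have pu: "complex_of_real (\<mu> q) = of_real (B q) * of_real (u q) - 2 * of_real (p q)"
    using arg_cong[OF p_u[OF q], of complex_of_real] by (simp add: algebra_simps)
  have Br: "complex_of_real (B q) * of_real (r q) = 2 * of_real (u q)"
    by (simp add: u_def)
  have "of_real (\<mu> q) * (\<i> * of_real k * ?h) = \<i> * of_real k * (2 * \<i> * ?a + of_real (B q) * ?c)"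
    unfolding h[symmetric] by simp
  also have "\<dots> = - 2 * (of_real k * ?a) + \<i> * of_real (B q) * (of_real k * ?c)"
    by (simp add: algebra_simps)
  also have "\<dots> = of_real (\<mu> q) * ?a + \<i> * ?c * (of_real (B q) * of_real (r q) - 2 * of_real (u q))"
    unfolding E pu by (simp add: algebra_simps)
  also have "\<dots> = of_real (\<mu> q) * ?a" unfolding Br by simp
  finally show "?a = \<i> * of_real k * ?h" using mu_nz[OF q] by simp
qed

text \<open>This is \<open>hp_fX\<close> written in the eigenbasis, where \<open>FX\<close> has the
  coordinates of \<open>f\<close> multiplied by \<i> k and \<i> l.\<close>

lemma eigen_basis_conic:
  assumes q: "q \<in> U" and e: "eigen_at q v k" "eigen_at q w l"
    and on: "hp v v = 1" "hp w w = 1" "hp v w = 0"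
  shows "k * (Re (hp v (f q) * cis (- k * z q)))\<^sup>2 + l * (Re (hp w (f q) * cis (- l * z q)))\<^sup>2 = -2"
proof -
  have n: "of_real ((Re (hp v (f q) * cis (- k * z q)))\<^sup>2) = hp (f q) v * hp v (f q)" if "eigen_at q v k" for v k
  proof -
    have "of_real ((Re (hp v (f q) * cis (- k * z q)))\<^sup>2) = complex_of_real ((cmod (hp v (f q) * cis (- k * z q)))\<^sup>2)"
      unfolding cmod_power2 eigen_at_coords(1)[OF q that] by simp
    also have "\<dots> = of_real ((cmod (hp v (f q)))\<^sup>2)" by (simp add: norm_mult)
    also have "\<dots> = hp (f q) v * hp v (f q)"
      unfolding complex_norm_square hp_cnj[of "f q" v] by (rule mult.commute)
    finally show ?thesis .
  qed
  define K where "K = k * (Re (hp v (f q) * cis (- k * z q)))\<^sup>2 + l * (Re (hp w (f q) * cis (- l * z q)))\<^sup>2"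
  have "- 2 * \<i> = hp (f q) v * hp v (FX q) + hp (f q) w * hp w (FX q)"
    using frame_expand(1)[of v 1 w "f q" "FX q"] on by (simp add: hp_fX[OF q])
  also have "\<dots> = \<i> * (of_real k * (hp (f q) v * hp v (f q)) + of_real l * (hp (f q) w * hp w (f q)))"
    unfolding eigen_at_coords(2)[OF q e(1)] eigen_at_coords(2)[OF q e(2)] by (simp add: algebra_simps)
  also have "\<dots> = \<i> * of_real (k * (Re (hp v (f q) * cis (- k * z q)))\<^sup>2 + l * (Re (hp w (f q) * cis (- l * z q)))\<^sup>2)"
    unfolding n[OF e(1), symmetric] n[OF e(2), symmetric] by simp
  finally have "- 2 * \<i> = \<i> * of_real K" unfolding K_def .
  from arg_cong[OF this, of Im] have "K = -2" by simp
  then show ?thesis unfolding K_def .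
qed

end

text \<open>The matrix has diagonal \<open>p\<close>, \<open>r\<close> and off-diagonal entry
  \<open>- u\<close>, with eigenvectors \<open>(C, s)\<close> and \<open>(s, - C)\<close>. It is S
  in the frame \<i> \<open>FX\<close>, \<open>FY\<close>, where the Hermitian matrix becomes
  real.\<close>

lemma diagonalize_sym2:
  fixes p u r :: real
  obtains C s k l where "C\<^sup>2 + s\<^sup>2 = 1" "p * C - u * s = k * C" "r * s - u * C = k * s"
    "p * s + u * C = l * s" "r * C + u * s = l * C" "k \<le> l" "k + l = p + r"
proof (cases "u = 0")
  case True
  show thesis
  proof (cases "p \<le> r")
    case True
    show thesis by (rule that[of 1 0 p r]) (use True \<open>u = 0\<close> in auto)
  next
    case False
    show thesis by (rule that[of 0 1 r p]) (use False \<open>u = 0\<close> in auto)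
  qed
next
  case False
  define d where "d = sqrt (((p - r) / 2)\<^sup>2 + u\<^sup>2)"
  define k where "k = (p + r) / 2 - d"
  define l where "l = (p + r) / 2 + d"
  have d: "d\<^sup>2 = ((p - r) / 2)\<^sup>2 + u\<^sup>2" "d \<ge> 0" by (simp_all add: d_def)
  have "(p - k) * (r - k) = u\<^sup>2"
  proof -
    have "(p - k) * (r - k) = d\<^sup>2 - ((p - r) / 2)\<^sup>2" unfolding k_def by (simp add: power2_eq_square field_simps)
    then show ?thesis using d by simp
  qed
  then have pk: "(p - k) * (r - k) = u * u" by (simp add: power2_eq_square)
  \<comment> \<open>The vector \<open>(u, p - k)\<close> is an eigenvector for \<open>k\<close>,
    nonzero because \<open>u\<close> is; \<open>n\<close> is its length.\<close>
  define n where "n = sqrt (u\<^sup>2 + (p - k)\<^sup>2)"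
  have n2: "n * n = u\<^sup>2 + (p - k)\<^sup>2" by (simp add: n_def)
  have "u\<^sup>2 + (p - k)\<^sup>2 > 0" using False by (simp add: add_pos_nonneg)
  then have n: "n > 0" by (simp add: n_def)
  have lk: "l = p + r - k" by (simp add: l_def k_def)
  show thesis
  proof (rule that[of "u / n" "(p - k) / n" k l])
    have "(u / n)\<^sup>2 + ((p - k) / n)\<^sup>2 = (u\<^sup>2 + (p - k)\<^sup>2) / (n * n)"
      by (simp add: power_divide add_divide_distrib power2_eq_square)
    also have "\<dots> = 1" unfolding n2[symmetric] using n by simp
    finally show "(u / n)\<^sup>2 + ((p - k) / n)\<^sup>2 = 1" .
    have "p * u - u * (p - k) = k * u" "r * (p - k) - u * u = k * (p - k)"
      "p * (p - k) + u * u = l * (p - k)" "r * u + u * (p - k) = l * u"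
      using pk by (simp_all add: lk algebra_simps)
    then show "p * (u / n) - u * ((p - k) / n) = k * (u / n)" "r * ((p - k) / n) - u * (u / n) = k * ((p - k) / n)"
      "p * ((p - k) / n) + u * (u / n) = l * ((p - k) / n)" "r * (u / n) + u * ((p - k) / n) = l * (u / n)"
      by (simp_all add: diff_divide_distrib[symmetric] add_divide_distrib[symmetric])
    show "k \<le> l" using d(2) by (simp add: k_def l_def)
    show "k + l = p + r" by (simp add: lk)
  qed
qed

context shrinker_frame
begin

lemma eigen_basis_exists:
  assumes q: "q \<in> U"
  obtains v w k l where "hp v v = 1" "hp w w = 1" "hp v w = 0" "k \<le> l" "k + l = b / 2"
    "eigen_at q v k" "eigen_at q w l"
proof -
  obtain C s k l where d: "C\<^sup>2 + s\<^sup>2 = 1" "p q * C - u q * s = k * C" "r q * s - u q * C = k * s"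
    "p q * s + u q * C = l * s" "r q * C + u q * s = l * C" "k \<le> l" "k + l = p q + r q"
    using diagonalize_sym2 .
  define m where "m = 1 / sqrt (\<mu> q)"
  have m: "m * m * \<mu> q = 1" using \<mu>[OF q] by (simp add: m_def)
  define mul where "mul c v = (c * fst v, c * snd v)" for c :: complex and v :: C2
  have hm: "hp (mul c x) y = cnj c * hp x y" "hp x (mul c y) = c * hp x y" for c x y
    by (simp_all add: hp_def mul_def algebra_simps)
  have lin: "hp (x + x') y = hp x y + hp x' y" "hp y (x + x') = hp y x + hp y x'" for x x' y
    by (simp_all add: hp_simps)
  \<comment> \<open>The eigenvector from \<open>diagonalize_sym2\<close>, normalized by
    \<open>m\<close>. The factor \<open>cis (- k * z q)\<close> is conjugated by \<open>hp v\<close>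
    and so provides the phase that \<open>eigen_at\<close> prescribes.\<close>
  define v where "v = mul (cis (- k * z q) * of_real m) (mul (\<i> * of_real C) (FX q) + mul (of_real s) (FY q))"
  define w where "w = mul (cis (- l * z q) * of_real m) (mul (- \<i> * of_real s) (FX q) + mul (of_real C) (FY q))"
  note hh = XX[OF q] YY[OF q] XY[OF q] YX[OF q]
  have cc: "cnj (cis t) * cis t = 1" "cis t * cnj (cis t) = 1" for t
    using complex_norm_square[of "cis t"] by (simp_all add: mult.commute)
  have unit: "hp (mul (cis t * of_real m) x) (mul (cis t * of_real m) y) = of_real (m * m) * hp x y" for t x y
  proof -
    have "hp (mul (cis t * of_real m) x) (mul (cis t * of_real m) y) = (cnj (cis t) * cis t) * (of_real (m * m) * hp x y)"
      by (simp add: hm algebra_simps)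
    then show ?thesis unfolding cc by simp
  qed
  have Cs: "complex_of_real C * of_real C + of_real s * of_real s = 1"
    using d(1) by (metis of_real_1 of_real_add of_real_mult power2_eq_square)
  have mm: "complex_of_real (m * m) * of_real (\<mu> q) = 1"
    using m by (metis of_real_1 of_real_mult)
  have vv: "hp v v = 1"
  proof -
    have "hp v v = (of_real (m * m) * of_real (\<mu> q)) * (of_real C * of_real C + of_real s * of_real s)"
      unfolding v_def unit by (simp add: lin hm hh algebra_simps)
    then show ?thesis unfolding Cs mm by simp
  qed
  have ww: "hp w w = 1"
  proof -
    have "hp w w = (of_real (m * m) * of_real (\<mu> q)) * (of_real C * of_real C + of_real s * of_real s)"
      unfolding w_def unit by (simp add: lin hm hh algebra_simps)
    then show ?thesis unfolding Cs mm by simp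
  qed
  have vw: "hp v w = 0"
    unfolding v_def w_def by (simp add: lin hm hh algebra_simps)
  have vX: "hp v (FX q) = cnj (cis (- k * z q)) * (- \<i> * of_real (m * C * \<mu> q))"
    and vY: "hp v (FY q) = cnj (cis (- k * z q)) * of_real (m * s * \<mu> q)"
    and wX: "hp w (FX q) = cnj (cis (- l * z q)) * (\<i> * of_real (m * s * \<mu> q))"
    and wY: "hp w (FY q) = cnj (cis (- l * z q)) * of_real (m * C * \<mu> q)"
    unfolding v_def w_def by (simp_all add: lin hm hh algebra_simps)
  have "eigen_at q v k"
  proof -
    have 1: "(p q - k) * C - u q * s = 0" "(r q - k) * s - u q * C = 0" using d by (simp_all add: algebra_simps)
    have "of_real (p q - k) * hp v (FX q) + \<i> * of_real (u q) * hp v (FY q)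
        = cnj (cis (- k * z q)) * (- \<i> * of_real (m * \<mu> q * ((p q - k) * C - u q * s)))"
      unfolding vX vY by (simp add: algebra_simps)
    moreover have "of_real (r q - k) * hp v (FY q) - \<i> * of_real (u q) * hp v (FX q)
        = cnj (cis (- k * z q)) * of_real (m * \<mu> q * ((r q - k) * s - u q * C))"
      unfolding vX vY by (simp add: algebra_simps)
    moreover have "hp v (FX q) * cis (- k * z q) = - \<i> * of_real (m * C * \<mu> q)"
      unfolding vX using cc(1)[of "- k * z q"] by (metis (no_types, lifting) mult.assoc mult.commute mult_1)
    moreover have "hp v (FY q) * cis (- k * z q) = of_real (m * s * \<mu> q)"
      unfolding vY using cc(1)[of "- k * z q"] by (metis (no_types, lifting) mult.assoc mult.commute mult_1)
    ultimately show ?thesis unfolding eigen_at_def 1 by simp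
  qed
  moreover have "eigen_at q w l"
  proof -
    have 1: "(p q - l) * s + u q * C = 0" "(r q - l) * C + u q * s = 0" using d by (simp_all add: algebra_simps)
    have "of_real (p q - l) * hp w (FX q) + \<i> * of_real (u q) * hp w (FY q)
        = cnj (cis (- l * z q)) * (\<i> * of_real (m * \<mu> q * ((p q - l) * s + u q * C)))"
      unfolding wX wY by (simp add: algebra_simps)
    moreover have "of_real (r q - l) * hp w (FY q) - \<i> * of_real (u q) * hp w (FX q)
        = cnj (cis (- l * z q)) * of_real (m * \<mu> q * ((r q - l) * C + u q * s))"
      unfolding wX wY by (simp add: algebra_simps)
    moreover have "hp w (FX q) * cis (- l * z q) = \<i> * of_real (m * s * \<mu> q)"
      unfolding wX using cc(1)[of "- l * z q"] by (metis (no_types, lifting) mult.assoc mult.commute mult_1)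
    moreover have "hp w (FY q) * cis (- l * z q) = of_real (m * C * \<mu> q)"
      unfolding wY using cc(1)[of "- l * z q"] by (metis (no_types, lifting) mult.assoc mult.commute mult_1)
    ultimately show ?thesis unfolding eigen_at_def 1 by simp
  qed
  moreover have "k + l = b / 2" using d(7) by (simp add: p_def)
  ultimately show thesis using that vv ww vw d(6) by blast
qed

text \<open>A first-order contact with the model surface determines \<open>S\<close>: \<open>S\<close> is Hermitian, maps \<^term>\<open>f\<close>
  to \<open>- \<i> FX\<close> and has trace \<open>b/2\<close>.\<close>

lemma eigen_at_of_contact:
  assumes q: "q \<in> U" and on: "hp v v = 1" "hp w w = 1" "hp v w = 0" and kl: "k + l = b / 2"
    and real: "Im (hp v (f q) * cis (- k * z q)) = 0" "Im (hp w (f q) * cis (- l * z q)) = 0"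
    and realX: "Im ((hp v (FX q) - \<i> * of_real k * hp v (f q)) * cis (- k * z q)) = 0"
      "Im ((hp w (FX q) - \<i> * of_real l * hp w (f q)) * cis (- l * z q)) = 0"
    and realY: "Im (hp v (FY q) * cis (- k * z q)) = 0" "Im (hp w (FY q) * cis (- l * z q)) = 0"
    and conic: "k * (Re (hp v (f q) * cis (- k * z q)))\<^sup>2 + l * (Re (hp w (f q) * cis (- l * z q)))\<^sup>2 = -2"
    and conicX: "k * Re (hp v (f q) * cis (- k * z q)) * Re ((hp v (FX q) - \<i> * of_real k * hp v (f q)) * cis (- k * z q)) +
      l * Re (hp w (f q) * cis (- l * z q)) * Re ((hp w (FX q) - \<i> * of_real l * hp w (f q)) * cis (- l * z q)) = 0"
    and conicY: "k * Re (hp v (f q) * cis (- k * z q)) * Re (hp v (FY q) * cis (- k * z q)) +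
      l * Re (hp w (f q) * cis (- l * z q)) * Re (hp w (FY q) * cis (- l * z q)) = 0"
  shows "eigen_at q v k" "eigen_at q w l"
proof -
  \<comment> \<open>In the basis \<open>v\<close>, \<open>w\<close>, with phases removed,
    \<open>f\<close> is the real vector h, \<open>FY\<close> the real vector c, and
    \<open>FX\<close> is a + \<i> m, where m = (k h1, l h2) is half the gradient of the
    conic.\<close>
  define h1 where "h1 = Re (hp v (f q) * cis (- k * z q))"
  define h2 where "h2 = Re (hp w (f q) * cis (- l * z q))"
  define a1 where "a1 = Re ((hp v (FX q) - \<i> * of_real k * hp v (f q)) * cis (- k * z q))"
  define a2 where "a2 = Re ((hp w (FX q) - \<i> * of_real l * hp w (f q)) * cis (- l * z q))"
  define c1 where "c1 = Re (hp v (FY q) * cis (- k * z q))"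
  define c2 where "c2 = Re (hp w (FY q) * cis (- l * z q))"
  have inv: "x = of_real y * cis (j * z q)" if "Im (x * cis (- j * z q)) = 0" "y = Re (x * cis (- j * z q))" for x y j
  proof -
    have "x * cis (- j * z q) = of_real y" using that by (simp add: complex_eq_iff)
    then have "x * cis (- j * z q) * cis (j * z q) = of_real y * cis (j * z q)" by simp
    then show ?thesis by (simp add: mult.assoc cis_mult)
  qed
  have h: "hp v (f q) = of_real h1 * cis (k * z q)" "hp w (f q) = of_real h2 * cis (l * z q)"
    using inv[OF real(1) h1_def] inv[OF real(2) h2_def] by blast+
  have "hp v (FX q) - \<i> * of_real k * hp v (f q) = of_real a1 * cis (k * z q)"
    "hp w (FX q) - \<i> * of_real l * hp w (f q) = of_real a2 * cis (l * z q)"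
    using inv[OF realX(1) a1_def] inv[OF realX(2) a2_def] by blast+
  then have a: "hp v (FX q) = (of_real a1 + \<i> * of_real (k * h1)) * cis (k * z q)"
    "hp w (FX q) = (of_real a2 + \<i> * of_real (l * h2)) * cis (l * z q)"
    unfolding h by (simp_all add: algebra_simps)
  have c: "hp v (FY q) = of_real c1 * cis (k * z q)" "hp w (FY q) = of_real c2 * cis (l * z q)"
    using inv[OF realY(1) c1_def] inv[OF realY(2) c2_def] by blast+
  have con: "k * h1\<^sup>2 + l * h2\<^sup>2 = -2" "k * h1 * a1 + l * h2 * a2 = 0" "k * h1 * c1 + l * h2 * c2 = 0"
    using conic conicX conicY by (simp_all add: h1_def h2_def a1_def a2_def c1_def c2_def)
  define m1 where "m1 = k * h1"
  define m2 where "m2 = l * h2"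
  have cc: "cnj (cis t) * cis t = 1" "cis t * cnj (cis t) = 1" for t
    using complex_norm_square[of "cis t"] by (simp_all add: mult.commute)
  have fe: "hp x y = hp x v * hp v y + hp x w * hp w y" for x y
    using frame_expand(1)[of v 1 w x y] on by simp
  have pair: "hp x y = cnj x1 * y1 + cnj x2 * y2"
    if "hp v x = x1 * cis (k * z q)" "hp w x = x2 * cis (l * z q)" "hp v y = y1 * cis (k * z q)" "hp w y = y2 * cis (l * z q)"
    for x y x1 x2 y1 y2
  proof -
    have "hp x y = cnj x1 * y1 * (cnj (cis (k * z q)) * cis (k * z q)) + cnj x2 * y2 * (cnj (cis (l * z q)) * cis (l * z q))"
      unfolding fe[of x y] hp_cnj[of x v] hp_cnj[of x w] that by (simp add: algebra_simps)
    then show ?thesis unfolding cc by simp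
  qed
  have "hp (FX q) (FY q) = cnj (of_real a1 + \<i> * of_real (k * h1)) * of_real c1 + cnj (of_real a2 + \<i> * of_real (l * h2)) * of_real c2"
    by (rule pair[OF a c])
  from arg_cong[OF this, of Re] have ac: "a1 * c1 + a2 * c2 = 0"
    by (simp add: XY[OF q])
  have "hp (FY q) (FY q) = cnj (of_real c1) * of_real c1 + cnj (of_real c2) * of_real c2"
    by (rule pair[OF c c])
  from arg_cong[OF this, of Re] have cn: "c1 * c1 + c2 * c2 = \<mu> q"
    by (simp add: YY[OF q])
  have mc: "m1 * c1 + m2 * c2 = 0" using con by (simp add: m1_def m2_def)
  have ma: "m1 * a1 + m2 * a2 = 0" using con by (simp add: m1_def m2_def)
  have hm: "h1 * m1 + h2 * m2 = -2" using con(1) by (simp add: m1_def m2_def power2_eq_square mult.left_commute)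
  \<comment> \<open>The conic equation reads h . m = -2, so the normal m cannot vanish.\<close>
  have mpos: "m1 * m1 + m2 * m2 \<noteq> 0"
  proof
    assume "m1 * m1 + m2 * m2 = 0"
    then have "m1 = 0" "m2 = 0" by (simp_all add: sum_squares_eq_zero_iff)
    then show False using hm by simp
  qed
  have "(c1 * m2 - c2 * m1)\<^sup>2 = (c1 * c1 + c2 * c2) * (m1 * m1 + m2 * m2)"
    using mc by algebra
  then have det: "c1 * m2 - c2 * m1 \<noteq> 0" using cn mu_nz[OF q] mpos by auto
  \<comment> \<open>In the real plane a and c are both orthogonal to m and to each other, and c is
    nonzero; so a = 0.\<close>
  have "a1 * (c1 * m2 - c2 * m1) = 0" "a2 * (c1 * m2 - c2 * m1) = 0" using ac ma by algebra+
  then have a0: "a1 = 0" "a2 = 0" using det by auto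
  have a': "hp v (FX q) = (\<i> * of_real m1) * cis (k * z q)" "hp w (FX q) = (\<i> * of_real m2) * cis (l * z q)"
    using a a0 by (simp_all add: m1_def m2_def)
  have "hp (FX q) (FX q) = cnj (\<i> * of_real m1) * (\<i> * of_real m1) + cnj (\<i> * of_real m2) * (\<i> * of_real m2)"
    by (rule pair[OF a' a'])
  from arg_cong[OF this, of Re] have mn: "m1 * m1 + m2 * m2 = \<mu> q"
    by (simp add: XX[OF q])
  have fY': "hp (f q) (FY q) = cnj (of_real h1) * of_real c1 + cnj (of_real h2) * of_real c2"
    by (rule pair[OF h c])
  have Bh: "B q = h1 * c1 + h2 * c2"
    using arg_cong[OF fY', of Re] by (simp add: B_def)
  text \<open>\<open>(m\<^sub>1, m\<^sub>2)\<close> and \<open>(c\<^sub>1, c\<^sub>2)\<close> are orthogonal of the same length, hence so are the columns.\<close>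
  have col: "m1 * m1 + c1 * c1 = \<mu> q" "m2 * m2 + c2 * c2 = \<mu> q" "m1 * m2 + c1 * c2 = 0"
  proof -
    define \<delta> where "\<delta> = m1 * c2 - m2 * c1"
    define \<epsilon> where "\<epsilon> = \<delta> / \<mu> q"
    have "\<mu> q * c1 = - (m2 * \<delta>) + m1 * (m1 * c1 + m2 * c2)" "\<mu> q * c2 = m1 * \<delta> + m2 * (m1 * c1 + m2 * c2)"
      unfolding mn[symmetric] \<delta>_def by (simp_all add: algebra_simps)
    then have c: "c1 = - (m2 * \<epsilon>)" "c2 = m1 * \<epsilon>"
      unfolding mc \<epsilon>_def using mu_nz[OF q] by (simp_all add: field_simps)
    have "\<delta> * \<delta> = (m1 * m1 + m2 * m2) * (c1 * c1 + c2 * c2) - (m1 * c1 + m2 * c2) * (m1 * c1 + m2 * c2)"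
      by (simp add: \<delta>_def algebra_simps)
    then have e: "\<epsilon> * \<epsilon> = 1"
      unfolding mn cn mc \<epsilon>_def using mu_nz[OF q] by simp
    have "c1 * c1 = m2 * m2 * (\<epsilon> * \<epsilon>)" "c2 * c2 = m1 * m1 * (\<epsilon> * \<epsilon>)" "c1 * c2 = - (m1 * m2 * (\<epsilon> * \<epsilon>))"
      unfolding c by (simp_all add: algebra_simps)
    then show "m1 * m1 + c1 * c1 = \<mu> q" "m2 * m2 + c2 * c2 = \<mu> q" "m1 * m2 + c1 * c2 = 0"
      unfolding e using mn by simp_all
  qed
  \<comment> \<open>The coordinates of \<mu> f = 2 \<i> \<open>FX\<close> + \<open>B\<close>
    \<open>FY\<close>, obtained from the orthogonality of the columns.\<close>
  have mh1: "\<mu> q * h1 = - 2 * m1 + B q * c1" and mh2: "\<mu> q * h2 = - 2 * m2 + B q * c2"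
  proof -
    have "B q * c1 - 2 * m1 = h1 * (m1 * m1 + c1 * c1) + h2 * (m1 * m2 + c1 * c2)"
      "B q * c2 - 2 * m2 = h1 * (m1 * m2 + c1 * c2) + h2 * (m2 * m2 + c2 * c2)"
      unfolding Bh using hm by algebra+
    then show "\<mu> q * h1 = - 2 * m1 + B q * c1" "\<mu> q * h2 = - 2 * m2 + B q * c2"
      unfolding col by simp_all
  qed
  \<comment> \<open>The entries of diag(k, l) relative to the frame (m, c). They satisfy the trace
    equation and the two components of S f = - \<i> \<open>FX\<close>, hence equal \<mu> times
    \<open>p\<close>, \<open>u\<close>, \<open>r\<close> by the same elimination that produced
    \<open>r\<close>.\<close>
  define K11 where "K11 = k * m1 * m1 + l * m2 * m2"
  define K12 where "K12 = k * m1 * c1 + l * m2 * c2"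
  define K22 where "K22 = k * c1 * c1 + l * c2 * c2"
  have t: "K11 + K22 = \<mu> q * b / 2"
  proof -
    have "K11 + K22 = k * (m1 * m1 + c1 * c1) + l * (m2 * m2 + c2 * c2)" by (simp add: K11_def K22_def algebra_simps)
    then have "K11 + K22 = (k + l) * \<mu> q" unfolding col by (simp add: algebra_simps)
    then show ?thesis unfolding kl by simp
  qed
  have s1: "- 2 * K11 + B q * K12 = \<mu> q * \<mu> q"
  proof -
    have "- 2 * K11 + B q * K12 = k * m1 * (- 2 * m1 + B q * c1) + l * m2 * (- 2 * m2 + B q * c2)"
      by (simp add: K11_def K12_def algebra_simps)
    also have "\<dots> = \<mu> q * (k * h1 * m1 + l * h2 * m2)" unfolding mh1[symmetric] mh2[symmetric] by (simp add: algebra_simps)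
    also have "\<dots> = \<mu> q * (m1 * m1 + m2 * m2)" by (simp only: m1_def[symmetric] m2_def[symmetric])
    finally show ?thesis using mn by simp
  qed
  have s2: "- 2 * K12 + B q * K22 = 0"
  proof -
    have "- 2 * K12 + B q * K22 = k * c1 * (- 2 * m1 + B q * c1) + l * c2 * (- 2 * m2 + B q * c2)"
      by (simp add: K12_def K22_def algebra_simps)
    also have "\<dots> = \<mu> q * (k * h1 * c1 + l * h2 * c2)" unfolding mh1[symmetric] mh2[symmetric] by (simp add: algebra_simps)
    also have "\<dots> = \<mu> q * (m1 * c1 + m2 * c2)" by (simp only: m1_def[symmetric] m2_def[symmetric])
    finally show ?thesis using mc by simp
  qed
  have "K22 * (4 + (B q)\<^sup>2) = 2 * \<mu> q * (\<mu> q + b)" using t s1 s2 by algebra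
  then have K22: "K22 = \<mu> q * r q" using B_pos[of q] by (simp add: r_def field_simps)
  then have K12: "K12 = \<mu> q * u q" using s2 by (simp add: u_def mult.left_commute)
  have K11: "K11 = \<mu> q * p q" using t K22 by (simp add: p_def right_diff_distrib)
  have "\<mu> q * ((p q - k) * m1 + u q * c1) = 0" "\<mu> q * ((r q - k) * c1 + u q * m1) = 0"
    "\<mu> q * ((p q - l) * m2 + u q * c2) = 0" "\<mu> q * ((r q - l) * c2 + u q * m2) = 0"
  proof -
    have "\<mu> q * ((p q - k) * m1 + u q * c1) = K11 * m1 + K12 * c1 - \<mu> q * k * m1"
      "\<mu> q * ((r q - k) * c1 + u q * m1) = K22 * c1 + K12 * m1 - \<mu> q * k * c1"
      "\<mu> q * ((p q - l) * m2 + u q * c2) = K11 * m2 + K12 * c2 - \<mu> q * l * m2"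
      "\<mu> q * ((r q - l) * c2 + u q * m2) = K22 * c2 + K12 * m2 - \<mu> q * l * c2"
      unfolding K11 K12 K22 by (simp_all add: algebra_simps)
    moreover have "K11 * m1 + K12 * c1 = k * m1 * (m1 * m1 + c1 * c1) + l * m2 * (m1 * m2 + c1 * c2)"
      "K22 * c1 + K12 * m1 = k * c1 * (m1 * m1 + c1 * c1) + l * c2 * (m1 * m2 + c1 * c2)"
      "K11 * m2 + K12 * c2 = k * m1 * (m1 * m2 + c1 * c2) + l * m2 * (m2 * m2 + c2 * c2)"
      "K22 * c2 + K12 * m2 = k * c1 * (m1 * m2 + c1 * c2) + l * c2 * (m2 * m2 + c2 * c2)"
      by (simp_all add: K11_def K12_def K22_def algebra_simps)
    ultimately show "\<mu> q * ((p q - k) * m1 + u q * c1) = 0" "\<mu> q * ((r q - k) * c1 + u q * m1) = 0"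
      "\<mu> q * ((p q - l) * m2 + u q * c2) = 0" "\<mu> q * ((r q - l) * c2 + u q * m2) = 0"
      unfolding col by simp_all
  qed
  then have E: "(p q - k) * m1 + u q * c1 = 0" "(r q - k) * c1 + u q * m1 = 0"
    "(p q - l) * m2 + u q * c2 = 0" "(r q - l) * c2 + u q * m2 = 0"
    using mu_nz[OF q] by simp_all
  have fin: "eigen_at q x j" if "hp x (FX q) = (\<i> * of_real m) * cis (j * z q)" "hp x (FY q) = of_real c * cis (j * z q)"
    "(p q - j) * m + u q * c = 0" "(r q - j) * c + u q * m = 0" for x j m c
  proof -
    have 1: "of_real (p q - j) * hp x (FX q) + \<i> * of_real (u q) * hp x (FY q) = \<i> * of_real ((p q - j) * m + u q * c) * cis (j * z q)"
      unfolding that(1,2) by (simp add: algebra_simps)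
    have 2: "of_real (r q - j) * hp x (FY q) - \<i> * of_real (u q) * hp x (FX q) = of_real ((r q - j) * c + u q * m) * cis (j * z q)"
      unfolding that(1,2) by (simp add: algebra_simps)
    have 3: "hp x (FX q) * cis (- j * z q) = \<i> * of_real m" "hp x (FY q) * cis (- j * z q) = of_real c"
      unfolding that(1,2) by (simp_all add: mult.assoc cis_mult)
    show ?thesis unfolding eigen_at_def 1 2 3 that(3,4) by simp
  qed
  show "eigen_at q v k" by (rule fin[OF a'(1) c(1) E(1,2)])
  show "eigen_at q w l" by (rule fin[OF a'(2) c(2) E(3,4)])
qed

end

subsection \<open>Self-shrinkers in a chart\<close>

context legendrian_chart
begin

definition sG where "sG q = sqrt (dG q)"
definition Qf where "Qf q = (G e2 e2 q * dz e1 q - G e1 e2 q * dz e2 q) / sG q"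
definition Pf where "Pf q = (G e1 e2 q * dz e1 q - G e1 e1 q * dz e2 q) / sG q"
text \<open>The coefficient of the area form obtained by wedging dz with its Hodge dual; it vanishes
  exactly where dz does.\<close>

definition Dd where "Dd q = dz e1 q * Qf q - dz e2 q * Pf q"

lemma diff_dz: "q \<in> U \<Longrightarrow> dz e differentiable (at q)"
  using d_dz differentiableI by blast

lemma diff_G: assumes q: "q \<in> U" shows "G e e' differentiable (at q)"
proof -
  have "((\<lambda>x. Re (hp (dc e x) (dc e' x))) has_derivative
     (\<lambda>y. Re (hp (dc e q) (ddc y e' q) + hp (ddc y e q) (dc e' q)))) (at q)"
    by (intro bounded_linear.has_derivative[OF bounded_linear_Re] bounded_bilinear.FDERIV[OF bounded_bilinear_hp] d_dc q)
  then show ?thesis unfolding G_def[abs_def] by (rule differentiableI)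
qed

lemma sG: assumes q: "q \<in> U" shows "sG q > 0" "sG q * sG q = dG q"
  using dG_pos[OF q] by (simp_all add: sG_def)

lemma diff_sG: assumes q: "q \<in> U" shows "sG differentiable (at q)"
proof -
  have "dG differentiable (at q)"
    unfolding dG_def[abs_def] power2_eq_square by (intro differentiable_diff differentiable_mult diff_G q)
  then obtain d where d: "(dG has_derivative d) (at q)" unfolding differentiable_def by blast
  have "(sqrt has_derivative (*) (inverse (sqrt (dG q)) / 2)) (at (dG q))"
    using DERIV_real_sqrt[OF dG_pos[OF q]] unfolding has_field_derivative_def .
  from diff_chain_at[OF d this] have "(\<lambda>x. sqrt (dG x)) differentiable (at q)"
    unfolding o_def by (rule differentiableI)
  then show ?thesis unfolding sG_def[abs_def] .
qed

lemma diff_QP: assumes q: "q \<in> U" shows "Qf differentiable (at q)" "Pf differentiable (at q)"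
  unfolding Qf_def[abs_def] Pf_def[abs_def] using sG(1)[OF q]
  by (intro differentiable_divide differentiable_diff differentiable_mult diff_G diff_dz diff_sG q; simp)+

text \<open>In dimension two the flux components do not change when the metric is multiplied by a
  constant, since the area density scales alike. One computation thus serves gT with
  \<open>s = 1/4\<close> and the Euclidean metric with \<open>s = 1\<close>.\<close>

lemma laplacian_scaled:
  assumes q: "q \<in> U" and h: "\<And>x e e'. x \<in> U \<Longrightarrow> h x e e' = G e e' x * s" and s: "s > 0"
    and u: "\<And>x e. x \<in> U \<Longrightarrow> Df u x e = c * dz e x"
  shows "laplacian h u q = c * (Df Qf q e1 - Df Pf q e2) / (sG q * s)"
proof -
  have ar: "area h x = sG x * s" if x: "x \<in> U" for x
  proof -
    have "h x e1 e1 * h x e2 e2 - (h x e1 e2)\<^sup>2 = dG x * (s * s)"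
      unfolding h[OF x] dG_def by (simp add: power2_eq_square algebra_simps)
    then show ?thesis using s by (simp add: area_def sG_def real_sqrt_mult)
  qed
  have 1: "(h x e2 e2 * Df u x e1 - h x e1 e2 * Df u x e2) / area h x = c * Qf x"
    and 2: "(h x e1 e1 * Df u x e2 - h x e1 e2 * Df u x e1) / area h x = (- c) * Pf x" if x: "x \<in> U" for x
  proof -
    have "h x e2 e2 * Df u x e1 - h x e1 e2 * Df u x e2 = c * (G e2 e2 x * dz e1 x - G e1 e2 x * dz e2 x) * s"
      "h x e1 e1 * Df u x e2 - h x e1 e2 * Df u x e1 = (- c) * (G e1 e2 x * dz e1 x - G e1 e1 x * dz e2 x) * s"
      unfolding h[OF x] u[OF x] by (simp_all add: algebra_simps)
    then show "(h x e2 e2 * Df u x e1 - h x e1 e2 * Df u x e2) / area h x = c * Qf x"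
      "(h x e1 e1 * Df u x e2 - h x e1 e2 * Df u x e1) / area h x = (- c) * Pf x"
      unfolding ar[OF x] Qf_def Pf_def using s by (simp_all add: times_divide_eq_right)
  qed
  have lin: "Df (\<lambda>x. c * h x) q e = c * Df h q e" if "h differentiable (at q)" for c :: real and h e
    using Df_bounded_linear[OF bounded_linear_mult_right that, of c] by simp
  have "laplacian h u q = (Df (\<lambda>x. c * Qf x) q e1 + Df (\<lambda>x. (- c) * Pf x) q e2) / area h q"
    unfolding laplacian_def using Df_cong_open[OF open_U q 1] Df_cong_open[OF open_U q 2] by simp
  also have "\<dots> = (c * Df Qf q e1 + (- c) * Df Pf q e2) / (sG q * s)"
    unfolding lin[OF diff_QP(1)[OF q]] lin[OF diff_QP(2)[OF q]] ar[OF q] ..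
  finally show ?thesis by (simp add: algebra_simps)
qed

lemma laplacian_gT:
  assumes q: "q \<in> U"
  shows "laplacian (inducedT f) (\<lambda>x. c * fz x) q = 4 * c * (Df Qf q e1 - Df Pf q e2) / sG q"
proof -
  have "Df (\<lambda>x. c * fz x) x e = c * dz e x" if x: "x \<in> U" for x e
  proof -
    have "((\<lambda>x. c * fz x) has_derivative (\<lambda>e. c * dz e x)) (at x)"
      by (rule bounded_linear.has_derivative[OF bounded_linear_mult_right d_fz[OF x]])
    then show ?thesis by (simp add: Df_eqI)
  qed
  from laplacian_scaled[OF q, of "inducedT f" "1/4" "\<lambda>x. c * fz x" c, OF _ _ this]
  show ?thesis by (simp add: inducedT_eq)
qed

lemma G_quadratic: assumes q: "q \<in> U" shows "G e e q = (fst e)\<^sup>2 * G e1 e1 q + 2 * fst e * snd e * G e1 e2 q + (snd e)\<^sup>2 * G e2 e2 q"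
  and G_bilinear: "G e e' q = fst e * fst e' * G e1 e1 q + (fst e * snd e' + snd e * fst e') * G e1 e2 q + snd e * snd e' * G e2 e2 q"
proof -
  show "G e e' q = fst e * fst e' * G e1 e1 q + (fst e * snd e' + snd e * fst e') * G e1 e2 q + snd e * snd e' * G e2 e2 q" for e e'
    unfolding G_def dc_R2[OF q, of e] dc_R2[OF q, of e'] hp_simps using hp_Re_swap[of "dc e2 q" "dc e1 q"]
    by (simp add: algebra_simps)
  from this[of e e] show "G e e q = (fst e)\<^sup>2 * G e1 e1 q + 2 * fst e * snd e * G e1 e2 q + (snd e)\<^sup>2 * G e2 e2 q"
    by (simp add: power2_eq_square algebra_simps)
qed

end

section \<open>The commuting frame supplied by a harmonic height\<close>

text \<open>The hypotheses after elimination of \<alpha>: the angle and the harmonic function are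
  both expressed by the height.\<close>

locale shrinker_chart = legendrian_chart +
  fixes b \<theta> :: real
  assumes b: "b < 0"
    and angle: "\<And>q. q \<in> U \<Longrightarrow> Im (cdet (dc e1 q) (dc e2 q) * cis (- (b / 2) * fz q + \<theta>)) = 0"
    and harmonic: "\<And>q. q \<in> U \<Longrightarrow> laplacian (inducedT f) (\<lambda>x. - (b / 2) * fz x) q = 0"
begin

text \<open>The one-form with components \<open>(Pf, Qf)\<close> is the Hodge dual of the differential of the last
  coordinate; harmonicity says that it is closed.\<close>

lemma closed_dual: assumes q: "q \<in> U" shows "Df Qf q e1 = Df Pf q e2"
  using harmonic[OF q] b sG(1)[OF q] unfolding laplacian_gT[OF q] by simp

definition regular where "regular q \<longleftrightarrow> (dz e1 q, dz e2 q) \<noteq> 0"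

lemma Dd_eq: assumes q: "q \<in> U" shows "Dd q = G (- dz e2 q, dz e1 q) (- dz e2 q, dz e1 q) q / sG q"
proof -
  have "Dd q = (dz e1 q * (G e2 e2 q * dz e1 q - G e1 e2 q * dz e2 q) - dz e2 q * (G e1 e2 q * dz e1 q - G e1 e1 q * dz e2 q)) / sG q"
    by (simp only: Dd_def Qf_def Pf_def times_divide_eq_right diff_divide_distrib[symmetric])
  also have "dz e1 q * (G e2 e2 q * dz e1 q - G e1 e2 q * dz e2 q) - dz e2 q * (G e1 e2 q * dz e1 q - G e1 e1 q * dz e2 q)
      = G (- dz e2 q, dz e1 q) (- dz e2 q, dz e1 q) q"
    unfolding G_quadratic[OF q, of "(- dz e2 q, dz e1 q)"] by (simp add: algebra_simps power2_eq_square)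
  finally show ?thesis .
qed

lemma Dd_pos: "q \<in> U \<Longrightarrow> regular q \<Longrightarrow> Dd q > 0"
  unfolding Dd_eq using sG(1)[of q] G_pos[of q "(- dz e2 q, dz e1 q)"] by (auto simp: regular_def zero_prod_def)

text \<open>\<open>Tf\<close> and \<open>Nf\<close> form the frame dual to the coframe consisting of
  dz and its Hodge dual.\<close>

definition Tf where "Tf q = (Qf q / Dd q, - Pf q / Dd q)"
definition Nf where "Nf q = (- dz e2 q / Dd q, dz e1 q / Dd q)"

lemma TN_dual: assumes q: "q \<in> U" "regular q"
  shows "dz (Tf q) q = 1" "dz (Nf q) q = 0" "fst (Tf q) * Pf q + snd (Tf q) * Qf q = 0" "fst (Nf q) * Pf q + snd (Nf q) * Qf q = 1"
proof -
  have D: "Dd q \<noteq> 0" using Dd_pos[OF q] by simp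
  have "Qf q / Dd q * dz e1 q + - Pf q / Dd q * dz e2 q = Dd q / Dd q"
    "- dz e2 q / Dd q * dz e1 q + dz e1 q / Dd q * dz e2 q = 0"
    "Qf q / Dd q * Pf q + - Pf q / Dd q * Qf q = 0"
    "- dz e2 q / Dd q * Pf q + dz e1 q / Dd q * Qf q = Dd q / Dd q"
    unfolding times_divide_eq_left add_divide_distrib[symmetric] by (simp_all add: Dd_def mult.commute)
  then show "dz (Tf q) q = 1" "dz (Nf q) q = 0" "fst (Tf q) * Pf q + snd (Tf q) * Qf q = 0" "fst (Nf q) * Pf q + snd (Nf q) * Qf q = 1"
    unfolding dz_R2[OF q(1), of "Tf q"] dz_R2[OF q(1), of "Nf q"] using D by (simp_all add: Tf_def Nf_def)
qed

lemma G_TN: assumes q: "q \<in> U" "regular q"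
  shows "G (Tf q) (Tf q) q = sG q / Dd q" "G (Nf q) (Nf q) q = sG q / Dd q" "G (Tf q) (Nf q) q = 0"
proof -
  let ?D = "Dd q" and ?s = "sG q"
  have D: "?D > 0" and s: "?s > 0" "?s * ?s = dG q" using Dd_pos[OF q] sG[OF q(1)] by auto
  have Q: "?s * Qf q = G e2 e2 q * dz e1 q - G e1 e2 q * dz e2 q" and P: "?s * Pf q = G e1 e2 q * dz e1 q - G e1 e1 q * dz e2 q"
    using s by (simp_all add: Qf_def Pf_def)
  have d: "dG q = G e1 e1 q * G e2 e2 q - G e1 e2 q * G e1 e2 q" by (simp add: dG_def power2_eq_square)
  \<comment> \<open>The metric lowers the vector field \<open>(Qf, - Pf)\<close> to
    \<open>sG\<close> times dz; with this all three products collapse to \<open>Dd\<close>.\<close>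
  have QP1: "Qf q * G e1 e1 q - Pf q * G e1 e2 q = ?s * dz e1 q"
  proof -
    have "?s * (Qf q * G e1 e1 q - Pf q * G e1 e2 q) = (?s * Qf q) * G e1 e1 q - (?s * Pf q) * G e1 e2 q" by (simp add: algebra_simps)
    also have "\<dots> = dG q * dz e1 q" unfolding Q P d by (simp add: algebra_simps)
    also have "\<dots> = ?s * (?s * dz e1 q)" unfolding s(2)[symmetric] by simp
    finally show ?thesis using s by simp
  qed
  have QP2: "Qf q * G e1 e2 q - Pf q * G e2 e2 q = ?s * dz e2 q"
  proof -
    have "?s * (Qf q * G e1 e2 q - Pf q * G e2 e2 q) = (?s * Qf q) * G e1 e2 q - (?s * Pf q) * G e2 e2 q" by (simp add: algebra_simps)
    also have "\<dots> = dG q * dz e2 q" unfolding Q P d by (simp add: algebra_simps)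
    also have "\<dots> = ?s * (?s * dz e2 q)" unfolding s(2)[symmetric] by simp
    finally show ?thesis using s by simp
  qed
  have "G (Tf q) (Tf q) q = (Qf q * (Qf q * G e1 e1 q - Pf q * G e1 e2 q) - Pf q * (Qf q * G e1 e2 q - Pf q * G e2 e2 q)) / (?D * ?D)"
    unfolding G_bilinear[OF q(1), of "Tf q" "Tf q"] unfolding Tf_def fst_conv snd_conv times_divide_eq_left times_divide_eq_right
      add_divide_distrib[symmetric] divide_divide_eq_left by (simp add: algebra_simps)
  also have "\<dots> = ?s * ?D / (?D * ?D)" unfolding QP1 QP2 Dd_def by (simp add: algebra_simps)
  finally show "G (Tf q) (Tf q) q = ?s / ?D" using D by simp
  have "G (Tf q) (Nf q) q = (- dz e2 q * (Qf q * G e1 e1 q - Pf q * G e1 e2 q) + dz e1 q * (Qf q * G e1 e2 q - Pf q * G e2 e2 q)) / (?D * ?D)"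
    unfolding G_bilinear[OF q(1), of "Tf q" "Nf q"] unfolding Tf_def Nf_def fst_conv snd_conv times_divide_eq_left times_divide_eq_right
      add_divide_distrib[symmetric] divide_divide_eq_left by (simp add: algebra_simps)
  then show "G (Tf q) (Nf q) q = 0" unfolding QP1 QP2 by simp
  have "G (Nf q) (Nf q) q = G (- dz e2 q, dz e1 q) (- dz e2 q, dz e1 q) q / (?D * ?D)"
    unfolding G_bilinear[OF q(1), of "Nf q" "Nf q"] G_bilinear[OF q(1), of "(- dz e2 q, dz e1 q)" "(- dz e2 q, dz e1 q)"] unfolding Nf_def fst_conv snd_conv times_divide_eq_left times_divide_eq_right
      add_divide_distrib[symmetric] divide_divide_eq_left by (simp add: algebra_simps)
  also have "\<dots> = ?D * ?s / (?D * ?D)" using Dd_eq[OF q(1)] s by simp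
  finally show "G (Nf q) (Nf q) q = ?s / ?D" using D by simp
qed

lemma frame:
  assumes V: "open V" "V \<subseteq> U" "\<And>q. q \<in> V \<Longrightarrow> regular q"
  obtains FXX FXY FYY where "shrinker_frame V Tf Nf fc (\<lambda>q. dc (Tf q) q) (\<lambda>q. dc (Nf q) q) FXX FXY FYY fz (\<lambda>q. sG q / Dd q) b \<theta>"
proof -
  have diffD: "Dd differentiable (at q)" if "q \<in> V" for q
    unfolding Dd_def[abs_def] using that V by (intro differentiable_diff differentiable_mult diff_dz diff_QP) auto
  define T1 where "T1 q = fst (Tf q)" for q
  define T2 where "T2 q = snd (Tf q)" for q
  define N1 where "N1 q = fst (Nf q)" for q
  define N2 where "N2 q = snd (Nf q)" for q
  note TN_defs = T1_def T2_def N1_def N2_def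
  have diff: "T1 differentiable (at q)" "T2 differentiable (at q)" "N1 differentiable (at q)" "N2 differentiable (at q)" if "q \<in> V" for q
  proof -
    have "q \<in> U" "Dd q \<noteq> 0" using that V(2,3) Dd_pos[of q] by auto
    then show "T1 differentiable (at q)" "T2 differentiable (at q)" "N1 differentiable (at q)" "N2 differentiable (at q)"
      unfolding TN_defs[abs_def] Tf_def Nf_def fst_conv snd_conv using diffD[OF that]
      by (auto intro!: differentiable_divide differentiable_minus diff_dz diff_QP)
  qed
  note dT1 = Df_has_derivative[OF diff(1)] and dT2 = Df_has_derivative[OF diff(2)]
    and dN1 = Df_has_derivative[OF diff(3)] and dN2 = Df_has_derivative[OF diff(4)]
  have qU: "q \<in> U" if "q \<in> V" for q using V that by blast
  have dX: "((\<lambda>q. dc (Tf q) q) has_derivative (\<lambda>e. (T1 q *\<^sub>R ddc e e1 q + Df T1 q e *\<^sub>R dc e1 q) + (T2 q *\<^sub>R ddc e e2 q + Df T2 q e *\<^sub>R dc e2 q))) (at q)"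
    if q: "q \<in> V" for q
  proof -
    have "((\<lambda>q. T1 q *\<^sub>R dc e1 q + T2 q *\<^sub>R dc e2 q) has_derivative (\<lambda>e. (T1 q *\<^sub>R ddc e e1 q + Df T1 q e *\<^sub>R dc e1 q) + (T2 q *\<^sub>R ddc e e2 q + Df T2 q e *\<^sub>R dc e2 q))) (at q)"
      by (intro has_derivative_add has_derivative_scaleR dT1 dT2 d_dc qU q)
    then show ?thesis
      by (rule has_derivative_transform_within_open[OF _ V(1) q]) (simp add: dc_R2[OF qU, of _ "Tf _"] TN_defs)
  qed
  have dY: "((\<lambda>q. dc (Nf q) q) has_derivative (\<lambda>e. (N1 q *\<^sub>R ddc e e1 q + Df N1 q e *\<^sub>R dc e1 q) + (N2 q *\<^sub>R ddc e e2 q + Df N2 q e *\<^sub>R dc e2 q))) (at q)"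
    if q: "q \<in> V" for q
  proof -
    have "((\<lambda>q. N1 q *\<^sub>R dc e1 q + N2 q *\<^sub>R dc e2 q) has_derivative (\<lambda>e. (N1 q *\<^sub>R ddc e e1 q + Df N1 q e *\<^sub>R dc e1 q) + (N2 q *\<^sub>R ddc e e2 q + Df N2 q e *\<^sub>R dc e2 q))) (at q)"
      by (intro has_derivative_add has_derivative_scaleR dN1 dN2 d_dc qU q)
    then show ?thesis
      by (rule has_derivative_transform_within_open[OF _ V(1) q]) (simp add: dc_R2[OF qU, of _ "Nf _"] TN_defs)
  qed
  have lindd: "ddc e e' q = fst e *\<^sub>R ddc e1 e' q + snd e *\<^sub>R ddc e2 e' q" "ddz e e' q = fst e * ddz e1 e' q + snd e * ddz e2 e' q"
    if "q \<in> U" for q e e'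
    using linear_R2[OF has_derivative_linear[OF d_dc[OF that, of e']], of e] linear_R2[OF has_derivative_linear[OF d_dz[OF that, of e']], of e]
    by simp_all
  text \<open>The fields \<open>Tf\<close> and \<open>Nf\<close> commute because both dual one-forms are closed.\<close>
  have comm: "Df T1 q (Nf q) = Df N1 q (Tf q)" "Df T2 q (Nf q) = Df N2 q (Tf q)" if q: "q \<in> V" for q
  proof -
    let ?T = "Tf q" and ?N = "Nf q"
    \<comment> \<open>\<open>x1\<close>, \<open>x2\<close> are the components of the Lie bracket of
      \<open>Nf\<close> and \<open>Tf\<close>. Closedness makes dz and its dual annihilate the
      bracket, and these two forms are independent.\<close>
    define x1 where "x1 = Df T1 q ?N - Df N1 q ?T"
    define x2 where "x2 = Df T2 q ?N - Df N2 q ?T"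
    have prod: "((\<lambda>q. u q * u' q + v q * v' q) has_derivative (\<lambda>e. (u q * Df u' q e + du e * u' q) + (v q * Df v' q e + dv e * v' q))) (at q)"
      if "(u has_derivative du) (at q)" "(v has_derivative dv) (at q)" "u' differentiable (at q)" "v' differentiable (at q)"
      for u v u' v' :: "R2 \<Rightarrow> real" and du dv
      by (intro has_derivative_add has_derivative_mult that Df_has_derivative)
    have zero: "e = 0" if "(h has_derivative h') (at q)" "\<And>x. x \<in> V \<Longrightarrow> h x = c" "h' y = e" for h :: "R2 \<Rightarrow> real" and h' c y e
    proof -
      have "((\<lambda>x. h x - c) has_derivative h') (at q)" using has_derivative_diff[OF that(1) has_derivative_const] by simp
      from Df_eq_0_open[OF V(1) q _ this] have "h' = (\<lambda>e. 0)" using that(2) by simp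
      then show ?thesis using that(3) by simp
    qed
    have reg: "regular x" if "x \<in> V" for x using V that by blast
    have c1: "dz e1 x * T1 x + dz e2 x * T2 x = 1" "dz e1 x * N1 x + dz e2 x * N2 x = 0" 
      "Pf x * T1 x + Qf x * T2 x = 0" "Pf x * N1 x + Qf x * N2 x = 1" if "x \<in> V" for x
      using TN_dual[OF qU reg, OF that that] dz_R2[OF qU[OF that], of "Tf x"] dz_R2[OF qU[OF that], of "Nf x"]
      by (simp_all add: TN_defs mult.commute)
    note dP = Df_has_derivative[OF diff_QP(2)[OF qU[OF q]]] and dQ = Df_has_derivative[OF diff_QP(1)[OF qU[OF q]]]
    have 1: "(dz e1 q * Df T1 q ?N + ddz ?N e1 q * T1 q) + (dz e2 q * Df T2 q ?N + ddz ?N e2 q * T2 q) = 0"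
      by (rule zero[OF prod[OF d_dz[OF qU[OF q]] d_dz[OF qU[OF q]] diff(1,2)[OF q]] c1(1) refl])
    have 2: "(dz e1 q * Df N1 q ?T + ddz ?T e1 q * N1 q) + (dz e2 q * Df N2 q ?T + ddz ?T e2 q * N2 q) = 0"
      by (rule zero[OF prod[OF d_dz[OF qU[OF q]] d_dz[OF qU[OF q]] diff(3,4)[OF q]] c1(2) refl])
    have 3: "(Pf q * Df T1 q ?N + Df Pf q ?N * T1 q) + (Qf q * Df T2 q ?N + Df Qf q ?N * T2 q) = 0"
      by (rule zero[OF prod[OF dP dQ diff(1,2)[OF q]] c1(3) refl])
    have 4: "(Pf q * Df N1 q ?T + Df Pf q ?T * N1 q) + (Qf q * Df N2 q ?T + Df Qf q ?T * N2 q) = 0"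
      by (rule zero[OF prod[OF dP dQ diff(3,4)[OF q]] c1(4) refl])
    have PQ: "Df Pf q e = fst e * Df Pf q e1 + snd e * Df Pf q e2" "Df Qf q e = fst e * Df Qf q e1 + snd e * Df Qf q e2" for e
      using linear_R2[OF has_derivative_linear[OF dP], of e] linear_R2[OF has_derivative_linear[OF dQ], of e] by simp_all
    have A: "dz e1 q * x1 + dz e2 q * x2 = 0"
      using 1 2 ddz_sym[OF qU[OF q], of e2 e1]
      unfolding lindd(2)[OF qU[OF q], of ?N] lindd(2)[OF qU[OF q], of ?T] x1_def x2_def TN_defs by (simp add: algebra_simps)
    have B: "Pf q * x1 + Qf q * x2 = 0"
      using 3 4 closed_dual[OF qU[OF q]]
      unfolding PQ[of ?N] PQ[of ?T] x1_def x2_def TN_defs by (simp add: algebra_simps)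
    have "Dd q * x1 = 0" "Dd q * x2 = 0" using A B unfolding Dd_def by algebra+
    then have "x1 = 0" "x2 = 0" using Dd_pos[OF qU[OF q] reg[OF q]] by simp_all
    then show "Df T1 q ?N = Df N1 q ?T" "Df T2 q ?N = Df N2 q ?T" by (simp_all add: x1_def x2_def)
  qed
  define FX' where "FX' q e = (T1 q *\<^sub>R ddc e e1 q + Df T1 q e *\<^sub>R dc e1 q) + (T2 q *\<^sub>R ddc e e2 q + Df T2 q e *\<^sub>R dc e2 q)" for q e
  define FY' where "FY' q e = (N1 q *\<^sub>R ddc e e1 q + Df N1 q e *\<^sub>R dc e1 q) + (N2 q *\<^sub>R ddc e e2 q + Df N2 q e *\<^sub>R dc e2 q)" for q e
  have mixed: "FY' q (Tf q) = FX' q (Nf q)" if q: "q \<in> V" for q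
    unfolding FX'_def FY'_def comm[OF q] lindd(1)[OF qU[OF q], of "Nf q"] lindd(1)[OF qU[OF q], of "Tf q"]
    using ddc_sym[OF qU[OF q], of e2 e1] by (simp add: TN_defs algebra_simps)
  have "shrinker_frame V Tf Nf fc (\<lambda>q. dc (Tf q) q) (\<lambda>q. dc (Nf q) q) (\<lambda>q. FX' q (Tf q)) (\<lambda>q. FX' q (Nf q)) (\<lambda>q. FY' q (Nf q))
     fz (\<lambda>q. sG q / Dd q) b \<theta>"
  proof
    show "open V" "b \<noteq> 0" using V b by auto
    fix q assume q: "q \<in> V"
    note qu = qU[OF q] and reg = V(3)[OF q]
    note D = Dd_pos[OF qu reg]
    show "\<exists>x y. e = x *\<^sub>R Tf q + y *\<^sub>R Nf q" for e
    proof (intro exI)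
      \<comment> \<open>The coefficients are the values of the dual coframe on
        \<open>e\<close>.\<close>
      show "e = (dz e1 q * fst e + dz e2 q * snd e) *\<^sub>R Tf q + (Pf q * fst e + Qf q * snd e) *\<^sub>R Nf q"
      proof (rule prod_eqI)
        have "((dz e1 q * fst e + dz e2 q * snd e) * Qf q - (Pf q * fst e + Qf q * snd e) * dz e2 q) / Dd q = Dd q * fst e / Dd q"
          "((Pf q * fst e + Qf q * snd e) * dz e1 q - (dz e1 q * fst e + dz e2 q * snd e) * Pf q) / Dd q = Dd q * snd e / Dd q"
          by (simp_all add: Dd_def algebra_simps)
        then show "fst e = fst ((dz e1 q * fst e + dz e2 q * snd e) *\<^sub>R Tf q + (Pf q * fst e + Qf q * snd e) *\<^sub>R Nf q)"
          "snd e = snd ((dz e1 q * fst e + dz e2 q * snd e) *\<^sub>R Tf q + (Pf q * fst e + Qf q * snd e) *\<^sub>R Nf q)"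
          using D by (simp_all add: Tf_def Nf_def diff_divide_distrib)
      qed
    qed
    show "hasD Tf Nf fc q (dc (Tf q) q) (dc (Nf q) q)"
      unfolding hasD_def using d_fc[OF qu] by blast
    show "hasD Tf Nf fz q 1 0"
      unfolding hasD_def using d_fz[OF qu] TN_dual[OF qu reg] by blast
    show "hasD Tf Nf (\<lambda>q. dc (Tf q) q) q (FX' q (Tf q)) (FX' q (Nf q))"
      unfolding hasD_def FX'_def using dX[OF q] by blast
    show "hasD Tf Nf (\<lambda>q. dc (Nf q) q) q (FX' q (Nf q)) (FY' q (Nf q))"
      unfolding hasD_def mixed[OF q, symmetric] unfolding FY'_def using dY[OF q] by blast
    show "hp (dc (Tf q) q) (dc (Tf q) q) = of_real (sG q / Dd q)" "hp (dc (Nf q) q) (dc (Nf q) q) = of_real (sG q / Dd q)"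
      "hp (dc (Tf q) q) (dc (Nf q) q) = 0"
      unfolding hp_G[OF qu] G_TN[OF qu reg] by simp_all
    show "sG q / Dd q > 0" using D sG[OF qu] by simp
    show "Im (hp (fc q) (dc (Tf q) q)) = - 2" "Im (hp (fc q) (dc (Nf q) q)) = 0"
      unfolding leg'[OF qu] TN_dual[OF qu reg] by simp_all
    have Im_real_mult: "Im (of_real c * w * w') = c * Im (w * w')" for c w w'
      by (simp add: algebra_simps)
    \<comment> \<open>Changing the real basis multiplies the complex area form by a real
      determinant, which leaves the angle condition intact.\<close>
    have "cdet (dc (Tf q) q) (dc (Nf q) q) = of_real (fst (Tf q) * snd (Nf q) - snd (Tf q) * fst (Nf q)) * cdet (dc e1 q) (dc e2 q)"
      unfolding dc_R2[OF qu, of "Tf q"] dc_R2[OF qu, of "Nf q"] cdet_simps using cdet_swap[of "dc e2 q" "dc e1 q"]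
      by (simp add: algebra_simps)
    then have "Im (cdet (dc (Tf q) q) (dc (Nf q) q) * cis (- (b / 2) * fz q + \<theta>))
        = (fst (Tf q) * snd (Nf q) - snd (Tf q) * fst (Nf q)) * Im (cdet (dc e1 q) (dc e2 q) * cis (- (b / 2) * fz q + \<theta>))"
      by (simp only: Im_real_mult)
    then show "Im (cdet (dc (Tf q) q) (dc (Nf q) q) * cis (- (b / 2) * fz q + \<theta>)) = 0"
      unfolding angle[OF qu] by simp
  qed
  then show thesis by (rule that)
qed

end

section \<open>Models as level sets, and first order contact with them\<close>

definition on_model :: "C2 \<Rightarrow> real \<Rightarrow> C2 \<Rightarrow> real \<Rightarrow> R5 \<Rightarrow> bool" where
  "on_model v k w l y \<longleftrightarrow> Im (hp v (proj_C2 y) * cis (- k * ht y)) = 0 \<and> Im (hp w (proj_C2 y) * cis (- l * ht y)) = 0 \<and>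
     k * (Re (hp v (proj_C2 y) * cis (- k * ht y)))\<^sup>2 + l * (Re (hp w (proj_C2 y) * cis (- l * ht y)))\<^sup>2 = -2"

definition on_plane :: "C2 \<Rightarrow> C2 \<Rightarrow> real \<Rightarrow> R5 \<Rightarrow> bool" where
  "on_plane v w c y \<longleftrightarrow> Im (hp v (proj_C2 y)) = 0 \<and> Im (hp w (proj_C2 y)) = 0 \<and> ht y = c"

definition orthonormal2 :: "C2 \<Rightarrow> C2 \<Rightarrow> bool" where
  "orthonormal2 v w \<longleftrightarrow> hp v v = 1 \<and> hp w w = 1 \<and> hp v w = 0"

lemma orthonormal2_expand: "orthonormal2 v w \<Longrightarrow> hp x y = hp x v * hp v y + hp x w * hp w y"
  using frame_expand(1)[of v 1 w x y] by (simp add: orthonormal2_def)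

lemma open_not_all_zero:
  assumes "open U" "\<And>h. h \<in> Hs \<Longrightarrow> continuous_on U (h :: R2 \<Rightarrow> real)"
  shows "open {q\<in>U. \<not> (\<forall>h\<in>Hs. h q = 0)}"
proof -
  have "open (U \<inter> h -` (- {0}))" if "h \<in> Hs" for h
    by (rule continuous_open_preimage[OF assms(2)[OF that] assms(1)]) (intro open_Compl closed_singleton)
  then have "open (\<Union>h\<in>Hs. U \<inter> h -` (- {0}))" by blast
  moreover have "{q\<in>U. \<not> (\<forall>h\<in>Hs. h q = 0)} = (\<Union>h\<in>Hs. U \<inter> h -` (- {0}))" by auto
  ultimately show ?thesis by simp
qed

context legendrian_chart
begin

text \<open>The coordinate along \<open>v\<close> with the rotation of speed \<open>k\<close>
  undone; on a model it is real. \<open>drho\<close> is its derivative.\<close>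

definition rho where "rho v k q = hp v (fc q) * cis (- k * fz q)"
definition drho where "drho v k e q = (hp v (dc e q) - \<i> * of_real k * of_real (dz e q) * hp v (fc q)) * cis (- k * fz q)"

lemma d_rho: assumes q: "q \<in> U" shows "(rho v k has_derivative (\<lambda>e. drho v k e q)) (at q)"
proof -
  have "((\<lambda>q. hp v (fc q) * cis (- k * fz q)) has_derivative
     (\<lambda>e. hp v (fc q) * (\<i> * of_real (- k * dz e q) * cis (- k * fz q)) + hp v (dc e q) * cis (- k * fz q))) (at q)"
    by (intro has_derivative_mult has_derivative_cis bounded_linear.has_derivative[OF bounded_linear_mult_right] d_fz
      bounded_linear.has_derivative[OF bounded_bilinear.bounded_linear_right[OF bounded_bilinear_hp]] d_fc q)
  moreover have "(\<lambda>e. hp v (fc q) * (\<i> * of_real (- k * dz e q) * cis (- k * fz q)) + hp v (dc e q) * cis (- k * fz q)) = (\<lambda>e. drho v k e q)"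
    by (auto simp: drho_def algebra_simps)
  ultimately show ?thesis unfolding rho_def[abs_def] by simp
qed

lemma on_model_rho: "on_model v k w l (f q) \<longleftrightarrow> Im (rho v k q) = 0 \<and> Im (rho w l q) = 0 \<and>
    k * (Re (rho v k q))\<^sup>2 + l * (Re (rho w l q))\<^sup>2 = -2"
  by (simp only: on_model_def rho_def fc_def fz_def)

text \<open>The model equations together with their first derivatives in all directions. Formulated
  without \<open>Tf\<close> and \<open>Nf\<close>, it also makes sense where dz vanishes.\<close>

definition contact where "contact v k w l q \<longleftrightarrow> on_model v k w l (f q) \<and>
   (\<forall>e. Im (drho v k e q) = 0 \<and> Im (drho w l e q) = 0 \<and>
     k * Re (rho v k q) * Re (drho v k e q) + l * Re (rho w l q) * Re (drho w l e q) = 0)"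

lemma contact_of_on_model:
  assumes "open W" "W \<subseteq> U" "q \<in> W" "\<And>x. x \<in> W \<Longrightarrow> on_model v k w l (f x)"
  shows "contact v k w l q"
proof -
  have q: "q \<in> U" using assms by blast
  have i: "((\<lambda>x. Im (rho v k x)) has_derivative (\<lambda>e. Im (drho v k e q))) (at q)"
    and r: "((\<lambda>x. Re (rho v k x)) has_derivative (\<lambda>e. Re (drho v k e q))) (at q)" for v k
    by (intro bounded_linear.has_derivative[OF bounded_linear_Im] bounded_linear.has_derivative[OF bounded_linear_Re] d_rho q)+
  have c: "((\<lambda>x. k * (Re (rho v k x) * Re (rho v k x)) + l * (Re (rho w l x) * Re (rho w l x)) + 2) has_derivative
     (\<lambda>e. k * (Re (rho v k q) * Re (drho v k e q) + Re (drho v k e q) * Re (rho v k q)) +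
       l * (Re (rho w l q) * Re (drho w l e q) + Re (drho w l e q) * Re (rho w l q)) + 0)) (at q)"
    by (intro has_derivative_add has_derivative_const bounded_linear.has_derivative[OF bounded_linear_mult_right] has_derivative_mult r)
  have on: "Im (rho v k x) = 0" "Im (rho w l x) = 0" "k * (Re (rho v k x) * Re (rho v k x)) + l * (Re (rho w l x) * Re (rho w l x)) + 2 = 0"
    if "x \<in> W" for x
    using assms(4)[OF that] unfolding on_model_rho by (simp_all add: power2_eq_square)
  show ?thesis
    unfolding contact_def
  proof (intro conjI allI)
    show "on_model v k w l (f q)" using assms by blast
    fix e
    show "Im (drho v k e q) = 0" "Im (drho w l e q) = 0"
      using fun_cong[OF Df_eq_0_open[OF assms(1,3) on(1) i], of e] fun_cong[OF Df_eq_0_open[OF assms(1,3) on(2) i], of e] by simp_all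
    show "k * Re (rho v k q) * Re (drho v k e q) + l * Re (rho w l q) * Re (drho w l e q) = 0"
      using fun_cong[OF Df_eq_0_open[OF assms(1,3) on(3) c], of e] by (simp add: algebra_simps)
  qed
qed

lemma cont_dc: "continuous_on U (dc e)" and cont_fc: "continuous_on U fc" and cont_fz: "continuous_on U fz" and cont_dz: "continuous_on U (dz e)"
  using d_dc d_fc d_fz d_dz by (meson continuous_at_imp_continuous_on has_derivative_continuous)+

lemma cont_rho: "continuous_on U (rho v k)"
  using d_rho by (meson continuous_at_imp_continuous_on has_derivative_continuous)

lemma cont_hp: "continuous_on S x \<Longrightarrow> continuous_on S y \<Longrightarrow> continuous_on S (\<lambda>q. hp (x q) (y q))"
  by (rule bounded_bilinear.continuous_on[OF bounded_bilinear_hp])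

lemma cont_drho: "continuous_on U (drho v k e)"
  unfolding drho_def[abs_def] cis_conv_exp
  by (intro continuous_intros cont_hp cont_dc cont_fc cont_fz cont_dz)

lemma contact_closed: "open {q\<in>U. \<not> contact v k w l q}"
proof -
  define Hs where "Hs = {(\<lambda>q. Im (rho v k q)), (\<lambda>q. Im (rho w l q)), (\<lambda>q. k * (Re (rho v k q))\<^sup>2 + l * (Re (rho w l q))\<^sup>2 + 2)}
    \<union> range (\<lambda>e q. Im (drho v k e q)) \<union> range (\<lambda>e q. Im (drho w l e q))
    \<union> range (\<lambda>e q. k * Re (rho v k q) * Re (drho v k e q) + l * Re (rho w l q) * Re (drho w l e q))"
  have "contact v k w l q \<longleftrightarrow> (\<forall>h\<in>Hs. h q = 0)" for q
    unfolding contact_def on_model_rho Hs_def ball_Un ball_simps by (auto simp: add_eq_0_iff)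
  moreover have "continuous_on U h" if "h \<in> Hs" for h
    using that unfolding Hs_def by (auto intro!: continuous_intros cont_rho cont_drho)
  ultimately show ?thesis using open_not_all_zero[OF open_U, of Hs] by simp
qed

end

context shrinker_chart
begin

text \<open>If dz vanished, all tangent vectors would project to the tangent line of the conic in a
  single real plane, so the projection could not be an immersion. The tangent line exists because
  the conic equation, with right-hand side -2, keeps the gradient from vanishing.\<close>

lemma contact_regular:
  assumes q: "q \<in> U" and on: "orthonormal2 v w" and c: "contact v k w l q"
  shows "regular q"
proof (rule ccontr)
  assume "\<not> regular q"
  then have dz0: "dz e q = 0" for e using dz_R2[OF q, of e] by (simp add: regular_def zero_prod_def)
  define m1 where "m1 = k * Re (rho v k q)"
  define m2 where "m2 = l * Re (rho w l q)"
  have dr: "hp v (dc e q) = of_real (Re (drho v k e q)) * cis (k * fz q)" if "Im (drho v k e q) = 0" for v k e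
  proof -
    have "hp v (dc e q) * cis (- k * fz q) = of_real (Re (drho v k e q))"
      using that by (simp add: drho_def dz0 complex_eq_iff del: cis.sel times_complex.sel)
    then have "hp v (dc e q) * cis (- k * fz q) * cis (k * fz q) = of_real (Re (drho v k e q)) * cis (k * fz q)" by simp
    then show ?thesis by (simp add: mult.assoc cis_mult)
  qed
  have m: "m1 \<noteq> 0 \<or> m2 \<noteq> 0"
  proof (rule ccontr)
    assume "\<not> (m1 \<noteq> 0 \<or> m2 \<noteq> 0)"
    then have "k * (Re (rho v k q))\<^sup>2 + l * (Re (rho w l q))\<^sup>2 = 0"
      by (auto simp: m1_def m2_def power2_eq_square)
    then show False using c unfolding contact_def on_model_rho by simp
  qed
  have tan: "m1 * Re (drho v k e q) + m2 * Re (drho w l e q) = 0" for e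
    using c unfolding contact_def m1_def m2_def by blast
  \<comment> \<open>The component of a tangent vector along the tangent line of the conic: a real
    linear functional on the plane. It would have to be injective, but
    \<open>(\<delta> e2, - \<delta> e1)\<close> lies in its kernel.\<close>
  define \<delta> where "\<delta> e = m1 * Re (drho w l e q) - m2 * Re (drho v k e q)" for e
  have lin: "linear \<delta>"
  proof -
    have l: "linear (\<lambda>e. drho v k e q)" for v k using has_derivative_linear[OF d_rho[OF q]] .
    show ?thesis unfolding \<delta>_def
      by (intro linearI) (simp_all add: linear_add[OF l] linear_scale[OF l] algebra_simps)
  qed
  have "dc e q = 0" if "\<delta> e = 0" for e
  proof -
    let ?x = "Re (drho v k e q)" and ?y = "Re (drho w l e q)"
    have "(m1\<^sup>2 + m2\<^sup>2) * ?x = m1 * (m1 * ?x + m2 * ?y) - m2 * \<delta> e" "(m1\<^sup>2 + m2\<^sup>2) * ?y = m2 * (m1 * ?x + m2 * ?y) + m1 * \<delta> e"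
      by (simp_all add: \<delta>_def power2_eq_square algebra_simps)
    moreover have "m1\<^sup>2 + m2\<^sup>2 \<noteq> 0" using m by (simp add: sum_power2_eq_zero_iff)
    ultimately have "?x = 0" "?y = 0" using tan[of e] that by auto
    moreover have "Im (drho v k e q) = 0" "Im (drho w l e q) = 0" using c unfolding contact_def by blast+
    ultimately have "hp v (dc e q) = 0" "hp w (dc e q) = 0" using dr by simp_all
    then have "hp (dc e q) (dc e q) = 0" using orthonormal2_expand[OF on, of "dc e q" "dc e q"] by simp
    then show ?thesis using hp_self_pos[of "dc e q"] by force
  qed
  then have inj: "e = 0" if "\<delta> e = 0" for e using dc_nonzero[OF q] that by blast
  have "\<delta> (\<delta> e2, - \<delta> e1) = 0"
    by (subst linear_R2[OF lin]) simp
  from inj[OF this] have "\<delta> e1 = 0" by (simp add: zero_prod_def)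
  from inj[OF this] show False by (simp add: zero_prod_def)
qed

lemma regular_neighbourhood:
  assumes q: "q \<in> U" "regular q"
  obtains W where "open W" "connected W" "q \<in> W" "W \<subseteq> U" "\<forall>x\<in>W. regular x"
proof -
  have "continuous_on U (\<lambda>x. (dz e1 x, dz e2 x))" by (intro continuous_intros cont_dz)
  then have "open (U \<inter> (\<lambda>x. (dz e1 x, dz e2 x)) -` (- {0}))"
    by (rule continuous_open_preimage[OF _ open_U]) (intro open_Compl closed_singleton)
  moreover have "q \<in> U \<inter> (\<lambda>x. (dz e1 x, dz e2 x)) -` (- {0})" using q by (simp add: regular_def)
  ultimately obtain e where e: "e > 0" "ball q e \<subseteq> U \<inter> (\<lambda>x. (dz e1 x, dz e2 x)) -` (- {0})"
    using openE by blast
  show thesis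
    by (rule that[of "ball q e"]) (use e in \<open>auto simp: regular_def\<close>)
qed

text \<open>Contact at one point yields the eigenvector conditions there; these hold on a connected
  regular neighbourhood and give back the model equations.\<close>

lemma contact_spreads:
  assumes q: "q \<in> U" and on: "orthonormal2 v w" and kl: "k + l = b / 2" and c: "contact v k w l q"
  shows "\<exists>W. open W \<and> q \<in> W \<and> W \<subseteq> U \<and> (\<forall>x\<in>W. on_model v k w l (f x))"
proof -
  obtain W where W: "open W" "connected W" "q \<in> W" "W \<subseteq> U" "\<forall>x\<in>W. regular x"
    using regular_neighbourhood[OF q contact_regular[OF q on c]] .
  have reg: "regular x" if "x \<in> W" for x using W(5) that by blast
  obtain FXX FXY FYY where "shrinker_frame W Tf Nf fc (\<lambda>q. dc (Tf q) q) (\<lambda>q. dc (Nf q) q) FXX FXY FYY fz (\<lambda>q. sG q / Dd q) b \<theta>"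
    using frame[OF W(1,4) reg] .
  then interpret sf: shrinker_frame W Tf Nf fc "\<lambda>q. dc (Tf q) q" "\<lambda>q. dc (Nf q) q" FXX FXY FYY fz "\<lambda>q. sG q / Dd q" b \<theta> .
  note o = on[unfolded orthonormal2_def]
  note tn = TN_dual[OF q reg[OF W(3)]]
  have dT: "drho v k (Tf q) q = (hp v (dc (Tf q) q) - \<i> * of_real k * hp v (fc q)) * cis (- k * fz q)"
    and dN: "drho v k (Nf q) q = hp v (dc (Nf q) q) * cis (- k * fz q)" for v k
    by (simp_all add: drho_def tn)
  have "sf.eigen_at q v k" "sf.eigen_at q w l"
    using c o unfolding contact_def on_model_rho
    by (intro sf.eigen_at_of_contact[OF W(3) _ _ _ kl, of v w]; simp only: dT[symmetric] dN[symmetric] rho_def[symmetric])+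
  then have e: "sf.eigen_at x v k" "sf.eigen_at x w l" if "x \<in> W" for x
    using sf.eigen_at_everywhere[OF W(2,3) _ that] by blast+
  have "on_model v k w l (f x)" if x: "x \<in> W" for x
    unfolding on_model_rho rho_def
    using sf.eigen_at_coords(1)[OF x e(1)[OF x]] sf.eigen_at_coords(1)[OF x e(2)[OF x]]
      sf.eigen_basis_conic[OF x e(1)[OF x] e(2)[OF x]] o by blast
  then show ?thesis using W by blast
qed

lemma regular_model_exists:
  assumes q: "q \<in> U" "regular q"
  shows "\<exists>v w k l W. orthonormal2 v w \<and> k \<le> l \<and> k + l = b / 2 \<and> open W \<and> q \<in> W \<and> W \<subseteq> U \<and> (\<forall>x\<in>W. on_model v k w l (f x))"
proof -
  obtain W where W: "open W" "connected W" "q \<in> W" "W \<subseteq> U" "\<forall>x\<in>W. regular x"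
    using regular_neighbourhood[OF q] .
  have reg: "regular x" if "x \<in> W" for x using W(5) that by blast
  obtain FXX FXY FYY where "shrinker_frame W Tf Nf fc (\<lambda>q. dc (Tf q) q) (\<lambda>q. dc (Nf q) q) FXX FXY FYY fz (\<lambda>q. sG q / Dd q) b \<theta>"
    using frame[OF W(1,4) reg] .
  then interpret sf: shrinker_frame W Tf Nf fc "\<lambda>q. dc (Tf q) q" "\<lambda>q. dc (Nf q) q" FXX FXY FYY fz "\<lambda>q. sG q / Dd q" b \<theta> .
  obtain v w k l where o: "hp v v = 1" "hp w w = 1" "hp v w = 0" "k \<le> l" "k + l = b / 2"
    "sf.eigen_at q v k" "sf.eigen_at q w l"
    using sf.eigen_basis_exists[OF W(3)] .
  have e: "sf.eigen_at x v k" "sf.eigen_at x w l" if "x \<in> W" for x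
    using sf.eigen_at_everywhere[OF W(2,3) _ that] o by blast+
  have "on_model v k w l (f x)" if x: "x \<in> W" for x
    unfolding on_model_rho rho_def
    using sf.eigen_at_coords(1)[OF x e(1)[OF x]] sf.eigen_at_coords(1)[OF x e(2)[OF x]]
      sf.eigen_basis_conic[OF x e(1)[OF x] e(2)[OF x]] o by blast
  then show ?thesis using W o unfolding orthonormal2_def by blast
qed

end

subsection \<open>The static case\<close>

locale flat_shrinker_chart = shrinker_chart +
  assumes flat: "\<And>q e. q \<in> U \<Longrightarrow> dz e q = 0"
begin

lemma ddz0: assumes q: "q \<in> U" shows "ddz e' e q = 0"
  using fun_cong[OF Df_eq_0_open[OF open_U q flat d_dz[OF q]], of e'] .

lemma ddc_R2: assumes q: "q \<in> U" shows "ddc e e' q = fst e *\<^sub>R ddc e1 e' q + snd e *\<^sub>R ddc e2 e' q"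
  using linear_R2[OF has_derivative_linear[OF d_dc[OF q, of e']], of e] by simp

text \<open>With constant height the Legendrian identity makes the position symplectically
  orthogonal to the Lagrangian tangent plane. The projection is therefore conical: its position
  vector is tangent.\<close>

lemma fc_tangent: assumes q: "q \<in> U" obtains e where "fc q = dc e q"
proof -
  have "Im (hp (dc e q) (fc q)) = 0" for e
    using leg'[OF q, of e] flat[OF q, of e] hp_Im_swap[of "dc e q" "fc q"] by simp
  then obtain x y where "fc q = x *\<^sub>R dc e1 q + y *\<^sub>R dc e2 q"
    using span_Lagrangian[OF lag[OF q] cdet_nonzero[OF q]] by blast
  then show thesis using that[of "(x, y)"] dc_R2[OF q, of "(x, y)"] by simp
qed

text \<open>The cubic form has zero trace because the angle is locally constant, and it is
  annihilated by the position vector because the surface is conical. In dimension two both together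
  force it to vanish where the position is nonzero.\<close>

lemma cubic_form_vanishes: assumes q: "q \<in> U" 
  shows "Im (hp (dc e1 q) (ddc e1 e1 q)) = 0" "Im (hp (dc e1 q) (ddc e1 e2 q)) = 0"
    "Im (hp (dc e1 q) (ddc e2 e2 q)) = 0" "Im (hp (dc e2 q) (ddc e2 e2 q)) = 0"
proof -
  have main: "Im (hp (dc e1 x) (ddc e1 e1 x)) = 0 \<and> Im (hp (dc e1 x) (ddc e1 e2 x)) = 0 \<and>
    Im (hp (dc e1 x) (ddc e2 e2 x)) = 0 \<and> Im (hp (dc e2 x) (ddc e2 e2 x)) = 0" if x: "x \<in> U" and nz: "fc x \<noteq> 0" for x
  proof -
    obtain e where e: "fc x = dc e x" using fc_tangent[OF x] .
    then have e0: "e \<noteq> 0" using nz dc_R2[OF x, of e] by auto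
    define s where "s = fst e"
    define t where "t = snd e"
    define a where "a = Im (hp (dc e1 x) (ddc e1 e1 x))"
    define c where "c = Im (hp (dc e1 x) (ddc e1 e2 x))"
    define d where "d = Im (hp (dc e1 x) (ddc e2 e2 x))"
    define h where "h = Im (hp (dc e2 x) (ddc e2 e2 x))"
    have sy: "Im (hp (dc e2 x) (ddc e1 e1 x)) = c" "Im (hp (dc e2 x) (ddc e1 e2 x)) = d"
        "Im (hp (dc e1 x) (ddc e2 e1 x)) = c" "Im (hp (dc e2 x) (ddc e2 e1 x)) = d"
      unfolding c_def d_def using sym3[OF x, of e2 e1 e1] sym3[OF x, of e2 e1 e2] sym3[OF x, of e1 e2 e2] ddc_sym[OF x, of e1 e2]
      by simp_all
    have \<Theta>: "((\<lambda>x. - (b / 2) * fz x + \<theta>) has_derivative (\<lambda>e. - (b / 2) * dz e x)) (at x)"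
      by (auto intro!: derivative_eq_intros d_fz x)
    have 1: "G e2 e2 x * a - 2 * G e1 e2 x * c + G e1 e1 x * d = 0" "G e2 e2 x * c - 2 * G e1 e2 x * d + G e1 e1 x * h = 0"
      using angle_derivative[OF x \<Theta> angle, of e1] angle_derivative[OF x \<Theta> angle, of e2] flat[OF x]
      unfolding sy unfolding a_def[symmetric] c_def[symmetric] d_def[symmetric] h_def[symmetric] by simp_all
    \<comment> \<open>Contraction with the position, from horizontality of second derivatives and
      constant height.\<close>
    have "Im (hp (dc e x) (ddc i j x)) = 0" for i j
      using leg2[OF x, of i j] ddz0[OF x, of i j] e by simp
    then have "s * Im (hp (dc e1 x) (ddc i j x)) + t * Im (hp (dc e2 x) (ddc i j x)) = 0" for i j
      unfolding dc_R2[OF x, of e] by (simp add: hp_simps s_def t_def)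
    from this[of e1 e1] this[of e1 e2] this[of e2 e2]
    have 2: "s * a + t * c = 0" "s * c + t * d = 0" "s * d + t * h = 0"
      unfolding sy unfolding a_def c_def d_def h_def by simp_all
    have Gp: "s\<^sup>2 * G e1 e1 x + 2 * s * t * G e1 e2 x + t\<^sup>2 * G e2 e2 x > 0"
      using G_pos[OF x e0] unfolding G_quadratic(1)[OF x, of e] s_def t_def .
    have "a * (s\<^sup>2 * G e1 e1 x + 2 * s * t * G e1 e2 x + t\<^sup>2 * G e2 e2 x) = 0"
    proof -
      \<comment> \<open>After multiplication by \<open>t\<^sup>2\<close> every term of the trace is
        a multiple of \<open>a\<close>, and the total factor is the positive squared length of the
        position direction.\<close>
      have tc: "t * c = - (s * a)" "t\<^sup>2 * d = s\<^sup>2 * a" using 2 by algebra+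
      have "t\<^sup>2 * (G e2 e2 x * a - 2 * G e1 e2 x * c + G e1 e1 x * d) = t\<^sup>2 * G e2 e2 x * a - 2 * t * G e1 e2 x * (t * c) + G e1 e1 x * (t\<^sup>2 * d)"
        by (simp add: power2_eq_square algebra_simps)
      then show ?thesis unfolding tc 1 by (simp add: algebra_simps)
    qed
    then have a: "a = 0" using Gp by simp
    have "h * (s\<^sup>2 * G e1 e1 x + 2 * s * t * G e1 e2 x + t\<^sup>2 * G e2 e2 x) = 0"
    proof -
      have sd: "s * d = - (t * h)" "s\<^sup>2 * c = t\<^sup>2 * h" using 2 by algebra+
      have "s\<^sup>2 * (G e2 e2 x * c - 2 * G e1 e2 x * d + G e1 e1 x * h) = G e2 e2 x * (s\<^sup>2 * c) - 2 * s * G e1 e2 x * (s * d) + s\<^sup>2 * G e1 e1 x * h"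
        by (simp add: power2_eq_square algebra_simps)
      then show ?thesis unfolding sd 1 by (simp add: algebra_simps)
    qed
    then have h: "h = 0" using Gp by simp
    have "c = 0 \<and> d = 0"
    proof (cases "t = 0")
      case True
      then have "s \<noteq> 0" using e0 by (auto simp: s_def t_def zero_prod_def prod_eq_iff)
      then show ?thesis using 2 True by simp
    next
      case False
      then show ?thesis using 2 a by auto
    qed
    then show ?thesis using a h unfolding a_def c_def d_def h_def by simp
  qed
  text \<open>At a zero of \<^term>\<open>fc\<close> use continuity: \<^term>\<open>fc\<close> does not vanish on an open set.\<close>
  have ext: "Im (hp (dc i q) (ddc j k q)) = 0" if z: "\<And>x. x \<in> U \<Longrightarrow> fc x \<noteq> 0 \<Longrightarrow> Im (hp (dc i x) (ddc j k x)) = 0" for i j k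
  proof (rule ccontr)
    assume n: "Im (hp (dc i q) (ddc j k q)) \<noteq> 0"
    have "continuous_on U (ddc j k)"
      unfolding ddc_def[abs_def]
      by (rule smooth_on_continuous[OF smooth_on_bounded_linear[OF bounded_linear_proj_C2 smooth_on_Df[OF smooth_on_Df[OF smooth_f]] open_U]])
    then have "continuous_on U (\<lambda>x. Im (hp (dc i x) (ddc j k x)))"
      by (intro continuous_intros cont_hp cont_dc)
    then have o: "open (U \<inter> (\<lambda>x. Im (hp (dc i x) (ddc j k x))) -` (- {0}))"
      by (rule continuous_open_preimage[OF _ open_U]) (intro open_Compl closed_singleton)
    have "(\<lambda>e. dc e q) = (\<lambda>e. 0)"
      by (rule Df_eq_0_open[OF o _ _ d_fc[OF q]]) (use z n q in auto)
    then have "dc e1 q = 0" by (rule fun_cong)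
    then show False using dc_nonzero[OF q, of e1] by (simp add: zero_prod_def)
  qed
  show "Im (hp (dc e1 q) (ddc e1 e1 q)) = 0" "Im (hp (dc e1 q) (ddc e1 e2 q)) = 0"
    "Im (hp (dc e1 q) (ddc e2 e2 q)) = 0" "Im (hp (dc e2 q) (ddc e2 e2 q)) = 0"
    by (rule ext, use main in blast)+
qed

lemma second_tangent: assumes q: "q \<in> U"
  shows "\<exists>s t. ddc e e' q = s *\<^sub>R dc e1 q + t *\<^sub>R dc e2 q" and second_Im: "Im (hp (dc i q) (ddc e e' q)) = 0"
proof -
  note c = cubic_form_vanishes[OF q]
  have 1: "Im (hp (dc e1 q) (ddc i j q)) = 0 \<and> Im (hp (dc e2 q) (ddc i j q)) = 0" if "i \<in> {e1, e2}" "j \<in> {e1, e2}" for i j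
    using that c sym3[OF q, of e2 e1 e1] sym3[OF q, of e2 e1 e2] sym3[OF q, of e1 e2 e2] ddc_sym[OF q, of e1 e2] by auto
  have 2: "Im (hp (dc e1 q) (ddc e e' q)) = 0 \<and> Im (hp (dc e2 q) (ddc e e' q)) = 0" for e e'
  proof -
    have e: "ddc e e' q = fst e *\<^sub>R (fst e' *\<^sub>R ddc e1 e1 q + snd e' *\<^sub>R ddc e2 e1 q) + snd e *\<^sub>R (fst e' *\<^sub>R ddc e1 e2 q + snd e' *\<^sub>R ddc e2 e2 q)"
      unfolding ddc_R2[OF q, of e e'] ddc_sym[OF q, of e1 e'] ddc_sym[OF q, of e2 e'] ddc_R2[OF q, of e' e1] ddc_R2[OF q, of e' e2] ..
    show ?thesis unfolding e hp_simps using 1 by simp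
  qed
  show "\<exists>s t. ddc e e' q = s *\<^sub>R dc e1 q + t *\<^sub>R dc e2 q"
    using span_Lagrangian[OF lag[OF q] cdet_nonzero[OF q], of "ddc e e' q"] 2 by blast
  show "Im (hp (dc i q) (ddc e e' q)) = 0"
    unfolding dc_R2[OF q, of i] hp_simps using 2 by simp
qed

lemma minimal: assumes q: "q \<in> U" shows "mean_curvature f q = 0"
proof -
  have "tr q \<in> range (Df f q)"
  proof (rule horizontal_in_range[OF q])
    show "eta (f q) (tr q) = 0" unfolding tr_def eta_simps eta_second[OF q] by simp
    show "Im (hp (dc e q) (proj_C2 (tr q))) = 0" for e
      using second_Im[OF q, of e] unfolding tr_def by (simp add: hp_simps ddc_def)
  qed
  then obtain e where e: "tr q = Df f q e" by blast
  show ?thesis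
    unfolding mean_curvature_eq[OF q]
  proof (rule normal_part_eqI[OF lin[OF q]])
    show "(4 / dG q) *\<^sub>R tr q - 0 \<in> range (Df f q)"
      unfolding e using linear_scale[OF lin[OF q], of "4 / dG q" e] by (metis diff_zero rangeI)
  qed (simp add: g_simps)
qed

lemma fz_const: assumes "open W" "connected W" "W \<subseteq> U" "p \<in> W" "q \<in> W" shows "fz p = fz q"
proof (rule has_derivative_zero_unique_connected[OF assms(1,2) _ assms(4,5)])
  fix x assume "x \<in> W"
  then have x: "x \<in> U" using assms by blast
  show "(fz has_derivative (\<lambda>e. 0)) (at x)" using d_fz[OF x] unfolding flat[OF x] .
qed

text \<open>Second derivatives are tangential, so the one-form \<open>Im (hp v (dc e x))\<close> is
  parallel for the induced metric. \<open>n / dG\<close> is its squared length and hence constant;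
  if it is zero at one point, the one-form vanishes and so does the function it
  differentiates.\<close>

lemma plane_spreads:
  assumes W: "open W" "connected W" "W \<subseteq> U" and q0: "q0 \<in> W"
    and v: "Im (hp v (fc q0)) = 0" "\<And>e. Im (hp v (dc e q0)) = 0" and q: "q \<in> W"
  shows "Im (hp v (fc q)) = 0"
proof -
  define m where "m e x = Im (hp v (dc e x))" for e x
  define n where "n x = G e2 e2 x * (m e1 x * m e1 x) - 2 * (G e1 e2 x * (m e1 x * m e2 x)) + G e1 e1 x * (m e2 x * m e2 x)" for x
  have dm: "(m e has_derivative (\<lambda>e'. Im (hp v (ddc e' e x)))) (at x)" if "x \<in> U" for x e
    unfolding m_def[abs_def]
    by (intro bounded_linear.has_derivative[OF bounded_linear_Im]
      bounded_linear.has_derivative[OF bounded_bilinear.bounded_linear_right[OF bounded_bilinear_hp]] d_dc that)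
  have dGG: "(G e e' has_derivative (\<lambda>y. Re (hp (dc e x) (ddc y e' x) + hp (ddc y e x) (dc e' x)))) (at x)" if "x \<in> U" for x e e'
    unfolding G_def[abs_def]
    by (intro bounded_linear.has_derivative[OF bounded_linear_Re] bounded_bilinear.FDERIV[OF bounded_bilinear_hp] d_dc that)
  have ddG: "dG x = G e1 e1 x * G e2 e2 x - G e1 e2 x * G e1 e2 x" for x by (simp add: dG_def power2_eq_square)
  have R: "((\<lambda>x. n x / dG x) has_derivative (\<lambda>e. 0)) (at x)" if x: "x \<in> W" for x
  proof -
    have xU: "x \<in> U" using x W by blast
    define G' where "G' e e' y = Re (hp (dc e x) (ddc y e' x) + hp (ddc y e x) (dc e' x))" for e e' y
    define m' where "m' e y = Im (hp v (ddc y e x))" for e y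
    note D = dm[OF xU, folded m'_def] dGG[OF xU, folded G'_def]
    define n' where "n' y = (G e2 e2 x * (m e1 x * m' e1 y + m' e1 y * m e1 x) + G' e2 e2 y * (m e1 x * m e1 x))
        - 2 * (G e1 e2 x * (m e1 x * m' e2 y + m' e1 y * m e2 x) + G' e1 e2 y * (m e1 x * m e2 x))
        + (G e1 e1 x * (m e2 x * m' e2 y + m' e2 y * m e2 x) + G' e1 e1 y * (m e2 x * m e2 x))" for y
    define d' where "d' y = (G e1 e1 x * G' e2 e2 y + G' e1 e1 y * G e2 e2 x) - (G e1 e2 x * G' e1 e2 y + G' e1 e2 y * G e1 e2 x)" for y
    have dn: "(n has_derivative n') (at x)"
      unfolding n_def[abs_def] n'_def[abs_def]
      by (intro has_derivative_add has_derivative_diff has_derivative_mult bounded_linear.has_derivative[OF bounded_linear_mult_right] D)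
    have dd: "(dG has_derivative d') (at x)"
      unfolding ddG[abs_def] d'_def[abs_def]
      by (intro has_derivative_diff has_derivative_mult D)
    have d0: "dG x \<noteq> 0" using dG_pos[OF xU] by simp
    have "n' y * dG x = n x * d' y" for y
    proof -
      obtain s1 t1 s2 t2 where st: "ddc y e1 x = s1 *\<^sub>R dc e1 x + t1 *\<^sub>R dc e2 x" "ddc y e2 x = s2 *\<^sub>R dc e1 x + t2 *\<^sub>R dc e2 x"
        using second_tangent(1)[OF xU] by meson
      have mm: "m' e1 y = s1 * m e1 x + t1 * m e2 x" "m' e2 y = s2 * m e1 x + t2 * m e2 x"
        unfolding m'_def m_def st by (simp_all add: hp_simps)
      have gg: "G' e1 e1 y = 2 * (s1 * G e1 e1 x + t1 * G e1 e2 x)" "G' e2 e2 y = 2 * (s2 * G e1 e2 x + t2 * G e2 e2 x)"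
        "G' e1 e2 y = s1 * G e1 e2 x + t1 * G e2 e2 x + s2 * G e1 e1 x + t2 * G e1 e2 x"
        unfolding G'_def G_def st using hp_Re_swap[of "dc e2 x" "dc e1 x"] by (simp_all add: hp_simps)
      show ?thesis unfolding n'_def n_def d'_def ddG mm gg by (simp add: algebra_simps)
    qed
    then have "(\<lambda>y. (n' y * dG x - n x * d' y) / (dG x * dG x)) = (\<lambda>y. 0)" by simp
    with has_derivative_divide'[OF dn dd d0] show ?thesis by simp
  qed
  have "n x / dG x = n q0 / dG q0" if "x \<in> W" for x
    by (rule has_derivative_zero_unique_connected[OF W(1,2) R that q0])
  moreover have "n q0 = 0" using v(2) by (simp add: n_def m_def)
  ultimately have n0: "n x = 0" if "x \<in> W" for x
  proof -
    have "n x / dG x = 0" using \<open>n q0 = 0\<close> \<open>\<And>x. x \<in> W \<Longrightarrow> n x / dG x = n q0 / dG q0\<close>[OF that] by simp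
    moreover have "dG x \<noteq> 0" using that W(3) dG_pos[of x] by force
    ultimately show ?thesis by simp
  qed
  have m0: "m e x = 0" if x: "x \<in> W" for e x
  proof -
    have xU: "x \<in> U" using x W by blast
    have "n x = G (- m e2 x, m e1 x) (- m e2 x, m e1 x) x"
      unfolding G_quadratic(1)[OF xU, of "(- m e2 x, m e1 x)"] n_def by (simp add: power2_eq_square algebra_simps)
    then have "(- m e2 x, m e1 x) = 0" using G_pos[OF xU, of "(- m e2 x, m e1 x)"] n0[OF x] by force
    then have "m e1 x = 0" "m e2 x = 0" by (simp_all add: zero_prod_def)
    then show ?thesis unfolding m_def dc_R2[OF xU, of e] by (simp add: hp_simps)
  qed
  have "Im (hp v (fc q)) = Im (hp v (fc q0))"
  proof (rule has_derivative_zero_unique_connected[OF W(1,2) _ q q0])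
    fix x assume x: "x \<in> W"
    then have xU: "x \<in> U" using W by blast
    have "((\<lambda>x. Im (hp v (fc x))) has_derivative (\<lambda>e. Im (hp v (dc e x)))) (at x)"
      by (intro bounded_linear.has_derivative[OF bounded_linear_Im]
        bounded_linear.has_derivative[OF bounded_bilinear.bounded_linear_right[OF bounded_bilinear_hp]] d_fc xU)
    then show "((\<lambda>x. Im (hp v (fc x))) has_derivative (\<lambda>e. 0)) (at x)"
      using m0[OF x] by (simp add: m_def)
  qed
  then show ?thesis using v by simp
qed

definition plane_contact where "plane_contact v w c q \<longleftrightarrow> on_plane v w c (f q) \<and> (\<forall>e. Im (hp v (dc e q)) = 0 \<and> Im (hp w (dc e q)) = 0)"

lemma on_plane_fc: "on_plane v w c (f q) \<longleftrightarrow> Im (hp v (fc q)) = 0 \<and> Im (hp w (fc q)) = 0 \<and> fz q = c"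
  by (simp add: on_plane_def fc_def fz_def)

lemma plane_contact_of_on_plane:
  assumes "open W" "W \<subseteq> U" "q \<in> W" "\<And>x. x \<in> W \<Longrightarrow> on_plane v w c (f x)"
  shows "plane_contact v w c q"
proof -
  have q: "q \<in> U" using assms by blast
  have i: "((\<lambda>x. Im (hp v (fc x))) has_derivative (\<lambda>e. Im (hp v (dc e q)))) (at q)" for v
    by (intro bounded_linear.has_derivative[OF bounded_linear_Im]
      bounded_linear.has_derivative[OF bounded_bilinear.bounded_linear_right[OF bounded_bilinear_hp]] d_fc q)
  have on: "Im (hp v (fc x)) = 0" "Im (hp w (fc x)) = 0" if "x \<in> W" for x
    using assms(4)[OF that] unfolding on_plane_fc by simp_all
  show ?thesis
    unfolding plane_contact_def
    using assms(3,4) fun_cong[OF Df_eq_0_open[OF assms(1,3) on(1) i]] fun_cong[OF Df_eq_0_open[OF assms(1,3) on(2) i]] by blast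
qed

lemma plane_contact_closed: "open {q\<in>U. \<not> plane_contact v w c q}"
proof -
  define Hs where "Hs = {(\<lambda>q. Im (hp v (fc q))), (\<lambda>q. Im (hp w (fc q))), (\<lambda>q. fz q - c)}
    \<union> range (\<lambda>e q. Im (hp v (dc e q))) \<union> range (\<lambda>e q. Im (hp w (dc e q)))"
  have "plane_contact v w c q \<longleftrightarrow> (\<forall>h\<in>Hs. h q = 0)" for q
    unfolding plane_contact_def on_plane_fc Hs_def ball_Un ball_simps by auto
  moreover have "continuous_on U h" if "h \<in> Hs" for h
    using that unfolding Hs_def by (auto intro!: continuous_intros cont_hp cont_dc cont_fc cont_fz)
  ultimately show ?thesis using open_not_all_zero[OF open_U, of Hs] by simp
qed

lemma plane_contact_spreads:
  assumes q: "q \<in> U" and c: "plane_contact v w c q"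
  shows "\<exists>W. open W \<and> q \<in> W \<and> W \<subseteq> U \<and> (\<forall>x\<in>W. on_plane v w c (f x))"
proof -
  obtain e where e: "e > 0" "ball q e \<subseteq> U" using open_U q openE by blast
  note ps = plane_spreads[OF open_ball connected_ball e(2), of q]
  have "on_plane v w c (f x)" if x: "x \<in> ball q e" for x
    unfolding on_plane_fc
  proof (intro conjI)
    have c': "Im (hp v (fc q)) = 0" "Im (hp w (fc q)) = 0" "Im (hp v (dc e q)) = 0" "Im (hp w (dc e q)) = 0" for e
      using c unfolding plane_contact_def on_plane_fc by blast+
    have "q \<in> ball q e" using e by simp
    then show "Im (hp v (fc x)) = 0" "Im (hp w (fc x)) = 0"
      using ps[OF _ c'(1,3) x] ps[OF _ c'(2,4) x] by blast+
    show "fz x = c"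
      using fz_const[OF open_ball connected_ball e(2) x, of q] c e by (simp add: plane_contact_def on_plane_fc)
  qed
  then show ?thesis using e by (intro exI[of _ "ball q e"]) auto
qed

text \<open>The tangent plane at \<open>q\<close> serves as the plane itself: it is Lagrangian, and
  it contains the position vector by \<open>fc_tangent\<close>.\<close>

lemma plane_contact_exists:
  assumes q: "q \<in> U"
  shows "\<exists>v w. orthonormal2 v w \<and> plane_contact v w (fz q) q"
proof -
  have e: "e1 \<noteq> 0" "e2 \<noteq> 0" by (simp_all add: zero_prod_def)
  have G11: "G e1 e1 q > 0" by (rule G_pos[OF q e(1)])
  define v where "v = (1 / sqrt (G e1 e1 q)) *\<^sub>R dc e1 q"
  \<comment> \<open>Gram-Schmidt without division: this direction is orthogonal to
    \<open>e1\<close>.\<close>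
  define e' where "e' = (- G e1 e2 q, G e1 e1 q)"
  have e'0: "e' \<noteq> 0" using G11 by (simp add: e'_def zero_prod_def)
  have Gp: "G e' e' q > 0" by (rule G_pos[OF q e'0])
  define w where "w = (1 / sqrt (G e' e' q)) *\<^sub>R dc e' q"
  have "G e1 e' q = 0" unfolding G_bilinear[OF q, of e1 e'] by (simp add: e'_def)
  then have "orthonormal2 v w"
    unfolding orthonormal2_def v_def w_def hp_simps hp_G[OF q] using G11 Gp
    by (simp add: of_real_mult[symmetric] del: of_real_mult)
  moreover have t: "Im (hp v (dc e q)) = 0 \<and> Im (hp w (dc e q)) = 0" for e
    unfolding v_def w_def hp_simps hp_G[OF q] by simp
  moreover obtain e where "fc q = dc e q" using fc_tangent[OF q] .
  ultimately show ?thesis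
    unfolding plane_contact_def on_plane_fc by (intro exI[of _ v] exI[of _ w]) auto
qed

end

subsection \<open>Recognizing self-shrinkers\<close>

text \<open>Conditions that can be checked on a formula: a prescribed phase of the complex area
  form, with explicit modulus \<open>r\<close>, and closedness of the Hodge dual of dz.\<close>

locale model_chart = legendrian_chart +
  fixes b \<theta> :: real and r :: "R2 \<Rightarrow> real"
  assumes r: "\<And>q. q \<in> U \<Longrightarrow> r q > 0"
    and angle: "\<And>q. q \<in> U \<Longrightarrow> cdet (dc e1 q) (dc e2 q) = cis ((b / 2) * fz q - \<theta>) * of_real (r q)"
    and closed: "\<And>q. q \<in> U \<Longrightarrow> Df Qf q e1 = Df Pf q e2"
begin

lemma r_eq: assumes q: "q \<in> U" shows "sqrt (dG q) = r q"
  using cmod_cdet[OF q] r[OF q] unfolding angle[OF q] by (simp add: norm_mult)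

lemma OmegaT_model: assumes q: "q \<in> U"
  shows "OmegaT (Df f q e1) (Df f q e2) = exp (- \<i> * of_real (- (b / 2) * fz q + \<theta>)) * of_real (area (induced f) q)"
proof -
  have c: "cis ((b / 2) * fz q - \<theta>) = exp (- \<i> * of_real (- (b / 2) * fz q + \<theta>))"
    unfolding cis_conv_exp by (rule arg_cong[of _ _ exp]) (simp add: algebra_simps)
  have "cdet (dc e1 q) (dc e2 q) = exp (- \<i> * of_real (- (b / 2) * fz q + \<theta>)) * of_real (r q)"
    unfolding angle[OF q] c ..
  then show ?thesis
    unfolding OmegaT_eq dc_def[symmetric] area_induced[OF q] r_eq[OF q] by simp
qed

lemma self_similar_model: assumes q: "q \<in> U"
  shows "mean_curvature f q - (2 * (- (b / 2) * fz q)) *\<^sub>R xi = b *\<^sub>R normal_part f q (X (f q))"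
proof (rule angle_self_similar[OF q])
  fix x assume x: "x \<in> U"
  have "cdet (dc e1 x) (dc e2 x) * cis (- (b / 2) * fz x + \<theta>) = of_real (r x) * (cis ((b / 2) * fz x - \<theta>) * cis (- (b / 2) * fz x + \<theta>))"
    unfolding angle[OF x] by (simp add: algebra_simps)
  also have "\<dots> = of_real (r x)" unfolding cis_mult by simp
  finally show "Im (cdet (dc e1 x) (dc e2 x) * cis (- (b / 2) * fz x + \<theta>)) = 0" by simp
qed

lemma harmonic_model: assumes q: "q \<in> U" shows "laplacian (inducedT f) (\<lambda>x. - (b / 2) * fz x) q = 0"
  unfolding laplacian_gT[OF q] closed[OF q] by simp

definition pf where "pf q = proj_C2 (f q)"

lemma d_pf: assumes q: "q \<in> U" shows "Df pf q e = dc e q"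
  using Df_eqI[OF d_fc[OF q]] unfolding pf_def[abs_def] fc_def[abs_def] by simp

lemma inducedC_eq: assumes q: "q \<in> U" shows "inducedC pf q e e' = G e e' q"
  unfolding inducedC_def d_pf[OF q] G_def by (simp add: inner_prod_def inner_complex_def hp_def)

lemma area_inducedC: assumes q: "q \<in> U" shows "area (inducedC pf) q = r q"
  unfolding area_def inducedC_eq[OF q] r_eq[OF q, symmetric] dG_def ..

lemma pf_Lagrangian: assumes q: "q \<in> U"
  shows "let (v1, v2) = Df pf q e; (w1, w2) = Df pf q e' in Im (cnj v1 * w1 + cnj v2 * w2) = 0"
  using lag[OF q, of e e'] unfolding d_pf[OF q] by (cases "dc e q", cases "dc e' q") (simp add: hp_def)

lemma pf_angle: assumes q: "q \<in> U"
  shows "let (v1, v2) = Df pf q e1; (w1, w2) = Df pf q e2 in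
    v1 * w2 - v2 * w1 = cis ((b / 2) * fz q - \<theta>) * of_real (area (inducedC pf) q)"
  using angle[OF q] unfolding d_pf[OF q] area_inducedC[OF q]
  by (cases "dc e1 q", cases "dc e2 q") (simp add: cdet_def)

lemma pf_smooth: "smooth_on U pf"
  unfolding pf_def[abs_def] by (rule smooth_on_bounded_linear[OF bounded_linear_proj_C2 smooth_f open_U])

lemma pf_inj: assumes q: "q \<in> U" shows "inj (Df pf q)"
proof -
  have "linear (Df pf q)" by (rule Df_linear[OF smooth_on_differentiable[OF pf_smooth q]])
  moreover have "e = 0" if "Df pf q e = 0" for e
    using that dc_nonzero[OF q] unfolding d_pf[OF q] by blast
  ultimately show ?thesis using linear_injective_0 by blast
qed

lemma pf_harmonic: assumes q: "q \<in> U"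
  shows "laplacian (inducedC pf) (\<lambda>x. (b / 2) * fz x - \<theta>) q = 0"
proof -
  have "Df (\<lambda>x. (b / 2) * fz x - \<theta>) x e = (b / 2) * dz e x" if x: "x \<in> U" for x e
  proof -
    have "((\<lambda>x. (b / 2) * fz x - \<theta>) has_derivative (\<lambda>e. (b / 2) * dz e x - 0)) (at x)"
      by (intro has_derivative_diff has_derivative_const bounded_linear.has_derivative[OF bounded_linear_mult_right d_fz[OF x]])
    then show ?thesis by (simp add: Df_eqI)
  qed
  from laplacian_scaled[OF q, of "inducedC pf" 1 "\<lambda>x. (b / 2) * fz x - \<theta>", OF _ _ this] closed[OF q]
  show ?thesis by (simp add: inducedC_eq)
qed

end

lemma laplacian_cong:
  assumes "open U" "q \<in> U" "\<And>x. x \<in> U \<Longrightarrow> u x = v x"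
  shows "laplacian h u q = laplacian h v q"
proof -
  have d: "Df u x = Df v x" if "x \<in> U" for x by (rule Df_cong_open[OF assms(1) that assms(3)])
  have "Df (\<lambda>x. (h x e2 e2 * Df u x e1 - h x e1 e2 * Df u x e2) / area h x) q = Df (\<lambda>x. (h x e2 e2 * Df v x e1 - h x e1 e2 * Df v x e2) / area h x) q"
    "Df (\<lambda>x. (h x e1 e1 * Df u x e2 - h x e1 e2 * Df u x e1) / area h x) q = Df (\<lambda>x. (h x e1 e1 * Df v x e2 - h x e1 e2 * Df v x e1) / area h x) q"
    by (rule Df_cong_open[OF assms(1,2)], simp add: d)+
  then show ?thesis unfolding laplacian_def by simp
qed

lemma model_chart_subset:
  assumes "model_chart UNIV f b \<theta> r" "open U"
  shows "model_chart U f b \<theta> r"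
proof -
  interpret m: model_chart UNIV f b \<theta> r by fact
  show ?thesis
  proof
    show "smooth_on U f" by (rule smooth_on_subset[OF m.smooth_f]) simp
  qed (use assms(2) m.imm m.leg m.r m.angle m.closed in auto)
qed

text \<open>The function \<alpha> is the multiple of the height that
  \<open>self_similar_angle\<close> dictates; \<theta> is left to match the phase of the
  model.\<close>

lemma harmonic_self_shrinkerI:
  assumes "b < 0" "\<And>U \<phi>. (U, \<phi>) \<in> \<A> \<Longrightarrow> \<exists>r. model_chart U (F \<circ> \<phi>) b \<theta> r"
  shows "harmonic_self_shrinker \<A> F (\<lambda>p. - (b / 2) * ht (F p)) \<theta> b"
proof -
  define \<alpha> where "\<alpha> = (\<lambda>p. - (b / 2) * ht (F p))"
  have chart: "smooth_on U (F \<circ> \<phi>) \<and> smooth_on U (\<alpha> \<circ> \<phi>) \<and> smooth_on U ((\<lambda>p. \<alpha> p + \<theta>) \<circ> \<phi>) \<and>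
     (\<forall>q\<in>U. inj (Df (F \<circ> \<phi>) q) \<and> (\<forall>e. eta (F (\<phi> q)) (Df (F \<circ> \<phi>) q e) = 0) \<and>
        OmegaT (Df (F \<circ> \<phi>) q e1) (Df (F \<circ> \<phi>) q e2) =
          exp (- \<i> * of_real (\<alpha> (\<phi> q) + \<theta>)) * of_real (area (induced (F \<circ> \<phi>)) q) \<and>
        laplacian (inducedT (F \<circ> \<phi>)) (\<alpha> \<circ> \<phi>) q = 0 \<and>
        mean_curvature (F \<circ> \<phi>) q - (2 * \<alpha> (\<phi> q)) *\<^sub>R xi = b *\<^sub>R normal_part (F \<circ> \<phi>) q (X (F (\<phi> q))))"
    if c: "(U, \<phi>) \<in> \<A>" for U \<phi>
  proof -
    obtain r where "model_chart U (F \<circ> \<phi>) b \<theta> r" using assms(2)[OF c] by blast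
    then interpret m: model_chart U "F \<circ> \<phi>" b \<theta> r .
    have a: "\<alpha> (\<phi> q) = - (b / 2) * m.fz q" for q by (simp add: \<alpha>_def m.fz_def)
    have a': "\<alpha> \<circ> \<phi> = (\<lambda>x. - (b / 2) * m.fz x)" "(\<lambda>p. \<alpha> p + \<theta>) \<circ> \<phi> = (\<lambda>x. - (b / 2) * m.fz x + \<theta>)" using a by auto
    have sz: "smooth_on U m.fz"
      unfolding m.fz_def[abs_def] by (rule smooth_on_bounded_linear[OF bounded_linear_ht m.smooth_f m.open_U])
    have s: "smooth_on U (\<lambda>x. - (b / 2) * m.fz x)" "smooth_on U (\<lambda>x. - (b / 2) * m.fz x + \<theta>)"
      by (intro smooth_on_add smooth_on_mult smooth_on_const sz m.open_U)+
    show ?thesis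
      unfolding a' unfolding a
      using m.smooth_f s m.imm m.leg m.OmegaT_model m.harmonic_model m.self_similar_model by (simp only: o_apply) blast
  qed
  show ?thesis
    unfolding harmonic_self_shrinker_def legendrian_immersion_def smooth_immersion_def legendre_angle_def
      smooth_function_def harmonic_gT_def self_similar_def \<alpha>_def[symmetric]
    using chart assms(1) by blast
qed

lemma hamiltonian_stationaryI:
  assumes "\<And>U \<phi>. (U, \<phi>) \<in> \<A> \<Longrightarrow> \<exists>r. model_chart U (F \<circ> \<phi>) b \<theta> r"
  shows "hamiltonian_stationary_lagrangian \<A> (proj_C2 \<circ> F)"
proof -
  define \<beta> where "\<beta> = (\<lambda>p. (b / 2) * ht (F p) - \<theta>)"
  have chart: "smooth_on U (proj_C2 \<circ> F \<circ> \<phi>) \<and> smooth_on U (\<beta> \<circ> \<phi>) \<and>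
     (\<forall>q\<in>U. inj (Df (proj_C2 \<circ> F \<circ> \<phi>) q) \<and>
       (\<forall>e e'. let (v1, v2) = Df (proj_C2 \<circ> F \<circ> \<phi>) q e; (w1, w2) = Df (proj_C2 \<circ> F \<circ> \<phi>) q e' in Im (cnj v1 * w1 + cnj v2 * w2) = 0) \<and>
       (let (v1, v2) = Df (proj_C2 \<circ> F \<circ> \<phi>) q e1; (w1, w2) = Df (proj_C2 \<circ> F \<circ> \<phi>) q e2 in
          v1 * w2 - v2 * w1 = cis (\<beta> (\<phi> q)) * of_real (area (inducedC (proj_C2 \<circ> F \<circ> \<phi>)) q)) \<and>
       laplacian (inducedC (proj_C2 \<circ> F \<circ> \<phi>)) (\<beta> \<circ> \<phi>) q = 0)"
    if c: "(U, \<phi>) \<in> \<A>" for U \<phi>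
  proof -
    obtain r where "model_chart U (F \<circ> \<phi>) b \<theta> r" using assms[OF c] by blast
    then interpret m: model_chart U "F \<circ> \<phi>" b \<theta> r .
    have p: "proj_C2 \<circ> F \<circ> \<phi> = m.pf" by (auto simp: m.pf_def)
    have a: "\<beta> (\<phi> q) = (b / 2) * m.fz q - \<theta>" for q by (simp add: \<beta>_def m.fz_def)
    have a': "\<beta> \<circ> \<phi> = (\<lambda>x. (b / 2) * m.fz x - \<theta>)" using a by auto
    have sz: "smooth_on U m.fz"
      unfolding m.fz_def[abs_def] by (rule smooth_on_bounded_linear[OF bounded_linear_ht m.smooth_f m.open_U])
    have s: "smooth_on U (\<lambda>x. (b / 2) * m.fz x - \<theta>)"
      by (intro smooth_on_diff smooth_on_mult smooth_on_const sz m.open_U)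
    show ?thesis
      unfolding p a' unfolding a
      using m.pf_smooth s m.pf_inj m.pf_Lagrangian m.pf_angle m.pf_harmonic by blast
  qed
  show ?thesis
    unfolding hamiltonian_stationary_lagrangian_def lagrangian_immersion_def smooth_immersion_def lagrangian_angle_def smooth_function_def
    by (intro conjI exI[of _ \<beta>]) (use chart in blast)+
qed

lemma smooth_immersionI_model:
  assumes "\<And>U \<phi>. (U, \<phi>) \<in> \<A> \<Longrightarrow> \<exists>b \<theta> r. model_chart U (F \<circ> \<phi>) b \<theta> r"
  shows "smooth_immersion \<A> F"
  unfolding smooth_immersion_def
proof (intro ballI, clarify)
  fix U \<phi> assume "(U, \<phi>) \<in> \<A>"
  then obtain b \<theta> r where "model_chart U (F \<circ> \<phi>) b \<theta> r" using assms by blast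
  then interpret m: model_chart U "F \<circ> \<phi>" b \<theta> r .
  show "smooth_on U (F \<circ> \<phi>) \<and> (\<forall>q\<in>U. inj (Df (F \<circ> \<phi>) q))" using m.smooth_f m.imm by blast
qed

lemma Df_invariant:
  fixes H :: "R2 \<Rightarrow> real"
  assumes "H differentiable (at q)"
  shows "(\<And>s s' t. H (s, t) = H (s', t)) \<Longrightarrow> Df H q e1 = 0" "(\<And>s t t'. H (s, t) = H (s, t')) \<Longrightarrow> Df H q e2 = 0"
proof -
  have main: "Df H q e = 0" if "\<And>s. H (q + s *\<^sub>R e) = H q" for e
  proof -
    have "((\<lambda>s. H (q + s *\<^sub>R e)) has_real_derivative Df H (q + 0 *\<^sub>R e) e) (at 0)"
      by (rule DERIV_along_line) (use assms in simp)
    then have "((\<lambda>s. H q) has_real_derivative Df H q e) (at 0)" unfolding that by simp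
    then show ?thesis using DERIV_const DERIV_unique by blast
  qed
  obtain x y where q: "q = (x, y)" by (cases q)
  show "Df H q e1 = 0" if "\<And>s s' t. H (s, t) = H (s', t)"
    by (rule main) (use that[of "x + _" y x] in \<open>simp add: q\<close>)
  show "Df H q e2 = 0" if "\<And>s t t'. H (s, t) = H (s, t')"
    by (rule main) (use that[of x "y + _" y] in \<open>simp add: q\<close>)
qed

text \<open>\<open>inv1\<close> makes \<open>Qf\<close> independent of the first variable and
  \<open>inv2\<close> makes \<open>Pf\<close> independent of the second, so both terms in the
  closedness condition are zero.\<close>

lemma explicit_model_chart:
  fixes f F1 F2 :: "R2 \<Rightarrow> R5"
  assumes sm: "smooth_on UNIV f"
    and D: "\<And>q. (f has_derivative (\<lambda>e. fst e *\<^sub>R F1 q + snd e *\<^sub>R F2 q)) (at q)"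
    and leg: "\<And>q. eta (f q) (F1 q) = 0" "\<And>q. eta (f q) (F2 q) = 0"
    and angle: "\<And>q. cdet (proj_C2 (F1 q)) (proj_C2 (F2 q)) = cis ((b / 2) * ht (f q) - \<theta>) * of_real (r q)"
    and r: "\<And>q. r q > 0"
    and h: "\<And>q. Re (hp (proj_C2 (F1 q)) (proj_C2 (F1 q))) = h11 q" "\<And>q. Re (hp (proj_C2 (F1 q)) (proj_C2 (F2 q))) = h12 q"
      "\<And>q. Re (hp (proj_C2 (F2 q)) (proj_C2 (F2 q))) = h22 q"
    and z: "\<And>q. ht (F1 q) = z1" "\<And>q. ht (F2 q) = z2"
    and inv1: "\<And>s s' t. (h22 (s, t) * z1 - h12 (s, t) * z2) / sqrt (h11 (s, t) * h22 (s, t) - (h12 (s, t))\<^sup>2)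
      = (h22 (s', t) * z1 - h12 (s', t) * z2) / sqrt (h11 (s', t) * h22 (s', t) - (h12 (s', t))\<^sup>2)"
    and inv2: "\<And>s t t'. (h12 (s, t) * z1 - h11 (s, t) * z2) / sqrt (h11 (s, t) * h22 (s, t) - (h12 (s, t))\<^sup>2)
      = (h12 (s, t') * z1 - h11 (s, t') * z2) / sqrt (h11 (s, t') * h22 (s, t') - (h12 (s, t'))\<^sup>2)"
  shows "model_chart UNIV f b \<theta> r"
proof -
  have Df: "Df f q e = fst e *\<^sub>R F1 q + snd e *\<^sub>R F2 q" for q e
    using Df_eqI[OF D] by simp
  have nz: "cdet (proj_C2 (F1 q)) (proj_C2 (F2 q)) \<noteq> 0" for q
    unfolding angle using r[of q] by simp
  have lin: "linear (Df f q)" for q using has_derivative_linear[OF D] Df_eqI[OF D] by simp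
  interpret l: legendrian_chart UNIV f
  proof
    show "inj (Df f q)" for q
    proof -
      have "e = 0" if "Df f q e = 0" for e
      proof -
        have p: "fst e *\<^sub>R proj_C2 (F1 q) + snd e *\<^sub>R proj_C2 (F2 q) = 0"
          using arg_cong[OF that, of proj_C2] unfolding Df by simp
        have "cdet (fst e *\<^sub>R proj_C2 (F1 q) + snd e *\<^sub>R proj_C2 (F2 q)) (proj_C2 (F2 q)) = of_real (fst e) * cdet (proj_C2 (F1 q)) (proj_C2 (F2 q))"
          "cdet (proj_C2 (F1 q)) (fst e *\<^sub>R proj_C2 (F1 q) + snd e *\<^sub>R proj_C2 (F2 q)) = of_real (snd e) * cdet (proj_C2 (F1 q)) (proj_C2 (F2 q))"
          unfolding cdet_simps by simp_all
        then have "fst e = 0" "snd e = 0" unfolding p using nz by (simp_all add: cdet_def)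
        then show ?thesis by (simp add: prod_eq_iff)
      qed
      then show ?thesis using lin linear_injective_0 by blast
    qed
    show "eta (f q) (Df f q e) = 0" for q e
      unfolding Df eta_simps leg by simp
  qed (use sm in auto)
  have dc: "l.dc e1 q = proj_C2 (F1 q)" "l.dc e2 q = proj_C2 (F2 q)" and dz: "l.dz e1 q = z1" "l.dz e2 q = z2" for q
    unfolding l.dc_def l.dz_def Df using z by simp_all
  have G: "l.G e1 e1 q = h11 q" "l.G e1 e2 q = h12 q" "l.G e2 e2 q = h22 q" for q
    unfolding l.G_def dc h by simp_all
  show ?thesis
  proof
    show "r q > 0" for q by (rule r)
    show "cdet (l.dc e1 q) (l.dc e2 q) = cis ((b / 2) * l.fz q - \<theta>) * of_real (r q)" for q
      unfolding dc angle l.fz_def ..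
    show "Df l.Qf q e1 = Df l.Pf q e2" for q
    proof -
      have "Df l.Qf q e1 = 0"
        by (rule Df_invariant(1)[OF l.diff_QP(1)]) (simp_all add: l.Qf_def l.sG_def l.dG_def G dz inv1)
      moreover have "Df l.Pf q e2 = 0"
        by (rule Df_invariant(2)[OF l.diff_QP(2)]) (simp_all add: l.Pf_def l.sG_def l.dG_def G dz inv2)
      ultimately show ?thesis by simp
    qed
  qed
qed

subsection \<open>The models\<close>

text \<open>Orbits of a curve in a Lagrangian plane under a one-parameter group of unitary diagonal matrices.\<close>

definition rot :: "complex \<Rightarrow> (real \<Rightarrow> real) \<Rightarrow> (real \<Rightarrow> real) \<Rightarrow> real \<Rightarrow> real \<Rightarrow> real \<Rightarrow> real \<Rightarrow> R2 \<Rightarrow> R5" where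
  "rot \<epsilon> \<rho>1 \<rho>2 m1 m2 m0 c q = (\<epsilon> * of_real (\<rho>1 (snd q)) * cis (m1 * fst q), of_real (\<rho>2 (snd q)) * cis (m2 * fst q), m0 * fst q + c)"

lemma cnj_cis_mult: "cnj (cis t) * cis t = 1"
  by (simp add: cis_cnj cis_mult)

lemma hp_rot:
  assumes "cnj \<epsilon> * \<epsilon> = 1"
  shows "hp (\<epsilon> * x * cis s, y * cis t) (\<epsilon> * x' * cis s, y' * cis t) = cnj x * x' + cnj y * y'"
proof -
  have "hp (\<epsilon> * x * cis s, y * cis t) (\<epsilon> * x' * cis s, y' * cis t)
    = (cnj \<epsilon> * \<epsilon>) * (cnj (cis s) * cis s) * (cnj x * x') + (cnj (cis t) * cis t) * (cnj y * y')"
    by (simp add: hp_def algebra_simps)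
  then show ?thesis unfolding assms cnj_cis_mult by simp
qed

lemma cdet_rot: "cdet (\<epsilon> * x * cis s, y * cis t) (\<epsilon> * x' * cis s, y' * cis t) = \<epsilon> * (x * y' - y * x') * cis (s + t)"
  by (simp add: cdet_def cis_mult[symmetric] algebra_simps)

text \<open>\<open>conic\<close> is the Legendrian condition along the orbits, \<open>pos\<close>
  the positivity of the area density, and \<open>trace\<close> says that the angle advances by b / 2
  per unit of height.\<close>

locale rot_data =
  fixes \<epsilon> :: complex and \<rho>1 \<rho>2 \<rho>1' \<rho>2' :: "real \<Rightarrow> real" and m1 m2 m0 b :: real
  assumes eps: "cnj \<epsilon> * \<epsilon> = 1"
    and sm: "smooth_on UNIV \<rho>1" "smooth_on UNIV \<rho>2"
    and der: "\<And>t. (\<rho>1 has_real_derivative \<rho>1' t) (at t)" "\<And>t. (\<rho>2 has_real_derivative \<rho>2' t) (at t)"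
    and conic: "\<And>t. m1 * (\<rho>1 t)\<^sup>2 + m2 * (\<rho>2 t)\<^sup>2 = - 2 * m0"
    and conic': "\<And>t. m1 * \<rho>1 t * \<rho>1' t + m2 * \<rho>2 t * \<rho>2' t = 0"
    and pos: "\<And>t. m1 * \<rho>1 t * \<rho>2' t - m2 * \<rho>2 t * \<rho>1' t > 0"
    and trace: "m1 + m2 = b / 2 * m0"
begin

definition Rs where "Rs q = (\<epsilon> * (\<i> * of_real (m1 * \<rho>1 (snd q))) * cis (m1 * fst q), (\<i> * of_real (m2 * \<rho>2 (snd q))) * cis (m2 * fst q), m0)"
definition Rt where "Rt q = (\<epsilon> * of_real (\<rho>1' (snd q)) * cis (m1 * fst q), of_real (\<rho>2' (snd q)) * cis (m2 * fst q), 0 :: real)"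

lemma proj_R: "proj_C2 (Rs q) = (\<epsilon> * (\<i> * of_real (m1 * \<rho>1 (snd q))) * cis (m1 * fst q), (\<i> * of_real (m2 * \<rho>2 (snd q))) * cis (m2 * fst q))"
  "proj_C2 (Rt q) = (\<epsilon> * of_real (\<rho>1' (snd q)) * cis (m1 * fst q), of_real (\<rho>2' (snd q)) * cis (m2 * fst q))"
  "proj_C2 (rot \<epsilon> \<rho>1 \<rho>2 m1 m2 m0 c q) = (\<epsilon> * of_real (\<rho>1 (snd q)) * cis (m1 * fst q), of_real (\<rho>2 (snd q)) * cis (m2 * fst q))"
  "ht (Rs q) = m0" "ht (Rt q) = 0" "ht (rot \<epsilon> \<rho>1 \<rho>2 m1 m2 m0 c q) = m0 * fst q + c"
  by (simp_all add: Rs_def Rt_def rot_def ht_def)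

lemma real_chain: "(\<rho> has_real_derivative d) (at (snd q)) \<Longrightarrow> ((\<lambda>q. \<rho> (snd q)) has_derivative (\<lambda>e. d * snd e)) (at q)" for q :: R2
  using diff_chain_at[OF has_derivative_snd[OF has_derivative_ident], of \<rho> "(*) d" q]
  by (simp add: has_field_derivative_def o_def)

lemma d_rot: "(rot \<epsilon> \<rho>1 \<rho>2 m1 m2 m0 c has_derivative (\<lambda>e. fst e *\<^sub>R Rs q + snd e *\<^sub>R Rt q)) (at q)"
proof -
  have f: "((\<lambda>q. m * fst q) has_derivative (\<lambda>e. m * fst e)) (at q)" for m :: real and q :: R2
    by (auto intro!: derivative_eq_intros)
  have c: "((\<lambda>q. u * of_real (\<rho> (snd q)) * cis (m * fst q)) has_derivative
     (\<lambda>e. u * of_real (\<rho> (snd q)) * (\<i> * of_real (m * fst e) * cis (m * fst q)) + u * of_real (d * snd e) * cis (m * fst q))) (at q)"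
    if "(\<rho> has_real_derivative d) (at (snd q))" for u m \<rho> d and q :: R2
    by (intro has_derivative_mult has_derivative_cis f bounded_linear.has_derivative[OF bounded_linear_mult_right]
      bounded_linear.has_derivative[OF bounded_linear_of_real] real_chain that)
  have z: "((\<lambda>q. m0 * fst q + c) has_derivative (\<lambda>e. m0 * fst e + 0)) (at q)"
    by (intro has_derivative_add f has_derivative_const)
  have "((\<lambda>q. (\<epsilon> * of_real (\<rho>1 (snd q)) * cis (m1 * fst q), 1 * of_real (\<rho>2 (snd q)) * cis (m2 * fst q), m0 * fst q + c)) has_derivative
     (\<lambda>e. (\<epsilon> * of_real (\<rho>1 (snd q)) * (\<i> * of_real (m1 * fst e) * cis (m1 * fst q)) + \<epsilon> * of_real (\<rho>1' (snd q) * snd e) * cis (m1 * fst q),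
       1 * of_real (\<rho>2 (snd q)) * (\<i> * of_real (m2 * fst e) * cis (m2 * fst q)) + 1 * of_real (\<rho>2' (snd q) * snd e) * cis (m2 * fst q),
       m0 * fst e + 0))) (at q)"
    by (intro has_derivative_Pair c z der)
  then show ?thesis
    unfolding rot_def[abs_def] mult_1_left
    by (rule has_derivative_eq_rhs) (auto simp: Rs_def Rt_def scaleR_conv_of_real algebra_simps)
qed

lemma smooth_rot: "smooth_on UNIV (rot \<epsilon> \<rho>1 \<rho>2 m1 m2 m0 c)"
proof -
  have "smooth_on UNIV (\<lambda>q::R2. \<rho>1 (snd q))" "smooth_on UNIV (\<lambda>q::R2. \<rho>2 (snd q))"
    by (rule smooth_on_compose[where T = UNIV]; use sm in \<open>simp add: smooth_on_snd smooth_on_id\<close>)+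
  then show ?thesis
    unfolding rot_def[abs_def] by (intro smooth_on_intros open_UNIV)
qed

lemma eta_R: "eta (rot \<epsilon> \<rho>1 \<rho>2 m1 m2 m0 c q) (Rs q) = 0" "eta (rot \<epsilon> \<rho>1 \<rho>2 m1 m2 m0 c q) (Rt q) = 0"
proof -
  have "Im (hp (proj_C2 (rot \<epsilon> \<rho>1 \<rho>2 m1 m2 m0 c q)) (proj_C2 (Rs q))) = m1 * (\<rho>1 (snd q))\<^sup>2 + m2 * (\<rho>2 (snd q))\<^sup>2"
    unfolding proj_R hp_rot[OF eps] by (simp add: power2_eq_square algebra_simps)
  then show "eta (rot \<epsilon> \<rho>1 \<rho>2 m1 m2 m0 c q) (Rs q) = 0" unfolding eta_eq proj_R(4) conic by simp
  show "eta (rot \<epsilon> \<rho>1 \<rho>2 m1 m2 m0 c q) (Rt q) = 0"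
    unfolding eta_eq proj_R hp_rot[OF eps] by simp
qed

lemma hp_R: "Re (hp (proj_C2 (Rs q)) (proj_C2 (Rs q))) = (m1 * \<rho>1 (snd q))\<^sup>2 + (m2 * \<rho>2 (snd q))\<^sup>2"
  "Re (hp (proj_C2 (Rs q)) (proj_C2 (Rt q))) = 0" "Re (hp (proj_C2 (Rt q)) (proj_C2 (Rs q))) = 0"
  "Re (hp (proj_C2 (Rt q)) (proj_C2 (Rt q))) = (\<rho>1' (snd q))\<^sup>2 + (\<rho>2' (snd q))\<^sup>2"
  unfolding proj_R hp_rot[OF eps] by (simp_all add: power2_eq_square)

lemma cdet_R: "cdet (proj_C2 (Rs q)) (proj_C2 (Rt q)) = \<i> * \<epsilon> * cis (b / 2 * m0 * fst q) *
    of_real (m1 * \<rho>1 (snd q) * \<rho>2' (snd q) - m2 * \<rho>2 (snd q) * \<rho>1' (snd q))"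
  unfolding proj_R cdet_rot trace[symmetric] by (simp add: algebra_simps)

text \<open>The complex area form has phase \<open>\<i> * \<epsilon>\<close> at orbit parameter 0,
  where the height is \<open>c\<close>; comparison with the required phase there is the only
  condition on \<theta>.\<close>

lemma rot_model:
  assumes "\<i> * \<epsilon> = cis (b / 2 * c - \<theta>)"
  shows "\<exists>r. model_chart UNIV (rot \<epsilon> \<rho>1 \<rho>2 m1 m2 m0 c) b \<theta> r"
proof (rule exI, rule explicit_model_chart[OF smooth_rot d_rot eta_R])
  show "cdet (proj_C2 (Rs q)) (proj_C2 (Rt q)) = cis (b / 2 * ht (rot \<epsilon> \<rho>1 \<rho>2 m1 m2 m0 c q) - \<theta>) *
     of_real (m1 * \<rho>1 (snd q) * \<rho>2' (snd q) - m2 * \<rho>2 (snd q) * \<rho>1' (snd q))" for q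
    unfolding cdet_R assms cis_mult unfolding proj_R(6) by (simp add: algebra_simps)
  show "Re (hp (proj_C2 (Rs q)) (proj_C2 (Rs q))) = (m1 * \<rho>1 (snd q))\<^sup>2 + (m2 * \<rho>2 (snd q))\<^sup>2" "Re (hp (proj_C2 (Rs q)) (proj_C2 (Rt q))) = 0" "Re (hp (proj_C2 (Rt q)) (proj_C2 (Rt q))) = (\<rho>1' (snd q))\<^sup>2 + (\<rho>2' (snd q))\<^sup>2" for q
    using hp_R[of "q"] by simp_all
  show "ht (Rs q) = m0" "ht (Rt q) = 0" for q by (rule proj_R)+
  show "m1 * \<rho>1 (snd q) * \<rho>2' (snd q) - m2 * \<rho>2 (snd q) * \<rho>1' (snd q) > 0" for q by (rule pos)
qed simp_all

text \<open>With the curve parameter first, the orientation is reversed, whence the sign in front of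
  \<open>\<i> * \<epsilon>\<close>. This is the order in which the circle comes before the
  line.\<close>

lemma rot_model_swap:
  assumes "- \<i> * \<epsilon> = cis (b / 2 * c - \<theta>)"
  shows "\<exists>r. model_chart UNIV (\<lambda>q. rot \<epsilon> \<rho>1 \<rho>2 m1 m2 m0 c (snd q, fst q)) b \<theta> r"
proof (rule exI, rule explicit_model_chart[where ?F1.0 = "\<lambda>q. Rt (snd q, fst q)" and ?F2.0 = "\<lambda>q. Rs (snd q, fst q)"])
  show "smooth_on UNIV (\<lambda>q. rot \<epsilon> \<rho>1 \<rho>2 m1 m2 m0 c (snd q, fst q))"
    by (rule smooth_on_compose[OF smooth_rot]) (auto intro!: smooth_on_intros)
  show "((\<lambda>q. rot \<epsilon> \<rho>1 \<rho>2 m1 m2 m0 c (snd q, fst q)) has_derivative (\<lambda>e. fst e *\<^sub>R Rt (snd q, fst q) + snd e *\<^sub>R Rs (snd q, fst q))) (at q)" for q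
  proof -
    have "((\<lambda>q::R2. (snd q, fst q)) has_derivative (\<lambda>e. (snd e, fst e))) (at q)"
      by (auto intro!: derivative_eq_intros)
    from diff_chain_at[OF this d_rot] show ?thesis by (simp add: o_def add.commute)
  qed
  show "eta (rot \<epsilon> \<rho>1 \<rho>2 m1 m2 m0 c (snd q, fst q)) (Rt (snd q, fst q)) = 0"
    "eta (rot \<epsilon> \<rho>1 \<rho>2 m1 m2 m0 c (snd q, fst q)) (Rs (snd q, fst q)) = 0" for q
    by (rule eta_R)+
  show "cdet (proj_C2 (Rt (snd q, fst q))) (proj_C2 (Rs (snd q, fst q))) = cis (b / 2 * ht (rot \<epsilon> \<rho>1 \<rho>2 m1 m2 m0 c (snd q, fst q)) - \<theta>) *
     of_real (m1 * \<rho>1 (fst q) * \<rho>2' (fst q) - m2 * \<rho>2 (fst q) * \<rho>1' (fst q))" for q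
  proof -
    have "cdet (proj_C2 (Rt (snd q, fst q))) (proj_C2 (Rs (snd q, fst q))) = (- \<i> * \<epsilon>) * cis (b / 2 * m0 * snd q) *
       of_real (m1 * \<rho>1 (fst q) * \<rho>2' (fst q) - m2 * \<rho>2 (fst q) * \<rho>1' (fst q))"
      unfolding cdet_swap[of "proj_C2 (Rt (snd q, fst q))"] cdet_R by simp
    then show ?thesis unfolding assms cis_mult unfolding proj_R(6) by (simp add: algebra_simps)
  qed
  show "Re (hp (proj_C2 (Rt (snd q, fst q))) (proj_C2 (Rt (snd q, fst q)))) = (\<rho>1' (fst q))\<^sup>2 + (\<rho>2' (fst q))\<^sup>2" "Re (hp (proj_C2 (Rt (snd q, fst q))) (proj_C2 (Rs (snd q, fst q)))) = 0" "Re (hp (proj_C2 (Rs (snd q, fst q))) (proj_C2 (Rs (snd q, fst q)))) = (m1 * \<rho>1 (fst q))\<^sup>2 + (m2 * \<rho>2 (fst q))\<^sup>2" for q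
    using hp_R[of "(snd q, fst q)"] by simp_all
  show "ht (Rt (snd q, fst q)) = 0" "ht (Rs (snd q, fst q)) = m0" for q by (rule proj_R)+
  show "m1 * \<rho>1 (fst q) * \<rho>2' (fst q) - m2 * \<rho>2 (fst q) * \<rho>1' (fst q) > 0" for q by (rule pos)
qed simp_all

end

text \<open>A model has a fixed phase \<open>w\<close>, and \<open>b / 2 * c - \<theta> = w\<close>
  ties the height offset to the normalization of the angle; since b is nonzero, either of the two
  may be prescribed.\<close>

lemma shrinker_familyI:
  assumes "b < 0" "\<And>c \<theta> U \<phi>. b / 2 * c - \<theta> = w \<Longrightarrow> (U, \<phi>) \<in> \<A> \<Longrightarrow> \<exists>r. model_chart U (G c \<circ> \<phi>) b \<theta> r"
  shows "shrinker_family \<A> G b"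
proof -
  have c: "b / 2 * c - (b / 2 * c - w) = w" for c by simp
  have t: "b / 2 * ((w + \<theta>) * 2 / b) - \<theta> = w" for \<theta> using assms(1) by (simp add: field_simps)
  show ?thesis
    unfolding shrinker_family_def
  proof (intro conjI allI)
    fix c show "hamiltonian_stationary_lagrangian \<A> (proj_C2 \<circ> G c)"
      by (rule hamiltonian_stationaryI[OF assms(2)[OF c]])
    show "\<exists>\<alpha> \<theta>. harmonic_self_shrinker \<A> (G c) \<alpha> \<theta> b"
      using harmonic_self_shrinkerI[OF assms(1) assms(2)[OF c]] by blast
  next
    fix \<theta> show "\<exists>c \<alpha>. harmonic_self_shrinker \<A> (G c) \<alpha> \<theta> b"
      using harmonic_self_shrinkerI[OF assms(1) assms(2)[OF t]] by blast
  qed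
qed

section \<open>The individual models as solutions\<close>

definition rad :: "real \<Rightarrow> real" where "rad a = 1 / sqrt (- 2 * a)"

lemma rad: assumes "a < 0" shows "rad a > 0" "(rad a)\<^sup>2 = - (1 / (2 * a))"
  using assms by (simp_all add: rad_def power_divide)

lemma model_C_rot: "model_C a c = rot 1 (\<lambda>t. rad a) (\<lambda>t. t) 1 0 (1 / (4 * a)) c"
  by (rule ext) (auto simp: rot_def rad_def)

lemma model_Upsilon_rot: "model_Upsilon \<gamma> a c = rot (- \<i>) (\<lambda>t. sin \<gamma> * rad a * cosh t) (\<lambda>t. tan \<gamma> * rad a * sinh t)
    (1 / cos \<gamma>) (- cos \<gamma>) (sin \<gamma> * tan \<gamma> / (4 * a)) c"
  by (rule ext) (auto simp: rot_def rad_def)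

lemma model_Psi_rot: "model_Psi \<nu> a c \<circ> (\<lambda>(s, t). (cis s, t)) =
   (\<lambda>q. rot 1 (\<lambda>t. cosh \<nu> * rad a * cos t) (\<lambda>t. cosh \<nu> / sinh \<nu> * rad a * sin t) (1 / sinh \<nu>) (sinh \<nu>) (cosh \<nu> * (cosh \<nu> / sinh \<nu>) / (4 * a)) c (snd q, fst q))"
  by (rule ext) (auto simp: rot_def rad_def)

lemma smooth_real: "smooth_on UNIV (sin :: real \<Rightarrow> real)" "smooth_on UNIV (cos :: real \<Rightarrow> real)"
  "smooth_on UNIV (sinh :: real \<Rightarrow> real)" "smooth_on UNIV (cosh :: real \<Rightarrow> real)"
  using Ck_on_sin_cos Ck_on_sinh_cosh by (auto simp: smooth_on_def)

lemma rot_data_C: "a < 0 \<Longrightarrow> rot_data 1 (\<lambda>t. rad a) (\<lambda>t. t) (\<lambda>t. 0) (\<lambda>t. 1) 1 0 (1 / (4 * a)) (8 * a)"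
  by standard (auto simp: rad smooth_on_id intro!: derivative_eq_intros)

lemma rot_data_Upsilon:
  assumes "a < 0" "0 < \<gamma>" "\<gamma> < pi / 2"
  shows "rot_data (- \<i>) (\<lambda>t. sin \<gamma> * rad a * cosh t) (\<lambda>t. tan \<gamma> * rad a * sinh t) (\<lambda>t. sin \<gamma> * rad a * sinh t) (\<lambda>t. tan \<gamma> * rad a * cosh t)
    (1 / cos \<gamma>) (- cos \<gamma>) (sin \<gamma> * tan \<gamma> / (4 * a)) (8 * a)"
proof -
  have s: "sin \<gamma> > 0" "cos \<gamma> > 0" using assms sin_gt_zero[of \<gamma>] cos_gt_zero[of \<gamma>] by auto
  note r = rad[OF assms(1)]
  have ch: "(cosh t)\<^sup>2 = 1 + (sinh t)\<^sup>2" for t :: real using cosh_square_eq[of t] by simp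
  show ?thesis
  proof
    fix t
    have "1 / cos \<gamma> * (sin \<gamma> * rad a * cosh t)\<^sup>2 + - cos \<gamma> * (tan \<gamma> * rad a * sinh t)\<^sup>2 = (rad a)\<^sup>2 * (sin \<gamma>)\<^sup>2 / cos \<gamma> * ((cosh t)\<^sup>2 - (sinh t)\<^sup>2)"
      using s by (simp add: tan_def power_mult_distrib power_divide field_simps power2_eq_square)
    also have "\<dots> = - 2 * (sin \<gamma> * tan \<gamma> / (4 * a))"
      unfolding ch r using assms(1) by (simp add: tan_def power2_eq_square)
    finally show "1 / cos \<gamma> * (sin \<gamma> * rad a * cosh t)\<^sup>2 + - cos \<gamma> * (tan \<gamma> * rad a * sinh t)\<^sup>2 = - 2 * (sin \<gamma> * tan \<gamma> / (4 * a))" .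
    show "1 / cos \<gamma> * (sin \<gamma> * rad a * cosh t) * (sin \<gamma> * rad a * sinh t) + - cos \<gamma> * (tan \<gamma> * rad a * sinh t) * (tan \<gamma> * rad a * cosh t) = 0"
      using s by (simp add: tan_def)
    have "1 / cos \<gamma> * (sin \<gamma> * rad a * cosh t) * (tan \<gamma> * rad a * cosh t) - - cos \<gamma> * (tan \<gamma> * rad a * sinh t) * (sin \<gamma> * rad a * sinh t)
        = (rad a)\<^sup>2 * sin \<gamma> * tan \<gamma> * ((cosh t)\<^sup>2 / cos \<gamma> + cos \<gamma> * (sinh t)\<^sup>2)"
      by (simp add: power2_eq_square algebra_simps)
    also have "\<dots> > 0" 
      using s r(1) by (intro mult_pos_pos add_pos_nonneg divide_pos_pos) (auto simp: tan_def)
    finally show "1 / cos \<gamma> * (sin \<gamma> * rad a * cosh t) * (tan \<gamma> * rad a * cosh t) - - cos \<gamma> * (tan \<gamma> * rad a * sinh t) * (sin \<gamma> * rad a * sinh t) > 0" .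
    have "1 / cos \<gamma> + - cos \<gamma> = (1 - (cos \<gamma>)\<^sup>2) / cos \<gamma>" using s by (simp add: field_simps power2_eq_square)
    also have "\<dots> = sin \<gamma> * tan \<gamma>" unfolding sin_squared_eq[symmetric] by (simp add: tan_def power2_eq_square)
    finally show "1 / cos \<gamma> + - cos \<gamma> = 8 * a / 2 * (sin \<gamma> * tan \<gamma> / (4 * a))" using assms(1) by simp
    show "((\<lambda>t. sin \<gamma> * rad a * cosh t) has_real_derivative sin \<gamma> * rad a * sinh t) (at t)"
      "((\<lambda>t. tan \<gamma> * rad a * sinh t) has_real_derivative tan \<gamma> * rad a * cosh t) (at t)"
      by (auto intro!: derivative_eq_intros)
  next
    show "smooth_on UNIV (\<lambda>t. sin \<gamma> * rad a * cosh t)" "smooth_on UNIV (\<lambda>t. tan \<gamma> * rad a * sinh t)"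
      by (intro smooth_on_mult smooth_on_const smooth_real open_UNIV)+
  qed simp
qed

lemma rot_data_Psi:
  assumes "a < 0" "0 < \<nu>"
  shows "rot_data 1 (\<lambda>t. cosh \<nu> * rad a * cos t) (\<lambda>t. cosh \<nu> / sinh \<nu> * rad a * sin t) (\<lambda>t. - (cosh \<nu> * rad a * sin t)) (\<lambda>t. cosh \<nu> / sinh \<nu> * rad a * cos t)
    (1 / sinh \<nu>) (sinh \<nu>) (cosh \<nu> * (cosh \<nu> / sinh \<nu>) / (4 * a)) (8 * a)"
proof -
  have s: "sinh \<nu> > 0" "cosh \<nu> > 0" using assms by simp_all
  note r = rad[OF assms(1)]
  have alg: "1 / u * (v * d * y)\<^sup>2 + u * (v / u * d * x)\<^sup>2 = d\<^sup>2 * (v\<^sup>2 / u) * (x\<^sup>2 + y\<^sup>2)" if "u \<noteq> 0" for u v d x y :: real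
    using that by (simp add: field_simps power2_eq_square)
  have ch: "(cosh \<nu>)\<^sup>2 = 1 + (sinh \<nu>)\<^sup>2" using cosh_square_eq[of \<nu>] by simp
  show ?thesis
  proof
    fix t
    have "1 / sinh \<nu> * (cosh \<nu> * rad a * cos t)\<^sup>2 + sinh \<nu> * (cosh \<nu> / sinh \<nu> * rad a * sin t)\<^sup>2 = (rad a)\<^sup>2 * ((cosh \<nu>)\<^sup>2 / sinh \<nu>) * ((sin t)\<^sup>2 + (cos t)\<^sup>2)"
      using alg[of "sinh \<nu>" "cosh \<nu>" "rad a" "cos t" "sin t"] s by simp
    also have "\<dots> = - 2 * (cosh \<nu> * (cosh \<nu> / sinh \<nu>) / (4 * a))"
      unfolding r sin_cos_squared_add using assms(1) by (simp add: power2_eq_square)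
    finally show "1 / sinh \<nu> * (cosh \<nu> * rad a * cos t)\<^sup>2 + sinh \<nu> * (cosh \<nu> / sinh \<nu> * rad a * sin t)\<^sup>2 = - 2 * (cosh \<nu> * (cosh \<nu> / sinh \<nu>) / (4 * a))" .
    show "1 / sinh \<nu> * (cosh \<nu> * rad a * cos t) * - (cosh \<nu> * rad a * sin t) + sinh \<nu> * (cosh \<nu> / sinh \<nu> * rad a * sin t) * (cosh \<nu> / sinh \<nu> * rad a * cos t) = 0"
      using s by simp
    have "1 / sinh \<nu> * (cosh \<nu> * rad a * cos t) * (cosh \<nu> / sinh \<nu> * rad a * cos t) - sinh \<nu> * (cosh \<nu> / sinh \<nu> * rad a * sin t) * - (cosh \<nu> * rad a * sin t)
        = (rad a * cosh \<nu>)\<^sup>2 * ((cos t / sinh \<nu>)\<^sup>2 + (sin t)\<^sup>2)"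
      using s by (simp add: power2_eq_square field_simps)
    also have "\<dots> > 0"
    proof -
      have "(cos t / sinh \<nu>)\<^sup>2 + (sin t)\<^sup>2 \<noteq> 0"
        using s sin_zero_abs_cos_one[of t] by (auto simp: sum_power2_eq_zero_iff)
      then have "(cos t / sinh \<nu>)\<^sup>2 + (sin t)\<^sup>2 > 0" by (simp add: less_le)
      then show ?thesis using s r(1) by (intro mult_pos_pos) auto
    qed
    finally show "1 / sinh \<nu> * (cosh \<nu> * rad a * cos t) * (cosh \<nu> / sinh \<nu> * rad a * cos t) - sinh \<nu> * (cosh \<nu> / sinh \<nu> * rad a * sin t) * - (cosh \<nu> * rad a * sin t) > 0" .
    have "1 / sinh \<nu> + sinh \<nu> = (1 + (sinh \<nu>)\<^sup>2) / sinh \<nu>" using s by (simp add: field_simps power2_eq_square)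
    then show "1 / sinh \<nu> + sinh \<nu> = 8 * a / 2 * (cosh \<nu> * (cosh \<nu> / sinh \<nu>) / (4 * a))"
      unfolding ch[symmetric] using assms(1) by (simp add: power2_eq_square)
    show "((\<lambda>t. cosh \<nu> * rad a * cos t) has_real_derivative - (cosh \<nu> * rad a * sin t)) (at t)"
      "((\<lambda>t. cosh \<nu> / sinh \<nu> * rad a * sin t) has_real_derivative cosh \<nu> / sinh \<nu> * rad a * cos t) (at t)"
      using s by (auto intro!: derivative_eq_intros)
  next
    show "smooth_on UNIV (\<lambda>t. cosh \<nu> * rad a * cos t)" "smooth_on UNIV (\<lambda>t. cosh \<nu> / sinh \<nu> * rad a * sin t)"
      by (intro smooth_on_mult smooth_on_const smooth_real open_UNIV)+
  qed (use s in simp_all)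
qed

text \<open>The phase pi/2 is the argument of \<i> times the initial factor 1. In the same way
  Upsilon has 0 from \<i> (- \<i>), Psi has - pi/2 from its reversed orientation, and T has pi from
  its two factors \<i>.\<close>

lemma model_chart_C:
  assumes "a < 0" and \<theta>: "8 * a / 2 * c - \<theta> = pi / 2"
  shows "\<exists>r. model_chart UNIV (model_C a c) (8 * a) \<theta> r"
  unfolding model_C_rot by (rule rot_data.rot_model[OF rot_data_C[OF assms(1)]], unfold \<theta>, simp)

lemma model_chart_Upsilon:
  assumes "a < 0" "0 < \<gamma>" "\<gamma> < pi / 2" and \<theta>: "8 * a / 2 * c - \<theta> = 0"
  shows "\<exists>r. model_chart UNIV (model_Upsilon \<gamma> a c) (8 * a) \<theta> r"
  unfolding model_Upsilon_rot by (rule rot_data.rot_model[OF rot_data_Upsilon[OF assms(1-3)]], unfold \<theta>, simp)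

lemma model_chart_Psi:
  assumes "a < 0" "0 < \<nu>" and \<theta>: "8 * a / 2 * c - \<theta> = - (pi / 2)"
  shows "\<exists>r. model_chart UNIV (model_Psi \<nu> a c \<circ> (\<lambda>(s, t). (cis s, t))) (8 * a) \<theta> r"
  unfolding model_Psi_rot
  by (rule rot_data.rot_model_swap[OF rot_data_Psi[OF assms(1,2)]], unfold \<theta>, simp add: complex_eq_iff)

text \<open>Both coordinate directions rotate, so this parametrization is not of the form
  \<open>rot\<close>. Metric and height derivatives have constant coefficients, which makes the dual
  form constant.\<close>

lemma model_chart_T:
  assumes a: "a < 0" and \<theta>: "8 * a / 2 * c - \<theta> = pi"
  shows "\<exists>r. model_chart UNIV (model_T a c) (8 * a) \<theta> r"
proof -
  have T: "model_T a c = (\<lambda>q. (of_real (rad a) * cis (fst q), of_real (rad a) * cis (snd q), 1 / (4 * a) * (fst q + snd q) + c))"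
    by (rule ext) (auto simp: rad_def)
  define F1 where "F1 q = (of_real (rad a) * (\<i> * cis (fst q)), 0 :: complex, 1 / (4 * a))" for q :: R2
  define F2 where "F2 q = (0 :: complex, of_real (rad a) * (\<i> * cis (snd q)), 1 / (4 * a))" for q :: R2
  note r = rad[OF a]
  have p: "proj_C2 (F1 q) = (of_real (rad a) * (\<i> * cis (fst q)), 0)" "proj_C2 (F2 q) = (0, of_real (rad a) * (\<i> * cis (snd q)))"
    "ht (F1 q) = 1 / (4 * a)" "ht (F2 q) = 1 / (4 * a)" 
    "proj_C2 (model_T a c q) = (of_real (rad a) * cis (fst q), of_real (rad a) * cis (snd q))" "ht (model_T a c q) = 1 / (4 * a) * (fst q + snd q) + c" for q
    by (simp_all add: F1_def F2_def T ht_def)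
  have u: "cnj (of_real d * cis t) * (of_real d * (\<i> * cis t)) = \<i> * of_real (d * d)"
    "cnj (of_real d * (\<i> * cis t)) * (of_real d * (\<i> * cis t)) = of_real (d * d)" for d t
  proof -
    have "cnj (of_real d * cis t) * (of_real d * (\<i> * cis t)) = \<i> * (of_real d * of_real d) * (cnj (cis t) * cis t)"
      "cnj (of_real d * (\<i> * cis t)) * (of_real d * (\<i> * cis t)) = (cnj \<i> * \<i>) * (of_real d * of_real d) * (cnj (cis t) * cis t)"
      by (simp_all only: complex_cnj_mult complex_cnj_complex_of_real mult_ac)
    then show "cnj (of_real d * cis t) * (of_real d * (\<i> * cis t)) = \<i> * of_real (d * d)"
      "cnj (of_real d * (\<i> * cis t)) * (of_real d * (\<i> * cis t)) = of_real (d * d)"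
      unfolding cnj_cis_mult by simp_all
  qed
  have rr: "rad a * rad a = - (1 / (2 * a))" using r(2) by (simp add: power2_eq_square)
  have hs: "hp (proj_C2 (model_T a c q)) (proj_C2 (F1 q)) = \<i> * of_real (rad a * rad a)" "hp (proj_C2 (model_T a c q)) (proj_C2 (F2 q)) = \<i> * of_real (rad a * rad a)"
    "hp (proj_C2 (F1 q)) (proj_C2 (F1 q)) = of_real (rad a * rad a)" "hp (proj_C2 (F2 q)) (proj_C2 (F2 q)) = of_real (rad a * rad a)"
    "hp (proj_C2 (F1 q)) (proj_C2 (F2 q)) = 0" for q
    unfolding p hp_def fst_conv snd_conv u by simp_all
  have "model_chart UNIV (model_T a c) (8 * a) \<theta> (\<lambda>q. rad a * rad a)"
  proof (rule explicit_model_chart[where ?F1.0 = F1 and ?F2.0 = F2])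
    show "smooth_on UNIV (model_T a c)" unfolding T by (intro smooth_on_intros open_UNIV)
    show "(model_T a c has_derivative (\<lambda>e. fst e *\<^sub>R F1 q + snd e *\<^sub>R F2 q)) (at q)" for q
    proof -
      have c1: "((\<lambda>q::R2. of_real (rad a) * cis (fst q)) has_derivative (\<lambda>e. of_real (rad a) * (\<i> * of_real (fst e) * cis (fst q)))) (at q)"
        and c2: "((\<lambda>q::R2. of_real (rad a) * cis (snd q)) has_derivative (\<lambda>e. of_real (rad a) * (\<i> * of_real (snd e) * cis (snd q)))) (at q)"
        by (intro bounded_linear.has_derivative[OF bounded_linear_mult_right] has_derivative_cis has_derivative_fst has_derivative_snd has_derivative_ident)+
      have c3: "((\<lambda>q::R2. 1 / (4 * a) * (fst q + snd q) + c) has_derivative (\<lambda>e. 1 / (4 * a) * (fst e + snd e) + 0)) (at q)"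
        by (intro has_derivative_add has_derivative_const bounded_linear.has_derivative[OF bounded_linear_mult_right] has_derivative_fst has_derivative_snd has_derivative_ident)
      show ?thesis
        unfolding T
        by (rule has_derivative_eq_rhs[OF has_derivative_Pair[OF c1 has_derivative_Pair[OF c2 c3]]])
           (auto simp: F1_def F2_def scaleR_conv_of_real algebra_simps add_divide_distrib)
    qed
    show "eta (model_T a c q) (F1 q) = 0" "eta (model_T a c q) (F2 q) = 0" for q
      unfolding eta_eq hs p(3,4) rr by simp_all
    show "cdet (proj_C2 (F1 q)) (proj_C2 (F2 q)) = cis (8 * a / 2 * ht (model_T a c q) - \<theta>) * of_real (rad a * rad a)" for q
    proof -
      have e: "8 * a / 2 * ht (model_T a c q) - \<theta> = (fst q + snd q) + pi"
        unfolding p \<theta>[symmetric] using a by (simp add: field_simps)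
      have "cdet (proj_C2 (F1 q)) (proj_C2 (F2 q)) = (\<i> * \<i>) * (cis (fst q) * cis (snd q)) * of_real (rad a * rad a)"
        unfolding p cdet_def by (simp only: fst_conv snd_conv of_real_mult mult_ac mult_zero_left mult_zero_right diff_zero)
      moreover have "cis ((fst q + snd q) + pi) = (\<i> * \<i>) * (cis (fst q) * cis (snd q))"
        by (simp add: cis_mult[symmetric])
      ultimately show ?thesis unfolding e by simp
    qed
    show "rad a * rad a > 0" using r by simp
    show "Re (hp (proj_C2 (F1 q)) (proj_C2 (F1 q))) = rad a * rad a" "Re (hp (proj_C2 (F1 q)) (proj_C2 (F2 q))) = 0"
      "Re (hp (proj_C2 (F2 q)) (proj_C2 (F2 q))) = rad a * rad a" for q
      unfolding hs by simp_all
    show "ht (F1 q) = 1 / (4 * a)" "ht (F2 q) = 1 / (4 * a)" for q by (rule p)+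
  qed simp_all
  then show ?thesis by blast
qed

text \<open>A plane has constant angle, which corresponds to \<open>b = 0\<close>; the purpose here
  is to obtain the immersion.\<close>

lemma model_chart_plane: "\<exists>b \<theta> r. model_chart UNIV (model_plane c) b \<theta> r"
proof -
  have T: "model_plane c = (\<lambda>q. (of_real (fst q), of_real (snd q), c))" by (rule ext) auto
  have "model_chart UNIV (model_plane c) 0 0 (\<lambda>q. 1)"
  proof (rule explicit_model_chart[where ?F1.0 = "\<lambda>q. (1, 0, 0)" and ?F2.0 = "\<lambda>q. (0, 1, 0)"])
    show "smooth_on UNIV (model_plane c)" unfolding T by (intro smooth_on_intros open_UNIV)
    show "(model_plane c has_derivative (\<lambda>e. fst e *\<^sub>R (1, 0, 0) + snd e *\<^sub>R (0, 1, 0))) (at q)" for q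
      unfolding T by (auto intro!: derivative_eq_intros simp: scaleR_conv_of_real)
    show "Re (hp (proj_C2 (1, 0, 0)) (proj_C2 (1, 0, 0))) = 1" "Re (hp (proj_C2 (1, 0, 0)) (proj_C2 (0, 1, 0))) = 0"
      "Re (hp (proj_C2 (0, 1, 0)) (proj_C2 (0, 1, 0))) = 1"
      by (simp_all add: hp_def)
    show "ht (1, 0, 0) = 0" "ht (0, 1, 0) = 0" by (simp_all add: ht_def)
  qed (simp_all add: eta_eq T ht_def cdet_def hp_def)
  then show ?thesis by blast
qed

subsection \<open>Embeddedness of the models\<close>

text \<open>The branch of the argument centred at \<open>s0\<close>; it is continuous off the ray
  opposite to \<open>cis s0\<close>.\<close>

definition ang :: "real \<Rightarrow> complex \<Rightarrow> real" where "ang s0 w = s0 + Arg (w * cis (- s0))"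

lemma ang_rotate: "d * cis s * cis (- s0) = d * cis (s - s0)"
  by (simp add: mult.assoc cis_mult)

lemma ang_eq:
  assumes "d > 0" "\<bar>s - s0\<bar> < pi"
  shows "ang s0 (of_real d * cis s) = s"
proof -
  have "Arg (of_real d * cis (s - s0)) = s - s0"
    by (rule cis_Arg_unique) (use assms in \<open>auto simp: sgn_eq norm_mult\<close>)
  then show ?thesis by (simp add: ang_def ang_rotate)
qed

lemma continuous_on_ang:
  assumes "\<And>w. w \<in> S \<Longrightarrow> \<exists>d s. d > 0 \<and> \<bar>s - s0\<bar> < pi \<and> w = of_real d * cis s"
  shows "continuous_on S (ang s0)"
proof -
  have nonpos: "w * cis (- s0) \<in> - \<real>\<^sub>\<le>\<^sub>0" if w: "w \<in> S" for w
  proof -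
    obtain d s where d: "d > 0" "\<bar>s - s0\<bar> < pi" "w = of_real d * cis s" using assms[OF w] by blast
    have False if "of_real d * cis (s - s0) \<in> \<real>\<^sub>\<le>\<^sub>0"
    proof -
      have n: "d * cos (s - s0) \<le> 0" "d * sin (s - s0) = 0"
        using that by (simp_all add: complex_nonpos_Reals_iff)
      then have sn: "sin (s - s0) = 0" using d by simp
      have "s - s0 = 0" by (rule sin_eq_0_pi[OF _ _ sn]) (use d in auto)
      then show False using n d by simp
    qed
    then show ?thesis unfolding d(3) ang_rotate by blast
  qed
  have "continuous_on S (\<lambda>w. w * cis (- s0))" by (intro continuous_intros)
  then have "continuous_on S (\<lambda>w. Arg (w * cis (- s0)))"
    by (rule continuous_on_compose2[OF continuous_on_Arg]) (use nonpos in blast)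
  then show ?thesis unfolding ang_def[abs_def] by (intro continuous_on_add continuous_on_const)
qed

lemma plane_charted: "charted UNIV plane_atlas"
  unfolding charted_def plane_atlas_def by (auto intro!: exI[of _ "\<lambda>q. q"] homeomorphismI)

text \<open>The interval has midpoint \<open>s0 + pi\<close>, so the branch of the argument centred
  there inverts the chart; the omitted ray passes through \<open>cis s0\<close>.\<close>

lemma cylinder_chart:
  fixes s0 :: real
  defines "Q \<equiv> {s0 <..< s0 + 2 * pi} \<times> (UNIV :: real set)" and "\<psi> \<equiv> (\<lambda>(s, t::real). (cis s, t))"
  shows "\<psi> ` Q = cylinder \<inter> (- {cis s0}) \<times> UNIV" "homeomorphism Q (\<psi> ` Q) \<psi> (\<lambda>(w, t). (ang (s0 + pi) w, t))"
proof -
  have inv: "ang (s0 + pi) (cis s) = s" if "s0 < s" "s < s0 + 2 * pi" for s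
    using ang_eq[of 1 s "s0 + pi"] that by (simp add: abs_less_iff)
  have cisne: "cis s \<noteq> cis s0" if "s0 < s" "s < s0 + 2 * pi" for s
  proof
    assume c: "cis s = cis s0"
    have "cis (s - s0) = 1" using c by (simp add: cis_divide[symmetric])
    then have sc: "cos (s - s0) = 1" "sin (s - s0) = 0" by (simp_all add: complex_eq_iff)
    have sn: "sin (s - s0 - pi) = 0" unfolding sin_diff[of "s - s0" pi] sc by simp
    have "s - s0 - pi = 0" by (rule sin_eq_0_pi[OF _ _ sn]) (use that in simp_all)
    then have "s - s0 = pi" by simp
    then show False using sc by simp
  qed
  show 1: "\<psi> ` Q = cylinder \<inter> (- {cis s0}) \<times> UNIV"
  proof (intro equalityI subsetI)
    fix y assume "y \<in> \<psi> ` Q"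
    then show "y \<in> cylinder \<inter> (- {cis s0}) \<times> UNIV"
      using cisne by (auto simp: \<psi>_def Q_def cylinder_def)
  next
    fix y assume y: "y \<in> cylinder \<inter> (- {cis s0}) \<times> UNIV"
    obtain w t where wt: "y = (w, t)" by (cases y)
    have w: "cmod w = 1" "w \<noteq> cis s0" using y by (auto simp: wt cylinder_def)
    define x where "x = Arg (w * cis (- (s0 + pi)))"
    have nw: "cmod (w * cis (- (s0 + pi))) = 1" using w by (simp add: norm_mult)
    then have "w * cis (- (s0 + pi)) \<noteq> 0" by force
    then have "cis x = w * cis (- (s0 + pi))"
      unfolding x_def using nw by (simp add: cis_Arg sgn_eq)
    then have "cis x * cis (s0 + pi) = w" by (simp add: mult.assoc cis_mult)
    then have c: "cis (s0 + pi + x) = w" by (simp add: cis_mult add.commute)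
    have "x \<noteq> pi"
    proof
      assume "x = pi"
      then have "w = cis (s0 + (pi + pi))" using c by (simp add: add.assoc)
      also have "\<dots> = cis s0" by (simp add: cis_mult[symmetric])
      finally show False using w by simp
    qed
    then have "- pi < x" "x < pi" using Arg_bounded[of "w * cis (- (s0 + pi))"] by (simp_all add: x_def)
    then show "y \<in> \<psi> ` Q"
      unfolding \<psi>_def Q_def wt using c by (intro image_eqI[of _ _ "(s0 + pi + x, t)"]) auto
  qed
  have cont: "continuous_on (\<psi> ` Q) (\<lambda>(w, t). (ang (s0 + pi) w, t))"
  proof -
    have "continuous_on (fst ` \<psi> ` Q) (ang (s0 + pi))"
    proof (rule continuous_on_ang)
      fix w assume "w \<in> fst ` \<psi> ` Q"
      then obtain s where "s0 < s" "s < s0 + 2 * pi" "w = cis s" by (auto simp: \<psi>_def Q_def)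
      then show "\<exists>d s. d > 0 \<and> \<bar>s - (s0 + pi)\<bar> < pi \<and> w = of_real d * cis s"
        by (intro exI[of _ 1] exI[of _ s]) (auto simp: abs_less_iff)
    qed
    then have "continuous_on (\<psi> ` Q) (\<lambda>y. ang (s0 + pi) (fst y))"
      by (rule continuous_on_compose2[OF _ continuous_on_fst[OF continuous_on_id]]) auto
    then have "continuous_on (\<psi> ` Q) (\<lambda>y. (ang (s0 + pi) (fst y), snd y))"
      by (intro continuous_on_Pair continuous_on_snd continuous_on_id)
    then show ?thesis by (simp add: case_prod_unfold)
  qed
  show "homeomorphism Q (\<psi> ` Q) \<psi> (\<lambda>(w, t). (ang (s0 + pi) w, t))"
  proof (rule homeomorphismI[OF _ cont])
    have "continuous_on Q (\<lambda>q. (cis (fst q), snd q))"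
      unfolding cis_conv_exp by (intro continuous_intros)
    then show "continuous_on Q \<psi>" by (simp add: \<psi>_def case_prod_unfold)
  qed (auto simp: \<psi>_def Q_def inv)
qed

lemma cylinder_charted: "charted cylinder cylinder_atlas"
proof -
  have op: "openin (top_of_set cylinder) (cylinder \<inter> (- {cis s0}) \<times> UNIV)" for s0
    by (intro openin_open_Int open_Times open_Compl) auto
  have cov: "y \<in> (\<Union>(U, \<phi>)\<in>cylinder_atlas. \<phi> ` U)" if y: "y \<in> cylinder" for y
  proof -
    have w: "cmod (fst y) = 1" using y by (auto simp: cylinder_def)
    then have "fst y \<noteq> 0" by force
    then have "cis (Arg (fst y)) = fst y" using w by (simp add: cis_Arg sgn_eq)
    moreover have "cis (Arg (fst y) - pi) = - cis (Arg (fst y))"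
      by (simp add: cis_divide[symmetric])
    ultimately have m: "cis (Arg (fst y) - pi) = - fst y" by simp
    \<comment> \<open>The chart that starts at \<open>Arg (fst y) - pi\<close> omits only the
      antipode of \<open>fst y\<close>.\<close>
    have "fst y \<noteq> cis (Arg (fst y) - pi)"
    proof
      assume "fst y = cis (Arg (fst y) - pi)"
      then have "fst y + fst y = 0" using m by simp
      then show False using \<open>fst y \<noteq> 0\<close> by (simp add: mult_2[symmetric] del: mult_2)
    qed
    then have "y \<in> (\<lambda>(s, t). (cis s, t)) ` ({Arg (fst y) - pi <..< Arg (fst y) - pi + 2 * pi} \<times> UNIV)"
      unfolding cylinder_chart(1) using y by (cases y) auto
    then show ?thesis unfolding cylinder_atlas_def by blast
  qed
  have sub: "(\<lambda>(s, t). (cis s, t)) ` ({s0 <..< s0 + 2 * pi} \<times> UNIV) \<subseteq> cylinder" for s0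
    unfolding cylinder_chart(1) by blast
  have "(\<Union>(U, \<phi>)\<in>cylinder_atlas. \<phi> ` U) = cylinder"
  proof (intro equalityI subsetI)
    fix y assume "y \<in> (\<Union>(U, \<phi>)\<in>cylinder_atlas. \<phi> ` U)"
    then show "y \<in> cylinder" unfolding cylinder_atlas_def using sub by auto
  qed (rule cov)
  moreover have "open U \<and> openin (top_of_set cylinder) (\<phi> ` U) \<and> (\<exists>\<psi>. homeomorphism U (\<phi> ` U) \<phi> \<psi>)"
    if c: "(U, \<phi>) \<in> cylinder_atlas" for U and \<phi> :: "R2 \<Rightarrow> complex \<times> real"
  proof -
    obtain s0 where U: "U = {s0 <..< s0 + 2 * pi} \<times> UNIV" "\<phi> = (\<lambda>(s, t). (cis s, t))"
      using c unfolding cylinder_atlas_def by auto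
    have "open U" unfolding U by (intro open_Times) auto
    moreover have "openin (top_of_set cylinder) (\<phi> ` U)" unfolding U cylinder_chart(1) by (rule op)
    moreover have "\<exists>\<psi>. homeomorphism U (\<phi> ` U) \<phi> \<psi>" unfolding U using cylinder_chart(2) by blast
    ultimately show ?thesis by blast
  qed
  ultimately show ?thesis unfolding charted_def by blast
qed

lemma homeomorphism_left_inverse:
  assumes "continuous_on S f" "continuous_on (f ` S) L" "\<And>x. x \<in> S \<Longrightarrow> L (f x) = x"
  shows "homeomorphism S (f ` S) f L"
  by (rule homeomorphismI) (use assms in auto)

lemma continuous_on_cis: "continuous_on S f \<Longrightarrow> continuous_on S (\<lambda>x. cis (f x))"
  unfolding cis_conv_exp by (intro continuous_intros)

lemma plane_immersion: "\<exists>b \<theta> r. model_chart UNIV F b \<theta> r \<Longrightarrow> smooth_immersion plane_atlas F"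
  by (rule smooth_immersionI_model) (auto simp: plane_atlas_def o_def)

lemma plane_embeddingI:
  assumes "\<exists>b \<theta> r. model_chart UNIV F b \<theta> r" "continuous_on UNIV L" "\<And>q. L (F q) = q"
  shows "smooth_embedding UNIV plane_atlas F"
proof -
  have im: "smooth_immersion plane_atlas F" by (rule plane_immersion[OF assms(1)])
  have "continuous_on UNIV F"
    using smooth_on_continuous[OF smooth_immersion_chart(1)[OF im, of UNIV "\<lambda>q. q"]] by (simp add: plane_atlas_def o_def)
  then have "homeomorphism UNIV (F ` UNIV) F L"
    by (rule homeomorphism_left_inverse) (use assms in \<open>auto intro: continuous_on_subset\<close>)
  then show ?thesis using im unfolding smooth_embedding_def by blast
qed

lemma embedding_C: assumes a: "a < 0" shows "smooth_embedding UNIV plane_atlas (model_C a c)"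
proof (rule plane_embeddingI[where L = "\<lambda>y. ((snd (snd y) - c) * (4 * a), Re (fst (snd y)))"])
  show "\<exists>b \<theta> r. model_chart UNIV (model_C a c) b \<theta> r"
    using model_chart_C[OF a, of c "8 * a / 2 * c - pi / 2"] by auto
  show "continuous_on UNIV (\<lambda>y::R5. ((snd (snd y) - c) * (4 * a), Re (fst (snd y))))"
    by (intro continuous_intros)
  show "((snd (snd (model_C a c q)) - c) * (4 * a), Re (fst (snd (model_C a c q)))) = q" for q
    using a by (cases q) simp
qed

lemma embedding_plane: "smooth_embedding UNIV plane_atlas (model_plane c)"
proof (rule plane_embeddingI[OF model_chart_plane, where L = "\<lambda>y. (Re (fst y), Re (fst (snd y)))"])
  show "continuous_on UNIV (\<lambda>y::R5. (Re (fst y), Re (fst (snd y))))"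
    by (intro continuous_intros)
  show "(Re (fst (model_plane c q)), Re (fst (snd (model_plane c q)))) = q" for q
    by (cases q) simp
qed

text \<open>The height is linear in the orbit parameter and returns it; undoing the rotation of the
  second component then leaves a multiple of \<open>sinh t\<close>, inverted by
  \<open>arsinh\<close>.\<close>

lemma embedding_Upsilon:
  assumes a: "a < 0" and \<gamma>: "0 < \<gamma>" "\<gamma> < pi / 2"
  shows "smooth_embedding UNIV plane_atlas (model_Upsilon \<gamma> a c)"
proof -
  define S where "S y = (snd (snd y) - c) * (4 * a / (sin \<gamma> * tan \<gamma>))" for y :: R5
  define L where "L y = (S y, arsinh (Re (fst (snd y) * cis (cos \<gamma> * S y)) / (tan \<gamma> * rad a)))" for y
  have s: "sin \<gamma> > 0" "cos \<gamma> > 0" "tan \<gamma> > 0" using \<gamma> sin_gt_zero[of \<gamma>] cos_gt_zero[of \<gamma>] tan_gt_zero[of \<gamma>] by auto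
  have r: "rad a > 0" by (rule rad[OF a])
  show ?thesis
  proof (rule plane_embeddingI[where L = L])
    show "\<exists>b \<theta> r. model_chart UNIV (model_Upsilon \<gamma> a c) b \<theta> r"
      using model_chart_Upsilon[OF a \<gamma>, of c "8 * a / 2 * c"] by auto
    have cS: "continuous_on UNIV S" unfolding S_def[abs_def] by (intro continuous_intros)
    have nz: "tan \<gamma> * rad a \<noteq> 0" using s r by simp
    have "continuous_on UNIV (\<lambda>y::R5. Re (fst (snd y) * cis (cos \<gamma> * S y)))"
      by (intro continuous_intros continuous_on_cis cS)
    then have "continuous_on UNIV (\<lambda>y::R5. Re (fst (snd y) * cis (cos \<gamma> * S y)) / (tan \<gamma> * rad a))"
      by (rule continuous_on_divide[OF _ continuous_on_const]) (use nz in simp)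
    then show "continuous_on UNIV L"
      unfolding L_def[abs_def]
      by (intro continuous_on_Pair cS) (rule continuous_on_compose2[OF continuous_on_arsinh[of UNIV]], auto)
    fix q :: R2
    obtain x t where q: "q = (x, t)" by (cases q)
    have "S (model_Upsilon \<gamma> a c q) = x" using a s by (simp add: S_def q)
    moreover have "of_real (tan \<gamma> / sqrt (- 2 * a) * sinh t) * cis (- cos \<gamma> * x) * cis (cos \<gamma> * x) = of_real (tan \<gamma> * rad a * sinh t)"
      by (simp add: mult.assoc cis_mult rad_def)
    ultimately show "L (model_Upsilon \<gamma> a c q) = q"
      using s r by (simp add: L_def q arsinh_sinh_real del: of_real_mult)
  qed
qed

text \<open>Again the height gives the orbit parameter. Undoing both rotations leaves multiples of
  the real and imaginary parts of the circle point, so no choice of argument is involved.\<close>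

lemma embedding_Psi:
  assumes a: "a < 0" and \<nu>: "0 < \<nu>"
  shows "smooth_embedding cylinder cylinder_atlas (model_Psi \<nu> a c)"
proof -
  define S where "S y = (snd (snd y) - c) * (4 * a / (cosh \<nu> * (cosh \<nu> / sinh \<nu>)))" for y :: R5
  define L where "L y = (Complex (Re (fst y * cis (- (S y / sinh \<nu>))) / (cosh \<nu> * rad a))
     (Re (fst (snd y) * cis (- (sinh \<nu> * S y))) / (cosh \<nu> / sinh \<nu> * rad a)), S y)" for y
  have s: "sinh \<nu> > 0" "cosh \<nu> > 0" using \<nu> by simp_all
  have r: "rad a > 0" by (rule rad[OF a])
  have mc: "\<exists>b \<theta> r. model_chart U (model_Psi \<nu> a c \<circ> \<phi>) b \<theta> r" if c: "(U, \<phi>) \<in> cylinder_atlas" for U and \<phi> :: "R2 \<Rightarrow> complex \<times> real"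
  proof -
    obtain s0 where U: "U = {s0 <..< s0 + 2 * pi} \<times> UNIV" "\<phi> = (\<lambda>(s, t). (cis s, t))"
      using c unfolding cylinder_atlas_def by auto
    have oU: "open U" unfolding U by (intro open_Times) auto
    have "8 * a / 2 * c - (8 * a / 2 * c + pi / 2) = - (pi / 2)" by simp
    from model_chart_Psi[OF a \<nu> this] show ?thesis
      unfolding U(2)[symmetric] using model_chart_subset[OF _ oU] by blast
  qed
  have im: "smooth_immersion cylinder_atlas (model_Psi \<nu> a c)" by (rule smooth_immersionI_model[OF mc])
  have "homeomorphism cylinder (model_Psi \<nu> a c ` cylinder) (model_Psi \<nu> a c) L"
  proof (rule homeomorphism_left_inverse)
    show "continuous_on cylinder (model_Psi \<nu> a c)"
      by (rule charted_continuous_on[OF cylinder_charted smooth_on_continuous[OF smooth_immersion_chart(1)[OF im]]])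
    have cS: "continuous_on T S" for T unfolding S_def[abs_def] by (intro continuous_intros)
    show "continuous_on (model_Psi \<nu> a c ` cylinder) L"
      unfolding L_def[abs_def] Complex_eq by (intro continuous_intros continuous_on_cis cS) (use s r in auto)
    fix y :: "complex \<times> real"
    obtain w t where y: "y = (w, t)" by (cases y)
    have "S (model_Psi \<nu> a c y) = t" using a s by (simp add: S_def y)
    moreover have "of_real (cosh \<nu> / sqrt (- 2 * a) * Re w) * cis (t / sinh \<nu>) * cis (- (t / sinh \<nu>)) = of_real (cosh \<nu> * rad a * Re w)"
      "of_real (cosh \<nu> / sinh \<nu> / sqrt (- 2 * a) * Im w) * cis (sinh \<nu> * t) * cis (- (sinh \<nu> * t)) = of_real (cosh \<nu> / sinh \<nu> * rad a * Im w)"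
      by (simp_all add: mult.assoc cis_mult rad_def)
    ultimately show "L (model_Psi \<nu> a c y) = y"
      using s r by (simp add: L_def y del: of_real_mult)
  qed
  then show ?thesis using im unfolding smooth_embedding_def by blast
qed

lemma cis_eq_iff: "cis t' = cis t \<longleftrightarrow> (\<exists>k::int. t' = t + 2 * pi * of_int k)"
  using sin_cos_eq_iff[of t' t] by (auto simp: complex_eq_iff)

text \<open>The first component determines \<open>t\<close> modulo the period, and the height
  determines the sum \<open>t + s\<close>.\<close>

lemma model_T_eq_iff:
  assumes a: "a < 0"
  shows "model_T a c (t, s) = model_T a c (t', s') \<longleftrightarrow> (\<exists>k::int. t' = t + 2 * pi * of_int k \<and> s' = s - 2 * pi * of_int k)"
proof
  have r: "sqrt (- 2 * a) \<noteq> 0" using a by simp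
  assume "model_T a c (t, s) = model_T a c (t', s')"
  then have h: "cis t' = cis t" "t + s = t' + s'" using a r by auto
  then obtain k :: int where "t' = t + 2 * pi * of_int k" using cis_eq_iff by blast
  then show "\<exists>k::int. t' = t + 2 * pi * of_int k \<and> s' = s - 2 * pi * of_int k" using h(2) by (intro exI[of _ k]) simp
next
  assume "\<exists>k::int. t' = t + 2 * pi * of_int k \<and> s' = s - 2 * pi * of_int k"
  then obtain k :: int where k: "t' = t + 2 * pi * of_int k" "s' = s - 2 * pi * of_int k" by blast
  have "s' = s + 2 * pi * of_int (- k)" using k(2) by simp
  then have "cis t' = cis t" "cis s' = cis s" using cis_eq_iff k(1) by blast+
  then show "model_T a c (t, s) = model_T a c (t', s')" using k by simp
qed

text \<open>Since the parametrization repeats, only its image is claimed to be embedded. A strip of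
  width 2 pi in \<open>t\<close> meets each period orbit at most once, and its image is the part of
  the surface whose first component avoids one value, hence relatively open.\<close>

lemma embedded_T: assumes a: "a < 0" shows "embedded_surface (range (model_T a c))"
  unfolding embedded_surface_def
proof
  fix p assume "p \<in> range (model_T a c)"
  then obtain q0 where q0: "p = model_T a c q0" by blast
  obtain t0 s0 where "q0 = (t0, s0)" by (cases q0)
  then have p: "p = model_T a c (t0, s0)" using q0 by simp
  define U where "U = {t0 - pi <..< t0 + pi} \<times> (UNIV :: real set)"
  have r: "rad a > 0" by (rule rad[OF a])
  have T: "model_T a c (t, s) = (of_real (rad a) * cis t, of_real (rad a) * cis s, 1 / (4 * a) * (t + s) + c)" for t s
    by (simp add: rad_def)
  have "8 * a / 2 * c - (8 * a / 2 * c - pi) = pi" by simp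
  from model_chart_T[OF a this] obtain r' where "model_chart UNIV (model_T a c) (8 * a) (8 * a / 2 * c - pi) r'" by blast
  then interpret m: model_chart UNIV "model_T a c" "8 * a" "8 * a / 2 * c - pi" r' .
  have oU: "open U" unfolding U_def by (intro open_Times) auto
  define L where "L y = (ang t0 (fst y), (snd (snd y) - c) * (4 * a) - ang t0 (fst y))" for y :: R5
  have angT: "ang t0 (of_real (rad a) * cis t) = t" if "t0 - pi < t" "t < t0 + pi" for t
    by (rule ang_eq[OF r]) (use that in \<open>auto simp: abs_less_iff\<close>)
  have hom: "homeomorphism U (model_T a c ` U) (model_T a c) L"
  proof (rule homeomorphism_left_inverse)
    show "continuous_on U (model_T a c)"
      using smooth_on_continuous[OF m.smooth_f] continuous_on_subset by blast
    have "continuous_on (fst ` model_T a c ` U) (ang t0)"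
    proof (rule continuous_on_ang)
      fix w assume "w \<in> fst ` model_T a c ` U"
      then obtain t s where "t0 - pi < t" "t < t0 + pi" "w = fst (model_T a c (t, s))" by (auto simp: U_def simp del: model_T.simps)
      then show "\<exists>d s. d > 0 \<and> \<bar>s - t0\<bar> < pi \<and> w = of_real d * cis s"
        unfolding T using r by (intro exI[of _ "rad a"] exI[of _ t]) (auto simp: abs_less_iff)
    qed
    then have "continuous_on (model_T a c ` U) (\<lambda>y. ang t0 (fst y))"
      by (rule continuous_on_compose2[OF _ continuous_on_fst[OF continuous_on_id]]) auto
    then show "continuous_on (model_T a c ` U) L"
      unfolding L_def[abs_def] by (intro continuous_intros)
    fix q assume "q \<in> U"
    then obtain t s where q: "q = (t, s)" "t0 - pi < t" "t < t0 + pi" by (auto simp: U_def simp del: model_T.simps)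
    show "L (model_T a c q) = q"
      unfolding q(1) T L_def using angT[OF q(2,3)] a by simp
  qed
  have op: "openin (top_of_set (range (model_T a c))) (model_T a c ` U)"
  proof -
    let ?V = "(- {of_real (rad a) * cis (t0 + pi)}) \<times> (UNIV :: (complex \<times> real) set)"
    have "model_T a c ` U = range (model_T a c) \<inter> ?V"
    proof (intro equalityI subsetI)
      fix y assume "y \<in> model_T a c ` U"
      then obtain t s where t: "t0 - pi < t" "t < t0 + pi" "y = model_T a c (t, s)" by (auto simp: U_def simp del: model_T.simps)
      have "cis t \<noteq> cis (t0 + pi)"
      proof
        assume "cis t = cis (t0 + pi)"
        then obtain k :: int where k: "t = t0 + pi + 2 * pi * of_int k" using cis_eq_iff by blast
        have "0 < 2 * pi * (of_int k + 1)" "0 < 2 * pi * (- of_int k)"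
          using t(1,2) unfolding k by (simp_all add: algebra_simps)
        then have "0 < (of_int k + 1 :: real)" "0 < - (of_int k :: real)"
          unfolding zero_less_mult_iff using pi_gt_zero by auto
        then have "real_of_int (k + 1) > 0" "real_of_int k < 0" by simp_all
        then have "k + 1 > 0" "k < 0" by (simp_all only: of_int_0_less_iff of_int_less_0_iff)
        then show False by linarith
      qed
      then have "fst y \<noteq> of_real (rad a) * cis (t0 + pi)" unfolding t(3) T using r by simp
      moreover have "y \<in> range (model_T a c)" using t(3) by blast
      ultimately show "y \<in> range (model_T a c) \<inter> ?V" by (simp add: mem_Times_iff)
    next
      fix y assume y: "y \<in> range (model_T a c) \<inter> ?V"
      then obtain t s where ts: "y = model_T a c (t, s)" by (auto simp del: model_T.simps)
      \<comment> \<open>The period that shifts \<open>t\<close> into the half-open strip; its left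
        endpoint is then excluded by the omitted value.\<close>
      define k :: int where "k = \<lfloor>(t - t0 + pi) / (2 * pi)\<rfloor>"
      define t' where "t' = t - 2 * pi * of_int k"
      have "of_int k \<le> (t - t0 + pi) / (2 * pi)" "(t - t0 + pi) / (2 * pi) < of_int k + 1"
        unfolding k_def by linarith+
      then have b: "t0 - pi \<le> t'" "t' < t0 + pi" by (simp_all add: t'_def field_simps)
      have t't: "t = t' + 2 * pi * of_int k" "s = (s + 2 * pi * of_int k) - 2 * pi * of_int k" by (simp_all add: t'_def)
      then have y': "y = model_T a c (t', s + 2 * pi * of_int k)"
        unfolding ts using model_T_eq_iff[OF a, of c t' "s + 2 * pi * of_int k" t s] by metis
      have "t' \<noteq> t0 - pi"
      proof
        assume e: "t' = t0 - pi"
        have "cis (t0 - pi) = cis (t0 + pi)" by (simp add: complex_eq_iff sin_diff cos_diff sin_add cos_add)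
        moreover have "fst y = of_real (rad a) * cis t'" unfolding y' T by simp
        ultimately show False using y unfolding e by (simp add: mem_Times_iff)
      qed
      then show "y \<in> model_T a c ` U" unfolding y' U_def using b by (intro imageI) auto
    qed
    moreover have "open ?V" by (intro open_Times open_Compl) auto
    ultimately show ?thesis using openin_open_Int by metis
  qed
  let ?T = "model_T a c"
  have cis_per: "cis (t0 + 0) = cis t0" by simp
  have "(t0, s0) \<in> U" by (simp add: U_def)
  then have "p \<in> ?T ` U" using p by blast
  moreover have "smooth_on U ?T" by (rule smooth_on_subset[OF m.smooth_f]) simp
  moreover have "\<forall>q\<in>U. inj (Df ?T q)" using m.imm by simp
  ultimately show "\<exists>(U :: R2 set) f g. open U \<and> p \<in> f ` U \<and> openin (top_of_set (range ?T)) (f ` U) \<and>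
        homeomorphism U (f ` U) f g \<and> smooth_on U f \<and> (\<forall>q\<in>U. inj (Df f q))"
    using oU op hom by blast
qed

subsection \<open>Unitary congruences\<close>

text \<open>The complex linear map with columns \<open>v\<close> and \<open>w\<close>, acting
  trivially on the height; \<open>uni_inv\<close> takes Hermitian coordinates in this basis.\<close>

definition uni :: "C2 \<Rightarrow> C2 \<Rightarrow> R5 \<Rightarrow> R5" where
  "uni v w y = (fst y * fst v + fst (snd y) * fst w, fst y * snd v + fst (snd y) * snd w, snd (snd y))"

lemma ht_uni [simp]: "ht (uni v w y) = ht y" by (simp add: uni_def ht_def)

lemma hp_uni_left:
  assumes "orthonormal2 v w"
  shows "hp v (proj_C2 (uni v w y)) = fst y" "hp w (proj_C2 (uni v w y)) = fst (snd y)"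
proof -
  have on: "hp v v = 1" "hp w w = 1" "hp v w = 0" "hp w v = 0" using assms hp_cnj[of w v] by (simp_all add: orthonormal2_def)
  have "hp u (proj_C2 (uni v w y)) = fst y * hp u v + fst (snd y) * hp u w" for u
    by (simp add: hp_def uni_def proj_C2_def algebra_simps)
  then show "hp v (proj_C2 (uni v w y)) = fst y" "hp w (proj_C2 (uni v w y)) = fst (snd y)"
    using on by simp_all
qed

lemma hp_uni:
  assumes "orthonormal2 v w"
  shows "hp (proj_C2 (uni v w x)) (proj_C2 (uni v w y)) = hp (proj_C2 x) (proj_C2 y)"
proof -
  have e: "hp a b = cnj (hp v a) * hp v b + cnj (hp w a) * hp w b" for a b
    using orthonormal2_expand[OF assms, of a b] hp_cnj[of a v] hp_cnj[of a w] by simp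
  show ?thesis
    unfolding e[of "proj_C2 (uni v w x)" "proj_C2 (uni v w y)"] hp_uni_left[OF assms] by (simp add: hp_def proj_C2_def)
qed

lemma bounded_linear_uni: "bounded_linear (uni v w)"
  unfolding uni_def[abs_def]
  by (intro bounded_linear_Pair bounded_linear_add bounded_linear_mult_const[THEN bounded_linear_compose]
      bounded_linear_compose[OF bounded_linear_mult_left] bounded_linear_fst bounded_linear_snd
      bounded_linear_compose[OF bounded_linear_fst] bounded_linear_compose[OF bounded_linear_snd])

definition uni_inv :: "C2 \<Rightarrow> C2 \<Rightarrow> R5 \<Rightarrow> R5" where
  "uni_inv v w y = (hp v (proj_C2 y), hp w (proj_C2 y), ht y)"

lemma uni_inv_uni: "orthonormal2 v w \<Longrightarrow> uni_inv v w (uni v w y) = y"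
  by (simp add: uni_inv_def hp_uni_left) (simp add: ht_def)

lemma uni_uni_inv:
  assumes "orthonormal2 v w" shows "uni v w (uni_inv v w y) = y"
proof -
  let ?d = "proj_C2 (uni v w (uni_inv v w y)) - proj_C2 y"
  have "hp v ?d = 0" "hp w ?d = 0"
    by (simp_all add: hp_simps hp_uni_left[OF assms]) (simp_all add: uni_inv_def)
  then have "hp ?d ?d = 0" using orthonormal2_expand[OF assms, of ?d ?d] by simp
  then have "?d = 0" using hp_self_pos[of ?d] by force
  moreover have "ht (uni v w (uni_inv v w y)) = ht y"
    unfolding ht_uni by (simp add: uni_inv_def ht_def)
  ultimately show ?thesis by (intro R5_eqI) simp_all
qed

lemma continuous_on_uni_inv: "continuous_on S (uni_inv v w)"
  unfolding uni_inv_def[abs_def]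
  by (intro continuous_intros bounded_bilinear.continuous_on[OF bounded_bilinear_hp]
      linear_continuous_on bounded_linear_proj_C2 bounded_linear_ht)

lemma proj_Phi: "proj_C2 (Phi p v) = (- \<i> * fst (proj_C2 v), - \<i> * snd (proj_C2 v))" "ht (Phi p v) = Re (hp (proj_C2 p) (proj_C2 v)) / 2"
  by (cases p; cases v; simp add: ht_def hp_def inner_complex_def)+

text \<open>All structure tensors are expressed by heights and the Hermitian form, which a unitary
  map preserves, and complex linearity gives compatibility with \<open>Phi\<close>.\<close>

lemma congruence_uni:
  assumes on: "orthonormal2 v w"
  shows "congruence (uni v w)"
proof -
  have D: "Df (uni v w) p = uni v w" for p
    by (rule Df_eqI[OF bounded_linear_imp_has_derivative[OF bounded_linear_uni]])
  have "bij (uni v w)"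
    by (rule bij_betw_byWitness[where f' = "uni_inv v w"]) (auto simp: uni_inv_uni[OF on] uni_uni_inv[OF on])
  moreover have "smooth_on UNIV (uni v w)" by (rule smooth_on_linear[OF bounded_linear_uni open_UNIV])
  moreover have "uni v w xi = xi" by (simp add: uni_def xi_def)
  moreover have "uni v w (X p) = X (uni v w p)" for p by (cases p) (simp add: uni_def)
  moreover have e: "eta (uni v w p) (uni v w x) = eta p x" for p x
    unfolding eta_eq hp_uni[OF on] by simp
  moreover have "uni v w (Phi p x) = Phi (uni v w p) (uni v w x)" for p x
  proof (rule R5_eqI)
    show "proj_C2 (uni v w (Phi p x)) = proj_C2 (Phi (uni v w p) (uni v w x))"
      unfolding proj_Phi by (cases p; cases x) (simp add: uni_def algebra_simps)
    show "ht (uni v w (Phi p x)) = ht (Phi (uni v w p) (uni v w x))"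
      unfolding ht_uni proj_Phi hp_uni[OF on] ..
  qed
  moreover have "g (uni v w p) (uni v w x) (uni v w y) = g p x y" for p x y
    unfolding g_def e gT_eq hp_uni[OF on] ..
  ultimately show ?thesis unfolding congruence_def D by blast
qed

text \<open>The moved model \<open>uni v w \<circ> G\<close> is again embedded, so
  \<open>surface_in_surface\<close> applies to it; the unitary map is reported as the
  congruence.\<close>

lemma model_conclusion:
  assumes M: "charted M \<A>" "smooth_immersion \<A> F" and N: "charted N \<B>" "smooth_embedding N \<B> G"
    and on: "orthonormal2 v w" and FG: "\<And>p. p \<in> M \<Longrightarrow> \<exists>n\<in>N. F p = uni v w (G n)"
  shows "embedded_surface (F ` M)" "inj_on F M \<Longrightarrow> smooth_embedding M \<A> F" "locally_congruent M \<A> F N \<B> G"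
proof -
  obtain L where L: "homeomorphism N (G ` N) G L" and imG: "smooth_immersion \<B> G"
    using N(2) unfolding smooth_embedding_def by blast
  have im: "smooth_immersion \<B> (uni v w \<circ> G)"
    unfolding smooth_immersion_def
  proof (intro ballI, clarify)
    fix U \<phi> assume c: "(U, \<phi>) \<in> \<B>"
    note s = smooth_immersion_chart[OF imG c]
    have "smooth_on U (uni v w \<circ> G \<circ> \<phi>)"
      using smooth_on_bounded_linear[OF bounded_linear_uni s(1) charted_chart(1)[OF N(1) c]] by (simp add: o_def)
    moreover have "inj (Df (uni v w \<circ> G \<circ> \<phi>) q)" if q: "q \<in> U" for q
    proof -
      have "Df (uni v w \<circ> G \<circ> \<phi>) q = uni v w \<circ> Df (G \<circ> \<phi>) q"
        using Df_bounded_linear[OF bounded_linear_uni smooth_on_differentiable[OF s(1) q]] by (simp add: o_def)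
      moreover have "inj (uni v w)" using uni_inv_uni[OF on] by (metis injI)
      ultimately show ?thesis using s(2)[OF q] inj_compose by metis
    qed
    ultimately show "smooth_on U (uni v w \<circ> G \<circ> \<phi>) \<and> (\<forall>q\<in>U. inj (Df (uni v w \<circ> G \<circ> \<phi>) q))" by blast
  qed
  have hom: "homeomorphism N ((uni v w \<circ> G) ` N) (uni v w \<circ> G) (L \<circ> uni_inv v w)"
  proof (rule homeomorphism_left_inverse)
    show "continuous_on N (uni v w \<circ> G)"
      using L by (intro continuous_on_compose linear_continuous_on bounded_linear_uni) (simp add: homeomorphism_def)
    have "uni_inv v w ` (uni v w \<circ> G) ` N = G ` N" by (simp add: image_comp o_def uni_inv_uni[OF on])
    then show "continuous_on ((uni v w \<circ> G) ` N) (L \<circ> uni_inv v w)"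
      using L by (intro continuous_on_compose continuous_on_uni_inv) (simp add: homeomorphism_def)
    show "(L \<circ> uni_inv v w) ((uni v w \<circ> G) x) = x" if "x \<in> N" for x
      using L that by (simp add: uni_inv_uni[OF on] homeomorphism_def)
  qed
  have sub: "F ` M \<subseteq> (uni v w \<circ> G) ` N"
  proof (rule image_subsetI)
    fix p assume "p \<in> M"
    then obtain n where "n \<in> N" "F p = uni v w (G n)" using FG by blast
    then show "F p \<in> (uni v w \<circ> G) ` N" by (intro image_eqI[of _ _ n]) simp_all
  qed
  interpret surface_in_surface M \<A> F N \<B> "uni v w \<circ> G" "L \<circ> uni_inv v w"
    by (rule surface_in_surface.intro[OF M(1) N(1) M(2) im hom sub])
  show "embedded_surface (F ` M)" by (rule embedded_image)
  show "inj_on F M \<Longrightarrow> smooth_embedding M \<A> F" by (rule embedding_if_inj)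
  show "locally_congruent M \<A> F N \<B> G"
    unfolding locally_congruent_def
  proof
    fix p assume "p \<in> M"
    from local_smooth_diffeo[OF this] obtain U V h k where "p \<in> U" "openin (top_of_set M) U" "openin (top_of_set N) V"
      "homeomorphism U V h k" "smooth_between \<A> \<B> U h" "smooth_between \<B> \<A> V k" "\<forall>x\<in>U. F x = uni v w (G (h x))"
      by auto
    then show "\<exists>U V h k A. p \<in> U \<and> openin (top_of_set M) U \<and> openin (top_of_set N) V \<and>
        homeomorphism U V h k \<and> smooth_between \<A> \<B> U h \<and> smooth_between \<B> \<A> V k \<and>
        congruence A \<and> (\<forall>x\<in>U. F x = A (G (h x)))"
      using congruence_uni[OF on] by blast
  qed
qed

subsection \<open>Classification\<close>

text \<open>The Reeb component of the equation eliminates \<alpha>. Multiplying the area form by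
  \<open>cis (\<alpha> (\<phi> q) + \<theta>)\<close> leaves four times the area, which is
  real.\<close>

lemma chart_shrinker:
  assumes F: "harmonic_self_shrinker \<A> F \<alpha> \<theta> b" and M: "charted M \<A>" and c: "(P, \<phi>) \<in> \<A>"
  shows "shrinker_chart P (F \<circ> \<phi>) b \<theta>"
proof -
  have F': "legendrian_immersion \<A> F" "legendre_angle \<A> F (\<lambda>p. \<alpha> p + \<theta>)" "harmonic_gT \<A> F \<alpha>" "b < 0" "self_similar \<A> F \<alpha> b"
    using F unfolding harmonic_self_shrinker_def by (safe; assumption)+
  have imm: "smooth_immersion \<A> F" using F'(1) unfolding legendrian_immersion_def by (rule conjunct1)
  note s = smooth_immersion_chart[OF imm c]
  have leg: "eta (F (\<phi> q)) (Df (F \<circ> \<phi>) q e) = 0" if "q \<in> P" for q e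
    using bspec[OF conjunct2[OF F'(1)[unfolded legendrian_immersion_def]] c, unfolded case_prod_conv] that by blast
  have om: "OmegaT (Df (F \<circ> \<phi>) q e1) (Df (F \<circ> \<phi>) q e2) =
      exp (- \<i> * of_real (\<alpha> (\<phi> q) + \<theta>)) * of_real (area (induced (F \<circ> \<phi>)) q)" if "q \<in> P" for q
    by (rule bspec[OF bspec[OF conjunct2[OF F'(2)[unfolded legendre_angle_def]] c, unfolded case_prod_conv] that])
  have ha: "laplacian (inducedT (F \<circ> \<phi>)) (\<alpha> \<circ> \<phi>) q = 0" if "q \<in> P" for q
    by (rule bspec[OF bspec[OF F'(3)[unfolded harmonic_gT_def] c, unfolded case_prod_conv] that])
  note b = F'(4)
  have ss: "mean_curvature (F \<circ> \<phi>) q - (2 * \<alpha> (\<phi> q)) *\<^sub>R xi = b *\<^sub>R normal_part (F \<circ> \<phi>) q (X (F (\<phi> q)))" if "q \<in> P" for q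
    by (rule bspec[OF bspec[OF F'(5)[unfolded self_similar_def] c, unfolded case_prod_conv] that])
  interpret l: legendrian_chart P "F \<circ> \<phi>"
    by standard (use s leg charted_chart(1)[OF M c] in simp_all)
  have \<alpha>: "\<alpha> (\<phi> q) = - (b / 2) * l.fz q" if q: "q \<in> P" for q
    by (rule l.self_similar_angle[OF q]) (use ss[OF q] in simp)
  show ?thesis
  proof
    show "b < 0" by (rule b)
    fix q assume q: "q \<in> P"
    have "cdet (l.dc e1 q) (l.dc e2 q) = cis (- (\<alpha> (\<phi> q) + \<theta>)) * of_real (4 * area (induced (F \<circ> \<phi>)) q)"
      using om[OF q] unfolding OmegaT_eq l.dc_def[symmetric] by (simp add: cis_conv_exp algebra_simps)
    then have "cdet (l.dc e1 q) (l.dc e2 q) * cis (\<alpha> (\<phi> q) + \<theta>) =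
      (cis (- (\<alpha> (\<phi> q) + \<theta>)) * cis (\<alpha> (\<phi> q) + \<theta>)) * of_real (4 * area (induced (F \<circ> \<phi>)) q)"
      by (simp only: mult_ac)
    then have "cdet (l.dc e1 q) (l.dc e2 q) * cis (\<alpha> (\<phi> q) + \<theta>) = of_real (4 * area (induced (F \<circ> \<phi>)) q)"
      unfolding cis_mult by simp
    then show "Im (cdet (l.dc e1 q) (l.dc e2 q) * cis (- (b / 2) * l.fz q + \<theta>)) = 0"
      unfolding \<alpha>[OF q] by simp
    have "laplacian (inducedT (F \<circ> \<phi>)) (\<lambda>x. - (b / 2) * l.fz x) q = laplacian (inducedT (F \<circ> \<phi>)) (\<alpha> \<circ> \<phi>) q"
      by (rule laplacian_cong[OF l.open_U q]) (simp add: \<alpha>)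
    then show "laplacian (inducedT (F \<circ> \<phi>)) (\<lambda>x. - (b / 2) * l.fz x) q = 0"
      using ha[OF q] by simp
  qed
qed

section \<open>From charts to connected surfaces: the classification\<close>

text \<open>Lying on a model at one point does not propagate, whereas contact \<open>C\<close> does
  but is stated in a chart. The two are linked through neighbourhoods on which \<open>good\<close>
  holds.\<close>

lemma clopen_spread:
  assumes M: "charted M \<A>" "connected M"
    and closed: "\<And>P \<phi>. (P, \<phi>) \<in> \<A> \<Longrightarrow> open {q\<in>P. \<not> C P \<phi> q}"
    and spread: "\<And>P \<phi> q. (P, \<phi>) \<in> \<A> \<Longrightarrow> q \<in> P \<Longrightarrow> C P \<phi> q \<Longrightarrow> \<exists>W. open W \<and> q \<in> W \<and> W \<subseteq> P \<and> (\<forall>x\<in>W. good (\<phi> x))"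
    and contact: "\<And>P \<phi> W q. (P, \<phi>) \<in> \<A> \<Longrightarrow> open W \<Longrightarrow> W \<subseteq> P \<Longrightarrow> q \<in> W \<Longrightarrow> (\<forall>x\<in>W. good (\<phi> x)) \<Longrightarrow> C P \<phi> q"
    and start: "(P0, \<phi>0) \<in> \<A>" "open W0" "W0 \<subseteq> P0" "q0 \<in> W0" "\<forall>x\<in>W0. good (\<phi>0 x)"
  shows "\<forall>p\<in>M. good p"
proof -
  \<comment> \<open>The interior of the good set, defined without charts. In each chart it coincides
    with the contact set, so it is both open and closed.\<close>
  define S where "S = {p\<in>M. \<exists>D. openin (top_of_set M) D \<and> p \<in> D \<and> (\<forall>x\<in>D. good x)}"
  have S_iff: "\<phi> q \<in> S \<longleftrightarrow> C P \<phi> q" if c: "(P, \<phi>) \<in> \<A>" and q: "q \<in> P" for P \<phi> q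
  proof
    assume "\<phi> q \<in> S"
    then obtain D where D: "openin (top_of_set M) D" "\<phi> q \<in> D" "\<forall>x\<in>D. good x" by (auto simp: S_def)
    show "C P \<phi> q"
      by (rule contact[OF c chart_open_preimage[OF M(1) c D(1)]]) (use D q in auto)
  next
    assume "C P \<phi> q"
    from spread[OF c q this] obtain W where W: "open W" "q \<in> W" "W \<subseteq> P" "\<forall>x\<in>W. good (\<phi> x)" by blast
    have "openin (top_of_set M) (\<phi> ` W)" by (rule chart_open_image[OF M(1) c W(1,3)])
    moreover have "\<phi> q \<in> M" using charted_chart(4)[OF M(1) c] q by blast
    ultimately show "\<phi> q \<in> S" unfolding S_def using W by blast
  qed
  have "openin (top_of_set M) S"
  proof (subst openin_subopen, intro ballI)
    fix p assume "p \<in> S"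
    then obtain D where D: "openin (top_of_set M) D" "p \<in> D" "\<forall>x\<in>D. good x" by (auto simp: S_def)
    have "D \<subseteq> S" using D openin_imp_subset[OF D(1)] unfolding S_def by blast
    then show "\<exists>T. openin (top_of_set M) T \<and> p \<in> T \<and> T \<subseteq> S" using D by blast
  qed
  moreover have "openin (top_of_set M) (M - S)"
  proof (rule charted_openinI[OF M(1)])
    fix P \<phi> assume c: "(P, \<phi>) \<in> \<A>"
    have "{q\<in>P. \<phi> q \<in> M - S} = {q\<in>P. \<not> C P \<phi> q}"
      using S_iff[OF c] charted_chart(4)[OF M(1) c] by blast
    then show "open {q\<in>P. \<phi> q \<in> M - S}" using closed[OF c] by simp
  qed auto
  moreover have "S \<subseteq> M" by (auto simp: S_def)
  ultimately have "S = {} \<or> S = M"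
    using M(2) unfolding connected_clopen closedin_def by simp
  moreover have "\<phi>0 q0 \<in> S"
  proof -
    have "q0 \<in> P0" using start by blast
    then show ?thesis using S_iff[OF start(1)] contact[OF start] by blast
  qed
  ultimately have "S = M" by blast
  then show ?thesis unfolding S_def by blast
qed

lemma constant_sign:
  assumes "connected M" "continuous_on M h" "\<And>p. p \<in> M \<Longrightarrow> h p \<noteq> (0::real)"
  obtains \<sigma> :: real where "\<sigma> * \<sigma> = 1" "\<And>p. p \<in> M \<Longrightarrow> \<sigma> * h p > 0"
proof (cases "\<forall>p\<in>M. h p > 0")
  case True
  then have "1 * h p > 0" if "p \<in> M" for p using that by simp
  with that[of 1] show thesis by simp
next
  case False
  then obtain p where p: "p \<in> M" "h p \<le> 0" by (auto simp: not_less)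
  have "connected (h ` M)" by (rule connected_continuous_image[OF assms(2,1)])
  then have i: "0 \<in> h ` M" if "q \<in> M" "0 \<le> h q" for q
    unfolding connected_iff_interval using p that by blast
  have "-1 * h q > 0" if "q \<in> M" for q
    using i[OF that] assms(3) by force
  with that[of "-1"] show thesis by simp
qed

text \<open>Changing \<open>v\<close> by a unit factor absorbs the sign or phase by which the first
  coordinates of \<open>F\<close> and of a model differ.\<close>

definition rot_vec :: "complex \<Rightarrow> C2 \<Rightarrow> C2" where "rot_vec c v = (c * fst v, c * snd v)"

lemma orthonormal2_rot_vec: "cnj c * c = 1 \<Longrightarrow> orthonormal2 v w \<Longrightarrow> orthonormal2 (rot_vec c v) w"
proof -
  assume c: "cnj c * c = 1" and on: "orthonormal2 v w"
  have "hp (rot_vec c v) (rot_vec c v) = (cnj c * c) * hp v v" "hp (rot_vec c v) w = cnj c * hp v w"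
    by (simp_all add: hp_def rot_vec_def algebra_simps)
  then show ?thesis using on unfolding orthonormal2_def c by simp
qed

lemma uni_rot_vec: "uni (rot_vec c v) w (x, y, z) = uni v w (c * x, y, z)"
  by (simp add: uni_def rot_vec_def algebra_simps)

lemma model_conclusion_rot:
  assumes M: "charted M \<A>" "smooth_immersion \<A> F" and N: "charted N \<B>" "smooth_embedding N \<B> G"
    and on: "orthonormal2 v w" and c: "cnj c * c = 1"
    and FG: "\<And>p. p \<in> M \<Longrightarrow> \<exists>n\<in>N. \<exists>x. G n = (x, hp w (proj_C2 (F p)), ht (F p)) \<and> c * x = hp v (proj_C2 (F p))"
  shows "embedded_surface (F ` M)" "inj_on F M \<Longrightarrow> smooth_embedding M \<A> F" "locally_congruent M \<A> F N \<B> G"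
proof -
  have "\<exists>n\<in>N. F p = uni (rot_vec c v) w (G n)" if p: "p \<in> M" for p
  proof -
    obtain n x where n: "n \<in> N" "G n = (x, hp w (proj_C2 (F p)), ht (F p))" "c * x = hp v (proj_C2 (F p))" using FG[OF p] by blast
    have "uni (rot_vec c v) w (G n) = uni v w (uni_inv v w (F p))"
      unfolding n(2) uni_rot_vec n(3) uni_inv_def ..
    also have "\<dots> = F p" by (rule uni_uni_inv[OF on])
    finally show ?thesis using n(1) by (intro bexI[of _ n]) (simp_all only:)
  qed
  note r = model_conclusion[OF M N orthonormal2_rot_vec[OF c on] this]
  show "embedded_surface (F ` M)" by (rule r(1); assumption)
  show "smooth_embedding M \<A> F" if "inj_on F M" by (rule r(2); use that in simp)
  show "locally_congruent M \<A> F N \<B> G" by (rule r(3); assumption)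
qed

text \<open>The parameters are read off by matching eigenvalues \<open>k\<close>, \<open>l\<close>:
  they are 4a and 0 for C, 4a / sin^2 \<gamma> and - 4a / tan^2 \<gamma> for Upsilon, 4a / cosh^2
  \<nu> and 4a tanh^2 \<nu> for Psi. The offset \<open>c\<close> can be 0 because the rotations are
  measured by the actual height and constant phases sit in \<open>v\<close> and
  \<open>w\<close>.\<close>

lemma classification_curved:
  fixes M :: "'m::topological_space set"
  assumes M: "charted M \<A>" "smooth_immersion \<A> F" "connected M"
    and on: "orthonormal2 v w" and kl: "k \<le> l" "k + l = 4 * a" and a: "a < 0"
    and om: "\<And>p. p \<in> M \<Longrightarrow> on_model v k w l (F p)"
  shows "embedded_surface (F ` M) \<and> (inj_on F M \<longrightarrow> smooth_embedding M \<A> F) \<and>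
      ((\<exists>c. locally_congruent M \<A> F UNIV plane_atlas (model_C a c)) \<or>
       (\<exists>\<gamma> c. 0 < \<gamma> \<and> \<gamma> < pi / 2 \<and> locally_congruent M \<A> F UNIV plane_atlas (model_Upsilon \<gamma> a c)) \<or>
       (\<exists>\<nu> c. 0 < \<nu> \<and> locally_congruent M \<A> F cylinder cylinder_atlas (model_Psi \<nu> a c)))"
proof -
  define h1 where "h1 p = Re (hp v (proj_C2 (F p)) * cis (- k * ht (F p)))" for p
  define h2 where "h2 p = Re (hp w (proj_C2 (F p)) * cis (- l * ht (F p)))" for p
  define z where "z p = ht (F p)" for p
  have pol: "x = of_real (Re (x * cis (- j * t))) * cis (j * t)" if "Im (x * cis (- j * t)) = 0" for x j t
  proof -
    have "x * cis (- j * t) = of_real (Re (x * cis (- j * t)))" using that by (simp add: complex_eq_iff)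
    then have "x * cis (- j * t) * cis (j * t) = of_real (Re (x * cis (- j * t))) * cis (j * t)" by (rule arg_cong)
    moreover have "x * cis (- j * t) * cis (j * t) = x" by (simp add: mult.assoc cis_mult)
    ultimately show ?thesis by (simp only:)
  qed
  have hv: "hp v (proj_C2 (F p)) = of_real (h1 p) * cis (k * z p)" and hw: "hp w (proj_C2 (F p)) = of_real (h2 p) * cis (l * z p)"
    and con: "k * (h1 p)\<^sup>2 + l * (h2 p)\<^sup>2 = -2" if p: "p \<in> M" for p
    using om[OF p] pol[of "hp v (proj_C2 (F p))" k "ht (F p)"] pol[of "hp w (proj_C2 (F p))" l "ht (F p)"]
    unfolding on_model_def h1_def h2_def z_def by blast+
  have contF: "continuous_on M F"
    by (rule charted_continuous_on[OF M(1) smooth_on_continuous[OF smooth_immersion_chart(1)[OF M(2)]]])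
  have conth1: "continuous_on M h1"
    unfolding h1_def[abs_def]
    by (intro continuous_intros continuous_on_cis bounded_bilinear.continuous_on[OF bounded_bilinear_hp]
       bounded_linear.continuous_on[OF bounded_linear_proj_C2 contF] bounded_linear.continuous_on[OF bounded_linear_ht contF])
  have r: "rad a > 0" "(rad a)\<^sup>2 = - (1 / (2 * a))" by (rule rad[OF a])+
  \<comment> \<open>The smaller of two numbers with negative sum is negative; the three cases
    concern \<open>l\<close> only.\<close>
  have k: "k < 0" using kl a by linarith
  have cr: "cnj (of_real \<sigma>) * complex_of_real \<sigma> = 1" if "\<sigma> * \<sigma> = 1" for \<sigma>
    using that by (metis complex_cnj_complex_of_real of_real_1 of_real_mult)
  consider "l = 0" | "l > 0" | "l < 0" by linarith
  then show ?thesis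
  proof cases
    case 1
    then have k4: "k = 4 * a" using kl by simp
    have h1s: "(h1 p)\<^sup>2 = (rad a)\<^sup>2" if "p \<in> M" for p
      using con[OF that] a unfolding 1 k4 r(2) by (simp add: field_simps)
    then have "h1 p \<noteq> 0" if "p \<in> M" for p using r(1) that by fastforce
    from constant_sign[OF M(3) conth1 this] obtain \<sigma> where s: "\<sigma> * \<sigma> = 1" "\<And>p. p \<in> M \<Longrightarrow> \<sigma> * h1 p > 0" by blast
    have sh: "\<sigma> * h1 p = rad a" if p: "p \<in> M" for p
    proof -
      have "(\<sigma> * h1 p)\<^sup>2 = (\<sigma> * \<sigma>) * (h1 p)\<^sup>2" by (simp add: power2_eq_square)
      then have "(\<sigma> * h1 p)\<^sup>2 = (rad a)\<^sup>2" unfolding s(1) h1s[OF p] by simp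
      then show ?thesis using s(2)[OF p] r(1) by (simp add: power2_eq_iff_nonneg)
    qed
    have "\<exists>n\<in>UNIV. \<exists>x. model_C a 0 n = (x, hp w (proj_C2 (F p)), ht (F p)) \<and> of_real \<sigma> * x = hp v (proj_C2 (F p))"
      if p: "p \<in> M" for p
    proof (intro bexI[of _ "(4 * a * z p, h2 p)"] exI conjI)
      have "1 / (4 * a) * (4 * a * z p) + 0 = z p" using a by simp
      then show "model_C a 0 (4 * a * z p, h2 p) = (of_real (rad a) * cis (k * z p), hp w (proj_C2 (F p)), ht (F p))"
        unfolding hw[OF p] 1 k4 by (simp add: rad_def z_def)
      have "of_real \<sigma> * (complex_of_real (rad a) * cis (k * z p)) = of_real (\<sigma> * \<sigma> * h1 p) * cis (k * z p)"
        unfolding sh[OF p, symmetric] by simp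
      then show "of_real \<sigma> * (complex_of_real (rad a) * cis (k * z p)) = hp v (proj_C2 (F p))"
        unfolding hv[OF p] s(1) by simp
    qed simp
    note m = model_conclusion_rot[OF M(1,2) plane_charted embedding_C[OF a, of 0] on cr[OF s(1)] this]
    show ?thesis using m by blast
  next
    case 2
    \<comment> \<open>The value of sin^2 \<gamma>, from matching k = 4a / sin^2 \<gamma>; it lies
      between 0 and 1 because \<open>l > 0\<close> makes \<open>k\<close> less than 4a.\<close>
    define q where "q = 4 * a / k"
    have kq: "k < 4 * a" using kl 2 by linarith
    have q: "0 < q" "q < 1" using kq k a by (simp_all add: q_def divide_neg_neg less_divide_eq divide_less_eq)
    define \<gamma> where "\<gamma> = arcsin (sqrt q)"
    have sq: "0 < sqrt q" "sqrt q < 1" using q by simp_all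
    have sg: "sin \<gamma> = sqrt q" unfolding \<gamma>_def by (rule sin_arcsin) (use sq in linarith)+
    have \<gamma>: "0 < \<gamma>" "\<gamma> < pi / 2"
      using arcsin_less_arcsin[of 0 "sqrt q"] arcsin_less_arcsin[of "sqrt q" 1] sq by (simp_all add: \<gamma>_def)
    have pos: "sin \<gamma> > 0" "cos \<gamma> > 0" "tan \<gamma> > 0" using \<gamma> sin_gt_zero[of \<gamma>] cos_gt_zero[of \<gamma>] tan_gt_zero[of \<gamma>] by auto
    have ks: "k * (sin \<gamma>)\<^sup>2 = 4 * a" unfolding sg using q k by (simp add: q_def)
    have c2: "(cos \<gamma>)\<^sup>2 = 1 - (sin \<gamma>)\<^sup>2" by (rule cos_squared_eq)
    have ls: "l * (sin \<gamma>)\<^sup>2 = - 4 * a * (cos \<gamma>)\<^sup>2"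
    proof -
      have "l * (sin \<gamma>)\<^sup>2 = 4 * a * (sin \<gamma>)\<^sup>2 - k * (sin \<gamma>)\<^sup>2" using kl(2) by (metis add_diff_cancel_left' left_diff_distrib)
      then show ?thesis unfolding ks c2 by (simp add: algebra_simps)
    qed
    have lt: "l * (tan \<gamma>)\<^sup>2 = - 4 * a" using ls pos by (simp add: tan_def power_divide field_simps)
    \<comment> \<open>The conic is a hyperbola missing the second axis, so a connected surface stays
      on one branch, while the model covers only the branch with positive
      \<open>cosh\<close>.\<close>
    have h1nz: "h1 p \<noteq> 0" if "p \<in> M" for p
    proof
      assume "h1 p = 0"
      then have "l * (h2 p)\<^sup>2 = -2" using con[OF that] by simp
      moreover have "l * (h2 p)\<^sup>2 \<ge> 0" using 2 by simp
      ultimately show False by linarith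
    qed
    from constant_sign[OF M(3) conth1 this] obtain \<sigma> where s: "\<sigma> * \<sigma> = 1" "\<And>p. p \<in> M \<Longrightarrow> \<sigma> * h1 p > 0" by blast
    \<comment> \<open>Cancels the factor - \<i> in the first component of the model and selects the
      branch.\<close>
    define c where "c = \<i> * complex_of_real \<sigma>"
    have ii: "\<i> * (s * (- \<i> * u)) = s * u" for s u :: complex by (simp add: complex_eq_iff)
    have cc: "cnj c * c = 1" using s(1) by (simp add: c_def complex_eq_iff)
    have "\<exists>n\<in>UNIV. \<exists>x. model_Upsilon \<gamma> a 0 n = (x, hp w (proj_C2 (F p)), ht (F p)) \<and> c * x = hp v (proj_C2 (F p))"
      if p: "p \<in> M" for p
    proof -
      define t where "t = arsinh (h2 p / (tan \<gamma> * rad a))"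
      define x where "x = z p * (4 * a / (sin \<gamma> * tan \<gamma>))"
      have h2t: "tan \<gamma> * rad a * sinh t = h2 p" using pos r by (simp add: t_def)
      have "k * (\<sigma> * h1 p)\<^sup>2 = (\<sigma> * \<sigma>) * (k * (h1 p)\<^sup>2)" by (simp add: power2_eq_square)
      then have "k * (\<sigma> * h1 p)\<^sup>2 = -2 - l * (h2 p)\<^sup>2" using con[OF p] unfolding s(1) by linarith
      also have "l * (h2 p)\<^sup>2 = (l * (tan \<gamma>)\<^sup>2) * (rad a)\<^sup>2 * (sinh t)\<^sup>2" unfolding h2t[symmetric] by (simp add: power_mult_distrib)
      also have "\<dots> = 2 * (sinh t)\<^sup>2" unfolding lt r(2) using a by simp
      finally have "k * (\<sigma> * h1 p)\<^sup>2 = - 2 * (cosh t)\<^sup>2" using cosh_square_eq[of t] by simp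
      moreover have "k * (sin \<gamma> * rad a * cosh t)\<^sup>2 = - 2 * (cosh t)\<^sup>2"
      proof -
        have "k * (sin \<gamma> * rad a * cosh t)\<^sup>2 = (k * (sin \<gamma>)\<^sup>2) * (rad a)\<^sup>2 * (cosh t)\<^sup>2" by (simp add: power_mult_distrib)
        then show ?thesis unfolding ks r(2) using a by simp
      qed
      ultimately have "k * (\<sigma> * h1 p)\<^sup>2 = k * (sin \<gamma> * rad a * cosh t)\<^sup>2" by simp
      then have "(\<sigma> * h1 p)\<^sup>2 = (sin \<gamma> * rad a * cosh t)\<^sup>2" using k by simp
      moreover have "sin \<gamma> * rad a * cosh t > 0" using pos r by simp
      ultimately have h1t: "\<sigma> * h1 p = sin \<gamma> * rad a * cosh t" using s(2)[OF p] by (simp add: power2_eq_iff_nonneg)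
      have e1: "x / cos \<gamma> = k * z p"
        unfolding x_def ks[symmetric] using pos by (simp add: tan_def power2_eq_square)
      have e2: "- cos \<gamma> * x = l * z p"
      proof -
        have "- cos \<gamma> * x = - (4 * a) / (tan \<gamma>)\<^sup>2 * z p" unfolding x_def using pos by (simp add: tan_def power2_eq_square)
        also have "- (4 * a) / (tan \<gamma>)\<^sup>2 = l" using lt pos by (simp add: field_simps)
        finally show ?thesis .
      qed
      have e3: "sin \<gamma> * tan \<gamma> / (4 * a) * x + 0 = z p" unfolding x_def using pos a by simp
      show ?thesis
      proof (intro bexI[of _ "(x, t)"] exI conjI)
        show "model_Upsilon \<gamma> a 0 (x, t) = (- \<i> * of_real (\<sigma> * h1 p) * cis (k * z p), hp w (proj_C2 (F p)), ht (F p))"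
          unfolding model_Upsilon_rot rot_def fst_conv snd_conv h1t[symmetric] h2t e3 hw[OF p] e2 z_def[symmetric] using e1 by simp
        have "c * (- \<i> * of_real (\<sigma> * h1 p) * cis (k * z p)) = of_real (\<sigma> * \<sigma> * h1 p) * cis (k * z p)"
          unfolding c_def of_real_mult mult.assoc ii ..
        then show "c * (- \<i> * of_real (\<sigma> * h1 p) * cis (k * z p)) = hp v (proj_C2 (F p))"
          unfolding hv[OF p] s(1) by simp
      qed simp
    qed
    note m = model_conclusion_rot[OF M(1,2) plane_charted embedding_Upsilon[OF a \<gamma>, of 0] on cc this]
    show ?thesis using m \<gamma> by blast
  next
    case 3
    \<comment> \<open>From l / k = sinh^2 \<nu>, positive as both eigenvalues are negative.\<close>
    define \<nu> where "\<nu> = arsinh (sqrt (l / k))"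
    have lk: "l / k > 0" using 3 k by (simp add: divide_neg_neg)
    have sn: "sinh \<nu> = sqrt (l / k)" by (simp add: \<nu>_def)
    then have sp: "sinh \<nu> > 0" using lk by simp
    then have \<nu>: "\<nu> > 0" by simp
    have cp: "cosh \<nu> > 0" by simp
    have ks: "k * (sinh \<nu>)\<^sup>2 = l" unfolding sn using lk k by simp
    have kc: "k * (cosh \<nu>)\<^sup>2 = 4 * a" unfolding cosh_square_eq using ks kl(2) by (simp add: algebra_simps)
    \<comment> \<open>The conic is an ellipse, covered entirely by the circle parameter, so no
      branch has to be selected.\<close>
    have cc: "cnj 1 * (1::complex) = 1" by simp
    have "\<exists>n\<in>cylinder. \<exists>x. model_Psi \<nu> a 0 n = (x, hp w (proj_C2 (F p)), ht (F p)) \<and> 1 * x = hp v (proj_C2 (F p))"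
      if p: "p \<in> M" for p
    proof -
      define x where "x = h1 p / (cosh \<nu> * rad a)"
      define y where "y = h2 p / (cosh \<nu> / sinh \<nu> * rad a)"
      define t where "t = z p * (4 * a / (cosh \<nu> * (cosh \<nu> / sinh \<nu>)))"
      have h1x: "cosh \<nu> * rad a * x = h1 p" and h2y: "cosh \<nu> / sinh \<nu> * rad a * y = h2 p"
        using cp sp r by (simp_all add: x_def y_def)
      have "x\<^sup>2 + y\<^sup>2 = 1"
      proof -
        have "k * (h1 p)\<^sup>2 = (k * (cosh \<nu>)\<^sup>2) * (rad a)\<^sup>2 * x\<^sup>2" unfolding h1x[symmetric] by (simp add: power_mult_distrib)
        also have "\<dots> = - 2 * x\<^sup>2" unfolding kc r(2) using a by simp
        finally have 1: "k * (h1 p)\<^sup>2 = - 2 * x\<^sup>2" .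
        have "l * (h2 p)\<^sup>2 = (k * (cosh \<nu>)\<^sup>2) * (rad a)\<^sup>2 * y\<^sup>2"
          unfolding h2y[symmetric] ks[symmetric] using sp by (simp add: power_mult_distrib power_divide)
        also have "\<dots> = - 2 * y\<^sup>2" unfolding kc r(2) using a by simp
        finally show ?thesis using con[OF p] 1 by simp
      qed
      then have cyl: "(Complex x y, t) \<in> cylinder" by (simp add: cylinder_def cmod_def)
      have e1: "t / sinh \<nu> = k * z p" unfolding t_def kc[symmetric] using cp sp by (simp add: power2_eq_square)
      have e2: "sinh \<nu> * t = l * z p" unfolding t_def kc[symmetric] ks[symmetric] using cp sp by (simp add: power2_eq_square)
      have e3: "cosh \<nu> * (cosh \<nu> / sinh \<nu>) / (4 * a) * t + 0 = z p" unfolding t_def using cp sp a by simp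
      have f1: "cosh \<nu> / sqrt (- 2 * a) * x = h1 p" "cosh \<nu> / sinh \<nu> / sqrt (- 2 * a) * y = h2 p"
        using h1x h2y by (simp_all add: rad_def)
      show ?thesis
      proof (intro bexI[OF _ cyl] exI conjI)
        show "model_Psi \<nu> a 0 (Complex x y, t) = (of_real (h1 p) * cis (k * z p), hp w (proj_C2 (F p)), ht (F p))"
          unfolding model_Psi.simps complex.sel f1 e1 e2 e3 hw[OF p] z_def[symmetric] ..
        show "1 * (of_real (h1 p) * cis (k * z p)) = hp v (proj_C2 (F p))" unfolding hv[OF p] by simp
      qed
    qed
    note m = model_conclusion_rot[OF M(1,2) cylinder_charted embedding_Psi[OF a \<nu>, of 0] on cc this]
    show ?thesis using m \<nu> by blast
  qed
qed

text \<open>One point with nonzero dz is enough: the model found near it extends to all of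
  \<open>M\<close>, and contact forces dz to be nonzero everywhere. Without such a point every chart
  is flat, and the tangent plane at any one point extends in the same way.\<close>

lemma classification:
  fixes M :: "'m::topological_space set"
  assumes M: "charted M \<A>" "connected M" "M \<noteq> {}" and F: "harmonic_self_shrinker \<A> F \<alpha> \<theta> b" and a: "b = 8 * a"
  shows "embedded_surface (F ` M) \<and> (inj_on F M \<longrightarrow> smooth_embedding M \<A> F) \<and>
      ((\<exists>c. locally_congruent M \<A> F UNIV plane_atlas (model_C a c)) \<or>
       (\<exists>\<gamma> c. 0 < \<gamma> \<and> \<gamma> < pi / 2 \<and> locally_congruent M \<A> F UNIV plane_atlas (model_Upsilon \<gamma> a c)) \<or>
       (\<exists>\<nu> c. 0 < \<nu> \<and> locally_congruent M \<A> F cylinder cylinder_atlas (model_Psi \<nu> a c)) \<or>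
       (minimal \<A> F \<and> (\<exists>c. locally_congruent M \<A> F UNIV plane_atlas (model_plane c))))"
proof -
  note sc = chart_shrinker[OF F M(1)]
  have im: "smooth_immersion \<A> F" and b: "b < 0"
    using F unfolding harmonic_self_shrinker_def legendrian_immersion_def by blast+
  have a0: "a < 0" using a b by simp
  show ?thesis
  proof (cases "\<exists>P \<phi> q. (P, \<phi>) \<in> \<A> \<and> q \<in> P \<and> shrinker_chart.regular (F \<circ> \<phi>) q")
    case True
    then obtain P \<phi> q where c: "(P, \<phi>) \<in> \<A>" "q \<in> P" "shrinker_chart.regular (F \<circ> \<phi>) q" by blast
    interpret s: shrinker_chart P "F \<circ> \<phi>" b \<theta> by (rule sc[OF c(1)])
    obtain v w k l W where m: "orthonormal2 v w" "k \<le> l" "k + l = b / 2" "open W" "q \<in> W" "W \<subseteq> P" "\<forall>x\<in>W. on_model v k w l ((F \<circ> \<phi>) x)"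
      using s.regular_model_exists[OF c(2,3)] by blast
    have "\<forall>p\<in>M. on_model v k w l (F p)"
    proof (rule clopen_spread[OF M(1,2), where C = "\<lambda>P \<phi>. legendrian_chart.contact (F \<circ> \<phi>) v k w l" and ?P0.0 = P and ?\<phi>0.0 = \<phi> and ?W0.0 = W and ?q0.0 = q])
      fix P \<phi> assume c: "(P, \<phi>) \<in> \<A>"
      interpret u: shrinker_chart P "F \<circ> \<phi>" b \<theta> by (rule sc[OF c])
      show "open {q\<in>P. \<not> u.contact v k w l q}" by (rule u.contact_closed)
      show "\<exists>W. open W \<and> q \<in> W \<and> W \<subseteq> P \<and> (\<forall>x\<in>W. on_model v k w l (F (\<phi> x)))" if "q \<in> P" "u.contact v k w l q" for q
        using u.contact_spreads[OF that(1) m(1,3) that(2)] by simp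
      show "u.contact v k w l q" if "open W" "W \<subseteq> P" "q \<in> W" "\<forall>x\<in>W. on_model v k w l (F (\<phi> x))" for W q
        by (rule u.contact_of_on_model[OF that(1-3)]) (use that(4) in simp)
    qed (use c m in auto)
    then show ?thesis
      using classification_curved[OF M(1) im M(2) m(1,2) _ a0] m(3) a by auto
  next
    case False
    have flat: "flat_shrinker_chart P (F \<circ> \<phi>) b \<theta>" if c: "(P, \<phi>) \<in> \<A>" for P \<phi>
    proof -
      interpret s: shrinker_chart P "F \<circ> \<phi>" b \<theta> by (rule sc[OF c])
      show ?thesis
      proof
        fix q e assume q: "q \<in> P"
        have "\<not> s.regular q" using False c q by blast
        then have "s.dz e1 q = 0" "s.dz e2 q = 0" unfolding s.regular_def by (simp_all add: zero_prod_def)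
        then show "s.dz e q = 0" using s.dz_R2[OF q, of e] by simp
      qed
    qed
    obtain p0 where "p0 \<in> M" using M(3) by blast
    then obtain P \<phi> q where c: "(P, \<phi>) \<in> \<A>" "q \<in> P" "p0 = \<phi> q" using charted_cover[OF M(1)] by metis
    interpret s: flat_shrinker_chart P "F \<circ> \<phi>" b \<theta> by (rule flat[OF c(1)])
    obtain v w where on: "orthonormal2 v w" and pc: "s.plane_contact v w (s.fz q) q" using s.plane_contact_exists[OF c(2)] by blast
    define h where "h = s.fz q"
    obtain W where W: "open W" "q \<in> W" "W \<subseteq> P" "\<forall>x\<in>W. on_plane v w h ((F \<circ> \<phi>) x)"
      using s.plane_contact_spreads[OF c(2) pc] unfolding h_def by blast
    have op: "\<forall>p\<in>M. on_plane v w h (F p)"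
    proof (rule clopen_spread[OF M(1,2), where C = "\<lambda>P \<phi>. flat_shrinker_chart.plane_contact (F \<circ> \<phi>) v w h" and ?P0.0 = P and ?\<phi>0.0 = \<phi> and ?W0.0 = W and ?q0.0 = q])
      fix P \<phi> assume c: "(P, \<phi>) \<in> \<A>"
      interpret u: flat_shrinker_chart P "F \<circ> \<phi>" b \<theta> by (rule flat[OF c])
      show "open {q\<in>P. \<not> u.plane_contact v w h q}" by (rule u.plane_contact_closed)
      show "\<exists>W. open W \<and> q \<in> W \<and> W \<subseteq> P \<and> (\<forall>x\<in>W. on_plane v w h (F (\<phi> x)))" if "q \<in> P" "u.plane_contact v w h q" for q
        using u.plane_contact_spreads[OF that] by simp
      show "u.plane_contact v w h q" if "open W" "W \<subseteq> P" "q \<in> W" "\<forall>x\<in>W. on_plane v w h (F (\<phi> x))" for W q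
        by (rule u.plane_contact_of_on_plane[OF that(1-3)]) (use that(4) in simp)
    qed (use c W in auto)
    have cc: "cnj 1 * (1::complex) = 1" by simp
    have "\<exists>n\<in>UNIV. \<exists>x. model_plane h n = (x, hp w (proj_C2 (F p)), ht (F p)) \<and> 1 * x = hp v (proj_C2 (F p))" if p: "p \<in> M" for p
    proof (intro bexI[of _ "(Re (hp v (proj_C2 (F p))), Re (hp w (proj_C2 (F p))))"] exI conjI)
      show "model_plane h (Re (hp v (proj_C2 (F p))), Re (hp w (proj_C2 (F p)))) = (hp v (proj_C2 (F p)), hp w (proj_C2 (F p)), ht (F p))"
        using op p unfolding on_plane_def by (simp add: complex_eq_iff)
    qed simp_all
    note m = model_conclusion_rot[OF M(1) im plane_charted embedding_plane[of h] on cc this]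
    have "minimal \<A> F"
      unfolding minimal_def
    proof (intro ballI, clarify)
      fix P \<phi> a b' assume c: "(P, \<phi>) \<in> \<A>" and q: "(a, b') \<in> P"
      interpret u: flat_shrinker_chart P "F \<circ> \<phi>" b \<theta> by (rule flat[OF c])
      show "mean_curvature (F \<circ> \<phi>) (a, b') = 0" by (rule u.minimal[OF q])
    qed
    then show ?thesis using m by blast
  qed
qed

lemma shrinker_families:
  assumes a: "a < 0"
  shows "shrinker_family plane_atlas (model_C a) (8 * a)" "shrinker_family plane_atlas (model_T a) (8 * a)"
    "0 < \<gamma> \<Longrightarrow> \<gamma> < pi / 2 \<Longrightarrow> shrinker_family plane_atlas (model_Upsilon \<gamma> a) (8 * a)"
    "\<nu> > 0 \<Longrightarrow> shrinker_family cylinder_atlas (model_Psi \<nu> a) (8 * a)"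
proof -
  have b: "8 * a < 0" using a by simp
  have pl: "\<exists>r. model_chart U (G \<circ> \<phi>) b \<theta> r" if "\<exists>r. model_chart UNIV G b \<theta> r" "(U, \<phi>) \<in> plane_atlas" for G b \<theta> U \<phi>
    using that by (auto simp: plane_atlas_def o_def)
  show "shrinker_family plane_atlas (model_C a) (8 * a)"
    by (rule shrinker_familyI[OF b pl[OF model_chart_C[OF a]]])
  show "shrinker_family plane_atlas (model_T a) (8 * a)"
    by (rule shrinker_familyI[OF b pl[OF model_chart_T[OF a]]])
  show "shrinker_family plane_atlas (model_Upsilon \<gamma> a) (8 * a)" if "0 < \<gamma>" "\<gamma> < pi / 2"
    by (rule shrinker_familyI[OF b pl[OF model_chart_Upsilon[OF a that]]])
  show "shrinker_family cylinder_atlas (model_Psi \<nu> a) (8 * a)" if n: "\<nu> > 0"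
  proof (rule shrinker_familyI[OF b])
    fix c \<theta> U and \<phi> :: "R2 \<Rightarrow> complex \<times> real"
    assume \<theta>: "8 * a / 2 * c - \<theta> = - (pi / 2)" and m: "(U, \<phi>) \<in> cylinder_atlas"
    obtain s0 where U: "U = {s0 <..< s0 + 2 * pi} \<times> UNIV" "\<phi> = (\<lambda>(s, t). (cis s, t))"
      using m unfolding cylinder_atlas_def by auto
    have oU: "open U" unfolding U by (intro open_Times) auto
    show "\<exists>r. model_chart U (model_Psi \<nu> a c \<circ> \<phi>) (8 * a) \<theta> r"
      using model_chart_Psi[OF a n \<theta>] unfolding U(2)[symmetric] using model_chart_subset[OF _ oU] by blast
  qed
qed

theorem theorem1p3:
  fixes M :: "'m::{t2_space,second_countable_topology} set"
    and \<A> :: "'m atlas" and F :: "'m \<Rightarrow> R5" and \<alpha> :: "'m \<Rightarrow> real" and \<theta> b :: real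
  assumes "oriented_surface M \<A>" and "connected M"
    and "harmonic_self_shrinker \<A> F \<alpha> \<theta> b"
  shows "embedded_surface (F ` M) \<and>
    (inj_on F M \<longrightarrow> smooth_embedding M \<A> F) \<and>
    (\<exists>a<0. b = 8 * a \<and>
      ((\<exists>c. locally_congruent M \<A> F UNIV plane_atlas (model_C a c)) \<or>
       (\<exists>c. locally_congruent M \<A> F UNIV plane_atlas (model_T a c)) \<or>
       (\<exists>\<gamma> c. 0 < \<gamma> \<and> \<gamma> < pi / 2 \<and>
          locally_congruent M \<A> F UNIV plane_atlas (model_Upsilon \<gamma> a c)) \<or>
       (\<exists>\<nu> c. 0 < \<nu> \<and>
          locally_congruent M \<A> F cylinder cylinder_atlas (model_Psi \<nu> a c)) \<or>
       (minimal \<A> F \<and> (\<exists>c. locally_congruent M \<A> F UNIV plane_atlas (model_plane c))))) \<and>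
    (\<forall>a<0.
      shrinker_family plane_atlas (model_C a) (8 * a) \<and>
      shrinker_family plane_atlas (model_T a) (8 * a) \<and>
      (\<forall>\<gamma>. 0 < \<gamma> \<and> \<gamma> < pi / 2 \<longrightarrow> shrinker_family plane_atlas (model_Upsilon \<gamma> a) (8 * a)) \<and>
      (\<forall>\<nu>>0. shrinker_family cylinder_atlas (model_Psi \<nu> a) (8 * a)) \<and>
      (\<forall>c. smooth_embedding UNIV plane_atlas (model_C a c) \<and>
         embedded_surface (range (model_T a c)) \<and>
         (\<forall>t s t' s'. model_T a c (t, s) = model_T a c (t', s') \<longleftrightarrow>
            (\<exists>k::int. t' = t + 2 * pi * of_int k \<and> s' = s - 2 * pi * of_int k)) \<and>
         (\<forall>\<gamma>. 0 < \<gamma> \<and> \<gamma> < pi / 2 \<longrightarrow>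
            smooth_embedding UNIV plane_atlas (model_Upsilon \<gamma> a c)) \<and>
         (\<forall>\<nu>>0. smooth_embedding cylinder cylinder_atlas (model_Psi \<nu> a c))))"
proof -
  have M: "charted M \<A>" by (rule oriented_surface_charted[OF assms(1)])
  have ne: "M \<noteq> {}" using assms(1) by (simp add: oriented_surface_def)
  have "b < 0" using assms(3) unfolding harmonic_self_shrinker_def by blast
  \<comment> \<open>Chosen so that k + l = b / 2 becomes 4a, the sum of the eigenvalues of each
    model.\<close>
  define a where "a = b / 8"
  have a: "a < 0" "b = 8 * a" using \<open>b < 0\<close> by (simp_all add: a_def)
  note cl = classification[OF M assms(2) ne assms(3) a(2)]
  have models: "shrinker_family plane_atlas (model_C a) (8 * a) \<and>
      shrinker_family plane_atlas (model_T a) (8 * a) \<and>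
      (\<forall>\<gamma>. 0 < \<gamma> \<and> \<gamma> < pi / 2 \<longrightarrow> shrinker_family plane_atlas (model_Upsilon \<gamma> a) (8 * a)) \<and>
      (\<forall>\<nu>>0. shrinker_family cylinder_atlas (model_Psi \<nu> a) (8 * a)) \<and>
      (\<forall>c. smooth_embedding UNIV plane_atlas (model_C a c) \<and>
         embedded_surface (range (model_T a c)) \<and>
         (\<forall>t s t' s'. model_T a c (t, s) = model_T a c (t', s') \<longleftrightarrow>
            (\<exists>k::int. t' = t + 2 * pi * of_int k \<and> s' = s - 2 * pi * of_int k)) \<and>
         (\<forall>\<gamma>. 0 < \<gamma> \<and> \<gamma> < pi / 2 \<longrightarrow>
            smooth_embedding UNIV plane_atlas (model_Upsilon \<gamma> a c)) \<and>
         (\<forall>\<nu>>0. smooth_embedding cylinder cylinder_atlas (model_Psi \<nu> a c)))" if a: "a < 0" for a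
  proof (intro conjI allI impI)
    show "shrinker_family plane_atlas (model_Upsilon \<gamma> a) (8 * a)" if "0 < \<gamma> \<and> \<gamma> < pi / 2" for \<gamma>
      by (rule shrinker_families(3)[OF a conjunct1[OF that] conjunct2[OF that]])
    show "smooth_embedding UNIV plane_atlas (model_Upsilon \<gamma> a c)" if "0 < \<gamma> \<and> \<gamma> < pi / 2" for \<gamma> c
      by (rule embedding_Upsilon[OF a conjunct1[OF that] conjunct2[OF that]])
    show "model_T a c (t, s) = model_T a c (t', s') \<longleftrightarrow>
        (\<exists>k::int. t' = t + 2 * pi * of_int k \<and> s' = s - 2 * pi * of_int k)" for c t s t' s'
      by (rule model_T_eq_iff[OF a])
  qed (rule shrinker_families(1,2,4)[OF a] embedding_C[OF a] embedded_T[OF a] embedding_Psi[OF a]; assumption)+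
  show ?thesis
  proof (intro conjI)
    show "embedded_surface (F ` M)" by (rule conjunct1[OF cl])
    show "inj_on F M \<longrightarrow> smooth_embedding M \<A> F" by (rule conjunct1[OF conjunct2[OF cl]])
    show "\<exists>a<0. b = 8 * a \<and>
      ((\<exists>c. locally_congruent M \<A> F UNIV plane_atlas (model_C a c)) \<or>
       (\<exists>c. locally_congruent M \<A> F UNIV plane_atlas (model_T a c)) \<or>
       (\<exists>\<gamma> c. 0 < \<gamma> \<and> \<gamma> < pi / 2 \<and>
          locally_congruent M \<A> F UNIV plane_atlas (model_Upsilon \<gamma> a c)) \<or>
       (\<exists>\<nu> c. 0 < \<nu> \<and>
          locally_congruent M \<A> F cylinder cylinder_atlas (model_Psi \<nu> a c)) \<or>
       (minimal \<A> F \<and> (\<exists>c. locally_congruent M \<A> F UNIV plane_atlas (model_plane c))))"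
    proof (intro exI[of _ a] conjI)
      show "(\<exists>c. locally_congruent M \<A> F UNIV plane_atlas (model_C a c)) \<or>
       (\<exists>c. locally_congruent M \<A> F UNIV plane_atlas (model_T a c)) \<or>
       (\<exists>\<gamma> c. 0 < \<gamma> \<and> \<gamma> < pi / 2 \<and>
          locally_congruent M \<A> F UNIV plane_atlas (model_Upsilon \<gamma> a c)) \<or>
       (\<exists>\<nu> c. 0 < \<nu> \<and>
          locally_congruent M \<A> F cylinder cylinder_atlas (model_Psi \<nu> a c)) \<or>
       (minimal \<A> F \<and> (\<exists>c. locally_congruent M \<A> F UNIV plane_atlas (model_plane c)))"
        \<comment> \<open>The classification offers four of the five alternatives; a piece of the
          torus appears there as \<open>model_Psi\<close> with equal eigenvalues.\<close>
        using conjunct2[OF conjunct2[OF cl]] by argo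
    qed (rule a)+
  qed (rule allI, rule impI, rule models)
qed

end
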